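(* Let $N$ be a definable smooth manifold and let $\Sigma$ be a definable stratification of some definable closed subset of $N$. Then the following statements are equivalent: (1) $\Sigma$ is Whitney $(a)$-regular. (2) For any definable smooth manifold $M$, the set $\{f\in\mathcal{D}^\infty(M,N): f\pitchfork\Sigma\}$ is open in $\mathcal{D}^\infty(M,N)$ with the $\mathcal{D}^\infty$-topology. (3) For any definable smooth manifold $M$ of dimension greater than or equal to the codimension (in $N$) of the smallest stratum in $\Sigma$ (i.e. with $\dim M\ge\dim N-\min_{S\in\Sigma}\dim S$), the set $\{f\in\mathcal{D}^\infty(M,N): f\pitchfork\Sigma\}$ is open in $\mathcal{D}^\infty(M,N)$ with the $\mathcal{D}^\infty$-topology.
   Context: Standing assumptions. Fix an o-minimal structure on the ordered field of real numbers $(\mathbb{R},<,+,\cdot,0,1)$ which is exponential (it contains the graph of the exponential function) and admits smooth ($\mathcal{C}^\infty$) cell decomposition. "Definable" means definable in this structure. $\mathbb{N}=\{0,1,2,\dots\}$; "smooth" means $\mathcal{C}^\infty$. Manifolds. A definable $\mathcal{C}^p$-submanifold of $\mathbb{R}^m$ ($0\le p\le\infty$) is a definable set that is a $\mathcal{C}^p$-submanifold of $\mathbb{R}^m$. A definable $\mathcal{C}^p$-manifold is a definable $\mathcal{C}^p$-submanifold of some Euclidean space; for $p=\infty$ it is called a definable smooth manifold. $\mathcal{D}^\infty(M,N)$ denotes the set of definable smooth maps $M\to N$. Tubular neighborhoods. For a definable smooth submanifold $M\subset\mathbb{R}^m$, let $\mathcal{N}M=\{(x,v)\in M\times\mathbb{R}^m: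 v\perp T_xM\}$ and $\varphi(x,v)=x+v$. There is a definable open neighborhood $U=\{(x,v)\in\mathcal{N}M:\|v\|<\varepsilon(x)\}$ of $M\times\{0\}$ (with $\varepsilon:M\to(0,\infty)$ definable, of class $\mathcal{C}^r$ for some $r\in\mathbb{N}$) such that $\varphi|_U$ is a definable smooth diffeomorphism onto an open neighborhood $T_M$ of $M$ in $\mathbb{R}^m$. With $\pi_M:T_M\to M$ sending $w=\varphi(x,v)$, $(x,v)\in U$, to $x$ (a definable smooth retraction), the pair $(T_M,\pi_M)$ is called a definable tubular neighborhood of $M$. Jet space. Let $M\subset\mathbb{R}^m$, $N\subset\mathbb{R}^n$ be definable smooth submanifolds, $k\in\mathbb{N}$, and let $A=\#\{\alpha\in\mathbb{N}^m:1\le|\alpha|\le k\}$. The definable $k$-jet space is $J^k_{\mathcal{D}}(M,N)=\{j^kf(x): x\in M,\ f\in\mathcal{D}^\infty(M,N)\}$. Fixing definable tubular neighborhoods $(T_M,\pi_M)$, $(T_N,\pi_N)$, the jet $j^kf(x)$ is identified with $j^k(f\circ\pi_M)(x)$, i.e. with the point $(x,f(x),(\partial^\alpha(f\circ\pi_M)(x))_{1\le|\alpha|\le k})\in T_M\times T_N\times\mathbb{R}^{nA}$, where $f\circ\pi_M$ is viewed as a map into $\mathbb{R}^n$. In this way $J^k_{\mathcal{D}}(M,N)$ is a definable smooth submanifold of $T_M\times T_N\times\mathbb{R}^{nA}$ with the induced topology and metric $d(u,v)=\|u-v\|_\infty$. For $f\in\mathcal{D}^\infty(M,N)$, $j^kf:M\to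 J^k_{\mathcal{D}}(M,N)$ is the map $x\mapsto j^kf(x)$. Topology. For $k\in\mathbb{N}$, the $\mathcal{D}^k$-topology on $\mathcal{D}^\infty(M,N)$ has as basis the sets $\{f: j^kf(M)\subset U\}$ with $U$ a definable open subset of $J^k_{\mathcal{D}}(M,N)$; equivalently, the sets $\mathcal{U}^k_\varepsilon(f)=\{g: d(j^kf(x),j^kg(x))<\varepsilon(x)\ \forall x\in M\}$ with $f\in\mathcal{D}^\infty(M,N)$ and $\varepsilon:M\to(0,\infty)$ continuous definable form a basis. The $\mathcal{D}^\infty$-topology is the one whose basis is the union over all $k\in\mathbb{N}$ of these bases. Transversality. A map $f:M\to N$ between $\mathcal{C}^1$-manifolds is transverse to a $\mathcal{C}^1$-submanifold $S\subset N$ if for each $p\in M$ either $f(p)\notin S$ or $D_pf(T_pM)+T_{f(p)}S=T_{f(p)}N$. For a collection $\Sigma$ of $\mathcal{C}^1$-submanifolds, $f\pitchfork\Sigma$ means $f$ is transverse to each member of $\Sigma$. Stratifications. A definable stratification of a definable set $V\subset\mathbb{R}^q$ is a partition $\Sigma$ of $V$ into finitely many definable $\mathcal{C}^1$-submanifolds of $\mathbb{R}^q$ (strata) such that for $X,Y\in\Sigma$ with $Y\cap\overline{X}\ne\emptyset$ one has $Y\subset\overline{X}$; then $(X,Y)$ is called a pair of adjacent strata. $X$ is Whitney $(a)$-regular over $Y$ if for every $y\in Y\cap\overline{X}$ and every sequence $x_i\in X$ tending to $y$ such that $T_{x_i}X$ tends to some $\tau$ in the Grassmannian of $(\dim X)$-dimensional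 linear subspaces of $\mathbb{R}^q$, one has $T_yY\subset\tau$. $\Sigma$ is Whitney $(a)$-regular if $X$ is Whitney $(a)$-regular over $Y$ for every pair of adjacent strata $(X,Y)$. *)

theory Defs
  imports "HOL-Analysis.Analysis"
begin

text \<open>
  Dimensions vary inside the statement, so \<open>\<real>\<^sup>n\<close> is the carrier of the library topology
  \<^const>\<open>Euclidean_space\<close> n: functions \<open>nat \<Rightarrow> real\<close> vanishing at all indices \<open>\<ge> n\<close>.
\<close>

abbreviation Rn :: "nat \<Rightarrow> (nat \<Rightarrow> real) set" where
  "Rn n \<equiv> topspace (Euclidean_space n)"

definition trunc :: "nat \<Rightarrow> (nat \<Rightarrow> real) \<Rightarrow> nat \<Rightarrow> real" where
  "trunc n x = (\<lambda>i. if i < n then x i else 0)"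

text \<open>Identification of \<open>\<real>\<^sup>m \<times> \<real>\<^sup>n\<close> with \<open>\<real>\<^sup>m\<^sup>+\<^sup>n\<close>.\<close>

definition append_vec :: "nat \<Rightarrow> (nat \<Rightarrow> real) \<Rightarrow> (nat \<Rightarrow> real) \<Rightarrow> nat \<Rightarrow> real" where
  "append_vec m x y = (\<lambda>i. if i < m then x i else y (i - m))"


section \<open>Differentiability\<close>

definition pderiv_coord :: "nat \<Rightarrow> ((nat \<Rightarrow> real) \<Rightarrow> real) \<Rightarrow> (nat \<Rightarrow> real) \<Rightarrow> real" where
  "pderiv_coord i g x = deriv (\<lambda>t. g (x(i := t))) (x i)"

definition mixed_pderiv ::
    "nat \<Rightarrow> (nat \<Rightarrow> nat) \<Rightarrow> ((nat \<Rightarrow> real) \<Rightarrow> real) \<Rightarrow> (nat \<Rightarrow> real) \<Rightarrow> real" where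
  "mixed_pderiv m \<alpha> = fold (\<lambda>i. pderiv_coord i ^^ \<alpha> i) [0..<m]"

text \<open>Class \<open>C\<^sup>k\<close> on an open subset \<open>U\<close> of \<open>\<real>\<^sup>n\<close>.\<close>

primrec Ck_open :: "nat \<Rightarrow> nat \<Rightarrow> (nat \<Rightarrow> real) set \<Rightarrow> ((nat \<Rightarrow> real) \<Rightarrow> real) \<Rightarrow> bool" where
  "Ck_open n 0 U g \<longleftrightarrow> continuous_map (subtopology (Euclidean_space n) U) euclideanreal g"
| "Ck_open n (Suc k) U g \<longleftrightarrow>
     continuous_map (subtopology (Euclidean_space n) U) euclideanreal g \<and>
     (\<forall>i<n. (\<forall>x\<in>U. (\<lambda>t. g (x(i := t))) field_differentiable (at (x i))) \<and>
            Ck_open n k U (pderiv_coord i g))"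

text \<open>Class \<open>C\<^sup>p\<close> (\<open>0 \<le> p \<le> \<infinity>\<close>) on an arbitrary subset \<open>A\<close> of \<open>\<real>\<^sup>n\<close>: local extendability to
  \<open>C\<^sup>p\<close> functions on open sets. On open sets and on submanifolds this is the usual notion.\<close>

definition Cp_on :: "nat \<Rightarrow> enat \<Rightarrow> (nat \<Rightarrow> real) set \<Rightarrow> ((nat \<Rightarrow> real) \<Rightarrow> real) \<Rightarrow> bool" where
  "Cp_on n p A g \<longleftrightarrow>
     (\<forall>x\<in>A. \<exists>U h. openin (Euclidean_space n) U \<and> x \<in> U \<and>
        (\<forall>k. enat k \<le> p \<longrightarrow> Ck_open n k U h) \<and> (\<forall>y\<in>U \<inter> A. h y = g y))"

definition Cp_map ::
    "nat \<Rightarrow> nat \<Rightarrow> enat \<Rightarrow> (nat \<Rightarrow> real) set \<Rightarrow> ((nat \<Rightarrow> real) \<Rightarrow> nat \<Rightarrow> real) \<Rightarrow> bool" where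
  "Cp_map m n p A F \<longleftrightarrow> F \<in> A \<rightarrow> Rn n \<and> (\<forall>j<n. Cp_on m p A (\<lambda>x. F x j))"

definition Cp_diffeo ::
    "nat \<Rightarrow> nat \<Rightarrow> enat \<Rightarrow> (nat \<Rightarrow> real) set \<Rightarrow> (nat \<Rightarrow> real) set \<Rightarrow>
     ((nat \<Rightarrow> real) \<Rightarrow> nat \<Rightarrow> real) \<Rightarrow> bool" where
  "Cp_diffeo m n p A B F \<longleftrightarrow>
     bij_betw F A B \<and> Cp_map m n p A F \<and> Cp_map n m p B (inv_into A F)"


section \<open>Submanifolds and tangent spaces\<close>

definition submanifold :: "nat \<Rightarrow> enat \<Rightarrow> nat \<Rightarrow> (nat \<Rightarrow> real) set \<Rightarrow> bool" where
  "submanifold n p d M \<longleftrightarrow> d \<le> n \<and> M \<subseteq> Rn n \<and>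
     (\<forall>x\<in>M. \<exists>U V \<phi>. openin (Euclidean_space n) U \<and> openin (Euclidean_space n) V \<and> x \<in> U \<and>
        Cp_diffeo n n p U V \<phi> \<and> \<phi> ` (U \<inter> M) = V \<inter> {y. \<forall>i\<ge>d. y i = 0})"

text \<open>The dimension of a nonempty \<open>C\<^sup>1\<close>-submanifold is unique; the empty one gets dimension 0.\<close>

definition mdim :: "nat \<Rightarrow> (nat \<Rightarrow> real) set \<Rightarrow> nat" where
  "mdim n M = (LEAST d. submanifold n 1 d M)"

definition has_velocity :: "(real \<Rightarrow> nat \<Rightarrow> real) \<Rightarrow> (nat \<Rightarrow> real) \<Rightarrow> bool" where
  "has_velocity \<gamma> v \<longleftrightarrow> (\<forall>i. ((\<lambda>t. \<gamma> t i) has_real_derivative v i) (at 0))"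

text \<open>\<open>C\<^sup>1\<close> curves in \<open>M\<close> passing through \<open>x\<close> at time 0 with velocity \<open>v\<close>.\<close>

definition curve_through ::
    "(nat \<Rightarrow> real) set \<Rightarrow> (nat \<Rightarrow> real) \<Rightarrow> (nat \<Rightarrow> real) \<Rightarrow> (real \<Rightarrow> nat \<Rightarrow> real) \<Rightarrow> bool" where
  "curve_through M x v \<gamma> \<longleftrightarrow> \<gamma> 0 = x \<and> has_velocity \<gamma> v \<and>
     (\<exists>e>0. (\<forall>t\<in>{-e<..<e}. \<gamma> t \<in> M) \<and> (\<forall>i. (\<lambda>t. \<gamma> t i) C1_differentiable_on {-e<..<e}))"

definition tangent_space :: "(nat \<Rightarrow> real) set \<Rightarrow> (nat \<Rightarrow> real) \<Rightarrow> (nat \<Rightarrow> real) set" where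
  "tangent_space M x = {v. \<exists>\<gamma>. curve_through M x v \<gamma>}"

text \<open>\<open>D\<^sub>xf(v)\<close> for \<open>v \<in> T\<^sub>xM\<close>; no extension of \<open>f\<close> off \<open>M\<close> is involved.\<close>

definition differential ::
    "(nat \<Rightarrow> real) set \<Rightarrow> ((nat \<Rightarrow> real) \<Rightarrow> nat \<Rightarrow> real) \<Rightarrow> (nat \<Rightarrow> real) \<Rightarrow>
     (nat \<Rightarrow> real) \<Rightarrow> nat \<Rightarrow> real" where
  "differential M f x v = (THE w. \<forall>\<gamma>. curve_through M x v \<gamma> \<longrightarrow> has_velocity (f \<circ> \<gamma>) w)"

definition transverse ::
    "(nat \<Rightarrow> real) set \<Rightarrow> (nat \<Rightarrow> real) set \<Rightarrow> ((nat \<Rightarrow> real) \<Rightarrow> nat \<Rightarrow> real) \<Rightarrow>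
     (nat \<Rightarrow> real) set \<Rightarrow> bool" where
  "transverse M N f S \<longleftrightarrow>
     (\<forall>p\<in>M. f p \<notin> S \<or>
        {\<lambda>i. a i + b i | a b. a \<in> differential M f p ` tangent_space M p \<and>
                              b \<in> tangent_space S (f p)} = tangent_space N (f p))"


section \<open>O-minimal structures\<close>

text \<open>\<open>Df n\<close> is the collection of definable subsets of \<open>\<real>\<^sup>n\<close>. The axiom \<open>one_dim\<close> makes all points
  definable, i.e. definability is with parameters.\<close>

definition definable_map ::
    "(nat \<Rightarrow> (nat \<Rightarrow> real) set set) \<Rightarrow> nat \<Rightarrow> nat \<Rightarrow> (nat \<Rightarrow> real) set \<Rightarrow>
     ((nat \<Rightarrow> real) \<Rightarrow> nat \<Rightarrow> real) \<Rightarrow> bool" where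
  "definable_map Df m n A F \<longleftrightarrow>
     A \<in> Df m \<and> F \<in> A \<rightarrow> Rn n \<and> {append_vec m x (F x) | x. x \<in> A} \<in> Df (m + n)"

definition definable_fun ::
    "(nat \<Rightarrow> (nat \<Rightarrow> real) set set) \<Rightarrow> nat \<Rightarrow> (nat \<Rightarrow> real) set \<Rightarrow>
     ((nat \<Rightarrow> real) \<Rightarrow> real) \<Rightarrow> bool" where
  "definable_fun Df n A g \<longleftrightarrow> A \<in> Df n \<and> {x(n := g x) | x. x \<in> A} \<in> Df (Suc n)"

locale o_minimal_field =
  fixes Df :: "nat \<Rightarrow> (nat \<Rightarrow> real) set set"
  assumes subset: "A \<in> Df n \<Longrightarrow> A \<subseteq> Rn n"
    and empty: "{} \<in> Df n"
    and union: "A \<in> Df n \<Longrightarrow> B \<in> Df n \<Longrightarrow> A \<union> B \<in> Df n"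
    and complement: "A \<in> Df n \<Longrightarrow> Rn n - A \<in> Df n"
    and times_R: "A \<in> Df n \<Longrightarrow> {x \<in> Rn (Suc n). trunc n x \<in> A} \<in> Df (Suc n)"
    and R_times: "A \<in> Df n \<Longrightarrow> {x \<in> Rn (Suc n). (\<lambda>i. x (Suc i)) \<in> A} \<in> Df (Suc n)"
    and diagonal: "i < n \<Longrightarrow> j < n \<Longrightarrow> {x \<in> Rn n. x i = x j} \<in> Df n"
    and projection: "A \<in> Df (Suc n) \<Longrightarrow> trunc n ` A \<in> Df n"
    and less: "{x \<in> Rn 2. x 0 < x 1} \<in> Df 2"
    and add: "{x \<in> Rn 3. x 0 + x 1 = x 2} \<in> Df 3"
    and mult: "{x \<in> Rn 3. x 0 * x 1 = x 2} \<in> Df 3"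
    and one_dim: "Df 1 = {{x \<in> Rn 1. x 0 \<in> B} | B :: real set. (finite union_of is_interval) B}"

definition definable_smooth_fun ::
    "(nat \<Rightarrow> (nat \<Rightarrow> real) set set) \<Rightarrow> nat \<Rightarrow> (nat \<Rightarrow> real) set \<Rightarrow>
     ((nat \<Rightarrow> real) \<Rightarrow> real) \<Rightarrow> bool" where
  "definable_smooth_fun Df n C g \<longleftrightarrow> definable_fun Df n C g \<and> Cp_on n \<infinity> C g"

text \<open>Smooth cells, starting from the one-point space \<open>\<real>\<^sup>0\<close>. In a band either bound may be
  identically infinite.\<close>

inductive smooth_cell :: "(nat \<Rightarrow> (nat \<Rightarrow> real) set set) \<Rightarrow> nat \<Rightarrow> (nat \<Rightarrow> real) set \<Rightarrow> bool"
  for Df where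
  point: "smooth_cell Df 0 (Rn 0)"
| graph: "smooth_cell Df n C \<Longrightarrow> definable_smooth_fun Df n C g \<Longrightarrow>
    smooth_cell Df (Suc n) {x \<in> Rn (Suc n). trunc n x \<in> C \<and> x n = g (trunc n x)}"
| band: "smooth_cell Df n C \<Longrightarrow>
    (lo = (\<lambda>_. -\<infinity>) \<or> (\<exists>g. definable_smooth_fun Df n C g \<and> lo = (\<lambda>x. ereal (g x)))) \<Longrightarrow>
    (hi = (\<lambda>_. \<infinity>) \<or> (\<exists>h. definable_smooth_fun Df n C h \<and> hi = (\<lambda>x. ereal (h x)))) \<Longrightarrow>
    (\<forall>x\<in>C. lo x < hi x) \<Longrightarrow>
    smooth_cell Df (Suc n) {x \<in> Rn (Suc n). trunc n x \<in> C \<and>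
       lo (trunc n x) < ereal (x n) \<and> ereal (x n) < hi (trunc n x)}"

primrec smooth_cell_decomposition ::
    "(nat \<Rightarrow> (nat \<Rightarrow> real) set set) \<Rightarrow> nat \<Rightarrow> (nat \<Rightarrow> real) set set \<Rightarrow> bool" where
  "smooth_cell_decomposition Df 0 \<C> \<longleftrightarrow> \<C> = {Rn 0}"
| "smooth_cell_decomposition Df (Suc n) \<C> \<longleftrightarrow>
     finite \<C> \<and> partition_on (Rn (Suc n)) \<C> \<and> (\<forall>C\<in>\<C>. smooth_cell Df (Suc n) C) \<and>
     smooth_cell_decomposition Df n ((\<lambda>C. trunc n ` C) ` \<C>)"

definition compatible :: "'a set set \<Rightarrow> 'a set \<Rightarrow> bool" where
  "compatible \<C> A \<longleftrightarrow> (\<forall>C\<in>\<C>. C \<subseteq> A \<or> C \<inter> A = {})"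

locale smooth_exp_o_minimal_field = o_minimal_field +
  assumes exponential: "{x \<in> Rn 2. x 1 = exp (x 0)} \<in> Df 2"
    and smooth_decomposition_sets:
      "finite \<A> \<Longrightarrow> \<A> \<subseteq> Df n \<Longrightarrow>
         \<exists>\<C>. smooth_cell_decomposition Df n \<C> \<and> (\<forall>A\<in>\<A>. compatible \<C> A)"
    and smooth_decomposition_functions:
      "definable_fun Df n A g \<Longrightarrow>
         \<exists>\<C>. smooth_cell_decomposition Df n \<C> \<and> compatible \<C> A \<and>
             (\<forall>C\<in>\<C>. C \<subseteq> A \<longrightarrow> Cp_on n \<infinity> C g)"


section \<open>Definable manifolds and tubular neighborhoods\<close>

definition definable_submanifold ::
    "(nat \<Rightarrow> (nat \<Rightarrow> real) set set) \<Rightarrow> nat \<Rightarrow> enat \<Rightarrow> (nat \<Rightarrow> real) set \<Rightarrow> bool" where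
  "definable_submanifold Df m p M \<longleftrightarrow> M \<in> Df m \<and> (\<exists>d. submanifold m p d M)"

text \<open>\<open>\<D>\<^sup>\<infinity>(M, N)\<close>. Maps are taken to be \<^const>\<open>undefined\<close> off \<open>M\<close>, so that equality of
  functions is equality of maps on \<open>M\<close>.\<close>

definition D_inf ::
    "(nat \<Rightarrow> (nat \<Rightarrow> real) set set) \<Rightarrow> nat \<Rightarrow> (nat \<Rightarrow> real) set \<Rightarrow> nat \<Rightarrow> (nat \<Rightarrow> real) set \<Rightarrow>
     ((nat \<Rightarrow> real) \<Rightarrow> nat \<Rightarrow> real) set" where
  "D_inf Df m M n N = {f \<in> M \<rightarrow>\<^sub>E N. definable_map Df m n M f \<and> Cp_map m n \<infinity> M f}"

text \<open>The part \<open>\<parallel>v\<parallel> < \<epsilon>(x)\<close> of the normal bundle of \<open>M\<close>, as a subset of \<open>\<real>\<^sup>2\<^sup>m\<close>.\<close>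

definition normal_tube ::
    "nat \<Rightarrow> (nat \<Rightarrow> real) set \<Rightarrow> ((nat \<Rightarrow> real) \<Rightarrow> real) \<Rightarrow> (nat \<Rightarrow> real) set" where
  "normal_tube m M \<epsilon> =
     {append_vec m x v | x v. x \<in> M \<and> v \<in> Rn m \<and>
        (\<forall>w\<in>tangent_space M x. (\<Sum>i<m. v i * w i) = 0) \<and> L2_set v {..<m} < \<epsilon> x}"

definition normal_exp :: "nat \<Rightarrow> (nat \<Rightarrow> real) \<Rightarrow> nat \<Rightarrow> real" where
  "normal_exp m z = (\<lambda>i. if i < m then z i + z (m + i) else 0)"

definition tubular_neighborhood ::
    "(nat \<Rightarrow> (nat \<Rightarrow> real) set set) \<Rightarrow> nat \<Rightarrow> (nat \<Rightarrow> real) set \<Rightarrow> (nat \<Rightarrow> real) set \<Rightarrow>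
     ((nat \<Rightarrow> real) \<Rightarrow> nat \<Rightarrow> real) \<Rightarrow> bool" where
  "tubular_neighborhood Df m M T \<pi> \<longleftrightarrow>
     (\<exists>\<epsilon>. definable_fun Df m M \<epsilon> \<and> (\<exists>r::nat. Cp_on m (enat r) M \<epsilon>) \<and> (\<forall>x\<in>M. \<epsilon> x > 0) \<and>
        openin (Euclidean_space m) T \<and> M \<subseteq> T \<and>
        definable_map Df (m + m) m (normal_tube m M \<epsilon>) (normal_exp m) \<and>
        Cp_diffeo (m + m) m \<infinity> (normal_tube m M \<epsilon>) T (normal_exp m) \<and>
        (\<forall>z\<in>normal_tube m M \<epsilon>. \<pi> (normal_exp m z) = trunc m z))"

text \<open>A fixed definable tubular neighborhood of each definable smooth submanifold, which exists by the
  definable tubular neighborhood theorem. Only the germ of the retraction along \<open>M\<close> enters below,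
  and this germ does not depend on the choice.\<close>

definition tubular_retraction ::
    "(nat \<Rightarrow> (nat \<Rightarrow> real) set set) \<Rightarrow> nat \<Rightarrow> (nat \<Rightarrow> real) set \<Rightarrow>
     (nat \<Rightarrow> real) \<Rightarrow> nat \<Rightarrow> real" where
  "tubular_retraction Df m M = (SOME \<pi>. \<exists>T. tubular_neighborhood Df m M T \<pi>)"


section \<open>Jets and the topology of the mapping space\<close>

definition multi_indices :: "nat \<Rightarrow> nat \<Rightarrow> (nat \<Rightarrow> nat) set" where
  "multi_indices m k = {\<alpha>. (\<forall>i\<ge>m. \<alpha> i = 0) \<and> 1 \<le> (\<Sum>i<m. \<alpha> i) \<and> (\<Sum>i<m. \<alpha> i) \<le> k}"

definition jet_dim :: "nat \<Rightarrow> nat \<Rightarrow> nat \<Rightarrow> nat" where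
  "jet_dim m n k = m + n + n * card (multi_indices m k)"

text \<open>The point \<open>(x, f(x), (\<partial>\<^sup>\<alpha>(f \<circ> \<pi>\<^sub>M)(x))\<^sub>\<alpha>)\<close>. The finite set of multi-indices is enumerated by
  \<^const>\<open>from_nat_into\<close>, which is a bijection from \<open>{..<card (multi_indices m k)}\<close>; the choice of
  enumeration only permutes coordinates.\<close>

definition jet ::
    "(nat \<Rightarrow> (nat \<Rightarrow> real) set set) \<Rightarrow> nat \<Rightarrow> (nat \<Rightarrow> real) set \<Rightarrow> nat \<Rightarrow> nat \<Rightarrow>
     ((nat \<Rightarrow> real) \<Rightarrow> nat \<Rightarrow> real) \<Rightarrow> (nat \<Rightarrow> real) \<Rightarrow> nat \<Rightarrow> real" where
  "jet Df m M n k f x = (\<lambda>i.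
     if i < m then x i
     else if i < m + n then f x (i - m)
     else if i < jet_dim m n k then
       mixed_pderiv m (from_nat_into (multi_indices m k) ((i - (m + n)) div n))
         (\<lambda>w. f (tubular_retraction Df m M w) ((i - (m + n)) mod n)) x
     else 0)"

definition jet_space ::
    "(nat \<Rightarrow> (nat \<Rightarrow> real) set set) \<Rightarrow> nat \<Rightarrow> (nat \<Rightarrow> real) set \<Rightarrow> nat \<Rightarrow> (nat \<Rightarrow> real) set \<Rightarrow>
     nat \<Rightarrow> (nat \<Rightarrow> real) set" where
  "jet_space Df m M n N k = {jet Df m M n k f x | x f. x \<in> M \<and> f \<in> D_inf Df m M n N}"

definition Dk_basis ::
    "(nat \<Rightarrow> (nat \<Rightarrow> real) set set) \<Rightarrow> nat \<Rightarrow> (nat \<Rightarrow> real) set \<Rightarrow> nat \<Rightarrow> (nat \<Rightarrow> real) set \<Rightarrow>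
     nat \<Rightarrow> ((nat \<Rightarrow> real) \<Rightarrow> nat \<Rightarrow> real) set set" where
  "Dk_basis Df m M n N k =
     {{f \<in> D_inf Df m M n N. jet Df m M n k f ` M \<subseteq> U} | U.
        U \<in> Df (jet_dim m n k) \<and>
        openin (subtopology (Euclidean_space (jet_dim m n k)) (jet_space Df m M n N k)) U}"

text \<open>The union of the bases is closed under finite intersections (pull back along the projections
  between jet spaces), so generating a topology from it amounts to taking unions.\<close>

definition D_inf_topology ::
    "(nat \<Rightarrow> (nat \<Rightarrow> real) set set) \<Rightarrow> nat \<Rightarrow> (nat \<Rightarrow> real) set \<Rightarrow> nat \<Rightarrow> (nat \<Rightarrow> real) set \<Rightarrow>
     ((nat \<Rightarrow> real) \<Rightarrow> nat \<Rightarrow> real) topology" where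
  "D_inf_topology Df m M n N = topology_generated_by (\<Union>k. Dk_basis Df m M n N k)"


section \<open>Stratifications\<close>

definition definable_stratification ::
    "(nat \<Rightarrow> (nat \<Rightarrow> real) set set) \<Rightarrow> nat \<Rightarrow> (nat \<Rightarrow> real) set \<Rightarrow> (nat \<Rightarrow> real) set set \<Rightarrow> bool" where
  "definable_stratification Df q V \<Sigma> \<longleftrightarrow>
     V \<in> Df q \<and> finite \<Sigma> \<and> partition_on V \<Sigma> \<and> (\<forall>X\<in>\<Sigma>. definable_submanifold Df q 1 X) \<and>
     (\<forall>X\<in>\<Sigma>. \<forall>Y\<in>\<Sigma>. Y \<inter> (Euclidean_space q closure_of X) \<noteq> {} \<longrightarrow>
        Y \<subseteq> Euclidean_space q closure_of X)"

text \<open>The Grassmannian of \<open>d\<close>-dimensional linear subspaces of \<open>\<real>\<^sup>q\<close>, with the quotient topology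
  from the space of linearly independent \<open>d\<close>-frames.\<close>

definition lin_span :: "nat \<Rightarrow> (nat \<Rightarrow> nat \<Rightarrow> real) \<Rightarrow> (nat \<Rightarrow> real) set" where
  "lin_span d b = {\<lambda>i. \<Sum>j<d. c j * b j i | c. True}"

definition frames :: "nat \<Rightarrow> nat \<Rightarrow> (nat \<Rightarrow> nat \<Rightarrow> real) topology" where
  "frames q d =
     subtopology (product_topology (\<lambda>_. Euclidean_space q) {..<d})
       {b. \<forall>c. (\<forall>i. (\<Sum>j<d. c j * b j i) = 0) \<longrightarrow> (\<forall>j<d. c j = 0)}"

definition grassmannian :: "nat \<Rightarrow> nat \<Rightarrow> (nat \<Rightarrow> real) set topology" where
  "grassmannian q d = topology (\<lambda>\<O>. \<O> \<subseteq> lin_span d ` topspace (frames q d) \<and>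
     openin (frames q d) {b \<in> topspace (frames q d). lin_span d b \<in> \<O>})"

lemma openin_grassmannian:
  "openin (grassmannian q d) \<O> \<longleftrightarrow> \<O> \<subseteq> lin_span d ` topspace (frames q d) \<and>
     openin (frames q d) {b \<in> topspace (frames q d). lin_span d b \<in> \<O>}"
proof -
  have "istopology (\<lambda>\<O>. \<O> \<subseteq> lin_span d ` topspace (frames q d) \<and>
     openin (frames q d) {b \<in> topspace (frames q d). lin_span d b \<in> \<O>})"
    unfolding istopology_def
  proof (intro conjI allI impI)
    fix S T
    assume S: "S \<subseteq> lin_span d ` topspace (frames q d) \<and>
         openin (frames q d) {b \<in> topspace (frames q d). lin_span d b \<in> S}"
      and T: "T \<subseteq> lin_span d ` topspace (frames q d) \<and>
         openin (frames q d) {b \<in> topspace (frames q d). lin_span d b \<in> T}"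
    show "S \<inter> T \<subseteq> lin_span d ` topspace (frames q d)" using S by blast
    have *: "{b \<in> topspace (frames q d). lin_span d b \<in> S \<inter> T} =
        {b \<in> topspace (frames q d). lin_span d b \<in> S} \<inter>
        {b \<in> topspace (frames q d). lin_span d b \<in> T}" by blast
    show "openin (frames q d) {b \<in> topspace (frames q d). lin_span d b \<in> S \<inter> T}"
      unfolding * using S T by (intro openin_Int) auto
  next
    fix \<K>
    assume K: "\<forall>K\<in>\<K>. K \<subseteq> lin_span d ` topspace (frames q d) \<and>
         openin (frames q d) {b \<in> topspace (frames q d). lin_span d b \<in> K}"
    show "\<Union>\<K> \<subseteq> lin_span d ` topspace (frames q d)" using K by blast
    have *: "{b \<in> topspace (frames q d). lin_span d b \<in> \<Union>\<K>} =
        \<Union>((\<lambda>K. {b \<in> topspace (frames q d). lin_span d b \<in> K}) ` \<K>)" by blast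
    show "openin (frames q d) {b \<in> topspace (frames q d). lin_span d b \<in> \<Union>\<K>}"
      unfolding * using K by (intro openin_Union) auto
  qed
  then show ?thesis unfolding grassmannian_def by (simp add: topology_inverse')
qed

definition whitney_a_over ::
    "nat \<Rightarrow> (nat \<Rightarrow> real) set \<Rightarrow> (nat \<Rightarrow> real) set \<Rightarrow> bool" where
  "whitney_a_over q X Y \<longleftrightarrow>
     (\<forall>y \<in> Y \<inter> (Euclidean_space q closure_of X). \<forall>x \<tau>.
        (\<forall>i. x i \<in> X) \<and> limitin (Euclidean_space q) x y sequentially \<and>
        limitin (grassmannian q (mdim q X)) (\<lambda>i. tangent_space X (x i)) \<tau> sequentially \<longrightarrow>
        tangent_space Y y \<subseteq> \<tau>)"

definition whitney_a_regular :: "nat \<Rightarrow> (nat \<Rightarrow> real) set set \<Rightarrow> bool" where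
  "whitney_a_regular q \<Sigma> \<longleftrightarrow>
     (\<forall>X\<in>\<Sigma>. \<forall>Y\<in>\<Sigma>. Y \<inter> (Euclidean_space q closure_of X) \<noteq> {} \<longrightarrow> whitney_a_over q X Y)"

end

theory Submission
 imports Defs
begin

text \<open>
 \<^item> (1) implies (2). Transversality of \<open>f\<close> to \<open>\<Sigma>\<close> is a condition on its 1-jets, and a definable one. If
  non-transverse jets over a stratum \<open>X\<close> tend to a jet over \<open>y \<in> Y\<close>, the unit vectors of \<open>TN\<close> orthogonal
  to the image of the differential and to \<open>TX\<close> subconverge to one orthogonal to \<open>lim TX \<supseteq> T\<^sub>yY\<close>, so the
  limit jet is not transverse: the transverse jets form an open set.
 \<^item> (3) implies (1). If \<open>v \<in> T\<^sub>yY\<close> is not in \<open>lim T\<^sub>xX\<close>, there are unit vectors \<open>\<eta>\<^sub>s \<in> TN\<close> orthogonal to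
  \<open>TX\<close> at \<open>x\<^sub>s\<close> with limit \<open>\<eta>\<close> not orthogonal to \<open>v\<close>. On a small ball of the ambient space,
  \<open>w \<mapsto> \<pi>\<^sub>N(y + w - (1 - |w|\<^sup>2)\<langle>w,\<eta>\<rangle>\<eta>)\<close> is transverse to \<open>\<Sigma>\<close>; perturbing it by the bump function built from
  \<open>exp(-1/t)\<close> gives definable maps with \<open>0 \<mapsto> x\<^sub>s\<close> and differential orthogonal to \<open>\<eta>\<^sub>s\<close>, which are not. The
  common compact support turns \<open>C\<^sup>\<infinity>\<close> convergence into convergence in the \<open>\<D>\<^sup>\<infinity>\<close>-topology.
\<close>

text \<open>The jet of a map is taken along a tubular retraction picked by choice, so it means
  nothing until a definable tubular neighborhood is known to exist. The obstacle is a definable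
  radius. A local form of reach supplies one: it is the supremum of a first-order condition, it is
  1-Lipschitz, and Taylor's formula makes it positive. A quarter of it is small enough for
  injectivity and for the implicit function theorem. Tangent vectors are given by curves, over which
  no formula can quantify; a description by difference quotients makes them definable. Since the jet
  space consists of jets of definable maps only, every formal 1-jet has to be realized by such a map
  before openness of a set of jets says anything about maps. Closedness of the support in
  \<open>N\<close> is what places the limit point in (1) implies (2) on a stratum. The test manifold
  for (3) is a ball of the ambient space, of dimension at least \<open>dim N\<close>, mapped near
  \<open>y\<close> and then retracted onto \<open>N\<close>. One manifold thus serves (2) and (3),
  and no chart of \<open>N\<close> has to be definable.\<close>

abbreviation opn :: "nat => (nat => real) set => bool" where
 "opn n \<equiv> openin (Euclidean_space n)"

section \<open>Open sets, limits and continuity in coordinates\<close>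

lemma mem_Rn: "x \<in> Rn n \<longleftrightarrow> (\<forall>i\<ge>n. x i = 0)"
 by (simp add: topspace_Euclidean_space)

lemma Rn_upd: "x \<in> Rn n ==> i < n ==> x(i := t) \<in> Rn n"
 by (auto simp: mem_Rn)

lemma openin_Euclidean_space_iff: "opn n U \<longleftrightarrow> (\<exists>T. open T \<and> U = Rn n \<inter> T)"
 by (simp add: Euclidean_space_def euclidean_product_topology openin_open)

lemma subtopology_Rn: "U \<subseteq> Rn n ==> subtopology (Euclidean_space n) U = top_of_set U"
 by (simp add: Euclidean_space_def euclidean_product_topology subtopology_subtopology Int_absorb1)

lemma tendsto_fun_iff:
 fixes f :: "'b => 'a => 'c::topological_space"
 shows "(f \<longlongrightarrow> l) F \<longleftrightarrow> (\<forall>i. ((\<lambda>n. f n i) \<longlongrightarrow> l i) F)"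
 using limitin_componentwise[of "\<lambda>i. euclidean" UNIV f l F]
 by (simp add: euclidean_product_topology)

lemma tendsto_Rn:
 assumes "\<forall>\<^sub>F s in F. f s \<in> Rn n" "l \<in> Rn n" "\<And>i. i < n ==> ((\<lambda>s. f s i) \<longlongrightarrow> l i) F"
 shows "(f \<longlongrightarrow> l) F"
 unfolding tendsto_fun_iff
proof
 fix i show "((\<lambda>s. f s i) \<longlongrightarrow> l i) F"
 proof (cases "i < n")
  case False
  then have "\<forall>\<^sub>F s in F. f s i = l i"
   using assms(1,2) by (auto simp: mem_Rn elim!: eventually_mono)
  then show ?thesis by (rule tendsto_eventually)
 qed (use assms in auto)
qed

text \<open>A basic open set of the product topology restricts finitely many coordinates, and those
  of index at least \<open>n\<close> vanish on \<open>Rn n\<close>; a box in the first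
  \<open>n\<close> coordinates remains.\<close>

lemma opn_iff:
 "opn n U \<longleftrightarrow>
   U \<subseteq> Rn n \<and> (\<forall>x\<in>U. \<exists>e>0. \<forall>y\<in>Rn n. (\<forall>i<n. \<bar>y i - x i\<bar> < e) --> y \<in> U)"
proof
 assume L: "opn n U"
 then obtain T where T: "open T" "U = Rn n \<inter> T"
  unfolding openin_Euclidean_space_iff by blast
 show "U \<subseteq> Rn n \<and> (\<forall>x\<in>U. \<exists>e>0. \<forall>y\<in>Rn n. (\<forall>i<n. \<bar>y i - x i\<bar> < e) --> y \<in> U)"
 proof (intro conjI ballI)
  fix x assume "x \<in> U"
  then have "x \<in> T" using T(2) by blast
  have "openin (product_topology (\<lambda>i::nat. euclidean::real topology) UNIV) T"
   using T(1) unfolding open_fun_def .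
  from this \<open>x \<in> T\<close> have TT: "x \<in> T" "openin (product_topology (\<lambda>i::nat. euclidean::real topology) UNIV) T"
   by blast+
  from product_topology_open_contains_basis[OF TT(2,1)]
  obtain X where X0: "x \<in> Pi\<^sub>E UNIV X \<and> (\<forall>i. openin euclidean (X i)) \<and>
    finite {i. X i \<noteq> topspace euclidean} \<and> Pi\<^sub>E UNIV X \<subseteq> T" by (elim exE)
  then have X: "x \<in> Pi\<^sub>E UNIV X" "\<And>i. openin euclidean (X i)" "Pi\<^sub>E UNIV X \<subseteq> T"
   by simp_all
  have "\<exists>e>0. \<forall>t. \<bar>t - x i\<bar> < e --> t \<in> X i" for i
  proof -
   have "open (X i)" "x i \<in> X i" using X(1,2) by (simp_all add: PiE_iff)
   then show ?thesis by (auto simp: open_real)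
  qed
  then obtain e where e: "\<And>i. e i > 0" "\<And>i t. \<bar>t - x i\<bar> < e i ==> t \<in> X i" by metis
  \<comment> \<open>The inserted 1 keeps the minimum meaningful and positive for
    \<open>n = 0\<close>.\<close>
  define d where "d = Min (insert 1 (e ` {..<n}))"
  have d: "d > 0" "\<And>i. i < n ==> d \<le> e i" unfolding d_def by (simp_all add: e(1))
  have "y \<in> U" if y: "y \<in> Rn n" "\<forall>i<n. \<bar>y i - x i\<bar> < d" for y
  proof -
   have "y i \<in> X i" for i
   proof (cases "i < n")
    case True then show ?thesis using y d e by (meson order_less_le_trans)
   next
    case False
    then have "y i = x i" using y(1) \<open>x \<in> U\<close> T(2) by (auto simp: mem_Rn)
    then show ?thesis using X(1) by (simp add: PiE_iff)
   qed
   then have "y \<in> Pi\<^sub>E UNIV X" by (simp add: PiE_iff)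
   then show ?thesis using X(3) y(1) T(2) by blast
  qed
  then show "\<exists>e>0. \<forall>y\<in>Rn n. (\<forall>i<n. \<bar>y i - x i\<bar> < e) --> y \<in> U"
   using d(1) by (intro exI[of _ d]) simp
 qed (use T(2) in simp)
next
 assume R: "U \<subseteq> Rn n \<and> (\<forall>x\<in>U. \<exists>e>0. \<forall>y\<in>Rn n. (\<forall>i<n. \<bar>y i - x i\<bar> < e) --> y \<in> U)"
 then have R1: "U \<subseteq> Rn n" by blast
 from R obtain e where e: "\<And>x. x \<in> U ==> e x > 0"
   "\<And>x y. x \<in> U ==> y \<in> Rn n ==> \<forall>i<n. \<bar>y i - x i\<bar> < e x ==> y \<in> U" by metis
 define B where "B x = {y. \<forall>i\<in>{..<n}. y (id i) \<in> {x i - e x<..<x i + e x}}" for x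
 have "open (B x)" for x
  unfolding B_def by (rule product_topology_basis') auto
 then have "open (\<Union>x\<in>U. B x)" by blast
 moreover have "U = Rn n \<inter> (\<Union>x\<in>U. B x)"
 proof
  show "U \<subseteq> Rn n \<inter> (\<Union>x\<in>U. B x)" using R1 e(1) by (auto simp: B_def)
  have "y \<in> U" if "y \<in> Rn n" "y \<in> B x" "x \<in> U" for x y
   by (rule e(2)[OF that(3,1)]) (use that(2) in \<open>force simp: B_def abs_less_iff\<close>)
  then show "Rn n \<inter> (\<Union>x\<in>U. B x) \<subseteq> U" by blast
 qed
 ultimately show "opn n U" unfolding openin_Euclidean_space_iff by blast
qed

lemma opn_subset: "opn n U ==> U \<subseteq> Rn n"
 by (rule openin_subset)

lemma opn_eventually:
 assumes "opn n U" "p \<in> U" "(f \<longlongrightarrow> p) F" "\<forall>\<^sub>F s in F. f s \<in> Rn n"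
 shows "\<forall>\<^sub>F s in F. f s \<in> U"
proof -
 obtain T where T: "open T" "U = Rn n \<inter> T"
  using assms(1) by (auto simp: openin_Euclidean_space_iff)
 then have "\<forall>\<^sub>F s in F. f s \<in> T" using assms by (auto intro: topological_tendstoD)
 with assms(4) show ?thesis by eventually_elim (use T in auto)
qed

lemma opn_eventually_upd:
 assumes "opn n U" "x \<in> U" "i < n"
 shows "\<forall>\<^sub>F t in nhds (x i). x(i := t) \<in> U"
proof (rule opn_eventually[OF assms(1,2)])
 show "((\<lambda>t. x(i := t)) \<longlongrightarrow> x) (nhds (x i))"
  unfolding tendsto_fun_iff
 proof
  fix j show "((\<lambda>t. (x(i := t)) j) \<longlongrightarrow> x j) (nhds (x i))"
   by (cases "j = i") (auto simp: filterlim_ident)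
 qed
 show "\<forall>\<^sub>F t in nhds (x i). x(i := t) \<in> Rn n"
  using opn_subset[OF assms(1)] assms(2,3) Rn_upd by auto
qed

lemma continuous_map_opn:
 assumes "U \<subseteq> Rn n"
 shows "continuous_map (subtopology (Euclidean_space n) U) euclidean g \<longleftrightarrow> continuous_on U g"
 by (simp add: subtopology_Rn[OF assms])

lemma continuous_on_coord: "continuous_on S (\<lambda>x::nat => real. x i)"
 by (rule continuous_on_product_then_coordinatewise) simp

lemma continuous_on_opn_tendsto:
 assumes "opn n U" "continuous_on U (g :: _ => 'a::topological_space)" "p \<in> U"
  "(f \<longlongrightarrow> p) F" "\<forall>\<^sub>F s in F. f s \<in> Rn n"
 shows "((\<lambda>s. g (f s)) \<longlongrightarrow> g p) F"
 by (rule continuous_on_tendsto_compose[OF assms(2,4,3) opn_eventually[OF assms(1,3-5)]])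

section \<open>Functions of class \<open>C\<^sup>p\<close> on open sets\<close>

lemma Ck_open_continuous: "U \<subseteq> Rn n ==> Ck_open n k U g ==> continuous_on U g"
 by (cases k) (auto simp: continuous_map_opn)

lemma Ck_open_SucD: "Ck_open n (Suc k) U g ==> Ck_open n k U g"
 by (induction k arbitrary: g) auto

lemma Ck_open_pderivD: "Ck_open n (Suc k) U g ==> i < n ==> Ck_open n k U (pderiv_coord i g)"
 by simp

lemma Ck_open_mono: "Ck_open n k U g ==> j \<le> k ==> Ck_open n j U g"
proof (induction k arbitrary: j)
 case (Suc k)
 then show ?case using Ck_open_SucD[OF Suc.prems(1)] by (cases "j = Suc k") auto
qed simp

lemma pderiv_coord_cong:
 assumes "opn n U" "\<And>x. x \<in> U ==> f x = g x" "x \<in> U" "i < n"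
 shows "pderiv_coord i f x = pderiv_coord i g x"
 unfolding pderiv_coord_def
 by (rule deriv_cong_ev) (use opn_eventually_upd[OF assms(1,3,4)] in \<open>auto elim!: eventually_mono intro: assms(2)\<close>)

lemma field_differentiable_cong_opn:
 assumes "opn n U" "\<And>x. x \<in> U ==> f x = g x" "x \<in> U" "i < n"
  "(\<lambda>t. f (x(i := t))) field_differentiable (at (x i))"
 shows "(\<lambda>t. g (x(i := t))) field_differentiable (at (x i))"
proof -
 obtain D where D: "((\<lambda>t. f (x(i := t))) has_field_derivative D) (at (x i))"
  using assms(5) by (auto simp: field_differentiable_def)
 have "((\<lambda>t. g (x(i := t))) has_field_derivative D) (at (x i))"
  using D by (subst DERIV_cong_ev[OF refl _ refl, symmetric])
   (use opn_eventually_upd[OF assms(1,3,4)] in \<open>auto elim!: eventually_mono simp: assms(2)\<close>)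
 then show ?thesis by (auto simp: field_differentiable_def)
qed

lemma Ck_open_cong_imp:
 assumes "opn n U" "\<And>x. x \<in> U ==> f x = g x" "Ck_open n k U f"
 shows "Ck_open n k U g"
 using assms(2,3)
proof (induction k arbitrary: f g)
 case 0
 then show ?case using opn_subset[OF assms(1)]
  by (simp add: continuous_map_opn cong: continuous_on_cong)
next
 case (Suc k)
 have "continuous_on U g" using Suc.prems opn_subset[OF assms(1)]
  by (simp add: continuous_map_opn cong: continuous_on_cong)
 moreover have "Ck_open n k U (pderiv_coord i g)" if "i < n" for i
  by (rule Suc.IH[of "pderiv_coord i f"])
    (use that Suc.prems pderiv_coord_cong[OF assms(1) Suc.prems(1)] in auto)
 moreover have "(\<lambda>t. g (x(i := t))) field_differentiable at (x i)" if "x \<in> U" "i < n" for x i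
  by (rule field_differentiable_cong_opn[OF assms(1), of f g])
    (use Suc.prems that in \<open>auto\<close>)
 ultimately show ?case
  using opn_subset[OF assms(1)] by (simp add: continuous_map_opn)
qed

lemma Ck_open_cong:
 assumes "opn n U" "\<And>x. x \<in> U ==> f x = g x"
 shows "Ck_open n k U f \<longleftrightarrow> Ck_open n k U g"
 using Ck_open_cong_imp[OF assms(1)] assms(2) by metis

lemma Ck_open_subset: "Ck_open n k U g ==> W \<subseteq> U ==> Ck_open n k W g"
proof (induction k arbitrary: g)
 case 0 then show ?case
  using continuous_map_from_subtopology_mono by (auto, blast)
next
 case (Suc k) then show ?case
  using continuous_map_from_subtopology_mono by (auto, blast)
qed

lemma Ck_open_local:
 assumes "U \<subseteq> Rn n"
  "\<And>x. x \<in> U ==> \<exists>W. opn n W \<and> x \<in> W \<and> Ck_open n k W g"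
 shows "Ck_open n k U g"
 using assms(2)
proof (induction k arbitrary: g)
 have cont: "continuous_on U g"
  if *: "\<And>x. x \<in> U ==> \<exists>W. opn n W \<and> x \<in> W \<and> continuous_on W g" for g
  unfolding continuous_on_def
 proof
  fix x assume x: "x \<in> U"
  obtain W where W: "opn n W" "x \<in> W" "continuous_on W g"
   using *[OF x] by blast
  show "(g \<longlongrightarrow> g x) (at x within U)"
   by (rule continuous_on_opn_tendsto[OF W(1,3,2)])
     (use assms(1) in \<open>auto simp: eventually_at_filter intro!: always_eventually\<close>)
 qed
 {
  case 0
  have "continuous_on U g"
   by (rule cont) (meson 0 Ck_open_continuous opn_subset)
  then show ?case using assms(1) by (simp add: continuous_map_opn)
 next
  case (Suc k)
  have "continuous_on U g"
   by (rule cont) (meson Suc Ck_open_continuous opn_subset)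
  moreover have "(\<lambda>t. g (x(i := t))) field_differentiable (at (x i))" if "x \<in> U" "i < n" for x i
   using Suc.prems[OF that(1)] that(2) by auto
  moreover have "Ck_open n k U (pderiv_coord i g)" if i: "i < n" for i
  proof (rule Suc.IH)
   fix x assume "x \<in> U"
   from Suc.prems[OF this] show "\<exists>W. opn n W \<and> x \<in> W \<and> Ck_open n k W (pderiv_coord i g)"
    using i by auto
  qed
  ultimately show ?case using assms(1) by (simp add: continuous_map_opn)
 }
qed

lemma Ck_open_1D:
 assumes "Ck_open n (Suc k) U g" "opn n U"
 shows "\<And>x i. x \<in> U ==> i < n ==> ((\<lambda>t. g (x(i := t))) has_real_derivative pderiv_coord i g x) (at (x i))"
  "\<And>i. i < n ==> continuous_on U (pderiv_coord i g)"
proof -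
 show "((\<lambda>t. g (x(i := t))) has_real_derivative pderiv_coord i g x) (at (x i))" if "x \<in> U" "i < n" for x i
  using assms(1) that by (auto simp: pderiv_coord_def DERIV_deriv_iff_field_differentiable)
 show "continuous_on U (pderiv_coord i g)" if "i < n" for i
  using assms(1) that Ck_open_continuous[OF opn_subset[OF assms(2)], of k] by auto
qed

text \<open>The coordinates of \<open>x\<close> are exchanged for those of \<open>y\<close> one at a
  time, with the one-variable mean value theorem at each exchange. All intermediate points stay in
  the coordinate hull of \<open>x\<close> and \<open>y\<close>, so partial derivatives on that hull
  suffice.\<close>

lemma telescoping_mvt:
 assumes x: "x \<in> Rn n" and y: "y \<in> Rn n"
  and D: "\<And>z i. z \<in> Rn n ==> \<forall>j<n. min (x j) (y j) \<le> z j \<and> z j \<le> max (x j) (y j) ==> i < n ==>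
   ((\<lambda>t. g (z(i := t))) has_real_derivative pderiv_coord i g z) (at (z i))"
 shows "\<exists>\<xi>. (\<forall>i<n. \<xi> i \<in> Rn n \<and> (\<forall>j<n. min (x j) (y j) \<le> \<xi> i j \<and> \<xi> i j \<le> max (x j) (y j))) \<and>
   g y - g x = (\<Sum>i<n. pderiv_coord i g (\<xi> i) * (y i - x i))"
proof -
 define h where "h k = (\<lambda>j. if j < k then y j else x j)" for k :: nat
 have h0: "h 0 = x" and hn: "h n = y"
  using x y by (auto simp: h_def mem_Rn fun_eq_iff)
 have step: "\<exists>\<xi>. \<xi> \<in> Rn n \<and> (\<forall>j<n. min (x j) (y j) \<le> \<xi> j \<and> \<xi> j \<le> max (x j) (y j)) \<and>
   g (h (Suc i)) - g (h i) = pderiv_coord i g \<xi> * (y i - x i)" if i: "i < n" for i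
 proof -
  have hi: "h (Suc i) = (h i)(i := y i)" "h i = (h i)(i := x i)"
   by (auto simp: h_def fun_eq_iff)
  have box: "(h i)(i := t) \<in> Rn n \<and> (\<forall>j<n. min (x j) (y j) \<le> ((h i)(i := t)) j \<and> ((h i)(i := t)) j \<le> max (x j) (y j))"
   if "min (x i) (y i) \<le> t" "t \<le> max (x i) (y i)" for t
   using that x y i by (auto simp: mem_Rn h_def)
  define G where "G t = g ((h i)(i := t))" for t
  have GD: "(G has_real_derivative pderiv_coord i g ((h i)(i := t))) (at t)"
   if "min (x i) (y i) \<le> t" "t \<le> max (x i) (y i)" for t
   using D[of "(h i)(i := t)" i] box[OF that] i unfolding G_def by simp
  have "\<exists>t. min (x i) (y i) \<le> t \<and> t \<le> max (x i) (y i) \<and>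
    G (y i) - G (x i) = pderiv_coord i g ((h i)(i := t)) * (y i - x i)"
  proof -
   consider "x i < y i" | "y i < x i" | "x i = y i" by linarith
   then show ?thesis
   proof cases
    case 1
    from MVT2[of "x i" "y i" G "\<lambda>t. pderiv_coord i g ((h i)(i := t))"] 1 GD
    obtain z where z: "x i < z" "z < y i" "G (y i) - G (x i) = (y i - x i) * pderiv_coord i g ((h i)(i := z))"
     by auto
    then show ?thesis by (intro exI[of _ z]) auto
   next
    case 2
    from MVT2[of "y i" "x i" G "\<lambda>t. pderiv_coord i g ((h i)(i := t))"] 2 GD
    obtain z where z: "y i < z" "z < x i" "G (x i) - G (y i) = (x i - y i) * pderiv_coord i g ((h i)(i := z))"
     by auto
    then show ?thesis by (intro exI[of _ z]) (auto simp: algebra_simps)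
   next
    case 3 then show ?thesis by (intro exI[of _ "x i"]) auto
   qed
  qed
  then obtain t where t: "min (x i) (y i) \<le> t" "t \<le> max (x i) (y i)"
    "G (y i) - G (x i) = pderiv_coord i g ((h i)(i := t)) * (y i - x i)" by blast
  have "G (y i) = g (h (Suc i))" "G (x i) = g (h i)" unfolding G_def using hi by simp_all
  then show ?thesis using t box[OF t(1,2)] by (intro exI[of _ "(h i)(i := t)"]) simp
 qed
 then obtain \<xi> where \<xi>: "\<And>i. i < n ==> \<xi> i \<in> Rn n \<and> (\<forall>j<n. min (x j) (y j) \<le> \<xi> i j \<and> \<xi> i j \<le> max (x j) (y j)) \<and>
   g (h (Suc i)) - g (h i) = pderiv_coord i g (\<xi> i) * (y i - x i)" by metis
 have "g y - g x = (\<Sum>i<n. g (h (Suc i)) - g (h i))"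
  using sum_lessThan_telescope[of "\<lambda>i. g (h i)" n] by (simp add: h0 hn)
 also have "\<dots> = (\<Sum>i<n. pderiv_coord i g (\<xi> i) * (y i - x i))"
  using \<xi> by (intro sum.cong) auto
 finally show ?thesis using \<xi> by blast
qed

text \<open>Strict differentiability of a \<open>C^1\<close> function: both ends of the difference
  may move. The coefficients are partial derivatives at mean value points squeezed between
  \<open>x s\<close> and \<open>y s\<close>, which forces their convergence. The chain rule, the
  contingent description of tangent vectors and the implicit function theorem rest on it.\<close>

lemma strict_diff:
 assumes U: "opn n U" and g: "Ck_open n (Suc 0) U g" and p: "p \<in> U"
  and x: "(x \<longlongrightarrow> p) F" "\<forall>\<^sub>F s in F. x s \<in> Rn n" and y: "(y \<longlongrightarrow> p) F" "\<forall>\<^sub>F s in F. y s \<in> Rn n"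
 obtains c where "\<forall>\<^sub>F s in F. g (y s) - g (x s) = (\<Sum>i<n. c s i * (y s i - x s i))"
  "\<And>i. i < n ==> ((\<lambda>s. c s i) \<longlongrightarrow> pderiv_coord i g p) F"
proof -
 obtain e where e: "e > 0" "\<And>z. z \<in> Rn n ==> \<forall>i<n. \<bar>z i - p i\<bar> < e ==> z \<in> U"
  using U p unfolding opn_iff by metis
 define P where "P s \<longleftrightarrow> x s \<in> Rn n \<and> y s \<in> Rn n \<and> (\<forall>i<n. \<bar>x s i - p i\<bar> < e) \<and> (\<forall>i<n. \<bar>y s i - p i\<bar> < e)" for s
 have ev: "\<forall>\<^sub>F s in F. \<forall>i<n. \<bar>z s i - p i\<bar> < e" if "(z \<longlongrightarrow> p) F" for z :: "'a => nat => real"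
 proof -
  have "\<forall>\<^sub>F s in F. \<forall>i\<in>{..<n}. \<bar>z s i - p i\<bar> < e"
  proof (rule eventually_ball_finite)
   show "\<forall>i\<in>{..<n}. \<forall>\<^sub>F s in F. \<bar>z s i - p i\<bar> < e"
    using that e(1) unfolding tendsto_fun_iff by (auto simp: tendsto_iff dist_real_def)
  qed simp
  then show ?thesis by (auto elim!: eventually_mono)
 qed
 have evP: "\<forall>\<^sub>F s in F. P s"
  using ev[OF x(1)] ev[OF y(1)] x(2) y(2) unfolding P_def by eventually_elim auto
 define Q where "Q s \<xi> \<longleftrightarrow> (\<forall>i<n. \<xi> i \<in> Rn n \<and> (\<forall>j<n. min (x s j) (y s j) \<le> \<xi> i j \<and> \<xi> i j \<le> max (x s j) (y s j))) \<and>
   g (y s) - g (x s) = (\<Sum>i<n. pderiv_coord i g (\<xi> i) * (y s i - x s i))" for s \<xi>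
 have "\<exists>\<xi>. Q s \<xi>" if "P s" for s
  unfolding Q_def
 proof (rule telescoping_mvt)
  fix z i assume z: "z \<in> Rn n" "\<forall>j<n. min (x s j) (y s j) \<le> z j \<and> z j \<le> max (x s j) (y s j)" and i: "i < n"
  have "z \<in> U"
  proof (rule e(2)[OF z(1)], intro allI impI)
   fix j assume "j < n"
   then have "\<bar>x s j - p j\<bar> < e" "\<bar>y s j - p j\<bar> < e" "min (x s j) (y s j) \<le> z j" "z j \<le> max (x s j) (y s j)"
    using that z unfolding P_def by auto
   then show "\<bar>z j - p j\<bar> < e" by linarith
  qed
  then show "((\<lambda>t. g (z(i := t))) has_real_derivative pderiv_coord i g z) (at (z i))"
   using Ck_open_1D(1)[OF g U] i by blast
 qed (use that in \<open>auto simp: P_def\<close>)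
 then obtain \<xi> where Q: "\<And>s. P s ==> Q s (\<xi> s)" by metis
 have \<xi>: "\<And>s i. P s ==> i < n ==> \<xi> s i \<in> Rn n \<and> (\<forall>j<n. min (x s j) (y s j) \<le> \<xi> s i j \<and> \<xi> s i j \<le> max (x s j) (y s j))"
   "\<And>s. P s ==> g (y s) - g (x s) = (\<Sum>i<n. pderiv_coord i g (\<xi> s i) * (y s i - x s i))"
  using Q unfolding Q_def by blast+
 have lim: "((\<lambda>s. \<xi> s i) \<longlongrightarrow> p) F" if i: "i < n" for i
 proof (rule tendsto_Rn)
  show "\<forall>\<^sub>F s in F. \<xi> s i \<in> Rn n" using evP by (rule eventually_mono) (use \<xi>(1) i in auto)
  show "p \<in> Rn n" using p opn_subset[OF U] by auto
  fix j assume j: "j < n"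
  have xj: "((\<lambda>s. x s j) \<longlongrightarrow> p j) F" and yj: "((\<lambda>s. y s j) \<longlongrightarrow> p j) F"
   using x(1) y(1) unfolding tendsto_fun_iff by auto
  show "((\<lambda>s. \<xi> s i j) \<longlongrightarrow> p j) F"
  proof (rule tendsto_sandwich)
   show "((\<lambda>s. min (x s j) (y s j)) \<longlongrightarrow> p j) F" using tendsto_min[OF xj yj] by simp
   show "((\<lambda>s. max (x s j) (y s j)) \<longlongrightarrow> p j) F" using tendsto_max[OF xj yj] by simp
  qed (use evP \<xi>(1) i j in \<open>auto elim!: eventually_mono\<close>)
 qed
 show thesis
 proof
  show "\<forall>\<^sub>F s in F. g (y s) - g (x s) = (\<Sum>i<n. pderiv_coord i g (\<xi> s i) * (y s i - x s i))"
   using evP by (rule eventually_mono) (use \<xi>(2) in auto)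
  show "((\<lambda>s. pderiv_coord i g (\<xi> s i)) \<longlongrightarrow> pderiv_coord i g p) F" if "i < n" for i
   by (rule continuous_on_opn_tendsto[OF U Ck_open_1D(2)[OF g U that] p lim[OF that]])
     (use evP in \<open>rule eventually_mono, use \<xi>(1) that in auto\<close>)
 qed
qed

text \<open>The expansion of \<open>strict_diff\<close> is divided by \<open>t - t0\<close>.
  Differentiability of the curve at the single time \<open>t0\<close> suffices, and that is all a
  velocity provides.\<close>

lemma chain_curve:
 assumes U: "opn n U" and g: "Ck_open n (Suc 0) U g" and p: "\<gamma> t0 \<in> U"
  and \<gamma>: "\<forall>\<^sub>F t in nhds t0. \<gamma> t \<in> Rn n"
  and D: "\<And>i. i < n ==> ((\<lambda>t. \<gamma> t i) has_real_derivative v i) (at t0)"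
 shows "((\<lambda>t. g (\<gamma> t)) has_real_derivative (\<Sum>i<n. pderiv_coord i g (\<gamma> t0) * v i)) (at t0)"
proof -
 have \<gamma>': "\<forall>\<^sub>F t in at t0. \<gamma> t \<in> Rn n"
  using \<gamma> by (simp add: eventually_at_filter eventually_mono)
 have R0: "\<gamma> t0 \<in> Rn n" using p opn_subset[OF U] by auto
 have lim: "(\<gamma> \<longlongrightarrow> \<gamma> t0) (at t0)"
 proof (rule tendsto_Rn[OF \<gamma>' R0])
  fix i assume "i < n"
  from DERIV_isCont[OF D[OF this]] show "((\<lambda>t. \<gamma> t i) \<longlongrightarrow> \<gamma> t0 i) (at t0)"
   by (simp add: isCont_def)
 qed
 obtain c where c: "\<forall>\<^sub>F t in at t0. g (\<gamma> t) - g (\<gamma> t0) = (\<Sum>i<n. c t i * (\<gamma> t i - \<gamma> t0 i))"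
  "\<And>i. i < n ==> ((\<lambda>t. c t i) \<longlongrightarrow> pderiv_coord i g (\<gamma> t0)) (at t0)"
  by (rule strict_diff[OF U g p, of "\<lambda>_. \<gamma> t0" "at t0" \<gamma>]) (use R0 \<gamma>' lim in auto)
 have "((\<lambda>t. \<Sum>i<n. c t i * ((\<gamma> t i - \<gamma> t0 i) / (t - t0))) \<longlongrightarrow> (\<Sum>i<n. pderiv_coord i g (\<gamma> t0) * v i)) (at t0)"
  by (intro tendsto_sum tendsto_mult) (use c D in \<open>auto simp: has_field_derivative_iff\<close>)
 then have "((\<lambda>t. (g (\<gamma> t) - g (\<gamma> t0)) / (t - t0)) \<longlongrightarrow> (\<Sum>i<n. pderiv_coord i g (\<gamma> t0) * v i)) (at t0)"
 proof (rule Lim_transform_eventually)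
  show "\<forall>\<^sub>F t in at t0. (\<Sum>i<n. c t i * ((\<gamma> t i - \<gamma> t0 i) / (t - t0))) = (g (\<gamma> t) - g (\<gamma> t0)) / (t - t0)"
   using c(1) by eventually_elim (simp add: sum_divide_distrib)
 qed
 then show ?thesis by (simp add: has_field_derivative_iff)
qed

lemma pderiv_coord_eqI:
 "((\<lambda>t. g (x(i := t))) has_real_derivative D) (at (x i)) ==> pderiv_coord i g x = D"
 unfolding pderiv_coord_def by (rule DERIV_imp_deriv)

lemma Ck_open_SucI:
 assumes U: "opn n U" and c: "continuous_on U g"
  and d: "\<And>x i. x \<in> U ==> i < n ==> ((\<lambda>t. g (x(i := t))) has_real_derivative D i x) (at (x i))"
  and k: "\<And>i. i < n ==> Ck_open n k U (D i)"
 shows "Ck_open n (Suc k) U g"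
proof -
 have "Ck_open n k U (pderiv_coord i g)" if "i < n" for i
  using Ck_open_cong[OF U, of "pderiv_coord i g" "D i"] d k that pderiv_coord_eqI by metis
 then show ?thesis using c d opn_subset[OF U]
  by (auto simp: continuous_map_opn field_differentiable_def)
qed

lemma Ck_open_const: "opn n U ==> Ck_open n k U (\<lambda>_. c)"
proof (induction k arbitrary: c)
 case 0 then show ?case by auto
next
 case (Suc k) show ?case
  by (rule Ck_open_SucI[where D = "\<lambda>_ _. 0"]) (use Suc in auto)
qed

lemma Ck_open_coord: "opn n U ==> Ck_open n k U (\<lambda>x. x i)"
proof (cases k)
 case 0
 moreover assume "opn n U"
 ultimately show ?thesis using opn_subset by (auto simp: continuous_map_opn continuous_on_coord)
next
 case (Suc k')
 moreover assume U: "opn n U"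
 have "Ck_open n (Suc k') U (\<lambda>x. x i)"
  by (rule Ck_open_SucI[where D = "\<lambda>j _. if i = j then 1 else 0", OF U])
    (use U in \<open>auto intro!: Ck_open_const continuous_on_coord derivative_eq_intros\<close>)
 ultimately show ?thesis by simp
qed

lemma Ck_open_add:
 assumes U: "opn n U" and "Ck_open n k U f" "Ck_open n k U g"
 shows "Ck_open n k U (\<lambda>x. f x + g x)"
 using assms(2,3)
proof (induction k arbitrary: f g)
 case 0
 then show ?case using opn_subset[OF U] by (auto simp: continuous_map_opn intro: continuous_intros)
next
 case (Suc k)
 have c: "continuous_on U f" "continuous_on U g"
  using Suc.prems Ck_open_continuous opn_subset[OF U] by blast+
 show ?case
  by (rule Ck_open_SucI[where D = "\<lambda>i x. pderiv_coord i f x + pderiv_coord i g x", OF U])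
    (use c Suc Ck_open_1D(1)[OF Suc.prems(1) U] Ck_open_1D(1)[OF Suc.prems(2) U] in
     \<open>auto intro: continuous_intros derivative_intros\<close>)
qed

lemma Ck_open_mult:
 assumes U: "opn n U" and "Ck_open n k U f" "Ck_open n k U g"
 shows "Ck_open n k U (\<lambda>x. f x * g x)"
 using assms(2,3)
proof (induction k arbitrary: f g)
 case 0
 then show ?case using opn_subset[OF U] by (auto simp: continuous_map_opn intro: continuous_intros)
next
 case (Suc k)
 have c: "continuous_on U f" "continuous_on U g"
  using Suc.prems Ck_open_continuous opn_subset[OF U] by blast+
 show ?case
 proof (rule Ck_open_SucI[where D = "\<lambda>i x. pderiv_coord i f x * g x + f x * pderiv_coord i g x", OF U])
  fix x i assume x: "x \<in> U" and i: "i < n"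
  show "((\<lambda>t. f (x(i := t)) * g (x(i := t))) has_real_derivative
    pderiv_coord i f x * g x + f x * pderiv_coord i g x) (at (x i))"
   by (rule derivative_eq_intros Ck_open_1D(1)[OF Suc.prems(1) U x i] Ck_open_1D(1)[OF Suc.prems(2) U x i])+ simp
 next
  fix i assume i: "i < n"
  then show "Ck_open n k U (\<lambda>x. pderiv_coord i f x * g x + f x * pderiv_coord i g x)"
   by (intro Ck_open_add[OF U] Suc.IH Ck_open_SucD[OF Suc.prems(1)] Ck_open_SucD[OF Suc.prems(2)]
      Ck_open_pderivD[OF Suc.prems(1)] Ck_open_pderivD[OF Suc.prems(2)])
 qed (use c in \<open>auto intro: continuous_intros\<close>)
qed

lemma Ck_open_sum:
 assumes U: "opn n U" and "finite I" "\<And>i. i \<in> I ==> Ck_open n k U (f i)"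
 shows "Ck_open n k U (\<lambda>x. \<Sum>i\<in>I. f i x)"
 using assms(2,3) by (induction I rule: finite_induct) (auto intro: Ck_open_const Ck_open_add U)

text \<open>Induction on \<open>k\<close> for all \<open>g\<close> at once: the chain rule produces
  composites of partial derivatives of \<open>g\<close> with the same inner map, which are one order
  less smooth.\<close>

lemma Ck_open_compose:
 assumes U: "opn m U" and W: "opn n W"
  and "Ck_open n k W g" "\<And>i. i < n ==> Ck_open m k U (\<lambda>x. G x i)" "G \<in> U \<rightarrow> W"
 shows "Ck_open m k U (\<lambda>x. g (G x))"
 using assms(3,4)
proof (induction k arbitrary: g)
 have G: "continuous_on U G" if "\<And>i. i < n ==> continuous_on U (\<lambda>x. G x i)"
 proof (rule continuous_on_coordinatewise_then_product)
  fix i show "continuous_on U (\<lambda>x. G x i)"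
  proof (cases "i < n")
   case False
   then have "G x i = 0" if "x \<in> U" for x
    using that assms(5) opn_subset[OF W] by (force simp: mem_Rn)
   then show ?thesis by (simp cong: continuous_on_cong)
  qed (use that in auto)
 qed
 {
  case 0
  have "continuous_on U (\<lambda>x. g (G x))"
   using 0 opn_subset[OF U] opn_subset[OF W] assms(5)
   by (intro continuous_on_compose2[of W g U G] G) (auto simp: continuous_map_opn)
  then show ?case using opn_subset[OF U] by (simp add: continuous_map_opn)
 next
  case (Suc k)
  have cG: "continuous_on U G" using Suc.prems(2) Ck_open_continuous[OF opn_subset[OF U]] G by blast
  show ?case
  proof (rule Ck_open_SucI[where D = "\<lambda>j x. \<Sum>i<n. pderiv_coord i g (G x) * pderiv_coord j (\<lambda>x. G x i) x", OF U])
   show "continuous_on U (\<lambda>x. g (G x))"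
    using Ck_open_continuous[OF opn_subset[OF W] Suc.prems(1)] cG assms(5)
    by (intro continuous_on_compose2[of W g U G]) auto
  next
   fix x j assume x: "x \<in> U" and j: "j < m"
   have xj: "x(j := x j) = x" by simp
   have g1: "Ck_open n (Suc 0) W g" using Suc.prems(1) by (rule Ck_open_mono) simp
   have "((\<lambda>t. g (G (x(j := t)))) has_real_derivative
     (\<Sum>i<n. pderiv_coord i g (G (x(j := x j))) * pderiv_coord j (\<lambda>x. G x i) x)) (at (x j))"
   proof (rule chain_curve[OF W g1])
    show "G (x(j := x j)) \<in> W" using x assms(5) by auto
    show "\<forall>\<^sub>F t in nhds (x j). G (x(j := t)) \<in> Rn n"
     using opn_eventually_upd[OF U x j] by (rule eventually_mono) (use assms(5) opn_subset[OF W] in auto)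
    show "((\<lambda>t. G (x(j := t)) i) has_real_derivative pderiv_coord j (\<lambda>x. G x i) x) (at (x j))" if "i < n" for i
     using Ck_open_1D(1)[OF Suc.prems(2)[OF that] U x j] .
   qed
   then show "((\<lambda>t. g (G (x(j := t)))) has_real_derivative
     (\<Sum>i<n. pderiv_coord i g (G x) * pderiv_coord j (\<lambda>x. G x i) x)) (at (x j))" by simp
  next
   fix j assume j: "j < m"
   show "Ck_open m k U (\<lambda>x. \<Sum>i<n. pderiv_coord i g (G x) * pderiv_coord j (\<lambda>x. G x i) x)"
   proof (rule Ck_open_sum[OF U finite_lessThan], rule Ck_open_mult[OF U])
    fix i assume "i \<in> {..<n}"
    then have i: "i < n" by simp
    show "Ck_open m k U (\<lambda>x. pderiv_coord i g (G x))"
     by (rule Suc.IH[OF Ck_open_pderivD[OF Suc.prems(1) i] Ck_open_SucD[OF Suc.prems(2)]])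
    show "Ck_open m k U (pderiv_coord j (\<lambda>x. G x i))"
     by (rule Ck_open_pderivD[OF Suc.prems(2)[OF i] j])
   qed
  qed
 }
qed

lemma pderiv_coord_compose:
 assumes U: "opn m U" and W: "opn n W"
  and g: "Ck_open n (Suc 0) W g" and G: "\<And>i. i < n ==> Ck_open m (Suc 0) U (\<lambda>x. G x i)" "G \<in> U \<rightarrow> W"
  and x: "x \<in> U" and j: "j < m"
 shows "pderiv_coord j (\<lambda>x. g (G x)) x = (\<Sum>i<n. pderiv_coord i g (G x) * pderiv_coord j (\<lambda>x. G x i) x)"
proof (rule pderiv_coord_eqI)
 have "((\<lambda>t. g (G (x(j := t)))) has_real_derivative
     (\<Sum>i<n. pderiv_coord i g (G (x(j := x j))) * pderiv_coord j (\<lambda>x. G x i) x)) (at (x j))"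
 proof (rule chain_curve[OF W g])
  show "G (x(j := x j)) \<in> W" using x G(2) by auto
  show "\<forall>\<^sub>F t in nhds (x j). G (x(j := t)) \<in> Rn n"
   using opn_eventually_upd[OF U x j] by (rule eventually_mono) (use G(2) opn_subset[OF W] in auto)
  show "((\<lambda>t. G (x(j := t)) i) has_real_derivative pderiv_coord j (\<lambda>x. G x i) x) (at (x j))" if "i < n" for i
   using Ck_open_1D(1)[OF G(1)[OF that] U x j] .
 qed
 then show "((\<lambda>t. g (G (x(j := t)))) has_real_derivative
     (\<Sum>i<n. pderiv_coord i g (G x) * pderiv_coord j (\<lambda>x. G x i) x)) (at (x j))" by simp
qed

text \<open>The class \<open>C^p\<close> without local extensions; on open sets it agrees with
  \<open>Cp_on\<close>, by \<open>Cp_on_open_iff\<close>.\<close>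

definition Cp_open :: "nat => enat => (nat => real) set => ((nat => real) => real) => bool" where
 "Cp_open n p U g \<longleftrightarrow> (\<forall>k. enat k \<le> p --> Ck_open n k U g)"

lemma Cp_open_const: "opn n U ==> Cp_open n p U (\<lambda>_. c)"
 by (simp add: Cp_open_def Ck_open_const)

lemma Cp_open_coord: "opn n U ==> Cp_open n p U (\<lambda>x. x i)"
 by (simp add: Cp_open_def Ck_open_coord)

lemma Cp_open_add:
 "opn n U ==> Cp_open n p U f ==> Cp_open n p U g ==> Cp_open n p U (\<lambda>x. f x + g x)"
 by (simp add: Cp_open_def Ck_open_add)

lemma Cp_open_mult:
 "opn n U ==> Cp_open n p U f ==> Cp_open n p U g ==> Cp_open n p U (\<lambda>x. f x * g x)"
 by (simp add: Cp_open_def Ck_open_mult)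

lemma Cp_open_uminus:
 assumes "opn n U" "Cp_open n p U f"
 shows "Cp_open n p U (\<lambda>x. - f x)"
 using Cp_open_mult[OF assms(1) Cp_open_const[OF assms(1), of p "-1"] assms(2)] by simp

lemma Cp_open_diff:
 "opn n U ==> Cp_open n p U f ==> Cp_open n p U g ==> Cp_open n p U (\<lambda>x. f x - g x)"
 using Cp_open_add[of n U p f "\<lambda>x. - g x"] Cp_open_uminus[of n U p g] by simp

lemma Cp_open_sum:
 assumes "opn n U" "finite I" "\<And>i. i \<in> I ==> Cp_open n p U (f i)"
 shows "Cp_open n p U (\<lambda>x. \<Sum>i\<in>I. f i x)"
 using assms by (auto simp: Cp_open_def intro: Ck_open_sum)

lemma Cp_open_compose:
 assumes "opn m U" "opn n W"
  "Cp_open n p W g" "\<And>i. i < n ==> Cp_open m p U (\<lambda>x. G x i)" "G \<in> U \<rightarrow> W"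
 shows "Cp_open m p U (\<lambda>x. g (G x))"
 unfolding Cp_open_def
proof (intro allI impI)
 fix k assume k: "enat k \<le> p"
 show "Ck_open m k U (\<lambda>x. g (G x))"
  by (rule Ck_open_compose[OF assms(1,2) _ _ assms(5)]) (use assms(3,4) k in \<open>simp_all add: Cp_open_def\<close>)
qed

lemma Cp_open_cong:
 "opn n U ==> (\<And>x. x \<in> U ==> f x = g x) ==> Cp_open n p U f \<longleftrightarrow> Cp_open n p U g"
 unfolding Cp_open_def using Ck_open_cong by blast

lemma Cp_open_subset: "Cp_open n p U g ==> W \<subseteq> U ==> Cp_open n p W g"
 unfolding Cp_open_def using Ck_open_subset by blast

lemma Cp_open_Ck: "Cp_open n p U g ==> enat k \<le> p ==> Ck_open n k U g"
 unfolding Cp_open_def by simp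

lemma Cp_open_local:
 assumes "U \<subseteq> Rn n"
  "\<And>x. x \<in> U ==> \<exists>W. opn n W \<and> x \<in> W \<and> Cp_open n p W g"
 shows "Cp_open n p U g"
 unfolding Cp_open_def
proof (intro allI impI Ck_open_local[OF assms(1)])
 fix k x assume "enat k \<le> p" "x \<in> U"
 then show "\<exists>W. opn n W \<and> x \<in> W \<and> Ck_open n k W g"
  using assms(2)[of x] unfolding Cp_open_def by blast
qed

lemma Cp_on_open_iff:
 assumes U: "opn n U"
 shows "Cp_on n p U g \<longleftrightarrow> Cp_open n p U g"
proof
 assume L: "Cp_on n p U g"
 show "Cp_open n p U g"
 proof (rule Cp_open_local[OF opn_subset[OF U]])
  fix x assume "x \<in> U"
  then obtain W h where W: "opn n W" "x \<in> W" "Cp_open n p W h" "\<forall>y\<in>W \<inter> U. h y = g y"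
   using L unfolding Cp_on_def Cp_open_def by metis
  have "Cp_open n p (W \<inter> U) g"
   using Cp_open_cong[OF openin_Int[OF W(1) U], of h g p] W(4) Cp_open_subset[OF W(3), of "W \<inter> U"] by auto
  then show "\<exists>W. opn n W \<and> x \<in> W \<and> Cp_open n p W g"
   using openin_Int[OF W(1) U] W(2) \<open>x \<in> U\<close> by blast
 qed
next
 assume "Cp_open n p U g"
 then show "Cp_on n p U g" using U unfolding Cp_on_def Cp_open_def by blast
qed

lemma Cp_open_pderiv:
 assumes "Cp_open n \<infinity> U g" "i < n"
 shows "Cp_open n \<infinity> U (pderiv_coord i g)"
 unfolding Cp_open_def
proof (intro allI impI)
 fix k
 have "enat (Suc k) \<le> \<infinity>" by simp
 then have "Ck_open n (Suc k) U g" using assms(1) unfolding Cp_open_def by blast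
 then show "Ck_open n k U (pderiv_coord i g)" by (rule Ck_open_pderivD[OF _ assms(2)])
qed

lemma opn_1: "open S ==> opn 1 {x \<in> Rn 1. x 0 \<in> S}"
 unfolding opn_iff open_real by (auto simp del: One_nat_def) (meson less_one)

text \<open>The whole tower of derivatives is supplied as \<open>D\<close>, so no iterated
  derivative has to be computed. Reciprocals and the bump function enter through such
  towers.\<close>

lemma Ck_open_1:
 assumes S: "open S" and D: "\<And>j t. t \<in> S ==> (D j has_real_derivative D (Suc j) t) (at t)"
 shows "Ck_open 1 k {x \<in> Rn 1. x 0 \<in> S} (\<lambda>x. D j (x 0))"
proof (induction k arbitrary: j)
 have c: "continuous_on {x \<in> Rn 1. x 0 \<in> S} (\<lambda>x. D j (x 0))" for j
  by (rule continuous_on_compose2[of S "D j"])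
    (use D in \<open>auto intro!: DERIV_isCont continuous_at_imp_continuous_on continuous_on_coord\<close>)
 {
  case 0 show ?case using c by (simp add: continuous_map_opn)
 next
  case (Suc k) show ?case
   by (rule Ck_open_SucI[OF opn_1[OF S] c, where D = "\<lambda>i x. D (Suc j) (x 0)"]) (use D Suc in auto)
 }
qed

lemma Cp_open_real_compose:
 assumes U: "opn n U" and S: "open S"
  and D: "\<And>j t. t \<in> S ==> (D j has_real_derivative D (Suc j) t) (at t)"
  and f: "Cp_open n p U f" "\<And>x. x \<in> U ==> f x \<in> S"
 shows "Cp_open n p U (\<lambda>x. D 0 (f x))"
proof -
 have "Cp_open n p U (\<lambda>x. (\<lambda>y. D 0 (y (0::nat))) ((\<lambda>x i. if i = 0 then f x else 0) x))"
 proof (rule Cp_open_compose[where g = "\<lambda>y. D 0 (y 0)" and G = "\<lambda>x i. if i = 0 then f x else 0", OF U opn_1[OF S]])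
  show "Cp_open 1 p {x \<in> Rn 1. x 0 \<in> S} (\<lambda>y. D 0 (y 0))"
   unfolding Cp_open_def by (intro allI impI Ck_open_1[where D = D, OF S] D)
 qed (use f in \<open>auto simp: mem_Rn\<close>)
 then show ?thesis by simp
qed

lemma Cp_open_inverse:
 assumes U: "opn n U" and f: "Cp_open n p U f" "\<And>x. x \<in> U ==> f x \<noteq> 0"
 shows "Cp_open n p U (\<lambda>x. inverse (f x))"
proof -
 have "Cp_open n p U (\<lambda>x. (\<lambda>j t. (-1)^j * fact j * inverse t ^ Suc j) 0 (f x))"
 proof (rule Cp_open_real_compose[where D = "\<lambda>j t. (-1)^j * fact j * inverse t ^ Suc j" and S = "-{0}", OF U _ _ f(1)])
  fix j and t :: real assume "t \<in> - {0}"
  then have "(inverse has_real_derivative - (inverse t ^ Suc (Suc 0))) (at t)"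
   using DERIV_inverse[of t UNIV] by simp
  from DERIV_cmult[OF DERIV_power_Suc[OF this, of j], of "(-1)^j * fact j"] show "((\<lambda>t. (-1)^j * fact j * inverse t ^ Suc j) has_real_derivative
    (-1) ^ Suc j * fact (Suc j) * inverse t ^ Suc (Suc j)) (at t)"
   by (simp add: algebra_simps)
 qed (use f in auto)
 then show ?thesis by simp
qed

section \<open>Linear algebra\<close>

definition ip :: "nat => (nat => real) => (nat => real) => real" where
 "ip n x y = (\<Sum>i<n. x i * y i)"

definition subsp :: "nat => (nat => real) set => bool" where
 "subsp n E \<longleftrightarrow> E \<subseteq> Rn n \<and> (\<lambda>_. 0) \<in> E \<and> (\<forall>x\<in>E. \<forall>y\<in>E. (\<lambda>i. x i + y i) \<in> E) \<and>
   (\<forall>x\<in>E. \<forall>c. (\<lambda>i. c * x i) \<in> E)"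

definition orthonormal :: "nat => nat => (nat => nat => real) => bool" where
 "orthonormal n d b \<longleftrightarrow> (\<forall>j<d. b j \<in> Rn n) \<and>
   (\<forall>j<d. \<forall>k<d. ip n (b j) (b k) = (if j = k then 1 else 0))"

definition indep :: "nat => (nat => nat => real) => bool" where
 "indep d b \<longleftrightarrow> (\<forall>c. (\<forall>i. (\<Sum>j<d. c j * b j i) = 0) --> (\<forall>j<d. c j = 0))"

definition proj :: "nat => nat => (nat => nat => real) => (nat => real) => nat => real" where
 "proj n d b v = (\<lambda>i. \<Sum>j<d. ip n v (b j) * b j i)"

lemma sum_kron:
 fixes f :: "nat => real"
 assumes "k < d"
 shows "(\<Sum>j<d. f j * (if j = k then 1 else 0)) = f k" "(\<Sum>j<d. f j * (if k = j then 1 else 0)) = f k"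
  "(\<Sum>j<d. (if j = k then 1 else 0) * f j) = f k" "(\<Sum>j<d. (if k = j then 1 else 0) * f j) = f k"
proof -
 have "(\<Sum>j<d. f j * (if j = k then 1 else 0)) = (\<Sum>j<d. if k = j then f j else 0)"
  by (rule sum.cong) auto
 then show 1: "(\<Sum>j<d. f j * (if j = k then 1 else 0)) = f k" using assms by simp
 then show "(\<Sum>j<d. f j * (if k = j then 1 else 0)) = f k" by (simp add: eq_commute[of k])
 then show "(\<Sum>j<d. (if j = k then 1 else 0) * f j) = f k" "(\<Sum>j<d. (if k = j then 1 else 0) * f j) = f k"
  using 1 by (simp_all add: mult.commute)
qed

lemma Rn_add: "x \<in> Rn n ==> y \<in> Rn n ==> (\<lambda>i. x i + y i) \<in> Rn n"
 and Rn_diff: "x \<in> Rn n ==> y \<in> Rn n ==> (\<lambda>i. x i - y i) \<in> Rn n"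
 and Rn_scale: "x \<in> Rn n ==> (\<lambda>i. c * x i) \<in> Rn n"
 and Rn_zero: "(\<lambda>_. 0) \<in> Rn n"
 by (auto simp: mem_Rn)

lemma Rn_sum: "(\<And>j. j \<in> J ==> b j \<in> Rn n) ==> (\<lambda>i. \<Sum>j\<in>J. c j * b j i) \<in> Rn n"
 by (auto simp: mem_Rn intro!: sum.neutral)

lemma ip_add: "ip n (\<lambda>i. x i + y i) z = ip n x z + ip n y z" "ip n z (\<lambda>i. x i + y i) = ip n z x + ip n z y"
 and ip_diff: "ip n (\<lambda>i. x i - y i) z = ip n x z - ip n y z" "ip n z (\<lambda>i. x i - y i) = ip n z x - ip n z y"
 and ip_scale: "ip n (\<lambda>i. c * x i) z = c * ip n x z" "ip n z (\<lambda>i. c * x i) = c * ip n z x"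
 and ip_divide: "ip n (\<lambda>i. x i / c) z = ip n x z / c" "ip n z (\<lambda>i. x i / c) = ip n z x / c"
 and ip_zero: "ip n (\<lambda>_. 0) z = 0" "ip n z (\<lambda>_. 0) = 0"
 by (simp_all add: ip_def algebra_simps sum.distrib sum_subtractf sum_distrib_left sum_divide_distrib)

lemma ip_sum: "ip n (\<lambda>i. \<Sum>j\<in>J. c j * b j i) z = (\<Sum>j\<in>J. c j * ip n (b j) z)"
 "ip n z (\<lambda>i. \<Sum>j\<in>J. c j * b j i) = (\<Sum>j\<in>J. c j * ip n z (b j))"
proof -
 show "ip n (\<lambda>i. \<Sum>j\<in>J. c j * b j i) z = (\<Sum>j\<in>J. c j * ip n (b j) z)"
  unfolding ip_def sum_distrib_left sum_distrib_right by (subst sum.swap) (simp add: mult_ac)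
 show "ip n z (\<lambda>i. \<Sum>j\<in>J. c j * b j i) = (\<Sum>j\<in>J. c j * ip n z (b j))"
  unfolding ip_def sum_distrib_left sum_distrib_right by (subst sum.swap) (simp add: mult_ac)
qed

lemma ip_commute: "ip n x y = ip n y x"
 by (simp add: ip_def mult.commute)

lemma ip_self_nonneg: "0 \<le> ip n x x"
 by (simp add: ip_def sum_nonneg)

lemma ip_self_eq_0: "x \<in> Rn n ==> ip n x x = 0 \<longleftrightarrow> x = (\<lambda>_. 0)"
 by (auto simp: ip_def sum_nonneg_eq_0_iff mem_Rn fun_eq_iff) (metis lessThan_iff linorder_not_less)

lemma coord_le_ip: "i < n ==> (x i)\<^sup>2 \<le> ip n x x"
 unfolding ip_def power2_eq_square by (rule member_le_sum) auto

lemma abs_coord_le_ip: "i < n ==> \<bar>x i\<bar> \<le> sqrt (ip n x x)"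
 using coord_le_ip[of i n x] by (metis real_sqrt_abs real_sqrt_le_iff)

lemma ip_Cauchy_Schwarz: "(ip n x y)\<^sup>2 \<le> ip n x x * ip n y y"
 unfolding ip_def using Cauchy_Schwarz_ineq_sum[of x y "{..<n}"] by (simp add: power2_eq_square)

lemma abs_ip_le: "\<bar>ip n x y\<bar> \<le> sqrt (ip n x x) * sqrt (ip n y y)"
 using ip_Cauchy_Schwarz[of n x y] by (metis real_sqrt_abs real_sqrt_le_iff real_sqrt_mult)

lemma sqrt_ip_triangle: "sqrt (ip n (\<lambda>i. x i + y i) (\<lambda>i. x i + y i)) \<le> sqrt (ip n x x) + sqrt (ip n y y)"
 using L2_set_triangle_ineq[of x y "{..<n}"] by (simp add: L2_set_def ip_def power2_eq_square)

lemma L2_set_eq_ip: "L2_set v {..<n} = sqrt (ip n v v)"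
 by (simp add: L2_set_def ip_def power2_eq_square)

lemma tendsto_ip:
 "(x \<longlongrightarrow> a) F ==> (y \<longlongrightarrow> b) F ==> ((\<lambda>s. ip n (x s) (y s)) \<longlongrightarrow> ip n a b) F"
 unfolding ip_def tendsto_fun_iff by (intro tendsto_intros) auto

lemma subspD:
 assumes "subsp n E"
 shows "x \<in> E ==> x \<in> Rn n" "(\<lambda>_. 0) \<in> E" "x \<in> E ==> y \<in> E ==> (\<lambda>i. x i + y i) \<in> E"
  "x \<in> E ==> (\<lambda>i. c * x i) \<in> E"
 using assms by (auto simp: subsp_def)

lemma subsp_diff:
 assumes "subsp n E" "x \<in> E" "y \<in> E"
 shows "(\<lambda>i. x i - y i) \<in> E"
 using subspD(3)[OF assms(1,2) subspD(4)[OF assms(1,3), of "-1"]] by simp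

lemma subsp_sum:
 assumes "subsp n E" "finite J" "\<And>j. j \<in> J ==> b j \<in> E"
 shows "(\<lambda>i. \<Sum>j\<in>J. c j * b j i) \<in> E"
 using assms(2,3)
proof (induction J rule: finite_induct)
 case (insert j J)
 then show ?case using subspD(3)[OF assms(1) subspD(4)[OF assms(1), of "b j" "c j"]] by simp
qed (use subspD(2)[OF assms(1)] in simp)

lemma lin_span_subset:
 assumes "subsp n E" "\<And>j. j < d ==> b j \<in> E"
 shows "lin_span d b \<subseteq> E"
 using subsp_sum[OF assms(1), of "{..<d}" b] assms(2) by (auto simp: lin_span_def)

lemma lin_spanI: "(\<lambda>i. \<Sum>j<d. c j * b j i) \<in> lin_span d b"
 by (auto simp: lin_span_def)

lemma subsp_lin_span:
 assumes "\<And>j. j < d ==> b j \<in> Rn n"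
 shows "subsp n (lin_span d b)"
 unfolding subsp_def
proof (intro conjI ballI allI)
 show "lin_span d b \<subseteq> Rn n" using assms Rn_sum[of "{..<d}" b n] by (auto simp: lin_span_def)
 show "(\<lambda>_. 0) \<in> lin_span d b" unfolding lin_span_def by (auto intro!: exI[of _ "\<lambda>_. 0"])
next
 fix x y assume "x \<in> lin_span d b" "y \<in> lin_span d b"
 then obtain c e where "x = (\<lambda>i. \<Sum>j<d. c j * b j i)" "y = (\<lambda>i. \<Sum>j<d. e j * b j i)"
  by (auto simp: lin_span_def)
 then have "(\<lambda>i. x i + y i) = (\<lambda>i. \<Sum>j<d. (c j + e j) * b j i)"
  by (simp add: sum.distrib algebra_simps)
 then show "(\<lambda>i. x i + y i) \<in> lin_span d b" by (simp add: lin_spanI)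
next
 fix x k assume "x \<in> lin_span d b"
 then obtain c where "x = (\<lambda>i. \<Sum>j<d. c j * b j i)" by (auto simp: lin_span_def)
 then have "(\<lambda>i. k * x i) = (\<lambda>i. \<Sum>j<d. (k * c j) * b j i)"
  by (simp add: sum_distrib_left mult.assoc)
 then show "(\<lambda>i. k * x i) \<in> lin_span d b" by (simp add: lin_spanI)
qed

lemma lin_span_base: "j < d ==> b j \<in> lin_span d b"
 unfolding lin_span_def
 by (auto intro!: exI[of _ "\<lambda>k. if k = j then 1 else 0"] simp: sum_kron)

lemma lin_span_cong: "(\<And>j. j < d ==> b j = b' j) ==> lin_span d b = lin_span d b'"
proof -
 assume "\<And>j. j < d ==> b j = b' j"
 then have "(\<lambda>i. \<Sum>j<d. c j * b j i) = (\<lambda>i. \<Sum>j<d. c j * b' j i)" for c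
  by (intro ext sum.cong) auto
 then show ?thesis unfolding lin_span_def by simp
qed

lemma orthonormalD:
 assumes "orthonormal n d b"
 shows "j < d ==> b j \<in> Rn n" "j < d ==> k < d ==> ip n (b j) (b k) = (if j = k then 1 else 0)"
 using assms by (auto simp: orthonormal_def)

lemma subsp_orthonormal: "orthonormal n d b ==> subsp n (lin_span d b)"
 by (rule subsp_lin_span) (rule orthonormalD)

lemma proj_in_span: "proj n d b v \<in> lin_span d b"
 unfolding proj_def by (rule lin_spanI)

lemma proj_Rn: "orthonormal n d b ==> proj n d b v \<in> Rn n"
 by (rule subspD(1)[OF subsp_orthonormal proj_in_span])

lemma ip_proj:
 assumes "orthonormal n d b" "k < d"
 shows "ip n (proj n d b v) (b k) = ip n v (b k)"
proof -
 have "ip n (proj n d b v) (b k) = (\<Sum>j<d. ip n v (b j) * (if j = k then 1 else 0))"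
  unfolding proj_def ip_sum using orthonormalD(2)[OF assms(1) _ assms(2)] by (intro sum.cong) auto
 also have "\<dots> = ip n v (b k)" by (rule sum_kron[OF assms(2)])
 finally show ?thesis .
qed

lemma residual_orthogonal:
 assumes "orthonormal n d b" "w \<in> lin_span d b"
 shows "ip n (\<lambda>i. v i - proj n d b v i) w = 0"
proof -
 obtain c where "w = (\<lambda>i. \<Sum>j<d. c j * b j i)" using assms(2) by (auto simp: lin_span_def)
 then show ?thesis by (simp add: ip_sum ip_diff ip_proj[OF assms(1)])
qed

lemma proj_id:
 assumes "orthonormal n d b" "v \<in> lin_span d b"
 shows "proj n d b v = v"
proof -
 have E: "subsp n (lin_span d b)" by (rule subsp_orthonormal[OF assms(1)])
 let ?r = "\<lambda>i. v i - proj n d b v i"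
 have r: "?r \<in> lin_span d b" by (rule subsp_diff[OF E assms(2) proj_in_span])
 have "ip n ?r ?r = 0" by (rule residual_orthogonal[OF assms(1) r])
 then have "?r = (\<lambda>_. 0)" using ip_self_eq_0 subspD(1)[OF E r] by blast
 then show ?thesis by (auto simp: fun_eq_iff)
qed

text \<open>Pythagoras for projection and residual, kept as an identity because the residuals
  themselves are summed when dimensions are compared.\<close>

lemma Bessel:
 assumes "orthonormal n d b"
 shows "ip n v v = (\<Sum>j<d. (ip n v (b j))\<^sup>2) + ip n (\<lambda>i. v i - proj n d b v i) (\<lambda>i. v i - proj n d b v i)"
proof -
 have 1: "ip n v (proj n d b v) = (\<Sum>j<d. (ip n v (b j))\<^sup>2)"
  unfolding proj_def ip_sum by (simp add: power2_eq_square)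
 have "ip n (\<lambda>i. v i - proj n d b v i) (proj n d b v) = 0"
  by (rule residual_orthogonal[OF assms proj_in_span])
 then have "ip n (proj n d b v) (proj n d b v) = ip n v (proj n d b v)" by (simp add: ip_diff)
 then show ?thesis by (simp add: ip_diff 1 ip_commute[of n "proj n d b v" v])
qed

lemma proj_minimal:
 assumes "orthonormal n d b" "w \<in> lin_span d b"
 shows "ip n (\<lambda>i. v i - proj n d b v i) (\<lambda>i. v i - proj n d b v i) \<le> ip n (\<lambda>i. v i - w i) (\<lambda>i. v i - w i)"
proof -
 have "proj n d b (\<lambda>i. v i - w i) i = proj n d b v i - w i" for i
  using proj_id[OF assms] by (simp add: proj_def ip_diff algebra_simps sum_subtractf fun_eq_iff)
 then have "(\<lambda>i. (v i - w i) - proj n d b (\<lambda>i. v i - w i) i) = (\<lambda>i. v i - proj n d b v i)"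
  by (simp add: fun_eq_iff)
 then show ?thesis using Bessel[OF assms(1), of "\<lambda>i. v i - w i"] by (simp add: sum_nonneg)
qed

text \<open>The number \<open>\<Sum>\<^sub>j\<^sub>k \<langle>b\<^sub>j, b'\<^sub>k\<rangle>\<^sup>2\<close> is the trace of the product of the two projections.\<close>

lemma orthonormal_card_le:
 assumes b: "orthonormal n d b" and b': "orthonormal n e b'" and sub: "lin_span d b \<subseteq> lin_span e b'"
 shows "d \<le> e" "d = e ==> lin_span d b = lin_span e b'"
proof -
 \<comment> \<open>\<open>r k\<close> is the squared distance of \<open>b' k\<close> from the span
   of \<open>b\<close>. Summing the squared products \<open>ip n (b j) (b' k)\<close> by rows gives
   \<open>d\<close>, by columns \<open>e\<close> minus the sum of the \<open>r k\<close>; if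
   \<open>d = e\<close>, all distances vanish.\<close>
 define r where "r k = (let v = b' k in ip n (\<lambda>i. v i - proj n d b v i) (\<lambda>i. v i - proj n d b v i))" for k
 have r0: "r k \<ge> 0" for k unfolding r_def Let_def by (rule ip_self_nonneg)
 have "(\<Sum>k<e. (ip n (b j) (b' k))\<^sup>2) = 1" if "j < d" for j
 proof -
  have "b j \<in> lin_span e b'" using sub lin_span_base[OF that] by blast
  from Bessel[OF b', of "b j"] proj_id[OF b' this] orthonormalD(2)[OF b that that]
  show ?thesis by (simp add: ip_zero)
 qed
 then have "real d = (\<Sum>j<d. \<Sum>k<e. (ip n (b j) (b' k))\<^sup>2)" by simp
 also have "\<dots> = (\<Sum>k<e. \<Sum>j<d. (ip n (b' k) (b j))\<^sup>2)"
  by (subst sum.swap) (simp add: ip_commute)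
 also have "\<dots> = (\<Sum>k<e. 1 - r k)"
 proof (rule sum.cong[OF refl])
  fix k assume "k \<in> {..<e}"
  then show "(\<Sum>j<d. (ip n (b' k) (b j))\<^sup>2) = 1 - r k"
   using Bessel[OF b, of "b' k"] orthonormalD(2)[OF b', of k k] by (simp add: r_def Let_def)
 qed
 finally have *: "real d = real e - (\<Sum>k<e. r k)" by (simp add: sum_subtractf)
 have "(\<Sum>k<e. r k) \<ge> 0" using r0 by (simp add: sum_nonneg)
 then show "d \<le> e" using * by linarith
 assume "d = e"
 then have "(\<Sum>k<e. r k) = 0" using * by simp
 then have rk: "r k = 0" if "k < e" for k using sum_nonneg_eq_0_iff[of "{..<e}" r] r0 that by auto
 have "b' k \<in> lin_span d b" if k: "k < e" for k
 proof -
  have "(\<lambda>i. b' k i - proj n d b (b' k) i) \<in> Rn n"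
   by (rule Rn_diff[OF orthonormalD(1)[OF b' k] proj_Rn[OF b]])
  then have "(\<lambda>i. b' k i - proj n d b (b' k) i) = (\<lambda>_. 0)"
   using rk[OF k] ip_self_eq_0 unfolding r_def Let_def by blast
  then have "b' k = proj n d b (b' k)" by (auto simp: fun_eq_iff)
  then show ?thesis using proj_in_span by metis
 qed
 then show "lin_span d b = lin_span e b'"
  using sub lin_span_subset[OF subsp_orthonormal[OF b]] by blast
qed

definition stdb :: "nat => nat => real" where "stdb j = (\<lambda>i. if i = j then 1 else 0)"

lemma stdb_Rn: "j < n ==> stdb j \<in> Rn n"
 by (auto simp: stdb_def mem_Rn)

lemma sum_stdb: "i < n ==> (\<Sum>j<n. c j * stdb j i) = c i"
 unfolding stdb_def by (rule sum_kron)

lemma ip_stdb: "j < n ==> ip n v (stdb j) = v j"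
 unfolding stdb_def ip_def by (rule sum_kron)

lemma orthonormal_std: "orthonormal n n stdb"
 by (auto simp: orthonormal_def stdb_Rn ip_stdb) (auto simp: stdb_def)

lemma lin_span_std: "lin_span n stdb = Rn n"
proof
 show "lin_span n stdb \<subseteq> Rn n" using subsp_orthonormal[OF orthonormal_std] by (simp add: subsp_def)
 have "x = (\<lambda>i. \<Sum>j<n. x j * stdb j i)" if "x \<in> Rn n" for x
 proof
  fix i show "x i = (\<Sum>j<n. x j * stdb j i)"
  proof (cases "i < n")
   case False
   then show ?thesis using that by (auto simp: mem_Rn stdb_def intro!: sum.neutral[symmetric])
  qed (simp add: sum_stdb)
 qed
 then show "Rn n \<subseteq> lin_span n stdb" unfolding lin_span_def by blast
qed

text \<open>The Gram-Schmidt step.\<close>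

lemma orthonormal_extend:
 assumes b: "orthonormal n d b" and v: "v \<in> Rn n" "v \<notin> lin_span d b"
 defines "w \<equiv> \<lambda>i. v i - proj n d b v i"
 shows "ip n w w > 0" "orthonormal n (Suc d) (b(d := (\<lambda>i. w i / sqrt (ip n w w))))"
proof -
 have w: "w \<in> Rn n" unfolding w_def by (rule Rn_diff[OF v(1) proj_Rn[OF b]])
 have "w \<noteq> (\<lambda>_. 0)"
 proof
  assume "w = (\<lambda>_. 0)"
  then have "v = proj n d b v" by (auto simp: w_def fun_eq_iff)
  then show False using v(2) proj_in_span by metis
 qed
 then have "ip n w w \<noteq> 0" using ip_self_eq_0[OF w] by blast
 then show pos: "ip n w w > 0" using ip_self_nonneg[of n w] by linarith
 have "ip n w (b j) = 0" if "j < d" for j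
  unfolding w_def by (rule residual_orthogonal[OF b lin_span_base[OF that]])
 moreover define u where "u = (\<lambda>i. w i / sqrt (ip n w w))"
 ultimately have u: "u \<in> Rn n" "ip n u u = 1" "\<And>j. j < d ==> ip n u (b j) = 0" "\<And>j. j < d ==> ip n (b j) u = 0"
  using w pos by (auto simp: mem_Rn ip_divide ip_commute[of n "b _" w])
 have "orthonormal n (Suc d) (b(d := u))"
  unfolding orthonormal_def
 proof (intro conjI allI impI)
  fix j assume "j < Suc d"
  then show "(b(d := u)) j \<in> Rn n" using u(1) orthonormalD(1)[OF b, of j] by (cases "j = d") auto
 next
  fix j k assume "j < Suc d" "k < Suc d"
  then show "ip n ((b(d := u)) j) ((b(d := u)) k) = (if j = k then 1 else 0)"
   using u orthonormalD(2)[OF b, of j k] by (cases "j = d"; cases "k = d") auto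
 qed
 then show "orthonormal n (Suc d) (b(d := (\<lambda>i. w i / sqrt (ip n w w))))"
  by (simp add: u_def)
qed

text \<open>An orthonormal family in \<open>E\<close> of greatest length spans \<open>E\<close>,
  since a vector outside its span would extend it. Such a family exists because comparison with the
  standard basis bounds the length by \<open>n\<close>.\<close>

lemma orthonormal_basis_exists:
 assumes E: "subsp n E"
 obtains d b where "orthonormal n d b" "lin_span d b = E"
proof -
 define P where "P d \<longleftrightarrow> (\<exists>b. orthonormal n d b \<and> (\<forall>j<d. b j \<in> E))" for d
 have "P 0" by (auto simp: P_def orthonormal_def)
 moreover have "d \<le> n" if P: "P d" for d
 proof -
  obtain b where b: "orthonormal n d b" using P by (auto simp: P_def)
  have "lin_span d b \<subseteq> Rn n" using subsp_orthonormal[OF b] by (simp add: subsp_def)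
  then show ?thesis using orthonormal_card_le(1)[OF b orthonormal_std] by (simp add: lin_span_std)
 qed
 ultimately obtain d where d: "P d" "\<And>e. P e ==> e \<le> d"
  using Nat.ex_has_greatest_nat[of P 0 n] by blast
 obtain b where b: "orthonormal n d b" "\<And>j. j < d ==> b j \<in> E" using d(1) by (auto simp: P_def)
 have sub: "lin_span d b \<subseteq> E" by (rule lin_span_subset[OF E b(2)])
 have "v \<in> lin_span d b" if v: "v \<in> E" for v
 proof (rule ccontr)
  assume nv: "v \<notin> lin_span d b"
  define w where "w = (\<lambda>i. v i - proj n d b v i)"
  have "w \<in> E" unfolding w_def using subsp_diff[OF E v] sub proj_in_span by blast
  then have "(\<lambda>i. w i / sqrt (ip n w w)) \<in> E"
   using subspD(4)[OF E, of w "1 / sqrt (ip n w w)"] by simp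
  moreover have "orthonormal n (Suc d) (b(d := (\<lambda>i. w i / sqrt (ip n w w))))"
   unfolding w_def by (rule orthonormal_extend(2)[OF b(1) subspD(1)[OF E v] nv])
  ultimately have "P (Suc d)"
   using b(2) unfolding P_def
   by (intro exI[of _ "b(d := (\<lambda>i. w i / sqrt (ip n w w)))"]) (auto simp: less_Suc_eq)
  then show False using d(2)[of "Suc d"] by simp
 qed
 then show thesis using that[OF b(1)] sub by blast
qed

text \<open>Gram-Schmidt. It lets the frames behind the Grassmannian be exchanged for orthonormal
  ones, whose entries are bounded.\<close>

lemma indep_orthonormal_basis:
 assumes "\<And>j. j < d ==> b j \<in> Rn n" "indep d b"
 obtains b' where "orthonormal n d b'" "lin_span d b' = lin_span d b"
 using assms
proof (induction d arbitrary: thesis)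
 case 0
 show ?case by (rule 0(1)[of b]) (auto simp: orthonormal_def)
next
 case (Suc d)
 have "indep d b"
  unfolding indep_def
 proof (intro allI impI)
  fix c j assume c: "\<forall>i. (\<Sum>j<d. c j * b j i) = 0" and j: "j < d"
  have "\<forall>i. (\<Sum>j<Suc d. (c(d := 0)) j * b j i) = 0" using c by simp
  then have "(c(d := 0)) j = 0" using Suc.prems(3) j unfolding indep_def by (metis less_Suc_eq)
  then show "c j = 0" using j by simp
 qed
 then obtain b' where b': "orthonormal n d b'" "lin_span d b' = lin_span d b"
  using Suc.IH Suc.prems(2) by (metis less_Suc_eq)
 have nb: "b d \<notin> lin_span d b'"
 proof
  assume "b d \<in> lin_span d b'"
  then obtain c where c: "b d = (\<lambda>i. \<Sum>j<d. c j * b j i)" using b'(2) by (auto simp: lin_span_def)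
  have "(\<Sum>j<Suc d. (c(d := -1)) j * b j i) = 0" for i using fun_cong[OF c, of i] by simp
  then have "(c(d := -1)) d = 0" using Suc.prems(3) unfolding indep_def by blast
  then show False by simp
 qed
 have bd: "b d \<in> Rn n" using Suc.prems(2) by simp
 define w where "w = (\<lambda>i. b d i - proj n d b' (b d) i)"
 define b'' where "b'' = b'(d := (\<lambda>i. w i / sqrt (ip n w w)))"
 have w: "ip n w w > 0" and on: "orthonormal n (Suc d) b''"
  using orthonormal_extend[OF b'(1) bd nb] unfolding w_def b''_def by auto
 have S: "subsp n (lin_span (Suc d) b)" by (rule subsp_lin_span) (rule Suc.prems(2))
 have S'': "subsp n (lin_span (Suc d) b'')" by (rule subsp_orthonormal[OF on])
 have up: "lin_span d b \<subseteq> lin_span (Suc d) b"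
  by (rule lin_span_subset[OF S]) (rule lin_span_base, simp)
 have up'': "lin_span d b' \<subseteq> lin_span (Suc d) b''"
 proof (rule lin_span_subset[OF S''])
  fix j assume "j < d"
  then show "b' j \<in> lin_span (Suc d) b''" using lin_span_base[of j "Suc d" b''] by (simp add: b''_def)
 qed
 have "lin_span (Suc d) b'' \<subseteq> lin_span (Suc d) b"
 proof (rule lin_span_subset[OF S])
  fix j assume j: "j < Suc d"
  show "b'' j \<in> lin_span (Suc d) b"
  proof (cases "j = d")
   case True
   have "w \<in> lin_span (Suc d) b" unfolding w_def
    using subsp_diff[OF S lin_span_base[of d]] up b'(2) proj_in_span by blast
   then show ?thesis using subspD(4)[OF S, of w "1 / sqrt (ip n w w)"] True by (simp add: b''_def)
  next
   case False
   then have "b'' j \<in> lin_span d b'" using j lin_span_base[of j d b'] by (simp add: b''_def)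
   then show ?thesis using up b'(2) by blast
  qed
 qed
 moreover have "lin_span (Suc d) b \<subseteq> lin_span (Suc d) b''"
 proof (rule lin_span_subset[OF S''])
  fix j assume j: "j < Suc d"
  show "b j \<in> lin_span (Suc d) b''"
  proof (cases "j = d")
   case True
   have "(\<lambda>i. sqrt (ip n w w) * b'' d i) = w" using w by (simp add: b''_def)
   then have "w \<in> lin_span (Suc d) b''" using subspD(4)[OF S'' lin_span_base[of d]] by (metis lessI)
   moreover have "proj n d b' (b d) \<in> lin_span (Suc d) b''" using up'' proj_in_span by blast
   ultimately have "(\<lambda>i. w i + proj n d b' (b d) i) \<in> lin_span (Suc d) b''" by (rule subspD(3)[OF S''])
   then show ?thesis using True by (simp add: w_def)
  next
   case False
   then have "b j \<in> lin_span d b'" using j b'(2) lin_span_base[of j d b] by simp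
   then show ?thesis using up'' by blast
  qed
 qed
 ultimately show ?case using Suc.prems(1)[OF on] by blast
qed

text \<open>Injectivity makes the columns independent; \<open>d\<close> independent vectors span
  \<open>Rn d\<close>, which solves \<open>A B = 1\<close>. Then \<open>A (B A - 1) = 0\<close>, and
  injectivity gives \<open>B A = 1\<close>.\<close>

lemma matrix_inverse_exists:
 fixes A :: "nat => nat => real"
 assumes inj: "\<And>x. (\<forall>j<d. (\<Sum>l<d. A j l * x l) = 0) ==> (\<forall>l<d. x l = 0)"
 obtains B where "\<And>j l. j < d ==> l < d ==> (\<Sum>k<d. B j k * A k l) = (if j = l then 1 else 0)"
  "\<And>j l. j < d ==> l < d ==> (\<Sum>k<d. A j k * B k l) = (if j = l then 1 else 0)"
proof -
 define a where "a l = (\<lambda>j. if j < d then A j l else 0)" for l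
 have a: "a l \<in> Rn d" for l by (simp add: a_def mem_Rn)
 have "indep d a"
  unfolding indep_def
 proof (intro allI impI)
  fix c j assume c: "\<forall>i. (\<Sum>j<d. c j * a j i) = 0" and "j < d"
  have "(\<Sum>l<d. A i l * c l) = 0" if "i < d" for i
   using c[rule_format, of i] that by (simp add: a_def mult.commute)
  then show "c j = 0" using inj \<open>j < d\<close> by blast
 qed
 then obtain a' where a': "orthonormal d d a'" "lin_span d a' = lin_span d a"
  by (rule indep_orthonormal_basis[OF a, of d])
 have "lin_span d a' \<subseteq> lin_span d stdb"
  using subsp_orthonormal[OF a'(1)] by (simp add: subsp_def lin_span_std)
 then have "lin_span d a = Rn d"
  using orthonormal_card_le(2)[OF a'(1) orthonormal_std] a'(2) by (simp add: lin_span_std)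
 then have "\<exists>c. stdb k = (\<lambda>i. \<Sum>l<d. c l * a l i)" if "k < d" for k
  using stdb_Rn[OF that] by (auto simp: lin_span_def)
 then obtain C where C: "\<And>k. k < d ==> stdb k = (\<lambda>i. \<Sum>l<d. C k l * a l i)" by metis
 define B where "B l k = C k l" for l k
 have AB: "(\<Sum>k<d. A j k * B k l) = (if j = l then 1 else 0)" if "j < d" "l < d" for j l
  using fun_cong[OF C[OF that(2)], of j] that by (simp add: a_def B_def stdb_def mult.commute)
 have BA: "(\<Sum>k<d. B j k * A k l) = (if j = l then 1 else 0)" if jl: "j < d" "l < d" for j l
 proof -
  define x where "x = (\<lambda>j. (\<Sum>k<d. B j k * A k l) - (if j = l then 1 else 0))"
  have "(\<Sum>j<d. A i j * x j) = 0" if i: "i < d" for i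
  proof -
   have "(\<Sum>j<d. A i j * (\<Sum>k<d. B j k * A k l)) = (\<Sum>k<d. (\<Sum>j<d. A i j * B j k) * A k l)"
    unfolding sum_distrib_left sum_distrib_right by (subst sum.swap) (simp add: mult.assoc)
   also have "\<dots> = (\<Sum>k<d. (if i = k then 1 else 0) * A k l)"
    using AB i by (intro sum.cong) auto
   also have "\<dots> = A i l" by (rule sum_kron[OF i])
   finally have 1: "(\<Sum>j<d. A i j * (\<Sum>k<d. B j k * A k l)) = A i l" .
   have 2: "(\<Sum>j<d. A i j * (if j = l then 1 else 0)) = A i l"
    by (rule sum_kron[OF jl(2)])
   show ?thesis unfolding x_def right_diff_distrib sum_subtractf 1 2 by simp
  qed
  then have "x j = 0" using inj jl(1) by blast
  then show ?thesis by (simp add: x_def)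
 qed
 show thesis by (rule that[OF BA AB])
qed

section \<open>Compactness and the Grassmannian\<close>

lemma finite_family_subseq:
 fixes f :: "nat => 'i => real"
 assumes "finite I" "\<And>i. i \<in> I ==> \<exists>B. \<forall>s. \<bar>f s i\<bar> \<le> B"
 obtains r where "strict_mono r" "\<And>i. i \<in> I ==> convergent (\<lambda>s. f (r s) i)"
 using assms
proof (induction I arbitrary: thesis rule: finite_induct)
 case empty
 show ?case by (rule empty(1)[of id]) (auto simp: strict_mono_def)
next
 case (insert i I)
 obtain r where r: "strict_mono r" "\<And>i. i \<in> I ==> convergent (\<lambda>s. f (r s) i)"
  using insert.IH insert.prems(2) by blast
 obtain B where B: "\<And>s. \<bar>f s i\<bar> \<le> B" using insert.prems(2) by blast
 have "compact {-B..B}" "\<forall>s. f (r s) i \<in> {-B..B}" using B by (auto simp: abs_le_iff minus_le_iff)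
 then obtain l r' where r': "strict_mono r'" "((\<lambda>s. f (r s) i) \<circ> r') \<longlonglongrightarrow> l"
  unfolding compact_eq_seq_compact_metric seq_compact_def by metis
 show ?case
 proof (rule insert.prems(1))
  show "strict_mono (r \<circ> r')" using r(1) r'(1) by (rule strict_mono_o)
  fix k assume "k \<in> insert i I"
  then show "convergent (\<lambda>s. f ((r \<circ> r') s) k)"
  proof
   assume "k = i"
   then show ?thesis using r'(2) by (auto simp: convergent_def o_def)
  next
   assume "k \<in> I"
   from convergent_subseq_convergent[OF r(2)[OF this] r'(1)] show ?thesis by (simp add: o_def)
  qed
 qed
qed

lemma bounded_subseq:
 fixes f :: "nat => nat => real"
 assumes "\<And>s. f s \<in> Rn n" "\<And>s i. i < n ==> \<bar>f s i\<bar> \<le> B"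
 obtains r l where "strict_mono r" "l \<in> Rn n" "(\<lambda>s. f (r s)) \<longlonglongrightarrow> l"
proof -
 obtain r where r: "strict_mono r" "\<And>i. i \<in> {..<n} ==> convergent (\<lambda>s. f (r s) i)"
  by (rule finite_family_subseq[of "{..<n}" f]) (use assms(2) in auto)
 then obtain l where l: "\<And>i. i < n ==> (\<lambda>s. f (r s) i) \<longlonglongrightarrow> l i"
  unfolding convergent_def by (metis lessThan_iff)
 have "(\<lambda>s. f (r s)) \<longlonglongrightarrow> (\<lambda>i. if i < n then l i else 0)"
  by (rule tendsto_Rn[where n = n]) (use l assms(1) in \<open>auto simp: mem_Rn\<close>)
 then show thesis by (rule that[OF r(1), rotated]) (simp add: mem_Rn)
qed

text \<open>Compactness of the Stiefel manifold: the entries are at most 1 in absolute value, and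
  orthonormality is a closed condition.\<close>

lemma orthonormal_subseq:
 fixes b :: "nat => nat => nat => real"
 assumes "\<And>s. orthonormal n d (b s)"
 obtains r l where "strict_mono r" "orthonormal n d l" "\<And>j. j < d ==> (\<lambda>s. b (r s) j) \<longlonglongrightarrow> l j"
proof -
 have bd: "\<bar>b s j i\<bar> \<le> 1" if "j < d" "i < n" for s j i
  using abs_coord_le_ip[OF that(2), of "b s j"] orthonormalD(2)[OF assms that(1) that(1)] by simp
 obtain r where r: "strict_mono r" "\<And>p. p \<in> {..<d} \<times> {..<n} ==> convergent (\<lambda>s. b (r s) (fst p) (snd p))"
  by (rule finite_family_subseq[of "{..<d} \<times> {..<n}" "\<lambda>s p. b s (fst p) (snd p)"]) (use bd in \<open>auto intro!: exI[of _ 1]\<close>)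
 then obtain L where L: "\<And>p. p \<in> {..<d} \<times> {..<n} ==> (\<lambda>s. b (r s) (fst p) (snd p)) \<longlonglongrightarrow> L p"
  unfolding convergent_def by metis
 define l where "l j = (\<lambda>i. if i < n then L (j, i) else 0)" for j
 have lR: "l j \<in> Rn n" for j by (simp add: l_def mem_Rn)
 have lim: "(\<lambda>s. b (r s) j) \<longlonglongrightarrow> l j" if "j < d" for j
  by (rule tendsto_Rn[where n = n])
    (use L[of "(j, _)"] that lR assms in \<open>auto simp: l_def orthonormal_def\<close>)
 have "ip n (l j) (l k) = (if j = k then 1 else 0)" if "j < d" "k < d" for j k
 proof (rule LIMSEQ_unique[OF tendsto_ip[OF lim[OF that(1)] lim[OF that(2)]]])
  show "(\<lambda>s. ip n (b (r s) j) (b (r s) k)) \<longlonglongrightarrow> (if j = k then 1 else 0)"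
   using orthonormalD(2)[OF assms that] by simp
 qed
 then have "orthonormal n d l" using lR by (simp add: orthonormal_def)
 then show thesis using that[OF r(1)] lim by blast
qed

lemma orthonormal_indep: "orthonormal n d b ==> indep d b"
 unfolding indep_def
proof (intro allI impI)
 fix c j assume b: "orthonormal n d b" and c: "\<forall>i. (\<Sum>j<d. c j * b j i) = 0" and j: "j < d"
 have "0 = ip n (\<lambda>i. \<Sum>j<d. c j * b j i) (b j)" using c by (simp add: ip_zero)
 also have "\<dots> = (\<Sum>k<d. c k * (if k = j then 1 else 0))"
  unfolding ip_sum using orthonormalD(2)[OF b _ j] by (intro sum.cong) auto
 also have "\<dots> = c j" by (rule sum_kron[OF j])
 finally show "c j = 0" by simp
qed

lemma topspace_frames: "topspace (frames n d) = {b \<in> {..<d} \<rightarrow>\<^sub>E Rn n. indep d b}"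
 by (auto simp: frames_def indep_def)

lemma topspace_grassmannian: "topspace (grassmannian n d) = lin_span d ` topspace (frames n d)"
proof
 show "topspace (grassmannian n d) \<subseteq> lin_span d ` topspace (frames n d)"
  using openin_topspace[of "grassmannian n d"] unfolding openin_grassmannian by blast
 have "{b \<in> topspace (frames n d). lin_span d b \<in> lin_span d ` topspace (frames n d)} = topspace (frames n d)"
  by auto
 then have "openin (grassmannian n d) (lin_span d ` topspace (frames n d))"
  unfolding openin_grassmannian by simp
 then show "lin_span d ` topspace (frames n d) \<subseteq> topspace (grassmannian n d)" by (rule openin_subset)
qed

lemma limitin_Euclidean_space:
 "limitin (Euclidean_space n) f l F \<longleftrightarrow> l \<in> Rn n \<and> (\<forall>\<^sub>F s in F. f s \<in> Rn n) \<and> (f \<longlongrightarrow> l) F"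
proof -
 have "Euclidean_space n = subtopology euclidean {x. \<forall>i\<ge>n. x i = 0}"
  by (simp add: Euclidean_space_def euclidean_product_topology)
 then show ?thesis unfolding topspace_Euclidean_space by (simp only: limitin_subtopology limitin_canonical_iff)
qed

text \<open>The Grassmannian is a quotient of the space of frames, so convergence of frames descends
  to their spans.\<close>

lemma limitin_grassmannian_orthonormal:
 assumes "\<And>s. orthonormal n d (b s)" "orthonormal n d l" "\<And>j. j < d ==> (\<lambda>s. b s j) \<longlonglongrightarrow> l j"
 shows "limitin (grassmannian n d) (\<lambda>s. lin_span d (b s)) (lin_span d l) sequentially"
proof -
 \<comment> \<open>Points of \<open>frames n d\<close> are extensional on \<open>{..<d}\<close>;
   restriction makes them so and leaves the span unchanged.\<close>
 define R where "R c = restrict c {..<d}" for c :: "nat => nat => real"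
 have span_R: "lin_span d (R c) = lin_span d c" for c
  by (rule lin_span_cong) (simp add: R_def)
 have R: "R c \<in> topspace (frames n d)" if "orthonormal n d c" for c
  using orthonormal_indep[OF that] orthonormalD(1)[OF that]
  by (auto simp: topspace_frames R_def indep_def)
 have lim: "limitin (frames n d) (\<lambda>s. R (b s)) (R l) sequentially"
  unfolding frames_def limitin_subtopology
 proof (intro conjI)
  show "limitin (product_topology (\<lambda>_. Euclidean_space n) {..<d}) (\<lambda>s. R (b s)) (R l) sequentially"
   unfolding limitin_componentwise limitin_Euclidean_space
   using assms(3) orthonormalD(1)[OF assms(1)] orthonormalD(1)[OF assms(2)]
   by (auto simp: R_def)
  show "R l \<in> {b. \<forall>c. (\<forall>i. (\<Sum>j<d. c j * b j i) = 0) --> (\<forall>j<d. c j = 0)}"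
   using R[OF assms(2)] by (simp add: topspace_frames indep_def)
  show "\<forall>\<^sub>F a in sequentially. R (b a) \<in> {b. \<forall>c. (\<forall>i. (\<Sum>j<d. c j * b j i) = 0) --> (\<forall>j<d. c j = 0)}"
   using R[OF assms(1)] by (simp add: topspace_frames indep_def)
 qed
 show ?thesis
  unfolding limitin_def
 proof (intro conjI allI impI)
  show "lin_span d l \<in> topspace (grassmannian n d)"
   unfolding topspace_grassmannian using R[OF assms(2)] span_R[of l] by (metis imageI)
  fix \<O> assume O: "openin (grassmannian n d) \<O> \<and> lin_span d l \<in> \<O>"
  then have "openin (frames n d) {b \<in> topspace (frames n d). lin_span d b \<in> \<O>}"
   by (simp add: openin_grassmannian)
  moreover have "R l \<in> {b \<in> topspace (frames n d). lin_span d b \<in> \<O>}"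
   using R[OF assms(2)] O span_R by simp
  ultimately have "\<forall>\<^sub>F s in sequentially. R (b s) \<in> {b \<in> topspace (frames n d). lin_span d b \<in> \<O>}"
   using lim unfolding limitin_def by blast
  then show "\<forall>\<^sub>F s in sequentially. lin_span d (b s) \<in> \<O>"
   by (rule eventually_mono) (simp add: span_R)
 qed
qed

text \<open>The subspaces that meet a ball about \<open>u\<close> form an open set: its preimage
  among the frames is a union, over coefficient vectors \<open>c\<close>, of open conditions on the
  frame. Convergence is tested on this set, so no metric on the Grassmannian is required.\<close>

lemma limitin_grassmannian_approx:
 assumes lim: "limitin (grassmannian n d) E \<tau> F" and u: "u \<in> \<tau>" and \<delta>: "\<delta> > 0"
 shows "\<forall>\<^sub>F s in F. \<exists>w\<in>E s. ip n (\<lambda>i. u i - w i) (\<lambda>i. u i - w i) < \<delta>"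
proof -
 define P where "P w \<longleftrightarrow> ip n (\<lambda>i. u i - w i) (\<lambda>i. u i - w i) < \<delta>" for w
 define \<O> where "\<O> = {E \<in> topspace (grassmannian n d). \<exists>w\<in>E. P w}"
 have "{b \<in> topspace (frames n d). lin_span d b \<in> \<O>} =
   (\<Union>c. {b \<in> topspace (frames n d). ip n (\<lambda>i. u i - (\<Sum>j<d. c j * b j i)) (\<lambda>i. u i - (\<Sum>j<d. c j * b j i)) \<in> {..<\<delta>}})"
  by (auto simp: \<O>_def topspace_grassmannian lin_span_def P_def)
 moreover have "openin (frames n d) {b \<in> topspace (frames n d).
   ip n (\<lambda>i. u i - (\<Sum>j<d. c j * b j i)) (\<lambda>i. u i - (\<Sum>j<d. c j * b j i)) \<in> {..<\<delta>}}" for c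
 proof (rule openin_continuous_map_preimage)
  have pc: "continuous_map (frames n d) euclideanreal (\<lambda>b. b j i)" if "j < d" for i j
  proof -
   have "continuous_map (frames n d) (Euclidean_space n) (\<lambda>b. b j)"
    unfolding frames_def using that
    by (intro continuous_map_from_subtopology continuous_map_product_projection) auto
   moreover have "continuous_map (Euclidean_space n) euclideanreal (\<lambda>x. x i)"
    unfolding continuous_map_Euclidean_space_iff by (rule continuous_on_coord)
   ultimately show ?thesis using continuous_map_compose by (fastforce simp: o_def)
  qed
  show "continuous_map (frames n d) euclideanreal
    (\<lambda>b. ip n (\<lambda>i. u i - (\<Sum>j<d. c j * b j i)) (\<lambda>i. u i - (\<Sum>j<d. c j * b j i)))"
   unfolding ip_def by (intro continuous_intros pc) auto
 qed auto
 ultimately have "openin (grassmannian n d) \<O>"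
  unfolding openin_grassmannian by (auto simp: \<O>_def topspace_grassmannian)
 moreover have "\<tau> \<in> \<O>" using lim u \<delta> by (auto simp: \<O>_def limitin_def P_def ip_zero intro!: bexI[of _ u])
 ultimately have "\<forall>\<^sub>F s in F. E s \<in> \<O>" using lim by (simp add: limitin_def)
 then show ?thesis by (rule eventually_mono) (simp add: \<O>_def P_def)
qed

text \<open>A substitute for the Hausdorff property. Vectors of the converging spans approach every
  \<open>u\<close> in \<open>\<tau>\<close>, and projections approximate at least as well, so the
  residual of \<open>u\<close> with respect to \<open>l\<close> is 0. The resulting inclusion is an
  equality because the dimensions agree.\<close>

lemma grassmannian_limit_unique:
 assumes b: "\<And>s. orthonormal n d (b s)" and l: "orthonormal n d l"
  and bl: "\<And>j. j < d ==> (\<lambda>s. b s j) \<longlonglongrightarrow> l j"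
  and lim: "limitin (grassmannian n d) (\<lambda>s. lin_span d (b s)) \<tau> sequentially"
 shows "\<tau> = lin_span d l"
proof -
 obtain c where c: "c \<in> topspace (frames n d)" "\<tau> = lin_span d c"
  using lim unfolding limitin_def topspace_grassmannian by blast
 then have cR: "\<And>j. j < d ==> c j \<in> Rn n" and ic: "indep d c" by (auto simp: topspace_frames)
 obtain c' where "orthonormal n d c'" "lin_span d c' = lin_span d c"
  by (rule indep_orthonormal_basis[OF cR ic])
 then have c': "orthonormal n d c'" "lin_span d c' = \<tau>" using c(2) by simp_all
 have sub: "u \<in> lin_span d l" if u: "u \<in> \<tau>" for u
 proof -
  define r where "r b = (\<lambda>i. u i - proj n d b u i)" for b
  have uR: "u \<in> Rn n" using u c'(2) subspD(1)[OF subsp_orthonormal[OF c'(1)]] by auto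
  have pl: "(\<lambda>s. proj n d (b s) u) \<longlonglongrightarrow> proj n d l u"
   unfolding proj_def tendsto_fun_iff
   by (intro allI tendsto_sum tendsto_mult tendsto_ip) (use bl in \<open>auto simp: tendsto_fun_iff\<close>)
  have "(\<lambda>s. ip n (r (b s)) (r (b s))) \<longlonglongrightarrow> ip n (r l) (r l)"
   unfolding r_def by (intro tendsto_ip) (use pl in \<open>auto simp: tendsto_fun_iff intro!: tendsto_intros\<close>)
  then have "ip n (r l) (r l) \<le> \<delta>" if "\<delta> > 0" for \<delta>
  proof (rule tendsto_upperbound)
   show "\<forall>\<^sub>F s in sequentially. ip n (r (b s)) (r (b s)) \<le> \<delta>"
    using limitin_grassmannian_approx[OF lim u that]
   proof eventually_elim
    case (elim s)
    then obtain w where w: "w \<in> lin_span d (b s)" "ip n (\<lambda>i. u i - w i) (\<lambda>i. u i - w i) < \<delta>" by blast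
    from proj_minimal[OF b w(1), of u] w(2) show ?case unfolding r_def by linarith
   qed
  qed simp
  then have "ip n (r l) (r l) \<le> 0" by (meson dense leD linorder_le_less_linear)
  then have "ip n (r l) (r l) = 0" using ip_self_nonneg[of n "r l"] by linarith
  moreover have "r l \<in> Rn n" unfolding r_def by (rule Rn_diff[OF uR proj_Rn[OF l]])
  ultimately have "r l = (\<lambda>_. 0)" using ip_self_eq_0 by blast
  then have "u = proj n d l u" by (auto simp: r_def fun_eq_iff)
  then show ?thesis using proj_in_span by metis
 qed
 then show ?thesis using orthonormal_card_le(2)[OF c'(1) l] c'(2) by auto
qed

declare Ck_open.simps(2) [simp del]

section \<open>Charts and tangent spaces\<close>

text \<open>\<open>D i j\<close> is the derivative of component \<open>j\<close> in direction
  \<open>i\<close>, hence the sum over the first index. The cut at \<open>n\<close> keeps all values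
  in \<open>Rn n\<close>.\<close>

definition lapp :: "nat => nat => (nat => nat => real) => (nat => real) => nat => real" where
 "lapp m n D v = (\<lambda>j. if j < n then \<Sum>i<m. D i j * v i else 0)"

lemma lapp_Rn: "lapp m n D v \<in> Rn n"
 by (simp add: lapp_def mem_Rn)

lemma lapp_add: "lapp m n D (\<lambda>i. v i + w i) = (\<lambda>j. lapp m n D v j + lapp m n D w j)"
 and lapp_scale: "lapp m n D (\<lambda>i. c * v i) = (\<lambda>j. c * lapp m n D v j)"
 and lapp_zero: "lapp m n D (\<lambda>i. 0) = (\<lambda>j. 0)"
 by (auto simp: lapp_def fun_eq_iff algebra_simps sum.distrib sum_distrib_left)

definition grad :: "(nat => (nat => real) => real) => (nat => real) => nat => nat => real" where
 "grad h x = (\<lambda>i j. pderiv_coord i (h j) x)"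

lemma curve_tendsto:
 assumes "curve_through M x v \<gamma>"
 shows "(\<gamma> \<longlongrightarrow> x) (nhds 0)"
 unfolding tendsto_fun_iff
proof
 fix i
 have "isCont (\<lambda>t. \<gamma> t i) 0"
  using assms unfolding curve_through_def has_velocity_def by (blast intro: DERIV_isCont)
 then have "((\<lambda>t. \<gamma> t i) \<longlongrightarrow> \<gamma> 0 i) (nhds 0)"
  unfolding isCont_def using tendsto_at_iff_tendsto_nhds[of "\<lambda>t. \<gamma> t i" 0] by simp
 then show "((\<lambda>t. \<gamma> t i) \<longlongrightarrow> x i) (nhds 0)" using assms by (simp add: curve_through_def)
qed

lemma curve_eventually:
 assumes "curve_through M x v \<gamma>"
 shows "\<forall>\<^sub>F t in nhds 0. \<gamma> t \<in> M"
proof -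
 obtain e where e: "e > 0" "\<forall>t\<in>{-e<..<e}. \<gamma> t \<in> M" using assms by (auto simp: curve_through_def)
 have "\<forall>\<^sub>F t in nhds (0::real). t \<in> {-e<..<e}" by (rule eventually_nhds_in_open) (use e in auto)
 then show ?thesis by (rule eventually_mono) (use e in auto)
qed

lemma tangent_space_mono: "S \<subseteq> N ==> tangent_space S y \<subseteq> tangent_space N y"
 unfolding tangent_space_def curve_through_def by blast

lemma tangent_space_Rn:
 assumes "M \<subseteq> Rn n" "v \<in> tangent_space M x"
 shows "v \<in> Rn n"
proof -
 obtain \<gamma> where g: "curve_through M x v \<gamma>" using assms(2) by (auto simp: tangent_space_def)
 have "v i = 0" if i: "i \<ge> n" for i
 proof -
  have "((\<lambda>t. \<gamma> t i) has_real_derivative v i) (at 0)"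
   using g by (simp add: curve_through_def has_velocity_def)
  moreover have "\<forall>\<^sub>F t in nhds 0. \<gamma> t i = 0"
   using curve_eventually[OF g] by (rule eventually_mono) (use assms(1) i in \<open>auto simp: mem_Rn\<close>)
  then have "((\<lambda>t. \<gamma> t i) has_real_derivative 0) (at 0)"
   by (subst DERIV_cong_ev[OF refl _ refl]) auto
  ultimately show ?thesis by (rule DERIV_unique)
 qed
 then show ?thesis by (simp add: mem_Rn)
qed

lemma tangent_spaceI:
 assumes e: "e > 0" "\<And>t. \<bar>t\<bar> < e ==> \<gamma> t \<in> M" and 0: "\<gamma> 0 = x"
  and D: "\<And>t i. \<bar>t\<bar> < e ==> ((\<lambda>t. \<gamma> t i) has_real_derivative D t i) (at t)"
  and c: "\<And>i. continuous_on {-e<..<e} (\<lambda>t. D t i)"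
 shows "D 0 \<in> tangent_space M x"
proof -
 have "curve_through M x (D 0) \<gamma>"
  unfolding curve_through_def has_velocity_def
 proof (intro conjI exI[of _ e] allI)
  show "((\<lambda>t. \<gamma> t i) has_real_derivative D 0 i) (at 0)" for i using D[of 0 i] e(1) by simp
  show "(\<lambda>t. \<gamma> t i) C1_differentiable_on {-e<..<e}" for i
   unfolding C1_differentiable_on_def has_real_derivative_iff_has_vector_derivative[symmetric]
   using D c by (intro exI[of _ "\<lambda>t. D t i"]) (auto simp: abs_less_iff)
 qed (use e 0 in \<open>auto simp: abs_less_iff\<close>)
 then show ?thesis by (auto simp: tangent_space_def)
qed

text \<open>\<open>F\<close> carries a segment to a \<open>C^1\<close> curve in \<open>M\<close>
  whose velocity is the derivative applied to \<open>v\<close>. Inverse charts, jets and retracted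
  maps all obtain their tangent vectors in this way.\<close>

lemma tangent_space_line:
 assumes U: "opn m U" and h: "\<And>j. j < n ==> Ck_open m (Suc 0) U (h j)"
  and x: "x \<in> U" and v: "v \<in> Rn m" and M: "M \<subseteq> Rn n"
  and F: "\<And>y j. y \<in> U ==> j < n ==> F y j = h j y"
  and FM: "\<And>t. (\<lambda>i. x i + t * v i) \<in> U ==> F (\<lambda>i. x i + t * v i) \<in> M"
 shows "lapp m n (grad h x) v \<in> tangent_space M (F x)"
proof -
 have xR: "x \<in> Rn m" using x opn_subset[OF U] by auto
 have line: "(\<lambda>i. x i + t * v i) \<in> Rn m" for t using xR v by (simp add: mem_Rn)
 have "\<forall>\<^sub>F t in nhds (0::real). (\<lambda>i. x i + t * v i) \<in> U"
 proof (rule opn_eventually[OF U x])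
  show "((\<lambda>t i. x i + t * v i) \<longlongrightarrow> x) (nhds 0)"
   unfolding tendsto_fun_iff by (auto intro!: tendsto_eq_intros filterlim_ident)
 qed (use line in simp)
 then obtain e where e: "e > 0" "\<And>t. \<bar>t\<bar> < e ==> (\<lambda>i. x i + t * v i) \<in> U"
  by (auto simp: eventually_nhds_metric dist_real_def)
 let ?l = "\<lambda>t i. x i + t * v i"
 have "lapp m n (grad h (?l 0)) v \<in> tangent_space M (F x)"
 proof (rule tangent_spaceI[OF e(1), of "\<lambda>t. F (?l t)" M _ "\<lambda>t. lapp m n (grad h (?l t)) v"])
  show "F (?l t) \<in> M" if "\<bar>t\<bar> < e" for t using FM e(2)[OF that] by simp
  show "F (?l 0) = F x" by simp
 next
  fix t i assume t: "\<bar>t\<bar> < e"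
  have ev: "\<forall>\<^sub>F s in nhds t. \<bar>s\<bar> < e"
   using eventually_nhds_in_open[of "{-e<..<e}" t] t by (auto simp: abs_less_iff elim!: eventually_mono)
  show "((\<lambda>t. F (?l t) i) has_real_derivative lapp m n (grad h (?l t)) v i) (at t)"
  proof (cases "i < n")
   case True
   have "((\<lambda>t. h i (?l t)) has_real_derivative (\<Sum>k<m. pderiv_coord k (h i) (?l t) * v k)) (at t)"
    by (rule chain_curve[where \<gamma> = ?l and v = v, OF U h[OF True] e(2)[OF t]])
      (use line in \<open>auto intro!: derivative_eq_intros\<close>)
   moreover have "\<forall>\<^sub>F s in nhds t. F (?l s) i = h i (?l s)"
    using ev by (rule eventually_mono) (use F e(2) True in auto)
   ultimately show ?thesis
    using True by (subst DERIV_cong_ev[OF refl _ refl]) (auto simp: lapp_def grad_def)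
  next
   case False
   have "\<forall>\<^sub>F s in nhds t. F (?l s) i = 0"
    using ev by (rule eventually_mono) (use FM e(2) M False in \<open>force simp: mem_Rn\<close>)
   then show ?thesis
    using False by (subst DERIV_cong_ev[OF refl _ refl]) (auto simp: lapp_def)
  qed
 next
  fix i
  have "continuous_on {-e<..<e} (\<lambda>t. pderiv_coord k (h i) (?l t))" if "i < n" "k < m" for k
   by (rule continuous_on_compose2[OF Ck_open_1D(2)[OF h[OF that(1)] U that(2)]])
     (use e(2) in \<open>auto intro!: continuous_on_coordinatewise_then_product continuous_intros simp: abs_less_iff\<close>)
  then show "continuous_on {-e<..<e} (\<lambda>t. lapp m n (grad h (?l t)) v i)"
   unfolding lapp_def grad_def by (cases "i < n") (auto intro!: continuous_intros)
 qed
 then show ?thesis by simp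
qed

text \<open>A submanifold chart in usable form: the inverse is named, both directions are smooth on
  open sets, and inside \<open>U\<close> the manifold is the zero set of the coordinates from
  \<open>d\<close> on.\<close>

locale chart =
 fixes n :: nat and p :: enat and d :: nat and M U V :: "(nat => real) set"
  and \<phi> \<psi> :: "(nat => real) => nat => real"
 assumes dn: "d \<le> n" and p: "1 \<le> p" and MR: "M \<subseteq> Rn n"
  and U: "opn n U" and V: "opn n V"
  and \<phi>V: "\<phi> \<in> U \<rightarrow> V" and \<psi>U: "\<psi> \<in> V \<rightarrow> U"
  and \<psi>\<phi>: "\<And>y. y \<in> U ==> \<psi> (\<phi> y) = y" and \<phi>\<psi>: "\<And>u. u \<in> V ==> \<phi> (\<psi> u) = u"
  and \<phi>p: "\<And>i. i < n ==> Cp_open n p U (\<lambda>y. \<phi> y i)" and \<psi>p: "\<And>i. i < n ==> Cp_open n p V (\<lambda>y. \<psi> y i)"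
  and M_iff: "\<And>y. y \<in> U ==> y \<in> M \<longleftrightarrow> (\<forall>i\<ge>d. \<phi> y i = 0)"

lemma submanifold_chart:
 assumes "submanifold n p d M" "x \<in> M" "1 \<le> p"
 obtains U V \<phi> \<psi> where "chart n p d M U V \<phi> \<psi>" "x \<in> U"
proof -
 obtain U V \<phi> where UV: "opn n U" "opn n V" "x \<in> U"
   and df: "Cp_diffeo n n p U V \<phi>" and im: "\<phi> ` (U \<inter> M) = V \<inter> {y. \<forall>i\<ge>d. y i = 0}"
  using assms(1,2) unfolding submanifold_def by blast
 have bij: "bij_betw \<phi> U V" and c: "Cp_map n n p U \<phi>" "Cp_map n n p V (inv_into U \<phi>)"
  using df by (auto simp: Cp_diffeo_def)
 have "chart n p d M U V \<phi> (inv_into U \<phi>)"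
 proof
  show "y \<in> M \<longleftrightarrow> (\<forall>i\<ge>d. \<phi> y i = 0)" if y: "y \<in> U" for y
  proof
   assume "y \<in> M" then show "\<forall>i\<ge>d. \<phi> y i = 0" using im y by blast
  next
   assume "\<forall>i\<ge>d. \<phi> y i = 0"
   then have "\<phi> y \<in> V \<inter> {y. \<forall>i\<ge>d. y i = 0}" using bij_betwE[OF bij] y by auto
   then obtain y' where y': "y' \<in> U" "y' \<in> M" "\<phi> y = \<phi> y'" using im by blast
   then have "y = y'" using bij y by (auto simp: bij_betw_def inj_on_def)
   then show "y \<in> M" using y' by simp
  qed
  show "\<phi> \<in> U \<rightarrow> V" using bij_betwE[OF bij] by auto
  show "inv_into U \<phi> \<in> V \<rightarrow> U" using bij_betwE[OF bij_betw_inv_into[OF bij]] by auto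
  show "inv_into U \<phi> (\<phi> y) = y" if "y \<in> U" for y using bij that by (rule bij_betw_inv_into_left)
  show "\<phi> (inv_into U \<phi> u) = u" if "u \<in> V" for u using bij that by (rule bij_betw_inv_into_right)
  show "Cp_open n p U (\<lambda>y. \<phi> y i)" if "i < n" for i
   using c(1) that by (simp add: Cp_map_def Cp_on_open_iff[OF UV(1)])
  show "Cp_open n p V (\<lambda>y. inv_into U \<phi> y i)" if "i < n" for i
   using c(2) that by (simp add: Cp_map_def Cp_on_open_iff[OF UV(2)])
 qed (use assms UV in \<open>auto simp: submanifold_def\<close>)
 then show thesis using that UV(3) by blast
qed

context chart
begin

lemma U_Rn: "U \<subseteq> Rn n" and V_Rn: "V \<subseteq> Rn n"
 using opn_subset U V by blast+

lemma \<phi>1: "i < n ==> Ck_open n (Suc 0) U (\<lambda>y. \<phi> y i)" and \<psi>1: "i < n ==> Ck_open n (Suc 0) V (\<lambda>y. \<psi> y i)"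
 using Cp_open_Ck[OF \<phi>p, of i "Suc 0"] Cp_open_Ck[OF \<psi>p, of i "Suc 0"] p by (simp_all add: one_enat_def)

text \<open>The derivative of the chart; \<open>J\<close> is that of the inverse chart.\<close>

definition K :: "(nat => real) => (nat => real) => nat => real" where
 "K y v = lapp n n (grad (\<lambda>j y. \<phi> y j) y) v"

definition J :: "(nat => real) => (nat => real) => nat => real" where
 "J u v = lapp n n (grad (\<lambda>j y. \<psi> y j) u) v"

lemma KJ_coeff:
 assumes "u \<in> V" "k < n" "j < n"
 shows "(\<Sum>i<n. pderiv_coord i (\<lambda>y. \<phi> y k) (\<psi> u) * pderiv_coord j (\<lambda>v. \<psi> v i) u) = (if j = k then 1 else 0)"
proof -
 have "pderiv_coord j (\<lambda>u. \<phi> (\<psi> u) k) u = (\<Sum>i<n. pderiv_coord i (\<lambda>y. \<phi> y k) (\<psi> u) * pderiv_coord j (\<lambda>v. \<psi> v i) u)"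
  by (rule pderiv_coord_compose[OF V U \<phi>1[OF assms(2)] \<psi>1 \<psi>U assms(1,3)])
 moreover have "pderiv_coord j (\<lambda>u. \<phi> (\<psi> u) k) u = pderiv_coord j (\<lambda>u. u k) u"
  by (rule pderiv_coord_cong[OF V _ assms(1,3)]) (simp add: \<phi>\<psi>)
 moreover have "pderiv_coord j (\<lambda>u. u k) u = (if j = k then 1 else 0)"
  by (rule pderiv_coord_eqI) (auto intro!: derivative_eq_intros)
 ultimately show ?thesis by simp
qed

lemma JK_coeff:
 assumes "y \<in> U" "k < n" "j < n"
 shows "(\<Sum>i<n. pderiv_coord i (\<lambda>u. \<psi> u k) (\<phi> y) * pderiv_coord j (\<lambda>y. \<phi> y i) y) = (if j = k then 1 else 0)"
proof -
 have "pderiv_coord j (\<lambda>y. \<psi> (\<phi> y) k) y = (\<Sum>i<n. pderiv_coord i (\<lambda>u. \<psi> u k) (\<phi> y) * pderiv_coord j (\<lambda>y. \<phi> y i) y)"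
  by (rule pderiv_coord_compose[OF U V \<psi>1[OF assms(2)] \<phi>1 \<phi>V assms(1,3)])
 moreover have "pderiv_coord j (\<lambda>y. \<psi> (\<phi> y) k) y = pderiv_coord j (\<lambda>u. u k) y"
  by (rule pderiv_coord_cong[OF U _ assms(1,3)]) (simp add: \<psi>\<phi>)
 moreover have "pderiv_coord j (\<lambda>u. u k) y = (if j = k then 1 else 0)"
  by (rule pderiv_coord_eqI) (auto intro!: derivative_eq_intros)
 ultimately show ?thesis by simp
qed

lemma lapp_inverse:
 assumes "\<And>k j. k < n ==> j < n ==> (\<Sum>i<n. A i k * B j i) = (if j = k then 1 else 0)" "v \<in> Rn n"
 shows "lapp n n A (lapp n n B v) = v"
proof
 fix k
 show "lapp n n A (lapp n n B v) k = v k"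
 proof (cases "k < n")
  case k: True
  have "lapp n n A (lapp n n B v) k = (\<Sum>i<n. \<Sum>j<n. (A i k * B j i) * v j)"
   using k by (auto simp: lapp_def sum_distrib_left mult.assoc intro!: sum.cong)
  also have "\<dots> = (\<Sum>j<n. (\<Sum>i<n. A i k * B j i) * v j)"
   by (subst sum.swap) (simp add: sum_distrib_right)
  also have "\<dots> = (\<Sum>j<n. (if j = k then 1 else 0) * v j)"
   using assms(1)[OF k] by (intro sum.cong) auto
  also have "\<dots> = v k" by (rule sum_kron[OF k])
  finally show ?thesis .
 qed (use assms(2) in \<open>auto simp: lapp_def mem_Rn\<close>)
qed

lemma KJ: "u \<in> V ==> v \<in> Rn n ==> K (\<psi> u) (J u v) = v"
 unfolding K_def J_def by (rule lapp_inverse) (simp_all add: grad_def KJ_coeff)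

lemma JK: "y \<in> U ==> v \<in> Rn n ==> J (\<phi> y) (K y v) = v"
 unfolding K_def J_def by (rule lapp_inverse) (simp_all add: grad_def JK_coeff)

text \<open>Along a curve in \<open>M\<close> the coordinates of \<open>\<phi>\<close> from
  \<open>d\<close> on are constantly 0; conversely \<open>\<psi>\<close> carries segments of
  \<open>Rn d\<close> into \<open>M\<close>. Tangency thus becomes a linear condition that varies
  continuously with the point.\<close>

lemma tangent_space_iff:
 assumes y: "y \<in> U" "y \<in> M"
 shows "v \<in> tangent_space M y \<longleftrightarrow> v \<in> Rn n \<and> K y v \<in> Rn d"
proof
 assume L: "v \<in> tangent_space M y"
 then obtain \<gamma> where g: "curve_through M y v \<gamma>" by (auto simp: tangent_space_def)
 have "K y v k = 0" if k: "k \<ge> d" for k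
 proof (cases "k < n")
  case True
  have g0: "\<gamma> 0 = y" and gv: "\<And>i. ((\<lambda>t. \<gamma> t i) has_real_derivative v i) (at 0)"
   using g by (auto simp: curve_through_def has_velocity_def)
  have ev: "\<forall>\<^sub>F t in nhds 0. \<gamma> t \<in> Rn n"
   using curve_eventually[OF g] by (rule eventually_mono) (use MR in auto)
  have "((\<lambda>t. \<phi> (\<gamma> t) k) has_real_derivative (\<Sum>i<n. pderiv_coord i (\<lambda>y. \<phi> y k) (\<gamma> 0) * v i)) (at 0)"
   by (rule chain_curve[OF U \<phi>1[OF True] _ ev gv]) (use g0 y in simp)
  moreover have "\<forall>\<^sub>F t in nhds 0. \<phi> (\<gamma> t) k = 0"
   using curve_eventually[OF g] opn_eventually[OF U y(1) curve_tendsto[OF g] ev]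
   by eventually_elim (use M_iff k in auto)
  then have "((\<lambda>t. \<phi> (\<gamma> t) k) has_real_derivative 0) (at 0)"
   by (subst DERIV_cong_ev[OF refl _ refl]) auto
  ultimately have "(\<Sum>i<n. pderiv_coord i (\<lambda>y. \<phi> y k) (\<gamma> 0) * v i) = 0" by (rule DERIV_unique)
  then show ?thesis using True g0 by (simp add: K_def lapp_def grad_def)
 qed (simp add: K_def lapp_def)
 then show "v \<in> Rn n \<and> K y v \<in> Rn d" using tangent_space_Rn[OF MR L] by (simp add: mem_Rn)
next
 assume R: "v \<in> Rn n \<and> K y v \<in> Rn d"
 have \<phi>y: "\<phi> y \<in> V" using \<phi>V y by auto
 have "lapp n n (grad (\<lambda>j u. \<psi> u j) (\<phi> y)) (K y v) \<in> tangent_space M (\<psi> (\<phi> y))"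
 proof (rule tangent_space_line[OF V \<psi>1 \<phi>y _ MR])
  show "K y v \<in> Rn n" by (simp add: K_def lapp_Rn)
  fix t assume t: "(\<lambda>i. \<phi> y i + t * K y v i) \<in> V"
  show "\<psi> (\<lambda>i. \<phi> y i + t * K y v i) \<in> M"
   using t \<psi>U R M_iff[OF y(1)] y(2) by (subst M_iff) (auto simp: \<phi>\<psi> mem_Rn)
 qed auto
 then have "J (\<phi> y) (K y v) \<in> tangent_space M y" by (simp add: J_def \<psi>\<phi> y)
 then show "v \<in> tangent_space M y" using JK[OF y(1)] R by simp
qed

lemma subsp_tangent:
 assumes y: "y \<in> U" "y \<in> M"
 shows "subsp n (tangent_space M y)"
 unfolding subsp_def using tangent_space_iff[OF y]
 by (auto simp: K_def lapp_add lapp_scale lapp_zero Rn_add Rn_scale Rn_zero)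

text \<open>\<open>J\<close> maps the first \<open>d\<close> standard vectors to a basis,
  independent because \<open>K\<close> inverts \<open>J\<close>.\<close>

lemma tangent_basis:
 assumes y: "y \<in> U" "y \<in> M"
 obtains b where "orthonormal n d b" "lin_span d b = tangent_space M y"
proof -
 define a where "a j = J (\<phi> y) (stdb j)" for j
 have \<phi>y: "\<phi> y \<in> V" using \<phi>V y by auto
 have aR: "a j \<in> Rn n" for j by (simp add: a_def J_def lapp_Rn)
 have comb: "(\<lambda>i. \<Sum>j<d. c j * a j i) = J (\<phi> y) (trunc d c)" for c
 proof
  fix i
  have "(\<Sum>j<d. c j * a j i) = (if i < n then \<Sum>k<n. pderiv_coord k (\<lambda>y. \<psi> y i) (\<phi> y) * (\<Sum>j<d. c j * stdb j k) else 0)"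
  proof (cases "i < n")
   case True
   have "(\<Sum>j<d. c j * a j i) = (\<Sum>j<d. \<Sum>k<n. pderiv_coord k (\<lambda>y. \<psi> y i) (\<phi> y) * (c j * stdb j k))"
    using True by (simp add: a_def J_def lapp_def grad_def sum_distrib_left mult_ac)
   then show ?thesis using True by (subst (asm) sum.swap) (simp add: sum_distrib_left)
  qed (simp add: a_def J_def lapp_def)
  moreover have "(\<Sum>j<d. c j * stdb j k) = trunc d c k" for k
  proof (cases "k < d")
   case False
   then show ?thesis by (auto simp: trunc_def stdb_def intro!: sum.neutral)
  qed (simp add: sum_stdb trunc_def)
  ultimately show "(\<Sum>j<d. c j * a j i) = J (\<phi> y) (trunc d c) i"
   by (simp add: J_def lapp_def grad_def)
 qed
 have tR: "trunc d c \<in> Rn n" for c using dn by (auto simp: trunc_def mem_Rn)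
 have "indep d a"
  unfolding indep_def
 proof (intro allI impI)
  fix c j assume "\<forall>i. (\<Sum>j<d. c j * a j i) = 0" and j: "j < d"
  then have "J (\<phi> y) (trunc d c) = (\<lambda>_. 0)" using comb[of c] by (simp add: fun_eq_iff)
  then have "trunc d c = (\<lambda>_. 0)" using KJ[OF \<phi>y tR, of c] by (simp add: K_def lapp_zero)
  then show "c j = 0" using j by (auto simp: trunc_def fun_eq_iff split: if_splits)
 qed
 then obtain b where b: "orthonormal n d b" "lin_span d b = lin_span d a"
  by (rule indep_orthonormal_basis[OF aR, of d])
 have "v \<in> lin_span d a \<longleftrightarrow> v \<in> tangent_space M y" for v
 proof
  assume "v \<in> lin_span d a"
  then obtain c where c: "v = J (\<phi> y) (trunc d c)" unfolding lin_span_def comb by auto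
  then have "K y v = trunc d c" using KJ[OF \<phi>y tR, of c] y by (simp add: \<psi>\<phi>)
  then show "v \<in> tangent_space M y"
   using tangent_space_iff[OF y] c by (auto simp: trunc_def mem_Rn J_def lapp_def)
 next
  assume v: "v \<in> tangent_space M y"
  then have "v \<in> Rn n" "trunc d (K y v) = K y v"
   using tangent_space_iff[OF y] by (auto simp: trunc_def mem_Rn fun_eq_iff)
  then have "v = J (\<phi> y) (trunc d (K y v))" using JK[OF y(1)] by simp
  then show "v \<in> lin_span d a" unfolding lin_span_def comb by blast
 qed
 then have "lin_span d a = tangent_space M y" by blast
 then show thesis using that[OF b(1)] b(2) by simp
qed

lemma K_tendsto:
 assumes "y \<in> U" "(ys \<longlongrightarrow> y) F" "\<forall>\<^sub>F s in F. ys s \<in> Rn n" "(vs \<longlongrightarrow> v) F"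
 shows "((\<lambda>s. K (ys s) (vs s)) \<longlongrightarrow> K y v) F"
 unfolding tendsto_fun_iff
proof
 fix k
 have "((\<lambda>s. pderiv_coord i (\<lambda>y. \<phi> y k) (ys s)) \<longlongrightarrow> pderiv_coord i (\<lambda>y. \<phi> y k) y) F" if "k < n" "i < n" for i
  by (rule continuous_on_opn_tendsto[OF U Ck_open_1D(2)[OF \<phi>1[OF that(1)] U that(2)] assms(1,2,3)])
 then show "((\<lambda>s. K (ys s) (vs s) k) \<longlongrightarrow> K y v k) F"
  using assms(4) unfolding K_def lapp_def grad_def tendsto_fun_iff
  by (cases "k < n") (auto intro!: tendsto_intros)
qed

lemma J_tendsto:
 assumes "u \<in> V" "(us \<longlongrightarrow> u) F" "\<forall>\<^sub>F s in F. us s \<in> Rn n"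
 shows "((\<lambda>s. J (us s) v) \<longlongrightarrow> J u v) F"
 unfolding tendsto_fun_iff
proof
 fix k
 have "((\<lambda>s. pderiv_coord i (\<lambda>y. \<psi> y k) (us s)) \<longlongrightarrow> pderiv_coord i (\<lambda>y. \<psi> y k) u) F" if "k < n" "i < n" for i
  by (rule continuous_on_opn_tendsto[OF V Ck_open_1D(2)[OF \<psi>1[OF that(1)] V that(2)] assms(1,2,3)])
 then show "((\<lambda>s. J (us s) v k) \<longlongrightarrow> J u v k) F"
  unfolding J_def lapp_def grad_def
  by (cases "k < n") (auto intro!: tendsto_intros)
qed

text \<open>The tangent bundle is closed over \<open>M\<close>: \<open>K\<close> is continuous in
  point and vector together, and \<open>Rn d\<close> is closed.\<close>

lemma tangent_closed_chart:
 assumes y: "y \<in> U" "y \<in> M" and ys: "ys \<longlonglongrightarrow> y" "\<And>s. ys s \<in> M"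
  and vs: "vs \<longlonglongrightarrow> v" "\<And>s. vs s \<in> tangent_space M (ys s)"
 shows "v \<in> tangent_space M y"
proof -
 have ysR: "\<forall>\<^sub>F s in sequentially. ys s \<in> Rn n"
  by (intro always_eventually allI) (use ys(2) MR in blast)
 have lim: "(\<lambda>s. K (ys s) (vs s)) \<longlonglongrightarrow> K y v" by (rule K_tendsto[OF y(1) ys(1) ysR vs(1)])
 have ev: "\<forall>\<^sub>F s in sequentially. vs s \<in> Rn n \<and> K (ys s) (vs s) \<in> Rn d"
  using opn_eventually[OF U y(1) ys(1) ysR] by eventually_elim (use tangent_space_iff ys(2) vs(2) in blast)
 have closed: "w \<in> Rn k" if "\<forall>\<^sub>F s in sequentially. ws s \<in> Rn k" "ws \<longlonglongrightarrow> w" for ws w k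
 proof -
  have "w i = 0" if "i \<ge> k" for i
  proof (rule LIMSEQ_unique)
   show "(\<lambda>s. ws s i) \<longlonglongrightarrow> w i" using \<open>ws \<longlonglongrightarrow> w\<close> by (simp add: tendsto_fun_iff)
   show "(\<lambda>s. ws s i) \<longlonglongrightarrow> 0"
    using \<open>\<forall>\<^sub>F s in sequentially. ws s \<in> Rn k\<close> that by (auto intro!: tendsto_eventually elim!: eventually_mono simp: mem_Rn)
  qed
  then show ?thesis by (simp add: mem_Rn)
 qed
 have "v \<in> Rn n" by (rule closed[OF _ vs(1)]) (use ev in \<open>auto elim: eventually_mono\<close>)
 moreover have "K y v \<in> Rn d" by (rule closed[OF _ lim]) (use ev in \<open>auto elim: eventually_mono\<close>)
 ultimately show ?thesis using tangent_space_iff[OF y] by blast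
qed

text \<open>Every tangent vector at the limit is a limit of tangent vectors along the sequence: its
  chart coordinates \<open>K y v\<close> are kept fixed and carried back at the nearby
  points.\<close>

lemma tangent_lsc_chart:
 assumes y: "y \<in> U" "y \<in> M" and ys: "ys \<longlonglongrightarrow> y" "\<And>s. ys s \<in> M" and v: "v \<in> tangent_space M y"
 obtains vs where "vs \<longlonglongrightarrow> v" "\<And>s. vs s \<in> tangent_space M (ys s)"
proof -
 have ysR: "\<forall>\<^sub>F s in sequentially. ys s \<in> Rn n"
  by (intro always_eventually allI) (use ys(2) MR in blast)
 have ysU: "\<forall>\<^sub>F s in sequentially. ys s \<in> U" by (rule opn_eventually[OF U y(1) ys(1) ysR])
 have zero: "(\<lambda>_. 0) \<in> tangent_space M (ys s)" for s
 proof -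
  have "D \<in> tangent_space M (ys s)" if "D = (\<lambda>t i. 0) (0::real)" for D
   unfolding that by (rule tangent_spaceI[of 1 "\<lambda>_. ys s"]) (use ys(2) in auto)
  then show ?thesis by blast
 qed
 have kv: "K y v \<in> Rn d" "v \<in> Rn n" using v tangent_space_iff[OF y] by auto
 have kvn: "K y v \<in> Rn n" using kv(1) dn by (auto simp: mem_Rn)
 \<comment> \<open>The value 0 outside the chart domain concerns finitely many \<open>s\<close>
   only.\<close>
 define vs where "vs s = (if ys s \<in> U then J (\<phi> (ys s)) (K y v) else (\<lambda>_. 0))" for s
 have "vs s \<in> tangent_space M (ys s)" for s
 proof (cases "ys s \<in> U")
  case True
  have "K (ys s) (J (\<phi> (ys s)) (K y v)) = K y v"
   using KJ[of "\<phi> (ys s)" "K y v"] True \<phi>V kvn by (auto simp: \<psi>\<phi>)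
  then show ?thesis
   using tangent_space_iff[OF True ys(2)] True kv by (simp add: vs_def J_def lapp_Rn)
 qed (simp add: vs_def zero)
 moreover have "vs \<longlonglongrightarrow> v"
 proof -
  have \<phi>l: "((\<lambda>s. \<phi> (ys s)) \<longlongrightarrow> \<phi> y) sequentially"
  proof (rule tendsto_Rn[where n = n])
   show "\<forall>\<^sub>F s in sequentially. \<phi> (ys s) \<in> Rn n" using ysU by eventually_elim (use \<phi>V V_Rn in auto)
   show "\<phi> y \<in> Rn n" using y \<phi>V V_Rn by auto
   show "(\<lambda>s. \<phi> (ys s) i) \<longlonglongrightarrow> \<phi> y i" if "i < n" for i
    by (rule continuous_on_opn_tendsto[OF U Ck_open_continuous[OF U_Rn \<phi>1[OF that]] y(1) ys(1) ysR])
  qed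
  have "(\<lambda>s. J (\<phi> (ys s)) (K y v)) \<longlonglongrightarrow> J (\<phi> y) (K y v)"
  proof (rule J_tendsto[OF _ \<phi>l])
   show "\<forall>\<^sub>F s in sequentially. \<phi> (ys s) \<in> Rn n" using ysU by eventually_elim (use \<phi>V V_Rn in auto)
  qed (use y \<phi>V in auto)
  then have "(\<lambda>s. J (\<phi> (ys s)) (K y v)) \<longlonglongrightarrow> v" using JK[OF y(1) kv(2)] by simp
  then show ?thesis
  proof (rule Lim_transform_eventually)
   show "\<forall>\<^sub>F s in sequentially. J (\<phi> (ys s)) (K y v) = vs s"
    using ysU by eventually_elim (simp add: vs_def)
  qed
 qed
 ultimately show thesis using that by blast
qed

text \<open>The chart coordinates from \<open>d\<close> on vanish at \<open>y\<close> and at the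
  nearby points of \<open>M\<close>. Their derivative in the direction \<open>v\<close> is therefore
  a limit of difference quotients that are eventually 0.\<close>

lemma contingent_chart:
 assumes y: "y \<in> U" "y \<in> M" and v: "v \<in> Rn n"
  and c: "\<And>\<epsilon>. \<epsilon> > 0 ==> \<exists>t. 0 < t \<and> t < \<epsilon> \<and> (\<exists>x\<in>M. \<forall>i<n. \<bar>x i - y i - t * v i\<bar> \<le> \<epsilon> * t)"
 shows "v \<in> tangent_space M y"
proof -
 define \<epsilon> where "\<epsilon> s = 1 / (real s + 1)" for s
 have \<epsilon>: "\<epsilon> s > 0" for s by (simp add: \<epsilon>_def)
 have \<epsilon>0: "\<epsilon> \<longlonglongrightarrow> 0"
  using LIMSEQ_inverse_real_of_nat by (simp add: \<epsilon>_def[abs_def] inverse_eq_divide add.commute)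
 have "\<forall>s. \<exists>t x. 0 < t \<and> t < \<epsilon> s \<and> x \<in> M \<and> (\<forall>i<n. \<bar>x i - y i - t * v i\<bar> \<le> \<epsilon> s * t)"
  using c[OF \<epsilon>] by blast
 then obtain t x where tx: "\<And>s. 0 < t s" "\<And>s. t s < \<epsilon> s" "\<And>s. x s \<in> M"
   "\<And>s i. i < n ==> \<bar>x s i - y i - t s * v i\<bar> \<le> \<epsilon> s * t s"
  by metis
 have t0: "t \<longlonglongrightarrow> 0"
  by (rule tendsto_sandwich[OF _ _ tendsto_const \<epsilon>0])
    (use tx(1,2) in \<open>auto intro!: always_eventually less_imp_le\<close>)
 have yR: "y \<in> Rn n" using y U_Rn by auto
 have q: "(\<lambda>s. (x s i - y i) / t s) \<longlonglongrightarrow> v i" if i: "i < n" for i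
 proof -
  have "(\<lambda>s. (x s i - y i) / t s - v i) \<longlonglongrightarrow> 0"
  proof (rule tendsto_rabs_zero_cancel, rule tendsto_sandwich[OF _ _ tendsto_const \<epsilon>0])
   show "\<forall>\<^sub>F s in sequentially. \<bar>(x s i - y i) / t s - v i\<bar> \<le> \<epsilon> s"
   proof (rule always_eventually, rule allI)
    fix s
    have "(x s i - y i) / t s - v i = (x s i - y i - t s * v i) / t s"
     using tx(1)[of s] by (simp add: field_simps)
    then show "\<bar>(x s i - y i) / t s - v i\<bar> \<le> \<epsilon> s"
     using tx(1)[of s] tx(4)[OF i, of s] by (simp add: abs_divide pos_divide_le_eq)
   qed
  qed auto
  then show ?thesis by (simp add: LIM_zero_iff)
 qed
 have xy: "x \<longlonglongrightarrow> y"
 proof (rule tendsto_Rn[where n = n])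
  show "\<forall>\<^sub>F s in sequentially. x s \<in> Rn n"
   by (intro always_eventually allI) (use tx(3) MR in blast)
  fix i assume i: "i < n"
  have "(\<lambda>s. y i + (x s i - y i) / t s * t s) \<longlonglongrightarrow> y i + v i * 0"
   by (intro tendsto_intros q[OF i] t0)
  then show "(\<lambda>s. x s i) \<longlonglongrightarrow> y i" using tx(1) by (simp add: less_imp_neq[symmetric])
 qed (rule yR)
 have xR: "\<forall>\<^sub>F s in sequentially. x s \<in> Rn n"
  by (intro always_eventually allI) (use tx(3) MR in blast)
 have xU: "\<forall>\<^sub>F s in sequentially. x s \<in> U" by (rule opn_eventually[OF U y(1) xy xR])
 have "K y v k = 0" if k: "k \<ge> d" for k
 proof (cases "k < n")
  case True
  obtain C where C: "\<forall>\<^sub>F s in sequentially. \<phi> (x s) k - \<phi> y k = (\<Sum>i<n. C s i * (x s i - y i))"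
   "\<And>i. i < n ==> (\<lambda>s. C s i) \<longlonglongrightarrow> pderiv_coord i (\<lambda>y. \<phi> y k) y"
   by (rule strict_diff[OF U \<phi>1[OF True] y(1), of "\<lambda>_. y" sequentially x]) (use xy xR yR in auto)
  have "(\<lambda>s. \<Sum>i<n. C s i * ((x s i - y i) / t s)) \<longlonglongrightarrow> (\<Sum>i<n. pderiv_coord i (\<lambda>y. \<phi> y k) y * v i)"
   by (intro tendsto_sum tendsto_mult C(2) q) auto
  moreover have "(\<lambda>s. \<Sum>i<n. C s i * ((x s i - y i) / t s)) \<longlonglongrightarrow> 0"
  proof (rule tendsto_eventually)
   show "\<forall>\<^sub>F s in sequentially. (\<Sum>i<n. C s i * ((x s i - y i) / t s)) = 0"
    using C(1) xU
   proof eventually_elim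
    case (elim s)
    have "(\<Sum>i<n. C s i * ((x s i - y i) / t s)) = (\<phi> (x s) k - \<phi> y k) / t s"
     using elim(1) by (simp add: sum_divide_distrib)
    also have "\<dots> = 0" using M_iff[OF elim(2)] M_iff[OF y(1)] y(2) tx(3) k by simp
    finally show ?case .
   qed
  qed
  ultimately have "(\<Sum>i<n. pderiv_coord i (\<lambda>y. \<phi> y k) y * v i) = 0" by (rule LIMSEQ_unique)
  then show ?thesis using True by (simp add: K_def lapp_def grad_def)
 qed (simp add: K_def lapp_def)
 then show ?thesis using tangent_space_iff[OF y] v by (simp add: mem_Rn)
qed

end

section \<open>Submanifolds\<close>

lemma submanifold_Rn: "submanifold n p d M ==> M \<subseteq> Rn n"
 by (simp add: submanifold_def)

lemma tangent_subsp:
 assumes "submanifold n p d M" "1 \<le> p" "x \<in> M"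
 shows "subsp n (tangent_space M x)"
 using submanifold_chart[OF assms(1,3,2)] chart.subsp_tangent assms(3) by metis

lemma tangent_orthonormal_basis:
 assumes "submanifold n p d M" "1 \<le> p" "x \<in> M"
 obtains b where "orthonormal n d b" "lin_span d b = tangent_space M x"
 using submanifold_chart[OF assms(1,3,2)] chart.tangent_basis assms(3) by metis

lemma tangent_closed:
 assumes "submanifold n p d M" "1 \<le> p" "y \<in> M" "ys \<longlonglongrightarrow> y" "\<And>s. ys s \<in> M"
  "vs \<longlonglongrightarrow> v" "\<And>s. vs s \<in> tangent_space M (ys s)"
 shows "v \<in> tangent_space M y"
proof -
 obtain U V \<phi> \<psi> where "chart n p d M U V \<phi> \<psi>" "y \<in> U" by (rule submanifold_chart[OF assms(1,3,2)])
 then show ?thesis using chart.tangent_closed_chart assms(3-7) by blast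
qed

lemma tangent_lsc:
 assumes "submanifold n p d M" "1 \<le> p" "y \<in> M" "ys \<longlonglongrightarrow> y" "\<And>s. ys s \<in> M" "v \<in> tangent_space M y"
 obtains vs where "vs \<longlonglongrightarrow> v" "\<And>s. vs s \<in> tangent_space M (ys s)"
proof -
 obtain U V \<phi> \<psi> where "chart n p d M U V \<phi> \<psi>" "y \<in> U" by (rule submanifold_chart[OF assms(1,3,2)])
 then show ?thesis using chart.tangent_lsc_chart assms(3-6) that by blast
qed

text \<open>The tangent space of a submanifold is its contingent cone. Unlike the definition by
  curves, this description quantifies over reals and points of \<open>M\<close> only, which makes
  the tangent bundle definable.\<close>

lemma tangent_space_contingent:
 assumes M: "submanifold n p d M" "1 \<le> p" and y: "y \<in> M"
 shows "v \<in> tangent_space M y \<longleftrightarrow> v \<in> Rn n \<and>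
  (\<forall>\<epsilon>>0. \<exists>t. 0 < t \<and> t < \<epsilon> \<and> (\<exists>x\<in>M. \<forall>i<n. \<bar>x i - y i - t * v i\<bar> \<le> \<epsilon> * t))"
proof
 assume L: "v \<in> tangent_space M y"
 then obtain \<gamma> where g: "curve_through M y v \<gamma>" by (auto simp: tangent_space_def)
 show "v \<in> Rn n \<and> (\<forall>\<epsilon>>0. \<exists>t. 0 < t \<and> t < \<epsilon> \<and> (\<exists>x\<in>M. \<forall>i<n. \<bar>x i - y i - t * v i\<bar> \<le> \<epsilon> * t))"
 proof (intro conjI allI impI)
  show "v \<in> Rn n" by (rule tangent_space_Rn[OF submanifold_Rn[OF M(1)] L])
  fix \<epsilon> :: real assume e: "\<epsilon> > 0"
  have ev: "\<forall>\<^sub>F t in at_right 0. \<bar>\<gamma> t i - y i - t * v i\<bar> \<le> \<epsilon> * t" for i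
  proof -
   have "((\<lambda>t. \<gamma> t i) has_real_derivative v i) (at 0)" "\<gamma> 0 i = y i"
    using g by (auto simp: curve_through_def has_velocity_def)
   then have "((\<lambda>t. (\<gamma> t i - y i) / t) \<longlongrightarrow> v i) (at 0)" by (simp add: has_field_derivative_iff)
   then have "((\<lambda>t. (\<gamma> t i - y i) / t) \<longlongrightarrow> v i) (at_right 0)"
    by (rule tendsto_mono[rotated]) (simp add: at_le)
   then have "\<forall>\<^sub>F t in at_right 0. \<bar>(\<gamma> t i - y i) / t - v i\<bar> < \<epsilon>"
    using e by (simp add: tendsto_iff dist_real_def)
   moreover have "\<forall>\<^sub>F t in at_right (0::real). t > 0" by (simp add: eventually_at_filter)
   ultimately show ?thesis
   proof eventually_elim
    case (elim t)
    have "\<gamma> t i - y i - t * v i = ((\<gamma> t i - y i) / t - v i) * t" using elim(2) by (simp add: field_simps)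
    then have "\<bar>\<gamma> t i - y i - t * v i\<bar> = \<bar>(\<gamma> t i - y i) / t - v i\<bar> * t" using elim(2) by (simp add: abs_mult)
    also have "\<dots> \<le> \<epsilon> * t" using elim by (intro mult_right_mono) auto
    finally show ?case .
   qed
  qed
  then have "\<forall>\<^sub>F t in at_right 0. \<forall>i\<in>{..<n}. \<bar>\<gamma> t i - y i - t * v i\<bar> \<le> \<epsilon> * t"
   by (intro eventually_ball_finite) auto
  moreover have "\<forall>\<^sub>F t in at_right 0. \<gamma> t \<in> M"
   using curve_eventually[OF g] by (simp add: eventually_at_filter eventually_mono)
  moreover have "\<forall>\<^sub>F t in at_right (0::real). t \<in> {0<..<\<epsilon>}"
   using e by (rule eventually_at_right_real)
  ultimately have "\<forall>\<^sub>F t in at_right 0. 0 < t \<and> t < \<epsilon> \<and> (\<exists>x\<in>M. \<forall>i<n. \<bar>x i - y i - t * v i\<bar> \<le> \<epsilon> * t)"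
   by eventually_elim auto
  then show "\<exists>t. 0 < t \<and> t < \<epsilon> \<and> (\<exists>x\<in>M. \<forall>i<n. \<bar>x i - y i - t * v i\<bar> \<le> \<epsilon> * t)"
   using eventually_happens[of _ "at_right (0::real)"] by (simp add: trivial_limit_at_right_real)
 qed
next
 assume R: "v \<in> Rn n \<and> (\<forall>\<epsilon>>0. \<exists>t. 0 < t \<and> t < \<epsilon> \<and> (\<exists>x\<in>M. \<forall>i<n. \<bar>x i - y i - t * v i\<bar> \<le> \<epsilon> * t))"
 obtain U V \<phi> \<psi> where "chart n p d M U V \<phi> \<psi>" "y \<in> U" by (rule submanifold_chart[OF M(1) y M(2)])
 then show "v \<in> tangent_space M y" using chart.contingent_chart[of n p d M U V \<phi> \<psi> y v] y R by blast
qed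

text \<open>Both dimensions are the length of an orthonormal basis of the same tangent
  space.\<close>

lemma submanifold_dim_unique:
 assumes "submanifold n p d M" "submanifold n p' d' M" "1 \<le> p" "1 \<le> p'" "x \<in> M"
 shows "d = d'"
proof -
 obtain b where b: "orthonormal n d b" "lin_span d b = tangent_space M x"
  by (rule tangent_orthonormal_basis[OF assms(1,3,5)])
 obtain b' where b': "orthonormal n d' b'" "lin_span d' b' = tangent_space M x"
  by (rule tangent_orthonormal_basis[OF assms(2,4,5)])
 show ?thesis using orthonormal_card_le(1)[OF b(1) b'(1)] orthonormal_card_le(1)[OF b'(1) b(1)] b(2) b'(2) by simp
qed

lemma Cp_on_mono: "Cp_on n p A g ==> p' \<le> p ==> Cp_on n p' A g"
 unfolding Cp_on_def by (meson order_trans)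

lemma submanifold_mono: "submanifold n p d M ==> p' \<le> p ==> submanifold n p' d M"
 unfolding submanifold_def Cp_diffeo_def Cp_map_def by (meson Cp_on_mono)

lemma submanifold_mdim:
 assumes "submanifold n 1 d M"
 shows "submanifold n 1 (mdim n M) M"
 unfolding mdim_def using assms by (rule LeastI)

lemma mdim_eq:
 assumes "submanifold n p d M" "1 \<le> p" "x \<in> M"
 shows "mdim n M = d"
proof -
 have M1: "submanifold n 1 d M" by (rule submanifold_mono[OF assms(1,2)])
 from submanifold_dim_unique[OF submanifold_mdim[OF M1] M1 _ _ assms(3)] show ?thesis by simp
qed

text \<open>\<open>differential\<close> is a definite description ranging over curves. By the chain
  rule all curves of velocity \<open>v\<close> have the same image velocity, computed from any local
  \<open>C^1\<close> extension \<open>h\<close>; some such curve exists, so the value is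
  unique.\<close>

lemma differential_eq:
 assumes M: "M \<subseteq> Rn m" and W: "opn m W" "x \<in> W"
  and h: "\<And>j. j < n ==> Ck_open m (Suc 0) W (h j)"
  and f: "\<And>y j. y \<in> W ==> y \<in> M ==> j < n ==> f y j = h j y" "f \<in> M \<rightarrow> Rn n"
  and v: "v \<in> tangent_space M x"
 shows "differential M f x v = lapp m n (grad h x) v"
proof -
 have vel: "has_velocity (f \<circ> \<gamma>) (lapp m n (grad h x) v)" if g: "curve_through M x v \<gamma>" for \<gamma>
  unfolding has_velocity_def o_def
 proof
  fix j
  have g0: "\<gamma> 0 = x" and gv: "\<And>i. ((\<lambda>t. \<gamma> t i) has_real_derivative v i) (at 0)"
   using g by (auto simp: curve_through_def has_velocity_def)
  have ev: "\<forall>\<^sub>F t in nhds 0. \<gamma> t \<in> Rn m"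
   using curve_eventually[OF g] by (rule eventually_mono) (use M in auto)
  show "((\<lambda>t. f (\<gamma> t) j) has_real_derivative lapp m n (grad h x) v j) (at 0)"
  proof (cases "j < n")
   case True
   have "((\<lambda>t. h j (\<gamma> t)) has_real_derivative (\<Sum>i<m. pderiv_coord i (h j) (\<gamma> 0) * v i)) (at 0)"
    by (rule chain_curve[OF W(1) h[OF True] _ ev gv]) (use g0 W in simp)
   moreover have "\<forall>\<^sub>F t in nhds 0. f (\<gamma> t) j = h j (\<gamma> t)"
    using curve_eventually[OF g] opn_eventually[OF W curve_tendsto[OF g] ev]
    by eventually_elim (use f True in auto)
   ultimately show ?thesis
    using True g0 by (subst DERIV_cong_ev[OF refl _ refl]) (auto simp: lapp_def grad_def)
  next
   case False
   have "\<forall>\<^sub>F t in nhds 0. f (\<gamma> t) j = 0"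
    using curve_eventually[OF g] by eventually_elim (use f(2) False in \<open>auto simp: Pi_iff mem_Rn\<close>)
   then show ?thesis
    using False by (subst DERIV_cong_ev[OF refl _ refl]) (auto simp: lapp_def)
  qed
 qed
 obtain \<gamma> where g: "curve_through M x v \<gamma>" using v by (auto simp: tangent_space_def)
 show ?thesis
  unfolding differential_def
 proof (rule the_equality)
  fix w assume "\<forall>\<gamma>. curve_through M x v \<gamma> --> has_velocity (f \<circ> \<gamma>) w"
  with g vel[OF g] show "w = lapp m n (grad h x) v"
   unfolding has_velocity_def fun_eq_iff by (blast intro: DERIV_unique)
 qed (use vel in blast)
qed

section \<open>Definability\<close>

lemma trunc_Rn: "trunc n z \<in> Rn n"
 by (simp add: trunc_def mem_Rn)

lemma trunc_id: "z \<in> Rn n ==> trunc n z = z"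
 by (auto simp: trunc_def mem_Rn fun_eq_iff)

lemma trunc_trunc: "a \<le> b ==> trunc a (trunc b z) = trunc a z"
 by (auto simp: trunc_def fun_eq_iff)

lemma shift_Rn: "z \<in> Rn (n + k) ==> (\<lambda>i. z (n + i)) \<in> Rn k"
 by (simp add: mem_Rn)

lemma append_vec_Rn: "y \<in> Rn k ==> append_vec n x y \<in> Rn (n + k)"
 by (auto simp: append_vec_def mem_Rn)

lemma trunc_append: "x \<in> Rn n ==> trunc n (append_vec n x y) = x"
 by (auto simp: append_vec_def trunc_def mem_Rn fun_eq_iff)

lemma shift_append: "(\<lambda>i. append_vec n x y (n + i)) = y"
 by (auto simp: append_vec_def)

lemma append_trunc_shift: "append_vec n (trunc n z) (\<lambda>i. z (n + i)) = z"
 by (auto simp: append_vec_def trunc_def fun_eq_iff)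

section \<open>Definable predicates and terms\<close>

context o_minimal_field
begin

text \<open>\<open>dp\<close> stands for definable predicates and \<open>dt\<close> for terms with
  definable graph. With closure rules for connectives, quantifiers and arithmetic, definability of a
  set follows from the shape of a first-order description.\<close>

definition dp :: "nat => ((nat => real) => bool) => bool" where
 "dp n P \<longleftrightarrow> {x \<in> Rn n. P x} \<in> Df n"

definition dt :: "nat => ((nat => real) => real) => bool" where
 "dt n t \<longleftrightarrow> dp (Suc n) (\<lambda>z. z n = t (trunc n z))"

lemma dp_cong: "(\<And>x. x \<in> Rn n ==> P x = Q x) ==> dp n P = dp n Q"
 unfolding dp_def by (metis (no_types, lifting) Collect_cong)

lemma dp_iffI: "dp n P ==> (\<And>x. x \<in> Rn n ==> P x \<longleftrightarrow> Q x) ==> dp n Q"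
 using dp_cong[of n P Q] by simp

lemma dt_cong: "(\<And>x. x \<in> Rn n ==> t x = u x) ==> dt n t = dt n u"
 unfolding dt_def by (rule dp_cong) (simp add: trunc_Rn)

lemma Rn_Df: "Rn n \<in> Df n"
 using complement[OF empty] by simp

lemma dp_not: "dp n P ==> dp n (\<lambda>x. \<not> P x)"
proof -
 have "{x \<in> Rn n. \<not> P x} = Rn n - {x \<in> Rn n. P x}" by blast
 then show "dp n P ==> dp n (\<lambda>x. \<not> P x)" unfolding dp_def using complement by simp
qed

lemma dp_or: "dp n P ==> dp n Q ==> dp n (\<lambda>x. P x \<or> Q x)"
proof -
 have "{x \<in> Rn n. P x \<or> Q x} = {x \<in> Rn n. P x} \<union> {x \<in> Rn n. Q x}" by blast
 then show "dp n P ==> dp n Q ==> dp n (\<lambda>x. P x \<or> Q x)" unfolding dp_def using union by simp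
qed

lemma dp_and: "dp n P ==> dp n Q ==> dp n (\<lambda>x. P x \<and> Q x)"
 using dp_not[OF dp_or[OF dp_not dp_not], of n P Q] by simp

lemma dp_imp: "dp n P ==> dp n Q ==> dp n (\<lambda>x. P x --> Q x)"
proof -
 assume "dp n P" "dp n Q"
 then have "dp n (\<lambda>x. \<not> P x \<or> Q x)" by (intro dp_or dp_not)
 then show ?thesis by (simp only: imp_conv_disj)
qed

lemma dp_const: "dp n (\<lambda>_. c)"
 by (cases c) (simp_all add: dp_def Rn_Df empty)

lemma dp_ball_finite: "finite I ==> (\<And>i. i \<in> I ==> dp n (P i)) ==> dp n (\<lambda>x. \<forall>i\<in>I. P i x)"
 by (induction I rule: finite_induct) (auto intro: dp_const dp_and)

lemma dp_all_less: "(\<And>i. i < (k::nat) ==> dp n (P i)) ==> dp n (\<lambda>x. \<forall>i<k. P i x)"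
proof -
 assume "\<And>i. i < k ==> dp n (P i)"
 then have "dp n (\<lambda>x. \<forall>i\<in>{..<k}. P i x)" using dp_ball_finite[of "{..<k}" n P] by simp
 then show ?thesis by (simp only: Ball_def lessThan_iff)
qed

lemma cylinder:
 assumes A: "A \<in> Df k" and "k \<le> n"
 shows "{x \<in> Rn n. trunc k x \<in> A} \<in> Df n"
 using assms(2)
proof (induction n rule: dec_induct)
 case base
 have "{x \<in> Rn k. trunc k x \<in> A} = A" using subset[OF A] by (auto simp: trunc_id)
 then show ?case using A by simp
next
 case (step n)
 from times_R[OF step.IH]
 have "{x \<in> Rn (Suc n). trunc n x \<in> {x \<in> Rn n. trunc k x \<in> A}} \<in> Df (Suc n)" .
 then show ?case using step.hyps by (simp add: trunc_Rn trunc_trunc)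
qed

lemma shift_Df: "A \<in> Df k ==> {x \<in> Rn (n + k). (\<lambda>i. x (n + i)) \<in> A} \<in> Df (n + k)"
proof (induction n)
 case 0
 have "{x \<in> Rn k. x \<in> A} = A" using subset[OF 0] by blast
 then show ?case using 0 by simp
next
 case (Suc n)
 have "{x \<in> Rn (Suc (n + k)). (\<lambda>i. x (Suc i)) \<in> {x \<in> Rn (n + k). (\<lambda>i. x (n + i)) \<in> A}} \<in> Df (Suc (n + k))"
  by (rule R_times[OF Suc.IH[OF Suc.prems]])
 moreover have "{x \<in> Rn (Suc (n + k)). (\<lambda>i. x (Suc i)) \<in> {x \<in> Rn (n + k). (\<lambda>i. x (n + i)) \<in> A}} =
   {x \<in> Rn (Suc n + k). (\<lambda>i. x (Suc n + i)) \<in> A}"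
  by (auto simp: mem_Rn)
 ultimately show ?case by simp
qed

lemma projection_n: "A \<in> Df (n + k) ==> trunc n ` A \<in> Df n"
proof (induction k arbitrary: A)
 case 0
 have "trunc n ` A = A" using subset[OF 0] by (force simp: trunc_id)
 then show ?case using 0 by simp
next
 case (Suc k)
 have "trunc (n + k) ` A \<in> Df (n + k)" using projection[of A "n + k"] Suc.prems by simp
 from Suc.IH[OF this] show ?case by (simp add: image_image trunc_trunc)
qed

text \<open>Existential quantification is projection, with the witness in the last \<open>k\<close>
  coordinates. In the premise \<open>trunc n z\<close> stands for the parameters and the shifted
  vector for the witness; all quantifier rules share this form.\<close>

lemma dp_ex_vec:
 assumes "dp (n + k) (\<lambda>z. P (trunc n z) (\<lambda>i. z (n + i)))"
 shows "dp n (\<lambda>x. \<exists>v\<in>Rn k. P x v)"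
proof -
 have "{x \<in> Rn n. \<exists>v\<in>Rn k. P x v} = trunc n ` {z \<in> Rn (n + k). P (trunc n z) (\<lambda>i. z (n + i))}"
 proof (intro equalityI subsetI)
  fix x assume "x \<in> {x \<in> Rn n. \<exists>v\<in>Rn k. P x v}"
  then obtain v where "x \<in> Rn n" "v \<in> Rn k" "P x v" by blast
  then show "x \<in> trunc n ` {z \<in> Rn (n + k). P (trunc n z) (\<lambda>i. z (n + i))}"
   by (intro image_eqI[of _ _ "append_vec n x v"]) (auto simp: trunc_append shift_append append_vec_Rn)
 qed (auto simp: trunc_Rn dest: shift_Rn)
 then show ?thesis using assms projection_n unfolding dp_def by metis
qed

lemma dp_all_vec:
 assumes "dp (n + k) (\<lambda>z. P (trunc n z) (\<lambda>i. z (n + i)))"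
 shows "dp n (\<lambda>x. \<forall>v\<in>Rn k. P x v)"
proof -
 have "dp n (\<lambda>x. \<exists>v\<in>Rn k. \<not> P x v)" by (rule dp_ex_vec) (rule dp_not[OF assms])
 from dp_not[OF this] show ?thesis by simp
qed

lemma dp_ex:
 assumes "dp (Suc n) (\<lambda>z. P (trunc n z) (z n))"
 shows "dp n (\<lambda>x. \<exists>t. P x t)"
proof -
 have "dp n (\<lambda>x. \<exists>v\<in>Rn 1. P x (v 0))"
  by (rule dp_ex_vec) (use assms in simp)
 moreover have "(\<exists>v\<in>Rn 1. P x (v 0)) \<longleftrightarrow> (\<exists>t. P x t)" for x
 proof
  assume "\<exists>t. P x t"
  then obtain t where "P x t" by blast
  then show "\<exists>v\<in>Rn 1. P x (v 0)" by (intro bexI[of _ "\<lambda>i. if i = 0 then t else 0"]) (auto simp: mem_Rn)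
 qed blast
 ultimately show ?thesis by simp
qed

lemma dp_all:
 assumes "dp (Suc n) (\<lambda>z. P (trunc n z) (z n))"
 shows "dp n (\<lambda>x. \<forall>t. P x t)"
proof -
 have "dp n (\<lambda>x. \<exists>t. \<not> P x t)" by (rule dp_ex) (rule dp_not[OF assms])
 from dp_not[OF this] show ?thesis by simp
qed

lemma dp_diag: "dp n (\<lambda>z. z i = z j)" if "i < n" "j < n"
 using diagonal[OF that] by (simp add: dp_def)

lemma dp_weaken: "dp n P ==> n \<le> N ==> dp N (\<lambda>z. P (trunc n z))"
 unfolding dp_def using cylinder[of "{x \<in> Rn n. P x}" n N] by (simp add: trunc_Rn)

lemma dp_shift: "dp k P ==> dp (n + k) (\<lambda>z. P (\<lambda>i. z (n + i)))"
proof -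
 assume "dp k P"
 then have "{x \<in> Rn (n + k). (\<lambda>i. x (n + i)) \<in> {x \<in> Rn k. P x}} \<in> Df (n + k)"
  unfolding dp_def by (rule shift_Df)
 moreover have "{x \<in> Rn (n + k). (\<lambda>i. x (n + i)) \<in> {x \<in> Rn k. P x}} = {x \<in> Rn (n + k). P (\<lambda>i. x (n + i))}"
  using shift_Rn by blast
 ultimately show ?thesis by (simp add: dp_def)
qed

text \<open>Reindexing of variables, repetitions included: fresh variables are tied to the chosen
  coordinates by diagonals and then quantified away.\<close>

lemma dp_subst:
 assumes P: "dp k P" and \<sigma>: "\<And>i. i < k ==> \<sigma> i < n"
 shows "dp n (\<lambda>x. P (\<lambda>i. if i < k then x (\<sigma> i) else 0))"
proof -
 have "dp (n + k) (\<lambda>z. (\<forall>i<k. z (n + i) = z (\<sigma> i)) \<and> P (\<lambda>i. z (n + i)))"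
  using \<sigma> by (intro dp_and dp_all_less dp_diag dp_shift[OF P]) (auto simp: trans_less_add1)
 then have *: "dp (n + k) (\<lambda>z. (\<forall>i<k. z (n + i) = trunc n z (\<sigma> i)) \<and> P (\<lambda>i. z (n + i)))"
  by (rule dp_iffI) (use \<sigma> in \<open>simp add: trunc_def\<close>)
 have "dp n (\<lambda>x. \<exists>v\<in>Rn k. (\<forall>i<k. v i = x (\<sigma> i)) \<and> P v)" by (rule dp_ex_vec[OF *])
 moreover have "(\<exists>v\<in>Rn k. (\<forall>i<k. v i = x (\<sigma> i)) \<and> P v) \<longleftrightarrow> P (\<lambda>i. if i < k then x (\<sigma> i) else 0)" for x
 proof
  assume "\<exists>v\<in>Rn k. (\<forall>i<k. v i = x (\<sigma> i)) \<and> P v"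
  then obtain v where v: "v \<in> Rn k" "\<forall>i<k. v i = x (\<sigma> i)" "P v" by blast
  then have "v = (\<lambda>i. if i < k then x (\<sigma> i) else 0)" by (auto simp: mem_Rn fun_eq_iff)
  then show "P (\<lambda>i. if i < k then x (\<sigma> i) else 0)" using v(3) by simp
 next
  assume "P (\<lambda>i. if i < k then x (\<sigma> i) else 0)"
  then show "\<exists>v\<in>Rn k. (\<forall>i<k. v i = x (\<sigma> i)) \<and> P v"
   by (intro bexI[of _ "\<lambda>i. if i < k then x (\<sigma> i) else 0"]) (auto simp: mem_Rn)
 qed
 ultimately show ?thesis by simp
qed

text \<open>Moves the value of a graph from the position after the arguments to an arbitrary
  coordinate \<open>j\<close>, with further parameters allowed.\<close>

lemma dt_at:
 assumes "dt n t" "n \<le> N" "j < N"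
 shows "dp N (\<lambda>z. z j = t (trunc n z))"
proof (cases "n < N")
 case True
 have "dp N (\<lambda>x. (\<lambda>z. z n = t (trunc n z)) (\<lambda>i. if i < Suc n then x (if i < n then i else j) else 0))"
  by (rule dp_subst[OF assms(1)[unfolded dt_def]]) (use assms True in auto)
 moreover have "trunc n (\<lambda>i. if i < Suc n then x (if i < n then i else j) else 0) = trunc n x" for x :: "nat => real"
  by (auto simp: trunc_def fun_eq_iff)
 ultimately show ?thesis by simp
next
 case False
 then have nN: "n = N" using assms by simp
 \<comment> \<open>For \<open>n = N\<close> the coordinate \<open>j\<close> is itself one of the
   arguments. The graph is taken with a fresh last coordinate, which is set equal to
   \<open>z j\<close> and quantified away.\<close>
 have "dp (Suc N) (\<lambda>z. z N = z j \<and> z N = t (trunc N z))"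
  using assms(1) assms(3) by (intro dp_and dp_diag) (auto simp: dt_def nN)
 then have "dp (Suc N) (\<lambda>z. z N = trunc N z j \<and> z N = t (trunc N z))"
  by (rule dp_iffI) (use assms(3) in \<open>simp add: trunc_def\<close>)
 then have "dp N (\<lambda>x. \<exists>s. s = x j \<and> s = t x)" by (rule dp_ex)
 then have "dp N (\<lambda>x. x j = t x)" by (rule dp_iffI) auto
 then show ?thesis
  by (subst dp_cong[where Q = "\<lambda>x. x j = t x"]) (simp_all add: nN trunc_id)
qed

lemma dt_weaken: "dt n t ==> n \<le> N ==> dt N (\<lambda>z. t (trunc n z))"
 unfolding dt_def[of N] using dt_at[of n t "Suc N" N] by (simp add: trunc_trunc)

lemma dp_mem:
 assumes A: "A \<in> Df k" and F: "\<And>i. i < k ==> dt n (\<lambda>x. F x i)" and R: "\<And>x. x \<in> Rn n ==> F x \<in> Rn k"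
 shows "dp n (\<lambda>x. F x \<in> A)"
proof -
 have A': "dp k (\<lambda>x. x \<in> A)"
  unfolding dp_def using A subset[OF A] by (metis (no_types, lifting) Collect_cong Collect_mem_eq subsetD)
 have *: "dp (n + k) (\<lambda>z. (\<forall>i<k. z (n + i) = F (trunc n z) i) \<and> (\<lambda>i. z (n + i)) \<in> A)"
  by (intro dp_and dp_all_less dp_shift[OF A'] dt_at F) auto
 have "dp n (\<lambda>x. \<exists>v\<in>Rn k. (\<forall>i<k. v i = F x i) \<and> v \<in> A)" by (rule dp_ex_vec[OF *])
 moreover have "(\<exists>v\<in>Rn k. (\<forall>i<k. v i = F x i) \<and> v \<in> A) \<longleftrightarrow> F x \<in> A" if x: "x \<in> Rn n" for x
 proof
  assume "\<exists>v\<in>Rn k. (\<forall>i<k. v i = F x i) \<and> v \<in> A"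
  then obtain v where v: "v \<in> Rn k" "\<forall>i<k. v i = F x i" "v \<in> A" by blast
  then have "v = F x" using R[OF x] by (auto simp: mem_Rn fun_eq_iff) (metis linorder_not_less)
  then show "F x \<in> A" using v by simp
 qed (use R[OF x] in auto)
 ultimately show ?thesis by (subst dp_cong) (auto)
qed

text \<open>Definability is with parameters: a singleton is an interval.\<close>

lemma dt_const: "dt n (\<lambda>_. c)"
proof -
 have "is_interval {c}" by (simp add: is_interval_1)
 then have "(finite union_of is_interval) {c}" by (intro union_of_inc) auto
 then have "dp 1 (\<lambda>x. x 0 = c)"
  unfolding dp_def one_dim by (auto intro!: exI[of _ "{c}"])
 then have "dp (Suc n) (\<lambda>x. (\<lambda>y. y (0::nat) = c) (\<lambda>i. if i < 1 then x ((\<lambda>_. n) i) else 0))"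
  by (rule dp_subst[where \<sigma> = "\<lambda>_. n" and P = "\<lambda>y. y 0 = c"]) simp
 then show ?thesis by (simp add: dt_def)
qed

lemma dt_coord: "dt n (\<lambda>z. z i)"
proof (cases "i < n")
 case True
 have "dp (Suc n) (\<lambda>z. z n = z i)" using True by (intro dp_diag) auto
 then show ?thesis using True by (simp add: dt_def trunc_def)
next
 case False
 have "dt n (\<lambda>z. z i) = dt n (\<lambda>z. 0)" by (rule dt_cong) (use False in \<open>simp add: mem_Rn\<close>)
 then show ?thesis by (simp add: dt_const)
qed

lemma dt_trunc: "dt n (\<lambda>z. F z i) ==> dt n (\<lambda>z. trunc a (F z) i)"
 by (cases "i < a") (simp_all add: trunc_def dt_const)

lemma dt_append: "(\<And>i. dt n (\<lambda>z. F z i)) ==> (\<And>i. dt n (\<lambda>z. G z i)) ==> dt n (\<lambda>z. append_vec a (F z) (G z) i)"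
 by (cases "i < a") (simp_all add: append_vec_def)

definition vec3 :: "real => real => real => nat => real" where
 "vec3 a b c = (\<lambda>i. if i = 0 then a else if i = 1 then b else if i = 2 then c else 0)"

lemma vec3_simps: "vec3 a b c 0 = a" "vec3 a b c (Suc 0) = b" "vec3 a b c 1 = b" "vec3 a b c 2 = c"
 "vec3 a b c \<in> Rn 3" "vec3 a b 0 \<in> Rn 2"
 by (auto simp: vec3_def mem_Rn)

lemma dt_vec3: "dt n t ==> dt n u ==> dt n w ==> dt n (\<lambda>x. vec3 (t x) (u x) (w x) i)"
 by (cases "i = 0"; cases "i = 1"; cases "i = 2") (simp_all add: vec3_def dt_const)

lemma dp_less: "dt n t ==> dt n u ==> dp n (\<lambda>x. t x < u x)"
proof -
 assume "dt n t" "dt n u"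
 then have "dp n (\<lambda>x. vec3 (t x) (u x) 0 \<in> {x \<in> Rn 2. x 0 < x 1})"
  by (intro dp_mem[OF less] dt_vec3 dt_const vec3_simps)
 then show ?thesis by (simp add: vec3_simps)
qed

lemma dp_eq: "dt n t ==> dt n u ==> dp n (\<lambda>x. t x = u x)"
proof -
 assume a: "dt n t" "dt n u"
 have "dp n (\<lambda>x. \<not> t x < u x \<and> \<not> u x < t x)"
  by (intro dp_and dp_not dp_less a)
 moreover have "(\<not> t x < u x \<and> \<not> u x < t x) \<longleftrightarrow> t x = u x" for x by auto
 ultimately show ?thesis by simp
qed

lemma dp_le: "dt n t ==> dt n u ==> dp n (\<lambda>x. t x \<le> u x)"
 using dp_not[OF dp_less[of n u t]] by (simp add: not_less)

lemma dt_add: "dt n t ==> dt n u ==> dt n (\<lambda>x. t x + u x)"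
proof -
 assume "dt n t" "dt n u"
 then have "dp (Suc n) (\<lambda>z. vec3 (t (trunc n z)) (u (trunc n z)) (z n) \<in> {x \<in> Rn 3. x 0 + x 1 = x 2})"
  by (intro dp_mem[OF add] dt_vec3 dt_weaken dt_coord vec3_simps) auto
 then show ?thesis by (simp add: vec3_simps dt_def eq_commute)
qed

lemma dt_mult: "dt n t ==> dt n u ==> dt n (\<lambda>x. t x * u x)"
proof -
 assume "dt n t" "dt n u"
 then have "dp (Suc n) (\<lambda>z. vec3 (t (trunc n z)) (u (trunc n z)) (z n) \<in> {x \<in> Rn 3. x 0 * x 1 = x 2})"
  by (intro dp_mem[OF mult] dt_vec3 dt_weaken dt_coord vec3_simps) auto
 then show ?thesis by (simp add: vec3_simps dt_def eq_commute)
qed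

lemma dt_uminus: "dt n t ==> dt n (\<lambda>x. - t x)"
 using dt_mult[OF dt_const[of n "-1"]] by simp

lemma dt_diff: "dt n t ==> dt n u ==> dt n (\<lambda>x. t x - u x)"
 using dt_add[OF _ dt_uminus, of n t u] by simp

lemma dt_power: "dt n t ==> dt n (\<lambda>x. t x ^ k)"
 by (induction k) (auto intro: dt_const dt_mult)

lemma dt_sum: "(\<And>i. i \<in> I ==> dt n (t i)) ==> dt n (\<lambda>x. \<Sum>i\<in>I. t i x)"
 by (induction I rule: infinite_finite_induct) (auto intro: dt_const dt_add)

lemma dt_ip: "(\<And>i. dt n (\<lambda>x. F x i)) ==> (\<And>i. dt n (\<lambda>x. G x i)) ==> dt n (\<lambda>x. ip k (F x) (G x))"
 unfolding ip_def by (intro dt_sum dt_mult)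

lemma dt_if: "dp n P ==> dt n t ==> dt n u ==> dt n (\<lambda>x. if P x then t x else u x)"
proof -
 assume a: "dp n P" "dt n t" "dt n u"
 have "dp (Suc n) (\<lambda>z. (P (trunc n z) \<and> z n = t (trunc n z)) \<or> (\<not> P (trunc n z) \<and> z n = u (trunc n z)))"
  using a by (intro dp_or dp_and dp_not dp_weaken[of n P] dt_at) auto
 then show ?thesis unfolding dt_def by (rule dp_iffI) auto
qed

lemma dt_abs: "dt n t ==> dt n (\<lambda>x. \<bar>t x\<bar>)"
 unfolding abs_if by (intro dt_if dp_less dt_const dt_uminus)

lemma dt_inverse: "dt n t ==> dt n (\<lambda>x. inverse (t x))"
proof -
 assume a: "dt n t"
 \<comment> \<open>The first disjunct records the convention \<open>inverse 0 = 0\<close>.\<close>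
 have "dp (Suc n) (\<lambda>z. (t (trunc n z) = 0 \<and> z n = 0) \<or> t (trunc n z) * z n = 1)"
  by (intro dp_or dp_and dp_eq dt_mult dt_const dt_coord dt_weaken[OF a]) auto
 then show ?thesis unfolding dt_def
 proof (rule dp_iffI)
  fix z
  show "(t (trunc n z) = 0 \<and> z n = 0) \<or> t (trunc n z) * z n = 1 \<longleftrightarrow> z n = inverse (t (trunc n z))"
   by (cases "t (trunc n z) = 0") (auto simp: field_simps)
 qed
qed

lemma dt_divide: "dt n t ==> dt n u ==> dt n (\<lambda>x. t x / u x)"
 unfolding divide_inverse by (intro dt_mult dt_inverse)

lemmas dt_intros = dt_const dt_coord dt_trunc dt_append dt_add dt_mult dt_uminus dt_diff dt_power dt_sum
 dt_ip dt_abs dt_inverse dt_divide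

lemmas dp_intros = dp_const dp_and dp_or dp_not dp_imp dp_less dp_le dp_eq dp_all_less

lemma dp_DfI:
 assumes "dp n P" "\<And>x. x \<in> A \<longleftrightarrow> x \<in> Rn n \<and> P x"
 shows "A \<in> Df n"
proof -
 have "A = {x \<in> Rn n. P x}" using assms(2) by blast
 then show ?thesis using assms(1) by (simp add: dp_def)
qed

lemma dp_bex:
 assumes "A \<in> Df k" "dp (n + k) (\<lambda>z. P (trunc n z) (\<lambda>i. z (n + i)))"
 shows "dp n (\<lambda>x. \<exists>v\<in>A. P x v)"
proof -
 have *: "dp (n + k) (\<lambda>z. (\<lambda>i. z (n + i)) \<in> A \<and> P (trunc n z) (\<lambda>i. z (n + i)))"
  by (intro dp_and assms(2) dp_mem[OF assms(1)] dt_coord shift_Rn)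
 have "dp n (\<lambda>x. \<exists>v\<in>Rn k. v \<in> A \<and> P x v)" by (rule dp_ex_vec[OF *])
 then show ?thesis by (rule dp_iffI) (use subset[OF assms(1)] in blast)
qed

lemma dp_ball:
 assumes "A \<in> Df k" "dp (n + k) (\<lambda>z. P (trunc n z) (\<lambda>i. z (n + i)))"
 shows "dp n (\<lambda>x. \<forall>v\<in>A. P x v)"
proof -
 have "dp n (\<lambda>x. \<exists>v\<in>A. \<not> P x v)" by (rule dp_bex[OF assms(1)]) (rule dp_not[OF assms(2)])
 from dp_not[OF this] show ?thesis by simp
qed

section \<open>Definable tangent bundles and definable maps\<close>

definition tangent_bundle :: "nat => (nat => real) set => (nat => real) set" where
 "tangent_bundle n M = {z \<in> Rn (n + n). trunc n z \<in> M \<and> (\<lambda>i. z (n + i)) \<in> tangent_space M (trunc n z)}"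

lemma tangent_bundle_Df:
 assumes D: "M \<in> Df n" and M: "submanifold n p d M" "1 \<le> p"
 shows "tangent_bundle n M \<in> Df (n + n)"
proof -
 have "dp (n + n) (\<lambda>z. trunc n z \<in> M \<and> (\<forall>\<epsilon>. \<epsilon> > 0 --> (\<exists>t. 0 < t \<and> t < \<epsilon> \<and>
   (\<exists>x\<in>M. \<forall>i<n. \<bar>x i - trunc n z i - t * z (n + i)\<bar> \<le> \<epsilon> * t))))"
  by (intro dp_and dp_mem[OF D] dp_all dp_ex dp_bex[OF D] dp_intros dt_intros trunc_Rn)
 then show ?thesis
 proof (rule dp_DfI)
  fix z show "z \<in> tangent_bundle n M \<longleftrightarrow> z \<in> Rn (n + n) \<and> (trunc n z \<in> M \<and> (\<forall>\<epsilon>. \<epsilon> > 0 --> (\<exists>t. 0 < t \<and> t < \<epsilon> \<and>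
   (\<exists>x\<in>M. \<forall>i<n. \<bar>x i - trunc n z i - t * z (n + i)\<bar> \<le> \<epsilon> * t))))"
   using tangent_space_contingent[OF M, of "trunc n z" "\<lambda>i. z (n + i)"] shift_Rn[of z n n]
   unfolding tangent_bundle_def by blast
 qed
qed

text \<open>The conjunct \<open>F x \<in> M\<close> stays in the formula because the contingent
  description identifies the tangent space at points of \<open>M\<close> only.\<close>

lemma dp_tangent:
 assumes D: "M \<in> Df n" and M: "submanifold n p d M" "1 \<le> p"
  and F: "\<And>i. dt N (\<lambda>x. F x i)" "\<And>x. x \<in> Rn N ==> F x \<in> Rn n"
  and G: "\<And>i. dt N (\<lambda>x. G x i)" "\<And>x. x \<in> Rn N ==> G x \<in> Rn n"
 shows "dp N (\<lambda>x. F x \<in> M \<and> G x \<in> tangent_space M (F x))"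
proof -
 have "dp N (\<lambda>x. append_vec n (F x) (G x) \<in> tangent_bundle n M)"
  by (intro dp_mem[OF tangent_bundle_Df[OF D M]] dt_intros F G append_vec_Rn)
 then show ?thesis
  by (subst (asm) dp_cong[where Q = "\<lambda>x. F x \<in> M \<and> G x \<in> tangent_space M (F x)"])
    (auto simp: tangent_bundle_def trunc_append shift_append append_vec_Rn F(2) G(2))
qed

lemma definable_mapI:
 assumes A: "A \<in> Df m" and F: "F \<in> A \<rightarrow> Rn n"
  and P: "dp (m + n) (\<lambda>z. trunc m z \<in> A \<and> Q (trunc m z) (\<lambda>i. z (m + i)))"
  and Q: "\<And>x y. x \<in> A ==> y \<in> Rn n ==> Q x y \<longleftrightarrow> y = F x"
 shows "definable_map Df m n A F"
 unfolding definable_map_def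
proof (intro conjI A F)
 show "{append_vec m x (F x) |x. x \<in> A} \<in> Df (m + n)"
  using P
 proof (rule dp_DfI)
  fix z show "z \<in> {append_vec m x (F x) |x. x \<in> A} \<longleftrightarrow>
    z \<in> Rn (m + n) \<and> (trunc m z \<in> A \<and> Q (trunc m z) (\<lambda>i. z (m + i)))"
  proof
   assume "z \<in> {append_vec m x (F x) |x. x \<in> A}"
   then obtain x where x: "x \<in> A" "z = append_vec m x (F x)" by blast
   moreover have "x \<in> Rn m" "F x \<in> Rn n" using x(1) F subset[OF A] by auto
   ultimately show "z \<in> Rn (m + n) \<and> (trunc m z \<in> A \<and> Q (trunc m z) (\<lambda>i. z (m + i)))"
    using Q by (simp add: trunc_append shift_append append_vec_Rn)
  next
   assume z: "z \<in> Rn (m + n) \<and> (trunc m z \<in> A \<and> Q (trunc m z) (\<lambda>i. z (m + i)))"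
   then have "(\<lambda>i. z (m + i)) = F (trunc m z)" using Q shift_Rn by blast
   then have "z = append_vec m (trunc m z) (F (trunc m z))" using append_trunc_shift[of m z] by metis
   then show "z \<in> {append_vec m x (F x) |x. x \<in> A}" using z by blast
  qed
 qed
qed

lemma definable_map_graph:
 assumes f: "definable_map Df m n A f"
  and F: "\<And>i. dt N (\<lambda>x. F x i)" "\<And>x. x \<in> Rn N ==> F x \<in> Rn m"
  and G: "\<And>i. dt N (\<lambda>x. G x i)" "\<And>x. x \<in> Rn N ==> G x \<in> Rn n"
 shows "dp N (\<lambda>x. F x \<in> A \<and> G x = f (F x))"
proof -
 have D: "{append_vec m x (f x) |x. x \<in> A} \<in> Df (m + n)" and A: "A \<subseteq> Rn m"
  using f subset[of A m] by (auto simp: definable_map_def)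
 have "dp N (\<lambda>x. append_vec m (F x) (G x) \<in> {append_vec m x (f x) |x. x \<in> A})"
  by (intro dp_mem[OF D] dt_intros F G append_vec_Rn)
 moreover have "append_vec m (F x) (G x) \<in> {append_vec m x (f x) |x. x \<in> A} \<longleftrightarrow> F x \<in> A \<and> G x = f (F x)"
  if x: "x \<in> Rn N" for x
 proof
  assume "append_vec m (F x) (G x) \<in> {append_vec m x (f x) |x. x \<in> A}"
  then obtain y where y: "y \<in> A" "append_vec m (F x) (G x) = append_vec m y (f y)" by blast
  have "F x = y" using arg_cong[OF y(2), of "trunc m"] F(2)[OF x] A y(1) by (simp add: trunc_append subsetD)
  moreover have "G x = f y" using arg_cong[OF y(2), of "\<lambda>z i. z (m + i)"] by (simp add: shift_append)
  ultimately show "F x \<in> A \<and> G x = f (F x)" using y(1) by simp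
 qed auto
 ultimately show ?thesis by (subst (asm) dp_cong) auto
qed

lemma definable_map_compose:
 assumes f: "definable_map Df m n A f" and g: "definable_map Df n k B g" and "f \<in> A \<rightarrow> B"
 shows "definable_map Df m k A (\<lambda>x. g (f x))"
proof (rule definable_mapI)
 show A: "A \<in> Df m" using f by (simp add: definable_map_def)
 show "(\<lambda>x. g (f x)) \<in> A \<rightarrow> Rn k" using g assms(3) by (auto simp: definable_map_def)
 have fR: "f \<in> A \<rightarrow> Rn n" using f by (simp add: definable_map_def)
 have "dp (m + k) (\<lambda>z. trunc m z \<in> A \<and> (\<exists>y\<in>Rn n. (trunc m z \<in> A \<and> y = f (trunc m z)) \<and> (y \<in> B \<and> (\<lambda>i. z (m + i)) = g y)))"
 proof (rule dp_and[OF dp_mem[OF A]], rule dt_trunc, rule dt_coord, rule trunc_Rn, rule dp_ex_vec, rule dp_and)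
  show "dp (m + k + n) (\<lambda>z. trunc m (trunc (m + k) z) \<in> A \<and> (\<lambda>i. z (m + k + i)) = f (trunc m (trunc (m + k) z)))"
   by (rule definable_map_graph[OF f]) (auto intro!: dt_intros trunc_Rn shift_Rn)
  show "dp (m + k + n) (\<lambda>z. (\<lambda>i. z (m + k + i)) \<in> B \<and> (\<lambda>i. trunc (m + k) z (m + i)) = g (\<lambda>i. z (m + k + i)))"
   by (rule definable_map_graph[OF g]) (auto intro!: dt_intros trunc_Rn shift_Rn)
 qed
 then show "dp (m + k) (\<lambda>z. trunc m z \<in> A \<and> (\<lambda>x w. \<exists>y\<in>Rn n. (x \<in> A \<and> y = f x) \<and> (y \<in> B \<and> w = g y)) (trunc m z) (\<lambda>i. z (m + i)))"
  by simp
qed (use assms(3) \<open>definable_map Df m n A f\<close> in \<open>auto simp: definable_map_def\<close>)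

lemma definable_map_terms:
 assumes A: "A \<in> Df m" and F: "F \<in> A \<rightarrow> Rn n" and t: "\<And>i. i < n ==> dt m (t i)"
  and eq: "\<And>x i. x \<in> A ==> i < n ==> F x i = t i x"
 shows "definable_map Df m n A F"
proof (rule definable_mapI[OF A F])
 show "dp (m + n) (\<lambda>z. trunc m z \<in> A \<and> (\<lambda>x y. \<forall>i<n. y i = t i x) (trunc m z) (\<lambda>i. z (m + i)))"
  by (intro dp_intros dp_mem[OF A] dt_at t dt_intros trunc_Rn) auto
 fix x y assume "x \<in> A" "y \<in> Rn n"
 then show "(\<forall>i<n. y i = t i x) \<longleftrightarrow> y = F x"
  using eq F by (auto simp: fun_eq_iff mem_Rn Pi_iff) (metis linorder_not_less)
qed

end

context smooth_exp_o_minimal_field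
begin

lemma dt_exp: "dt n t ==> dt n (\<lambda>x. exp (t x))"
proof -
 assume "dt n t"
 then have "dp (Suc n) (\<lambda>z. vec3 (t (trunc n z)) (z n) 0 \<in> {x \<in> Rn 2. x 1 = exp (x 0)})"
  by (intro dp_mem[OF exponential] dt_vec3 dt_coord dt_const vec3_simps dt_weaken) auto
 then show ?thesis unfolding dt_def by (rule dp_iffI) (simp only: mem_Collect_eq vec3_simps simp_thms)
qed

end

section \<open>The implicit function theorem\<close>

text \<open>The sum norm, and the coordinate boxes \<open>bx\<close>, fit the mean value theorem,
  which works one coordinate at a time.\<close>

definition l1 :: "nat => (nat => real) => real" where
 "l1 n x = (\<Sum>i<n. \<bar>x i\<bar>)"

definition bx :: "nat => (nat => real) => real => (nat => real) set" where
 "bx n p e = {x \<in> Rn n. \<forall>i<n. \<bar>x i - p i\<bar> < e}"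

lemma l1_nonneg: "0 \<le> l1 n x"
 by (simp add: l1_def sum_nonneg)

lemma coord_le_l1: "i < n ==> \<bar>x i\<bar> \<le> l1 n x"
 unfolding l1_def by (rule member_le_sum) auto

lemma l1_le_ip: "l1 n x \<le> real n * sqrt (ip n x x)"
proof -
 have "l1 n x \<le> (\<Sum>i<n. sqrt (ip n x x))"
  unfolding l1_def by (intro sum_mono abs_coord_le_ip) auto
 then show ?thesis by simp
qed

lemma bx_opn: "opn n (bx n p e)"
 unfolding opn_iff
proof (intro conjI ballI)
 fix x assume x: "x \<in> bx n p e"
 define d where "d = Min (insert 1 ((\<lambda>i. e - \<bar>x i - p i\<bar>) ` {..<n}))"
 have d: "d > 0" "\<And>i. i < n ==> d \<le> e - \<bar>x i - p i\<bar>"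
  unfolding d_def using x by (auto simp: bx_def)
 have "y \<in> bx n p e" if "y \<in> Rn n" "\<forall>i<n. \<bar>y i - x i\<bar> < d" for y
  unfolding bx_def using that d(2) by (auto, smt (verit, best))
 then show "\<exists>e'>0. \<forall>y\<in>Rn n. (\<forall>i<n. \<bar>y i - x i\<bar> < e') --> y \<in> bx n p e" using d(1) by blast
qed (auto simp: bx_def)

text \<open>\<open>nhds p\<close> belongs to the space of all sequences; cutting it down to
  \<open>Rn n\<close> leaves the neighborhoods of \<open>p\<close> in \<open>Rn n\<close>, for which
  the boxes form a base.\<close>

lemma eventually_nb:
 assumes "p \<in> Rn n"
 shows "eventually P (inf (nhds p) (principal (Rn n))) \<longleftrightarrow> (\<exists>e>0. \<forall>x\<in>bx n p e. P x)"
proof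
 assume "eventually P (inf (nhds p) (principal (Rn n)))"
 then obtain S where S: "open S" "p \<in> S" "\<And>x. x \<in> S ==> x \<in> Rn n ==> P x"
  unfolding eventually_inf_principal eventually_nhds by blast
 then have "opn n (Rn n \<inter> S)" unfolding openin_Euclidean_space_iff by blast
 then obtain e where "e > 0" "\<And>y. y \<in> Rn n ==> \<forall>i<n. \<bar>y i - p i\<bar> < e ==> y \<in> Rn n \<inter> S"
  unfolding opn_iff using S(2) assms by (metis IntI)
 then show "\<exists>e>0. \<forall>x\<in>bx n p e. P x" using S(3) by (auto simp: bx_def)
next
 assume "\<exists>e>0. \<forall>x\<in>bx n p e. P x"
 then obtain e where e: "e > 0" "\<And>x. x \<in> bx n p e ==> P x" by blast
 obtain T where T: "open T" "bx n p e = Rn n \<inter> T" using bx_opn openin_Euclidean_space_iff by metis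
 have "p \<in> bx n p e" using e(1) assms by (simp add: bx_def)
 then show "eventually P (inf (nhds p) (principal (Rn n)))"
  unfolding eventually_inf_principal eventually_nhds using T e(2) by blast
qed

lemma continuous_on_nb:
 assumes "opn n U" "continuous_on U g" "p \<in> U"
 shows "(g \<longlongrightarrow> g p) (inf (nhds p) (principal (Rn n)))"
proof (rule continuous_on_opn_tendsto[OF assms, of "\<lambda>x. x"])
 show "((\<lambda>x. x) \<longlongrightarrow> p) (inf (nhds p) (principal (Rn n)))"
  by (rule filterlim_ident[THEN filterlim_mono]) auto
qed (simp add: eventually_inf_principal)

lemma eventually_nb_in:
 assumes "opn n U" "p \<in> U"
 shows "\<forall>\<^sub>F x in inf (nhds p) (principal (Rn n)). x \<in> U"
 by (rule opn_eventually[OF assms])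
   (auto simp: eventually_inf_principal intro: filterlim_ident[THEN filterlim_mono])

lemma bx_hull:
 assumes "x \<in> bx n p e" "y \<in> bx n p e" "z \<in> Rn n" "\<forall>j<n. min (x j) (y j) \<le> z j \<and> z j \<le> max (x j) (y j)"
 shows "z \<in> bx n p e"
 unfolding bx_def
proof (intro CollectI conjI allI impI assms(3))
 fix i assume i: "i < n"
 then have "\<bar>x i - p i\<bar> < e" "\<bar>y i - p i\<bar> < e" using assms(1,2) by (auto simp: bx_def)
 then show "\<bar>z i - p i\<bar> < e" using assms(4) i by (smt (verit, best) max_def min_def)
qed

lemma mvt_bx:
 assumes U: "opn n U" and g: "Ck_open n (Suc 0) U g" and sub: "bx n p e \<subseteq> U"
  and x: "x \<in> bx n p e" and y: "y \<in> bx n p e"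
 obtains \<xi> where "\<And>i. i < n ==> \<xi> i \<in> bx n p e" "\<And>i j. i < n ==> j < n ==> \<bar>\<xi> i j - x j\<bar> \<le> \<bar>y j - x j\<bar>"
  "g y - g x = (\<Sum>i<n. pderiv_coord i g (\<xi> i) * (y i - x i))"
proof -
 have "\<exists>\<xi>. (\<forall>i<n. \<xi> i \<in> Rn n \<and> (\<forall>j<n. min (x j) (y j) \<le> \<xi> i j \<and> \<xi> i j \<le> max (x j) (y j))) \<and>
   g y - g x = (\<Sum>i<n. pderiv_coord i g (\<xi> i) * (y i - x i))"
 proof (rule telescoping_mvt)
  fix z i assume "z \<in> Rn n" "\<forall>j<n. min (x j) (y j) \<le> z j \<and> z j \<le> max (x j) (y j)" "i < n"
  then show "((\<lambda>t. g (z(i := t))) has_real_derivative pderiv_coord i g z) (at (z i))"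
   using Ck_open_1D(1)[OF g U] bx_hull[OF x y] sub by blast
 qed (use x y in \<open>auto simp: bx_def\<close>)
 then obtain \<xi> where \<xi>: "\<forall>i<n. \<xi> i \<in> Rn n \<and> (\<forall>j<n. min (x j) (y j) \<le> \<xi> i j \<and> \<xi> i j \<le> max (x j) (y j))"
   "g y - g x = (\<Sum>i<n. pderiv_coord i g (\<xi> i) * (y i - x i))" by blast
 show thesis
 proof (rule that[OF _ _ \<xi>(2)])
  show "\<xi> i \<in> bx n p e" if "i < n" for i using bx_hull[OF x y] \<xi>(1) that by blast
  fix i j assume "i < n" "j < n"
  then have "min (x j) (y j) \<le> \<xi> i j \<and> \<xi> i j \<le> max (x j) (y j)" using \<xi>(1) by blast
  then show "\<bar>\<xi> i j - x j\<bar> \<le> \<bar>y j - x j\<bar>" by (smt (verit, best) max_def min_def)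
 qed
qed

text \<open>By continuity the partial derivatives exceed their absolute values at \<open>p\<close>
  by at most 1 on some box, and the mean value theorem applies there; boxes contain the hulls of
  their points.\<close>

lemma loc_lip:
 assumes U: "opn n U" and g: "Ck_open n (Suc 0) U g" and p: "p \<in> U"
 obtains e C where "e > 0" "C \<ge> 0" "bx n p e \<subseteq> U"
  "\<And>x y. x \<in> bx n p e ==> y \<in> bx n p e ==> \<bar>g y - g x\<bar> \<le> C * l1 n (\<lambda>i. y i - x i)"
proof -
 let ?F = "inf (nhds p) (principal (Rn n))"
 have pR: "p \<in> Rn n" using p opn_subset[OF U] by auto
 have "\<forall>\<^sub>F z in ?F. \<bar>pderiv_coord i g z\<bar> \<le> \<bar>pderiv_coord i g p\<bar> + 1" if "i < n" for i
 proof -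
  have "\<forall>\<^sub>F z in ?F. dist (pderiv_coord i g z) (pderiv_coord i g p) < 1"
   using continuous_on_nb[OF U Ck_open_1D(2)[OF g U that] p] by (rule tendstoD) simp
  then show ?thesis by (rule eventually_mono) (auto simp: dist_real_def)
 qed
 then have "\<forall>\<^sub>F z in ?F. \<forall>i\<in>{..<n}. \<bar>pderiv_coord i g z\<bar> \<le> \<bar>pderiv_coord i g p\<bar> + 1"
  by (intro eventually_ball_finite) auto
 then have "\<forall>\<^sub>F z in ?F. z \<in> U \<and> (\<forall>i<n. \<bar>pderiv_coord i g z\<bar> \<le> \<bar>pderiv_coord i g p\<bar> + 1)"
  using eventually_nb_in[OF U p] by eventually_elim auto
 then obtain e where e: "e > 0" "\<And>z. z \<in> bx n p e ==> z \<in> U"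
   "\<And>z i. z \<in> bx n p e ==> i < n ==> \<bar>pderiv_coord i g z\<bar> \<le> \<bar>pderiv_coord i g p\<bar> + 1"
  unfolding eventually_nb[OF pR] by blast
 define C where "C = (\<Sum>i<n. \<bar>pderiv_coord i g p\<bar> + 1)"
 have Ci: "\<bar>pderiv_coord i g p\<bar> + 1 \<le> C" if "i < n" for i
  unfolding C_def by (rule member_le_sum[of i]) (use that in auto)
 have "\<bar>g y - g x\<bar> \<le> C * l1 n (\<lambda>i. y i - x i)" if xy: "x \<in> bx n p e" "y \<in> bx n p e" for x y
 proof -
  obtain \<xi> where \<xi>: "\<And>i. i < n ==> \<xi> i \<in> bx n p e"
   "g y - g x = (\<Sum>i<n. pderiv_coord i g (\<xi> i) * (y i - x i))"
   by (rule mvt_bx[OF U g _ xy]) (use e(2) in blast)+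
  have "\<bar>g y - g x\<bar> \<le> (\<Sum>i<n. \<bar>pderiv_coord i g (\<xi> i) * (y i - x i)\<bar>)" unfolding \<xi>(2) by (rule sum_abs)
  also have "\<dots> \<le> (\<Sum>i<n. C * \<bar>y i - x i\<bar>)"
  proof (rule sum_mono)
   fix i assume "i \<in> {..<n}"
   then have "\<bar>pderiv_coord i g (\<xi> i)\<bar> \<le> C" using e(3)[OF \<xi>(1)] Ci by force
   then show "\<bar>pderiv_coord i g (\<xi> i) * (y i - x i)\<bar> \<le> C * \<bar>y i - x i\<bar>"
    unfolding abs_mult by (rule mult_right_mono) simp
  qed
  finally show ?thesis by (simp add: l1_def sum_distrib_left)
 qed
 moreover have "C \<ge> 0" unfolding C_def by (intro sum_nonneg) auto
 ultimately show thesis using that[OF e(1)] e(2) by blast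
qed

lemma bx_mono: "e \<le> e' ==> bx n p e \<subseteq> bx n p e'"
 by (force simp: bx_def)

lemma loc_lip_family:
 assumes U: "opn n U" and "finite I" "\<And>k. k \<in> I ==> Ck_open n (Suc 0) U (g k)" and p: "p \<in> U"
 obtains e C where "e > 0" "C \<ge> 0" "bx n p e \<subseteq> U"
  "\<And>k x y. k \<in> I ==> x \<in> bx n p e ==> y \<in> bx n p e ==> \<bar>g k y - g k x\<bar> \<le> C * l1 n (\<lambda>i. y i - x i)"
 using assms(2,3)
proof (induction I arbitrary: thesis rule: finite_induct)
 case empty
 obtain e C where "e > 0" "bx n p e \<subseteq> U"
  by (rule loc_lip[OF U Ck_open_const[OF U, of "Suc 0" 0] p]) blast
 then show ?case using empty.prems(1)[of e 0] by simp
next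
 case (insert k I)
 obtain e C where e: "e > 0" "C \<ge> 0" "bx n p e \<subseteq> U"
  "\<And>k x y. k \<in> I ==> x \<in> bx n p e ==> y \<in> bx n p e ==> \<bar>g k y - g k x\<bar> \<le> C * l1 n (\<lambda>i. y i - x i)"
  by (rule insert.IH) (use insert.prems(2) in blast)+
 obtain e' C' where e': "e' > 0" "C' \<ge> 0"
  "\<And>x y. x \<in> bx n p e' ==> y \<in> bx n p e' ==> \<bar>g k y - g k x\<bar> \<le> C' * l1 n (\<lambda>i. y i - x i)"
  by (rule loc_lip[OF U insert.prems(2)[OF insertI1] p]) blast
 have sub: "bx n p (min e e') \<subseteq> bx n p e" "bx n p (min e e') \<subseteq> bx n p e'" by (simp_all add: bx_mono)
 show ?case
 proof (rule insert.prems(1)[of "min e e'" "C + C'"])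
  fix h x y assume h: "h \<in> insert k I" and xy: "x \<in> bx n p (min e e')" "y \<in> bx n p (min e e')"
  have "\<bar>g h y - g h x\<bar> \<le> C * l1 n (\<lambda>i. y i - x i) \<or> \<bar>g h y - g h x\<bar> \<le> C' * l1 n (\<lambda>i. y i - x i)"
   using h e(4)[of h x y] e'(3)[of x y] xy sub by blast
  then show "\<bar>g h y - g h x\<bar> \<le> (C + C') * l1 n (\<lambda>i. y i - x i)"
   using e(2) e'(2) l1_nonneg[of n "\<lambda>i. y i - x i"] by (smt (verit) mult_right_mono)
 qed (use e e' sub in auto)
qed

text \<open>The constant is uniform in both points of the box: the first derivatives are Lipschitz
  near \<open>p\<close>, and the mean value points are in each coordinate no farther from
  \<open>x\<close> than \<open>y\<close> is.\<close>

lemma taylor2: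
 assumes U: "opn n U" and g: "Ck_open n (Suc (Suc 0)) U g" and p: "p \<in> U"
 obtains e C where "e > 0" "C \<ge> 0" "bx n p e \<subseteq> U"
  "\<And>x y. x \<in> bx n p e ==> y \<in> bx n p e ==>
    \<bar>g y - g x - (\<Sum>i<n. pderiv_coord i g x * (y i - x i))\<bar> \<le> C * (l1 n (\<lambda>i. y i - x i))\<^sup>2"
proof -
 obtain e C where e: "e > 0" "C \<ge> 0" "bx n p e \<subseteq> U"
  "\<And>k x y. k \<in> {..<n} ==> x \<in> bx n p e ==> y \<in> bx n p e ==>
   \<bar>pderiv_coord k g y - pderiv_coord k g x\<bar> \<le> C * l1 n (\<lambda>i. y i - x i)"
  by (rule loc_lip_family[OF U finite_lessThan _ p, of n "\<lambda>k. pderiv_coord k g"])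
    (use Ck_open_pderivD[OF g] in auto)
 have "\<bar>g y - g x - (\<Sum>i<n. pderiv_coord i g x * (y i - x i))\<bar> \<le> C * (l1 n (\<lambda>i. y i - x i))\<^sup>2"
  if xy: "x \<in> bx n p e" "y \<in> bx n p e" for x y
 proof -
  let ?l = "l1 n (\<lambda>i. y i - x i)"
  obtain \<xi> where \<xi>: "\<And>i. i < n ==> \<xi> i \<in> bx n p e" "\<And>i j. i < n ==> j < n ==> \<bar>\<xi> i j - x j\<bar> \<le> \<bar>y j - x j\<bar>"
   "g y - g x = (\<Sum>i<n. pderiv_coord i g (\<xi> i) * (y i - x i))"
   by (rule mvt_bx[OF U Ck_open_SucD[OF g] e(3) xy]) blast
  have b: "\<bar>pderiv_coord i g (\<xi> i) - pderiv_coord i g x\<bar> \<le> C * ?l" if i: "i < n" for i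
  proof -
   have "l1 n (\<lambda>j. \<xi> i j - x j) \<le> ?l" unfolding l1_def by (rule sum_mono) (use \<xi>(2) i in auto)
   then show ?thesis using e(4)[of i x "\<xi> i"] \<xi>(1)[OF i] xy(1) e(2) i
    by (smt (verit, best) lessThan_iff mult_left_mono)
  qed
  have "\<bar>g y - g x - (\<Sum>i<n. pderiv_coord i g x * (y i - x i))\<bar> =
    \<bar>\<Sum>i<n. (pderiv_coord i g (\<xi> i) - pderiv_coord i g x) * (y i - x i)\<bar>"
   unfolding \<xi>(3) by (simp add: sum_subtractf left_diff_distrib)
  also have "\<dots> \<le> (\<Sum>i<n. \<bar>(pderiv_coord i g (\<xi> i) - pderiv_coord i g x) * (y i - x i)\<bar>)" by (rule sum_abs)
  also have "\<dots> \<le> (\<Sum>i<n. (C * ?l) * \<bar>y i - x i\<bar>)"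
   by (rule sum_mono) (auto simp: abs_mult intro!: mult_right_mono b)
  also have "\<dots> = C * ?l * ?l" by (simp add: l1_def sum_distrib_left)
  finally show ?thesis by (simp add: power2_eq_square mult.assoc)
 qed
 then show thesis using that[OF e(1,2,3)] by blast
qed

lemma matrix_inverse_ex:
 fixes A :: "nat => nat => real"
 assumes "\<forall>x. (\<forall>j<d. (\<Sum>l<d. A j l * x l) = 0) --> (\<forall>l<d. x l = 0)"
 shows "\<exists>B. (\<forall>j<d. \<forall>l<d. (\<Sum>k<d. B j k * A k l) = (if j = l then 1 else 0)) \<and>
  (\<forall>j<d. \<forall>l<d. (\<Sum>k<d. A j k * B k l) = (if j = l then 1 else 0))"
proof (rule matrix_inverse_exists[where A = A and d = d], goal_cases)
 case (2 B)
 then show ?case by (intro exI[of _ B]) simp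
qed (use assms in blast)

text \<open>The assumed estimate is the one that matrices close to the identity satisfy. It gives
  injectivity, hence an inverse.\<close>

lemma solve_exists:
 fixes A :: "nat => nat => real"
 assumes "\<And>x. l1 d x \<le> 2 * (\<Sum>j<d. \<bar>\<Sum>l<d. A j l * x l\<bar>)"
 obtains q where "\<And>j. j < d ==> (\<Sum>l<d. A j l * q l) = r j"
proof -
 have inj: "\<forall>l<d. x l = 0" if "\<forall>j<d. (\<Sum>l<d. A j l * x l) = 0" for x
 proof -
  have "l1 d x \<le> 0" using assms[of x] that by simp
  then show ?thesis using coord_le_l1[of _ d x] by force
 qed
 obtain B where B0: "\<forall>j<d. \<forall>l<d. (\<Sum>k<d. A j k * B k l) = (if j = l then 1 else 0)"
  using matrix_inverse_ex[of d A] inj by blast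
 have B: "(\<Sum>k<d. A j k * B k l) = (if j = l then 1 else 0)" if "j < d" "l < d" for j l
  using B0 that by simp
 have "(\<Sum>l<d. A j l * (\<Sum>k<d. B l k * r k)) = r j" if j: "j < d" for j
 proof -
  have "(\<Sum>l<d. A j l * (\<Sum>k<d. B l k * r k)) = (\<Sum>k<d. (\<Sum>l<d. A j l * B l k) * r k)"
   unfolding sum_distrib_left sum_distrib_right by (subst sum.swap) (simp add: mult.assoc)
  also have "\<dots> = (\<Sum>k<d. (if j = k then 1 else 0) * r k)" using B[OF j] by (intro sum.cong) auto
  also have "\<dots> = r j" by (rule sum_kron[OF j])
  finally show ?thesis .
 qed
 then show thesis using that[of "\<lambda>l. \<Sum>k<d. B l k * r k"] by blast
qed

text \<open>Solutions of a uniformly invertible linear system are as smooth as its coefficients: the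
 derivative of the solution solves the differentiated system.\<close>

lemma Ck_open_solve:
 assumes W: "opn n W"
  and inj: "\<And>w x. w \<in> W ==> l1 d x \<le> 2 * (\<Sum>j<d. \<bar>\<Sum>l<d. A j l w * x l\<bar>)"
 shows "(\<And>j l. j < d ==> l < d ==> Ck_open n k W (A j l)) ==> (\<And>j. j < d ==> Ck_open n k W (b j)) ==>
  (\<And>w j. w \<in> W ==> j < d ==> (\<Sum>l<d. A j l w * x l w) = b j w) ==> l < d ==> Ck_open n k W (x l)"
proof (induction k arbitrary: b x l)
 \<comment> \<open>The solution at \<open>w\<close>, substituted into the system at
   \<open>w'\<close>, leaves a residual that tends to 0; by \<open>inj\<close> the two solutions
   differ by at most twice the residual.\<close>
 have cont: "continuous_on W (x l)"
  if cA: "\<And>j l. j < d ==> l < d ==> continuous_on W (A j l)" and cb: "\<And>j. j < d ==> continuous_on W (b j)"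
   and eq: "\<And>w j. w \<in> W ==> j < d ==> (\<Sum>l<d. A j l w * x l w) = b j w" and l: "l < d" for b x l
  unfolding continuous_on_def
 proof
  fix w assume w: "w \<in> W"
  have "((\<lambda>w'. 2 * (\<Sum>j<d. \<bar>b j w' - (\<Sum>l<d. A j l w' * x l w)\<bar>)) \<longlongrightarrow>
    2 * (\<Sum>j<d. \<bar>b j w - (\<Sum>l<d. A j l w * x l w)\<bar>)) (at w within W)"
   using cA cb w unfolding continuous_on_def by (intro tendsto_intros) auto
  then have z: "((\<lambda>w'. 2 * (\<Sum>j<d. \<bar>b j w' - (\<Sum>l<d. A j l w' * x l w)\<bar>)) \<longlongrightarrow> 0) (at w within W)"
   using eq[OF w] by simp
  have "((\<lambda>w'. x l w' - x l w) \<longlongrightarrow> 0) (at w within W)"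
  proof (rule Lim_null_comparison[OF _ z])
   show "\<forall>\<^sub>F w' in at w within W. norm (x l w' - x l w) \<le> 2 * (\<Sum>j<d. \<bar>b j w' - (\<Sum>l<d. A j l w' * x l w)\<bar>)"
    unfolding eventually_at_filter
   proof (intro always_eventually allI impI)
    fix w' assume w': "w' \<in> W"
    have "\<bar>x l w' - x l w\<bar> \<le> l1 d (\<lambda>l. x l w' - x l w)"
     by (rule coord_le_l1[OF l, of "\<lambda>l. x l w' - x l w"])
    also have "\<dots> \<le> 2 * (\<Sum>j<d. \<bar>\<Sum>l<d. A j l w' * (x l w' - x l w)\<bar>)" by (rule inj[OF w'])
    also have "(\<Sum>j<d. \<bar>\<Sum>l<d. A j l w' * (x l w' - x l w)\<bar>) = (\<Sum>j<d. \<bar>b j w' - (\<Sum>l<d. A j l w' * x l w)\<bar>)"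
     using eq[OF w'] by (intro sum.cong) (auto simp: right_diff_distrib sum_subtractf)
    finally show "norm (x l w' - x l w) \<le> 2 * (\<Sum>j<d. \<bar>b j w' - (\<Sum>l<d. A j l w' * x l w)\<bar>)" by simp
   qed
  qed
  then show "(x l \<longlongrightarrow> x l w) (at w within W)" by (simp add: LIM_zero_iff)
 qed
 {
  case 0
  then show ?case
   using cont[of b x l] opn_subset[OF W] by (simp add: continuous_map_opn)
 next
  case (Suc k)
  have WR: "W \<subseteq> Rn n" by (rule opn_subset[OF W])
  have xk: "Ck_open n k W (x l)" if "l < d" for l
   by (rule Suc.IH[OF Ck_open_SucD[OF Suc.prems(1)] Ck_open_SucD[OF Suc.prems(2)] Suc.prems(3) that])
  have cx: "continuous_on W (x l)" if "l < d" for l by (rule Ck_open_continuous[OF WR xk[OF that]])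
  \<comment> \<open>The differentiated system reads \<open>A q = r\<close>, with \<open>q\<close>
    the prospective derivative of \<open>x\<close>.\<close>
  define r where "r i j w = pderiv_coord i (b j) w - (\<Sum>l<d. pderiv_coord i (A j l) w * x l w)" for i j w
  have ex: "\<exists>q. \<forall>j<d. (\<Sum>l<d. A j l w * q l) = r i j w" if "w \<in> W" for w i
   by (rule solve_exists[of d "\<lambda>j l. A j l w" "\<lambda>j. r i j w"]) (use inj[OF that] in auto)
  define q where "q i w = (SOME q. \<forall>j<d. (\<Sum>l<d. A j l w * q l) = r i j w)" for i w
  have q: "(\<Sum>l<d. A j l w * q i w l) = r i j w" if "w \<in> W" "j < d" for w i j
   using someI_ex[OF ex[OF that(1), of i]] that(2) unfolding q_def by blast
  show ?case
  proof (rule Ck_open_SucI[OF W cx[OF Suc.prems(4)], where D = "\<lambda>i w. q i w l"])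
   fix w i assume w: "w \<in> W" and i: "i < n"
   let ?F = "at (w i)"
   let ?y = "\<lambda>t. w(i := t)"
   define Q where "Q t l = (x l (?y t) - x l w) / (t - w i)" for t l
   have yW: "\<forall>\<^sub>F t in ?F. ?y t \<in> W"
    using opn_eventually_upd[OF W w i] by (simp add: eventually_at_filter eventually_mono)
   have dq: "((\<lambda>t. (g (?y t) - g w) / (t - w i)) \<longlongrightarrow> pderiv_coord i g w) ?F"
    if "Ck_open n (Suc k) W g" for g
    using Ck_open_1D(1)[OF that W w i] by (simp add: has_field_derivative_iff)
   have Al: "((\<lambda>t. A j l (?y t)) \<longlongrightarrow> A j l w) ?F" if "j < d" "l < d" for j l
   proof -
    have "isCont (\<lambda>t. A j l (?y t)) (w i)"
     by (rule DERIV_isCont[OF Ck_open_1D(1)[OF Suc.prems(1)[OF that] W w i]])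
    then show ?thesis by (simp add: isCont_def)
   qed
   \<comment> \<open>The residual of \<open>q\<close> in the system that the difference quotients
     \<open>Q t\<close> satisfy exactly. It tends to 0, and \<open>inj\<close> turns this into
     convergence of \<open>Q t\<close> to \<open>q\<close>.\<close>
   define R where "R t j = (b j (?y t) - b j w) / (t - w i) - (\<Sum>l<d. (A j l (?y t) - A j l w) / (t - w i) * x l w)
     - (\<Sum>l<d. A j l (?y t) * q i w l)" for t j
   have "((\<lambda>t. R t j) \<longlongrightarrow> r i j w - (\<Sum>l<d. A j l w * q i w l)) ?F" if "j < d" for j
    unfolding R_def r_def using that Suc.prems(1,2) by (intro tendsto_intros dq Al) auto
   then have "((\<lambda>t. 2 * (\<Sum>j<d. \<bar>R t j\<bar>)) \<longlongrightarrow> 2 * (\<Sum>j<d. \<bar>0\<bar>)) ?F"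
    using q[OF w] by (intro tendsto_intros) auto
   then have z: "((\<lambda>t. 2 * (\<Sum>j<d. \<bar>R t j\<bar>)) \<longlongrightarrow> 0) ?F" by simp
   have "((\<lambda>t. Q t l - q i w l) \<longlongrightarrow> 0) ?F"
   proof (rule Lim_null_comparison[OF _ z])
    have ne: "\<forall>\<^sub>F t in ?F. t \<noteq> w i" by (simp add: eventually_at_filter)
    show "\<forall>\<^sub>F t in ?F. norm (Q t l - q i w l) \<le> 2 * (\<Sum>j<d. \<bar>R t j\<bar>)"
     using yW ne
    proof eventually_elim
     case (elim t)
     have "\<bar>Q t l - q i w l\<bar> \<le> l1 d (\<lambda>l. Q t l - q i w l)"
      by (rule coord_le_l1[OF Suc.prems(4), of "\<lambda>l. Q t l - q i w l"])
     also have "\<dots> \<le> 2 * (\<Sum>j<d. \<bar>\<Sum>l<d. A j l (?y t) * (Q t l - q i w l)\<bar>)" by (rule inj[OF elim(1)])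
     also have "(\<Sum>j<d. \<bar>\<Sum>l<d. A j l (?y t) * (Q t l - q i w l)\<bar>) = (\<Sum>j<d. \<bar>R t j\<bar>)"
     proof (rule sum.cong[OF refl])
      fix j assume "j \<in> {..<d}"
      then have j: "j < d" by simp
      have "b j (?y t) - b j w - (\<Sum>l<d. (A j l (?y t) - A j l w) * x l w) = (\<Sum>l<d. A j l (?y t) * (x l (?y t) - x l w))"
       unfolding Suc.prems(3)[OF elim(1) j, symmetric] Suc.prems(3)[OF w j, symmetric]
       by (simp add: algebra_simps sum_subtractf)
      then have "(\<Sum>l<d. A j l (?y t) * Q t l) =
        (b j (?y t) - b j w) / (t - w i) - (\<Sum>l<d. (A j l (?y t) - A j l w) / (t - w i) * x l w)"
       unfolding Q_def by (simp add: sum_divide_distrib[symmetric] diff_divide_distrib[symmetric])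
      then show "\<bar>\<Sum>l<d. A j l (?y t) * (Q t l - q i w l)\<bar> = \<bar>R t j\<bar>"
       unfolding R_def by (simp add: right_diff_distrib sum_subtractf)
     qed
     finally show ?case by simp
    qed
   qed
   then show "((\<lambda>t. x l (?y t)) has_real_derivative q i w l) (at (w i))"
    by (simp add: Q_def has_field_derivative_iff LIM_zero_iff)
  next
   fix i assume i: "i < n"
   show "Ck_open n k W (\<lambda>w. q i w l)"
   proof (rule Suc.IH[where b = "r i" and x = "\<lambda>l w. q i w l", OF Ck_open_SucD[OF Suc.prems(1)]])
    fix j assume j: "j < d"
    have "Ck_open n k W (\<lambda>w. pderiv_coord i (b j) w + (\<Sum>l<d. (- 1) * (pderiv_coord i (A j l) w * x l w)))"
     using Suc.prems(1,2) i j xk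
     by (intro Ck_open_add[OF W] Ck_open_sum[OF W] Ck_open_mult[OF W] Ck_open_const[OF W] Ck_open_pderivD) auto
    then show "Ck_open n k W (r i j)" by (simp add: r_def[abs_def] sum_negf)
   qed (use q Suc.prems(4) in auto)
  qed
 }
qed

lemma compact_l1_ball:
 assumes "u0 \<in> Rn d"
 shows "compact {u \<in> Rn d. l1 d (\<lambda>i. u i - u0 i) \<le> \<delta>}"
 unfolding compact_eq_seq_compact_metric seq_compact_def
proof (intro allI impI)
 fix f :: "nat => nat => real"
 assume f: "\<forall>s. f s \<in> {u \<in> Rn d. l1 d (\<lambda>i. u i - u0 i) \<le> \<delta>}"
 have bd: "\<bar>f s i\<bar> \<le> \<delta> + l1 d u0" if "i < d" for s i
  using f[rule_format, of s] coord_le_l1[OF that, of "\<lambda>i. f s i - u0 i"] coord_le_l1[OF that, of u0] by auto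
 have fR: "f s \<in> Rn d" for s using f by blast
 obtain r l where r: "strict_mono r" "l \<in> Rn d" "(\<lambda>s. f (r s)) \<longlonglongrightarrow> l"
  by (rule bounded_subseq[OF fR bd])
 have "(\<lambda>s. l1 d (\<lambda>i. f (r s) i - u0 i)) \<longlonglongrightarrow> l1 d (\<lambda>i. l i - u0 i)"
  unfolding l1_def using r(3) unfolding tendsto_fun_iff by (intro tendsto_intros) auto
 then have "l1 d (\<lambda>i. l i - u0 i) \<le> \<delta>"
  by (rule tendsto_upperbound) (use f in auto)
 then show "\<exists>l\<in>{u \<in> Rn d. l1 d (\<lambda>i. u i - u0 i) \<le> \<delta>}. \<exists>r. strict_mono r \<and> (f \<circ> r) \<longlonglongrightarrow> l"
  using r by (auto simp: o_def)
qed

text \<open>Existence comes from compactness instead of an iteration: for fixed \<open>w\<close>, a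
  minimizer of the sum norm of \<open>\<Phi>\<close> over a small ball is a zero, because the step
  \<open>u - \<Phi> u\<close> would halve the norm. The unknowns occupy the first \<open>d\<close>
  coordinates.\<close>

lemma implicit_function_id:
 assumes Ob: "opn (d + m) Ob"
  and \<Phi>: "\<And>j. j < d ==> Cp_open (d + m) \<infinity> Ob (\<Phi> j)"
  and u0: "u0 \<in> Rn d" and w0: "w0 \<in> Rn m" and z0: "append_vec d u0 w0 \<in> Ob"
  and \<Phi>0: "\<And>j. j < d ==> \<Phi> j (append_vec d u0 w0) = 0"
  and id: "\<And>j l. j < d ==> l < d ==> pderiv_coord l (\<Phi> j) (append_vec d u0 w0) = (if j = l then 1 else 0)"
 obtains W u where "opn m W" "w0 \<in> W" "u w0 = u0"
  "\<And>w. w \<in> W ==> u w \<in> Rn d \<and> append_vec d (u w) w \<in> Ob"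
  "\<And>w j. w \<in> W ==> j < d ==> \<Phi> j (append_vec d (u w) w) = 0"
  "\<And>l. l < d ==> Cp_open m \<infinity> W (\<lambda>w. u w l)"
proof -
 define N where "N = d + m"
 define z where "z = append_vec d u0 w0"
 let ?a = "\<lambda>u w. append_vec d u w"
 note Ob' = Ob[folded N_def]
 have \<Phi>k: "Ck_open N k Ob (\<Phi> j)" if "j < d" for j k using Cp_open_Ck[OF \<Phi>[OF that]] by (simp add: N_def)
 have zR: "z \<in> Rn N" unfolding z_def N_def by (rule append_vec_Rn[OF w0])
 have zO: "z \<in> Ob" using z0 by (simp add: z_def)
 \<comment> \<open>A matrix whose entries are within \<open>\<eta>\<close> of the identity changes a
   vector by at most \<open>d * \<eta> \<le> 1 / 2\<close> of its sum norm; \<open>d + 1\<close>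
   covers \<open>d = 0\<close>.\<close>
 define \<eta> where "\<eta> = 1 / (2 * (real d + 1))"
 have \<eta>: "\<eta> > 0" "real d * \<eta> \<le> 1 / 2" by (auto simp: \<eta>_def field_simps)
 let ?F = "inf (nhds z) (principal (Rn N))"
 have pc: "\<forall>\<^sub>F y in ?F. dist (pderiv_coord i (\<Phi> j) y) (pderiv_coord i (\<Phi> j) z) < \<eta>" if "j < d" "i < N" for i j
  by (rule tendstoD[OF continuous_on_nb[OF Ob' Ck_open_1D(2)[OF \<Phi>k[OF that(1)] Ob' that(2)] zO] \<eta>(1)])
 have "\<forall>\<^sub>F y in ?F. \<forall>j\<in>{..<d}. \<forall>i\<in>{..<N}. dist (pderiv_coord i (\<Phi> j) y) (pderiv_coord i (\<Phi> j) z) < \<eta>"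
  by (intro eventually_ball_finite ballI finite_lessThan) (use pc in auto)
 then have "\<forall>\<^sub>F y in ?F. y \<in> Ob \<and> (\<forall>j<d. \<forall>i<N. \<bar>pderiv_coord i (\<Phi> j) y - pderiv_coord i (\<Phi> j) z\<bar> < \<eta>)"
  using eventually_nb_in[OF Ob' zO] by eventually_elim (auto simp: dist_real_def)
 then obtain e where e: "e > 0" "bx N z e \<subseteq> Ob"
   "\<And>y i j. y \<in> bx N z e ==> j < d ==> i < N ==> \<bar>pderiv_coord i (\<Phi> j) y - pderiv_coord i (\<Phi> j) z\<bar> < \<eta>"
  unfolding eventually_nb[OF zR] by blast
 define C where "C = (\<Sum>j<d. \<Sum>i<N. \<bar>pderiv_coord i (\<Phi> j) z\<bar>) + \<eta>"
 have C: "\<bar>pderiv_coord i (\<Phi> j) y\<bar> \<le> C" if "y \<in> bx N z e" "j < d" "i < N" for y i j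
 proof -
  have "\<bar>pderiv_coord i (\<Phi> j) z\<bar> \<le> (\<Sum>i<N. \<bar>pderiv_coord i (\<Phi> j) z\<bar>)"
   by (rule member_le_sum) (use that in auto)
  also have "\<dots> \<le> (\<Sum>j<d. \<Sum>i<N. \<bar>pderiv_coord i (\<Phi> j) z\<bar>)"
   by (rule member_le_sum[of j]) (use that in \<open>auto intro: sum_nonneg\<close>)
  finally show ?thesis using e(3)[OF that] unfolding C_def by linarith
 qed
 have C0: "C \<ge> 0" unfolding C_def using \<eta> by (auto intro!: add_nonneg_nonneg sum_nonneg)
 have abx: "?a u w \<in> bx N z e" if "u \<in> bx d u0 e" "w \<in> bx m w0 e" for u w
  using that append_vec_Rn[of w m d u] unfolding bx_def N_def z_def append_vec_def
  by (auto simp: less_diff_conv2)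
 \<comment> \<open>the linear parts are uniformly close to the identity\<close>
 have inj: "l1 d x \<le> 2 * (\<Sum>j<d. \<bar>\<Sum>l<d. c j l * x l\<bar>)"
  if c: "\<And>j l. j < d ==> l < d ==> \<bar>c j l - (if j = l then 1 else 0)\<bar> \<le> \<eta>" for x c
 proof -
  have "\<bar>x j\<bar> \<le> \<bar>\<Sum>l<d. c j l * x l\<bar> + \<eta> * l1 d x" if j: "j < d" for j
  proof -
   have "x j = (\<Sum>l<d. c j l * x l) - (\<Sum>l<d. (c j l - (if j = l then 1 else 0)) * x l)"
    using sum_kron(4)[OF j, of x] by (simp add: left_diff_distrib sum_subtractf)
   moreover have "\<bar>\<Sum>l<d. (c j l - (if j = l then 1 else 0)) * x l\<bar> \<le> (\<Sum>l<d. \<eta> * \<bar>x l\<bar>)"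
    by (rule order_trans[OF sum_abs]) (auto simp: abs_mult intro!: sum_mono mult_right_mono c j)
   ultimately show ?thesis unfolding l1_def sum_distrib_left[symmetric] by linarith
  qed
  then have "l1 d x \<le> (\<Sum>j<d. \<bar>\<Sum>l<d. c j l * x l\<bar> + \<eta> * l1 d x)"
   unfolding l1_def by (intro sum_mono) auto
  also have "\<dots> = (\<Sum>j<d. \<bar>\<Sum>l<d. c j l * x l\<bar>) + (real d * \<eta>) * l1 d x" by (simp add: sum.distrib)
  also have "\<dots> \<le> (\<Sum>j<d. \<bar>\<Sum>l<d. c j l * x l\<bar>) + 1 / 2 * l1 d x"
   using \<eta>(2) l1_nonneg by (intro add_left_mono mult_right_mono)
  finally show ?thesis by simp
 qed
 have splitN: "(\<Sum>i<N. f i * (?a u' w i - ?a u w i)) = (\<Sum>l<d. f l * (u' l - u l))" for f :: "nat => real" and u' u w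
 proof -
  have "(\<Sum>i<N. f i * (?a u' w i - ?a u w i)) = (\<Sum>l<d. f l * (?a u' w l - ?a u w l))"
   by (rule sum.mono_neutral_right) (auto simp: N_def append_vec_def)
  also have "\<dots> = (\<Sum>l<d. f l * (u' l - u l))" by (rule sum.cong) (auto simp: append_vec_def)
  finally show ?thesis .
 qed
 \<comment> \<open>The mean value coefficients form a matrix close to the identity. Each row has its
   own intermediate points, so the matrix depends on \<open>u\<close>, \<open>u'\<close> and
   \<open>w\<close>.\<close>
 have E: "\<exists>c. (\<forall>j<d. \<forall>l<d. \<bar>c j l - (if j = l then 1 else 0)\<bar> \<le> \<eta>) \<and>
    (\<forall>j<d. \<Phi> j (?a u' w) - \<Phi> j (?a u w) = (\<Sum>l<d. c j l * (u' l - u l)))"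
  if u: "u \<in> bx d u0 e" "u' \<in> bx d u0 e" and w: "w \<in> bx m w0 e" for u u' w
 proof -
  have "\<exists>c. (\<forall>l<d. \<bar>c l - (if j = l then 1 else 0)\<bar> \<le> \<eta>) \<and> \<Phi> j (?a u' w) - \<Phi> j (?a u w) = (\<Sum>l<d. c l * (u' l - u l))"
   if j: "j < d" for j
  proof -
   obtain \<xi> where \<xi>: "\<And>i. i < N ==> \<xi> i \<in> bx N z e"
    "\<Phi> j (?a u' w) - \<Phi> j (?a u w) = (\<Sum>i<N. pderiv_coord i (\<Phi> j) (\<xi> i) * (?a u' w i - ?a u w i))"
    by (rule mvt_bx[OF Ob' \<Phi>k[OF j] e(2) abx[OF u(1) w] abx[OF u(2) w]]) blast
   have "\<bar>pderiv_coord l (\<Phi> j) (\<xi> l) - (if j = l then 1 else 0)\<bar> \<le> \<eta>" if l: "l < d" for l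
    using e(3)[OF \<xi>(1) j, of l l] id[OF j l] l unfolding z_def[symmetric] by (simp add: N_def)
   then show ?thesis using \<xi>(2) unfolding splitN
    by (intro exI[of _ "\<lambda>l. pderiv_coord l (\<Phi> j) (\<xi> l)"]) blast
  qed
  then have "\<forall>j\<in>{..<d}. \<exists>c. (\<forall>l<d. \<bar>c l - (if j = l then 1 else 0)\<bar> \<le> \<eta>) \<and> \<Phi> j (?a u' w) - \<Phi> j (?a u w) = (\<Sum>l<d. c l * (u' l - u l))"
   by simp
  from bchoice[OF this] show ?thesis by fastforce
 qed
 have Elip: "l1 d (\<lambda>l. u' l - u l) \<le> 2 * (\<Sum>j<d. \<bar>\<Phi> j (?a u' w) - \<Phi> j (?a u w)\<bar>)"
  if u: "u \<in> bx d u0 e" "u' \<in> bx d u0 e" and w: "w \<in> bx m w0 e" for u u' w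
 proof -
  obtain c where c: "\<forall>j<d. \<forall>l<d. \<bar>c j l - (if j = l then 1 else 0)\<bar> \<le> \<eta>"
    "\<forall>j<d. \<Phi> j (?a u' w) - \<Phi> j (?a u w) = (\<Sum>l<d. c j l * (u' l - u l))"
   using E[OF u w] by blast
  then show ?thesis using inj[of c "\<lambda>l. u' l - u l"] by simp
 qed
 \<comment> \<open>\<open>\<Phi>\<close> minus the identity contracts by 1/2 in \<open>u\<close>,
   while \<open>Elip\<close> makes zeros unique and controls their dependence on
   \<open>w\<close>.\<close>
 have Econ: "(\<Sum>j<d. \<bar>\<Phi> j (?a u' w) - \<Phi> j (?a u w) - (u' j - u j)\<bar>) \<le> 1 / 2 * l1 d (\<lambda>l. u' l - u l)"
  if u: "u \<in> bx d u0 e" "u' \<in> bx d u0 e" and w: "w \<in> bx m w0 e" for u u' w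
 proof -
  let ?x = "\<lambda>l. u' l - u l"
  obtain c where c: "\<And>j l. j < d ==> l < d ==> \<bar>c j l - (if j = l then 1 else 0)\<bar> \<le> \<eta>"
    "\<And>j. j < d ==> \<Phi> j (?a u' w) - \<Phi> j (?a u w) = (\<Sum>l<d. c j l * ?x l)"
   using E[OF u w] by blast
  have "\<bar>\<Phi> j (?a u' w) - \<Phi> j (?a u w) - ?x j\<bar> \<le> \<eta> * l1 d ?x" if j: "j < d" for j
  proof -
   have "\<Phi> j (?a u' w) - \<Phi> j (?a u w) - ?x j = (\<Sum>l<d. (c j l - (if j = l then 1 else 0)) * ?x l)"
    using sum_kron(4)[OF j, of ?x] c(2)[OF j] by (simp add: left_diff_distrib sum_subtractf)
   moreover have "\<bar>\<Sum>l<d. (c j l - (if j = l then 1 else 0)) * ?x l\<bar> \<le> (\<Sum>l<d. \<eta> * \<bar>?x l\<bar>)"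
    by (rule order_trans[OF sum_abs]) (auto simp: abs_mult intro!: sum_mono mult_right_mono c j)
   ultimately show ?thesis by (simp add: l1_def sum_distrib_left)
  qed
  then have "(\<Sum>j<d. \<bar>\<Phi> j (?a u' w) - \<Phi> j (?a u w) - ?x j\<bar>) \<le> (\<Sum>j<d. \<eta> * l1 d ?x)"
   by (intro sum_mono) auto
  also have "\<dots> = (real d * \<eta>) * l1 d ?x" by simp
  also have "\<dots> \<le> 1 / 2 * l1 d ?x" using \<eta>(2) l1_nonneg by (intro mult_right_mono)
  finally show ?thesis .
 qed
 have u0b: "u0 \<in> bx d u0 e" using u0 e(1) by (simp add: bx_def)
 have wlip: "\<bar>\<Phi> j (?a u w') - \<Phi> j (?a u w)\<bar> \<le> C * l1 m (\<lambda>i. w' i - w i)"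
  if j: "j < d" and u: "u \<in> bx d u0 e" and w: "w \<in> bx m w0 e" "w' \<in> bx m w0 e" for j u w w'
 proof -
  obtain \<xi> where \<xi>: "\<And>i. i < N ==> \<xi> i \<in> bx N z e"
   "\<Phi> j (?a u w') - \<Phi> j (?a u w) = (\<Sum>i<N. pderiv_coord i (\<Phi> j) (\<xi> i) * (?a u w' i - ?a u w i))"
   by (rule mvt_bx[OF Ob' \<Phi>k[OF j] e(2) abx[OF u w(1)] abx[OF u w(2)]]) blast
  have "\<bar>\<Phi> j (?a u w') - \<Phi> j (?a u w)\<bar> \<le> (\<Sum>i<N. C * \<bar>?a u w' i - ?a u w i\<bar>)"
   unfolding \<xi>(2) by (rule order_trans[OF sum_abs])
    (auto simp: abs_mult intro!: sum_mono mult_right_mono C[OF \<xi>(1) j])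
  also have "\<dots> = C * l1 N (\<lambda>i. ?a u w' i - ?a u w i)" by (simp add: l1_def sum_distrib_left)
  also have "l1 N (\<lambda>i. ?a u w' i - ?a u w i) = l1 m (\<lambda>i. w' i - w i)"
   unfolding l1_def N_def
  proof -
   have "(\<Sum>i<d + m. \<bar>?a u w' i - ?a u w i\<bar>) = (\<Sum>i\<in>{d..<d + m}. \<bar>?a u w' i - ?a u w i\<bar>)"
    by (rule sum.mono_neutral_right) (auto simp: append_vec_def)
   also have "\<dots> = (\<Sum>i<m. \<bar>?a u w' (d + i) - ?a u w (d + i)\<bar>)"
    by (rule sum.reindex_bij_witness[of _ "\<lambda>i. d + i" "\<lambda>i. i - d"]) auto
   finally show "(\<Sum>i<d + m. \<bar>?a u w' i - ?a u w i\<bar>) = (\<Sum>i<m. \<bar>w' i - w i\<bar>)" by (simp add: append_vec_def)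
  qed
  finally show ?thesis .
 qed
 define \<delta> where "\<delta> = e / 2"
 have \<delta>: "\<delta> > 0" "\<delta> < e" using e(1) by (auto simp: \<delta>_def)
 \<comment> \<open>Small enough that the sum norm of \<open>\<Phi>\<close> at \<open>u0\<close> is
   at most \<open>\<delta> / 2\<close> for every \<open>w\<close> in \<open>W\<close>. Together with
   the contraction this keeps the step from a point of \<open>S\<close> inside
   \<open>S\<close>.\<close>
 define e' where "e' = min e (\<delta> / (2 * (real d * C * real m + 1)))"
 have e': "e' > 0" "e' \<le> e" using e(1) \<delta> C0 unfolding e'_def by (auto intro!: divide_pos_pos add_nonneg_pos)
 define W where "W = bx m w0 e'"
 have We: "w \<in> W ==> w \<in> bx m w0 e" for w using bx_mono[OF e'(2)] unfolding W_def by blast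
 have Wsmall: "(\<Sum>j<d. \<bar>\<Phi> j (?a u0 w)\<bar>) \<le> \<delta> / 2" if w: "w \<in> W" for w
 proof -
  have w0b: "w0 \<in> bx m w0 e" using w0 e(1) by (simp add: bx_def)
  have "l1 m (\<lambda>i. w i - w0 i) \<le> (\<Sum>i<m. e')"
   unfolding l1_def using w by (intro sum_mono) (auto simp: W_def bx_def less_imp_le)
  then have l: "l1 m (\<lambda>i. w i - w0 i) \<le> real m * e'" by simp
  have "(\<Sum>j<d. \<bar>\<Phi> j (?a u0 w)\<bar>) \<le> (\<Sum>j<d. C * (real m * e'))"
  proof (rule sum_mono)
   fix j assume "j \<in> {..<d}"
   then have "\<bar>\<Phi> j (?a u0 w)\<bar> \<le> C * l1 m (\<lambda>i. w i - w0 i)"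
    using wlip[OF _ u0b w0b We[OF w], of j] \<Phi>0 by simp
   then show "\<bar>\<Phi> j (?a u0 w)\<bar> \<le> C * (real m * e')" using mult_left_mono[OF l C0] by linarith
  qed
  also have "\<dots> = (real d * C * real m) * e'" by simp
  also have "\<dots> \<le> (real d * C * real m + 1) * e'" using e'(1) by (simp add: algebra_simps)
  also have "\<dots> \<le> (real d * C * real m + 1) * (\<delta> / (2 * (real d * C * real m + 1)))"
   using C0 unfolding e'_def by (intro mult_left_mono) auto
  also have "\<dots> = \<delta> / 2"
  proof -
   have "x * (\<delta> / (2 * x)) = \<delta> / 2" if "x > 0" for x using that by simp
   moreover have "real d * C * real m + 1 > 0" using C0 by (intro add_nonneg_pos) auto
   ultimately show ?thesis by blast
  qed
  finally show ?thesis .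
 qed
 define S where "S = {u \<in> Rn d. l1 d (\<lambda>i. u i - u0 i) \<le> \<delta>}"
 have Sb: "u \<in> bx d u0 e" if "u \<in> S" for u
  unfolding bx_def using that \<delta>(2) coord_le_l1[of _ d "\<lambda>i. u i - u0 i"] by (force simp: S_def)
 have ex: "\<exists>u\<in>S. \<forall>j<d. \<Phi> j (?a u w) = 0" if w: "w \<in> W" for w
 proof -
  have "continuous_on S (\<lambda>u. \<Sum>j<d. \<bar>\<Phi> j (?a u w)\<bar>)"
  proof (intro continuous_intros)
   fix j assume "j \<in> {..<d}"
   then have "continuous_on Ob (\<Phi> j)" using Ck_open_continuous[OF opn_subset[OF Ob'] \<Phi>k[of j 0]] by simp
   moreover have "continuous_on S (\<lambda>u. ?a u w)"
    unfolding append_vec_def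
   proof (rule continuous_on_coordinatewise_then_product)
    show "continuous_on S (\<lambda>x. if i < d then x i else w (i - d))" for i
     by (cases "i < d") (auto simp: continuous_on_coord)
   qed
   moreover have "(\<lambda>u. ?a u w) ` S \<subseteq> Ob" using abx[OF Sb We[OF w]] e(2) by blast
   ultimately show "continuous_on S (\<lambda>u. \<Phi> j (?a u w))" by (rule continuous_on_compose2)
  qed
  moreover have "S \<noteq> {}" using u0 \<delta>(1) by (auto simp: S_def l1_def intro!: exI[of _ u0])
  moreover have "compact S" unfolding S_def by (rule compact_l1_ball[OF u0])
  ultimately obtain u where u: "u \<in> S" "\<And>y. y \<in> S ==> (\<Sum>j<d. \<bar>\<Phi> j (?a u w)\<bar>) \<le> (\<Sum>j<d. \<bar>\<Phi> j (?a y w)\<bar>)"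
   using continuous_attains_inf[of S "\<lambda>u. \<Sum>j<d. \<bar>\<Phi> j (?a u w)\<bar>"] by blast
  \<comment> \<open>The simplified Newton step from the minimizer. As \<open>y - u\<close> is
    \<open>- \<Phi> u\<close>, the contraction estimate bounds \<open>\<Phi>\<close> at
    \<open>y\<close> by half of its norm at \<open>u\<close>, so minimality forces that norm to be
    0.\<close>
  define y where "y = (\<lambda>j. if j < d then u j - \<Phi> j (?a u w) else 0)"
  have "l1 d (\<lambda>i. y i - u0 i) \<le> (\<Sum>j<d. \<bar>\<Phi> j (?a u w) - \<Phi> j (?a u0 w) - (u j - u0 j)\<bar> + \<bar>\<Phi> j (?a u0 w)\<bar>)"
   unfolding l1_def by (rule sum_mono) (auto simp: y_def)
  also have "\<dots> \<le> 1 / 2 * l1 d (\<lambda>i. u i - u0 i) + \<delta> / 2"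
   unfolding sum.distrib by (intro add_mono Econ u0b Sb u(1) We w Wsmall)
  also have "\<dots> \<le> \<delta>" using u(1) by (simp add: S_def)
  finally have yS: "y \<in> S" by (simp add: S_def y_def mem_Rn)
  have "(\<Sum>j<d. \<bar>\<Phi> j (?a y w)\<bar>) = (\<Sum>j<d. \<bar>\<Phi> j (?a y w) - \<Phi> j (?a u w) - (y j - u j)\<bar>)"
   by (rule sum.cong) (auto simp: y_def)
  also have "\<dots> \<le> 1 / 2 * l1 d (\<lambda>l. y l - u l)" by (intro Econ Sb u(1) yS We w)
  also have "l1 d (\<lambda>l. y l - u l) = (\<Sum>j<d. \<bar>\<Phi> j (?a u w)\<bar>)" unfolding l1_def by (rule sum.cong) (auto simp: y_def)
  finally have "(\<Sum>j<d. \<bar>\<Phi> j (?a u w)\<bar>) \<le> 1 / 2 * (\<Sum>j<d. \<bar>\<Phi> j (?a u w)\<bar>)" using u(2)[OF yS] by linarith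
  then have "(\<Sum>j<d. \<bar>\<Phi> j (?a u w)\<bar>) = 0"
   by (intro antisym) (auto intro: sum_nonneg)
  then have "\<forall>j<d. \<Phi> j (?a u w) = 0" by (simp add: sum_nonneg_eq_0_iff)
  then show ?thesis using u(1) by blast
 qed
 define u where "u w = (SOME u. u \<in> S \<and> (\<forall>j<d. \<Phi> j (?a u w) = 0))" for w
 have "u w \<in> S \<and> (\<forall>j<d. \<Phi> j (?a (u w) w) = 0)" if "w \<in> W" for w
  using someI_ex[of "\<lambda>u. u \<in> S \<and> (\<forall>j<d. \<Phi> j (?a u w) = 0)"] ex[OF that] unfolding u_def by blast
 then have u: "w \<in> W ==> u w \<in> S" "w \<in> W ==> j < d ==> \<Phi> j (?a (u w) w) = 0" for w j
  by blast+
 have ub: "w \<in> W ==> u w \<in> bx d u0 e" for w using Sb u(1) by blast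
 have aO: "w \<in> W ==> ?a (u w) w \<in> Ob" "w \<in> W ==> ?a (u w) w \<in> bx N z e" for w
  using abx[OF ub We] e(2) by blast+
 have Wopn: "opn m W" unfolding W_def by (rule bx_opn)
 have w0W: "w0 \<in> W" using w0 e'(1) by (simp add: W_def bx_def)
 have ulip: "l1 d (\<lambda>l. u w' l - u w l) \<le> 2 * (real d * C) * l1 m (\<lambda>i. w' i - w i)" if w: "w \<in> W" "w' \<in> W" for w w'
 proof -
  have "l1 d (\<lambda>l. u w' l - u w l) \<le> 2 * (\<Sum>j<d. \<bar>\<Phi> j (?a (u w') w) - \<Phi> j (?a (u w) w)\<bar>)"
   by (rule Elip[OF ub ub We]) (use w in auto)
  also have "(\<Sum>j<d. \<bar>\<Phi> j (?a (u w') w) - \<Phi> j (?a (u w) w)\<bar>) \<le> (\<Sum>j<d. C * l1 m (\<lambda>i. w' i - w i))"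
  proof (rule sum_mono)
   fix j assume "j \<in> {..<d}"
   then have j: "j < d" by simp
   show "\<bar>\<Phi> j (?a (u w') w) - \<Phi> j (?a (u w) w)\<bar> \<le> C * l1 m (\<lambda>i. w' i - w i)"
    using wlip[OF j ub[OF w(2)] We[OF w(1)] We[OF w(2)]] u(2)[OF w(1) j] u(2)[OF w(2) j] by simp
  qed
  finally show ?thesis by simp
 qed
 have ucont: "continuous_on W (\<lambda>w. u w l)" if l: "l < d" for l
  unfolding continuous_on_def
 proof
  fix w assume w: "w \<in> W"
  have "((\<lambda>w'. 2 * (real d * C) * l1 m (\<lambda>i. w' i - w i)) \<longlongrightarrow> 2 * (real d * C) * l1 m (\<lambda>i. w i - w i)) (at w within W)"
   unfolding l1_def using continuous_on_coord[of UNIV] unfolding continuous_on_def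
   by (intro tendsto_intros) (auto intro: tendsto_within_subset)
  then have z: "((\<lambda>w'. 2 * (real d * C) * l1 m (\<lambda>i. w' i - w i)) \<longlongrightarrow> 0) (at w within W)" by (simp add: l1_def)
  have "((\<lambda>w'. u w' l - u w l) \<longlongrightarrow> 0) (at w within W)"
   by (rule Lim_null_comparison[OF _ z])
     (use ulip[OF w] coord_le_l1[OF l, of "\<lambda>l. u _ l - u w l"] in
      \<open>auto simp: eventually_at_filter intro!: always_eventually order_trans[OF coord_le_l1[OF l, of "\<lambda>l. u _ l - u w l"]]\<close>)
  then show "((\<lambda>w. u w l) \<longlongrightarrow> u w l) (at w within W)" by (simp add: LIM_zero_iff)
 qed
 define A where "A j l w = pderiv_coord l (\<Phi> j) (?a (u w) w)" for j l w
 have Ainj: "l1 d x \<le> 2 * (\<Sum>j<d. \<bar>\<Sum>l<d. A j l w * x l\<bar>)" if w: "w \<in> W" for w x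
 proof (rule inj)
  fix j l assume jl: "j < d" "l < d"
  show "\<bar>A j l w - (if j = l then 1 else 0)\<bar> \<le> \<eta>"
   using e(3)[OF aO(2)[OF w] jl(1), of l] id[OF jl] jl unfolding A_def z_def[symmetric] by (simp add: N_def)
 qed
 define r where "r k j w = - pderiv_coord (d + k) (\<Phi> j) (?a (u w) w)" for k j w
 have exq: "\<exists>q. \<forall>j<d. (\<Sum>l<d. A j l w * q l) = r k j w" if "w \<in> W" for w k
  by (rule solve_exists[of d "\<lambda>j l. A j l w" "\<lambda>j. r k j w"]) (use Ainj[OF that] in auto)
 define q where "q k w = (SOME q. \<forall>j<d. (\<Sum>l<d. A j l w * q l) = r k j w)" for k w
 have q: "(\<Sum>l<d. A j l w * q k w l) = r k j w" if "w \<in> W" "j < d" for w k j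
  using someI_ex[OF exq[OF that(1), of k]] that(2) unfolding q_def by blast
 have WR: "W \<subseteq> Rn m" by (rule opn_subset[OF Wopn])
 have aR: "w \<in> W ==> ?a (u w) w \<in> Rn N" for w using append_vec_Rn[of w m d] WR unfolding N_def by blast
 \<comment> \<open>The difference quotients \<open>Q\<close> are known to be bounded, by
   \<open>ulip\<close>. In the expansion of \<open>\<Phi> j\<close> along the zero set the
   coefficients converge, so \<open>A\<close> applied to \<open>Q\<close> tends to \<open>r\<close>;
   the estimate \<open>Ainj\<close> then gives convergence of \<open>Q\<close> itself.\<close>
 have der: "((\<lambda>t. u (w(k := t)) l) has_real_derivative q k w l) (at (w k))" if w: "w \<in> W" and k: "k < m" and l: "l < d" for w k l
 proof -
  let ?G = "at (w k)"
  let ?y = "\<lambda>t. w(k := t)"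
  let ?zt = "\<lambda>t. ?a (u (?y t)) (?y t)"
  define Q where "Q t l = (u (?y t) l - u w l) / (t - w k)" for t l
  have yW: "\<forall>\<^sub>F t in ?G. ?y t \<in> W"
   using opn_eventually_upd[OF Wopn w k] by (simp add: eventually_at_filter eventually_mono)
  have ne: "\<forall>\<^sub>F t in ?G. t \<noteq> w k" by (simp add: eventually_at_filter)
  have yR: "\<forall>\<^sub>F t in ?G. ?y t \<in> Rn m" using yW by eventually_elim (use WR in auto)
  have ylim: "(?y \<longlongrightarrow> w) ?G"
   unfolding tendsto_fun_iff
  proof
   fix i show "((\<lambda>t. ?y t i) \<longlongrightarrow> w i) ?G" by (cases "i = k") (auto simp: tendsto_ident_at)
  qed
  have zt: "(?zt \<longlongrightarrow> ?a (u w) w) ?G"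
   unfolding tendsto_fun_iff
  proof
   fix i
   show "((\<lambda>t. ?zt t i) \<longlongrightarrow> ?a (u w) w i) ?G"
   proof (cases "i < d")
    case True
    then show ?thesis using continuous_on_opn_tendsto[OF Wopn ucont[OF True] w ylim yR] by (simp add: append_vec_def)
   next
    case False
    then show ?thesis using ylim by (simp add: append_vec_def tendsto_fun_iff)
   qed
  qed
  have Qb: "\<forall>\<^sub>F t in ?G. \<bar>Q t l\<bar> \<le> 2 * (real d * C)" if l: "l < d" for l
   using yW ne
  proof eventually_elim
   case (elim t)
   have lt: "l1 m (\<lambda>i. ?y t i - w i) = \<bar>t - w k\<bar>"
   proof -
    have "l1 m (\<lambda>i. ?y t i - w i) = (\<Sum>i<m. if i = k then \<bar>t - w k\<bar> else 0)"
     unfolding l1_def by (rule sum.cong) auto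
    then show ?thesis using k by simp
   qed
   have "\<bar>u (?y t) l - u w l\<bar> \<le> 2 * (real d * C) * l1 m (\<lambda>i. ?y t i - w i)"
    using ulip[OF w elim(1)] coord_le_l1[OF l, of "\<lambda>l. u (?y t) l - u w l"] by linarith
   then have "\<bar>u (?y t) l - u w l\<bar> \<le> 2 * (real d * C) * \<bar>t - w k\<bar>" unfolding lt .
   moreover have "\<bar>t - w k\<bar> > 0" using elim(2) by simp
   ultimately show ?case unfolding Q_def abs_divide by (simp only: pos_divide_le_eq)
  qed
  have lim0: "((\<lambda>t. \<Sum>l<d. A j l w * (Q t l - q k w l)) \<longlongrightarrow> 0) ?G" if j: "j < d" for j
  proof -
   obtain c where c: "\<forall>\<^sub>F t in ?G. \<Phi> j (?zt t) - \<Phi> j (?a (u w) w) = (\<Sum>i<N. c t i * (?zt t i - ?a (u w) w i))"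
    "\<And>i. i < N ==> ((\<lambda>t. c t i) \<longlongrightarrow> pderiv_coord i (\<Phi> j) (?a (u w) w)) ?G"
   proof (rule strict_diff[OF Ob' \<Phi>k[OF j] aO(1)[OF w], of "\<lambda>_. ?a (u w) w" ?G ?zt])
    show "\<forall>\<^sub>F t in ?G. ?zt t \<in> Rn N" using yW by eventually_elim (rule aR)
   qed (use zt aR[OF w] in auto)
   have "((\<lambda>t. (\<Sum>l<d. (A j l w - c t l) * Q t l) + (- r k j w - c t (d + k)) ) \<longlongrightarrow> (\<Sum>l<d. 0) + 0) ?G"
   proof (intro tendsto_add tendsto_sum)
    fix l assume "l \<in> {..<d}"
    then have l: "l < d" by simp
    have "((\<lambda>t. A j l w - c t l) \<longlongrightarrow> A j l w - A j l w) ?G"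
     unfolding A_def using l by (intro tendsto_intros c(2)) (simp add: N_def)
    then have a0: "((\<lambda>t. \<bar>A j l w - c t l\<bar> * (2 * (real d * C))) \<longlongrightarrow> \<bar>A j l w - A j l w\<bar> * (2 * (real d * C))) ?G"
     by (intro tendsto_mult_right tendsto_rabs)
    show "((\<lambda>t. (A j l w - c t l) * Q t l) \<longlongrightarrow> 0) ?G"
    proof (rule Lim_null_comparison)
     show "\<forall>\<^sub>F t in ?G. norm ((A j l w - c t l) * Q t l) \<le> \<bar>A j l w - c t l\<bar> * (2 * (real d * C))"
      using Qb[OF l] by eventually_elim (auto simp: abs_mult intro!: mult_left_mono)
    qed (rule a0[unfolded diff_self abs_zero mult_zero_left])
   next
    have "((\<lambda>t. - r k j w - c t (d + k)) \<longlongrightarrow> - r k j w - pderiv_coord (d + k) (\<Phi> j) (?a (u w) w)) ?G"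
     using k by (intro tendsto_intros c(2)) (simp add: N_def)
    then show "((\<lambda>t. - r k j w - c t (d + k)) \<longlongrightarrow> 0) ?G" by (simp add: r_def)
   qed
   then show ?thesis
   proof (rule Lim_transform_eventually[OF tendsto_eq_rhs], goal_cases)
    case 2
    show ?case using c(1) yW ne
    proof eventually_elim
     case (elim t)
     have "0 = (\<Sum>i<N. c t i * (?zt t i - ?a (u w) w i))"
      using elim(1) u(2)[OF elim(2) j] u(2)[OF w j] by simp
     also have "\<dots> = (\<Sum>i<d. c t i * (u (?y t) i - u w i)) + (\<Sum>i\<in>{d..<N}. c t i * (?zt t i - ?a (u w) w i))"
     proof -
      have "{..<N} = {..<d} \<union> {d..<N}" by (auto simp: N_def)
      then have "(\<Sum>i<N. c t i * (?zt t i - ?a (u w) w i)) =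
        (\<Sum>i<d. c t i * (?zt t i - ?a (u w) w i)) + (\<Sum>i\<in>{d..<N}. c t i * (?zt t i - ?a (u w) w i))"
       by (simp add: sum.union_disjoint ivl_disj_int)
      moreover have "(\<Sum>i<d. c t i * (?zt t i - ?a (u w) w i)) = (\<Sum>i<d. c t i * (u (?y t) i - u w i))"
       by (rule sum.cong) (auto simp: append_vec_def)
      ultimately show ?thesis by simp
     qed
     also have "(\<Sum>i\<in>{d..<N}. c t i * (?zt t i - ?a (u w) w i)) = (\<Sum>i\<in>{d + k}. c t i * (?zt t i - ?a (u w) w i))"
      by (rule sum.mono_neutral_right) (use k in \<open>auto simp: N_def append_vec_def\<close>)
     also have "(\<Sum>i\<in>{d + k}. c t i * (?zt t i - ?a (u w) w i)) = c t (d + k) * (t - w k)"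
      by (simp add: append_vec_def)
     finally have z0: "0 = (\<Sum>i<d. c t i * (u (?y t) i - u w i)) + c t (d + k) * (t - w k)" .
     have "0 = ((\<Sum>i<d. c t i * (u (?y t) i - u w i)) + c t (d + k) * (t - w k)) / (t - w k)" unfolding z0[symmetric] by (rule div_0[symmetric])
     also have "\<dots> = (\<Sum>l<d. c t l * Q t l) + c t (d + k)"
      using elim(3) by (simp add: Q_def add_divide_distrib sum_divide_distrib)
     finally have "(\<Sum>l<d. c t l * Q t l) = - c t (d + k)" by simp
     then show ?case using q[OF w j, of k]
      by (simp add: left_diff_distrib right_diff_distrib sum_subtractf)
    qed
   qed simp
  qed
  have "((\<lambda>t. 2 * (\<Sum>j<d. \<bar>\<Sum>l<d. A j l w * (Q t l - q k w l)\<bar>)) \<longlongrightarrow> 2 * (\<Sum>j<d. \<bar>0\<bar>)) ?G"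
   by (intro tendsto_intros lim0) auto
  then have z: "((\<lambda>t. 2 * (\<Sum>j<d. \<bar>\<Sum>l<d. A j l w * (Q t l - q k w l)\<bar>)) \<longlongrightarrow> 0) ?G" by simp
  have "((\<lambda>t. Q t l - q k w l) \<longlongrightarrow> 0) ?G"
  proof (rule Lim_null_comparison[OF _ z], rule always_eventually, rule allI)
   fix t
   show "norm (Q t l - q k w l) \<le> 2 * (\<Sum>j<d. \<bar>\<Sum>l<d. A j l w * (Q t l - q k w l)\<bar>)"
    using Ainj[OF w, of "\<lambda>l. Q t l - q k w l"] coord_le_l1[OF l, of "\<lambda>l. Q t l - q k w l"] by simp
  qed
  then show ?thesis by (simp add: Q_def has_field_derivative_iff LIM_zero_iff)
 qed
 \<comment> \<open>Bootstrapping: if \<open>u\<close> is \<open>C^K\<close>, so are the coefficients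
   of the linear system for its derivative, and by \<open>Ck_open_solve\<close> the derivative is
   \<open>C^K\<close> as well.\<close>
 have "\<forall>l<d. Ck_open m K W (\<lambda>w. u w l)" for K
 proof (induction K)
  case 0
  show ?case using ucont WR by (simp add: continuous_map_opn)
 next
  case (Suc K)
  have comp: "Ck_open m K W (\<lambda>w. g (?a (u w) w))" if g: "Ck_open N K Ob g" for g
  proof (rule Ck_open_compose[OF Wopn Ob' g])
   fix i assume "i < N"
   show "Ck_open m K W (\<lambda>w. ?a (u w) w i)"
    using Suc by (cases "i < d") (simp_all add: append_vec_def Ck_open_coord[OF Wopn])
  qed (use aO(1) in auto)
  show ?case
  proof (intro allI impI)
   fix l assume l: "l < d"
   show "Ck_open m (Suc K) W (\<lambda>w. u w l)"
   proof (rule Ck_open_SucI[OF Wopn ucont[OF l], where D = "\<lambda>k w. q k w l"])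
    fix k assume k: "k < m"
    show "Ck_open m K W (\<lambda>w. q k w l)"
    proof (rule Ck_open_solve[OF Wopn Ainj, where b = "r k" and x = "\<lambda>l w. q k w l"])
     fix j l' assume "j < d" "l' < d"
     then show "Ck_open m K W (A j l')"
      unfolding A_def[abs_def] by (intro comp Ck_open_pderivD[OF \<Phi>k]) (auto simp: N_def)
    next
     fix j assume "j < d"
     then have "Ck_open m K W (\<lambda>w. (- 1) * pderiv_coord (d + k) (\<Phi> j) (?a (u w) w))"
      using k by (intro Ck_open_mult[OF Wopn] Ck_open_const[OF Wopn] comp Ck_open_pderivD[OF \<Phi>k]) (auto simp: N_def)
     then show "Ck_open m K W (r k j)" by (simp add: r_def[abs_def])
    qed (use q l in auto)
   qed (use der l in auto)
  qed
 qed
 then have smooth: "l < d ==> Cp_open m \<infinity> W (\<lambda>w. u w l)" for l by (simp add: Cp_open_def)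
 have "l1 d (\<lambda>l. u w0 l - u0 l) \<le> 2 * (\<Sum>j<d. \<bar>\<Phi> j (?a (u w0) w0) - \<Phi> j (?a u0 w0)\<bar>)"
  by (rule Elip[OF u0b ub We]) (use w0W in auto)
 then have "l1 d (\<lambda>l. u w0 l - u0 l) \<le> 0" using u(2)[OF w0W] \<Phi>0 by simp
 then have "u w0 l = u0 l" if "l < d" for l using coord_le_l1[OF that, of "\<lambda>l. u w0 l - u0 l"] by simp
 moreover have uR: "u w \<in> Rn d" if "w \<in> W" for w using u(1)[OF that] by (simp add: S_def)
 ultimately have "u w0 = u0" using u0 uR[OF w0W] by (metis (no_types, lifting) ext mem_Rn linorder_not_less)
 then show thesis using that[OF Wopn w0W] uR aO(1) u(2) smooth by blast
qed

text \<open>Multiplying the equations by the inverse of the partial Jacobian keeps the zero set and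
  turns that Jacobian into the identity.\<close>

lemma implicit_function:
 assumes Ob: "opn (d + m) Ob"
  and \<Phi>: "\<And>j. j < d ==> Cp_open (d + m) \<infinity> Ob (\<Phi> j)"
  and u0: "u0 \<in> Rn d" and w0: "w0 \<in> Rn m" and z0: "append_vec d u0 w0 \<in> Ob"
  and \<Phi>0: "\<And>j. j < d ==> \<Phi> j (append_vec d u0 w0) = 0"
  and inj: "\<And>x. (\<forall>j<d. (\<Sum>l<d. pderiv_coord l (\<Phi> j) (append_vec d u0 w0) * x l) = 0) ==> (\<forall>l<d. x l = 0)"
 obtains W u where "opn m W" "w0 \<in> W" "u w0 = u0"
  "\<And>w. w \<in> W ==> u w \<in> Rn d \<and> append_vec d (u w) w \<in> Ob"
  "\<And>w j. w \<in> W ==> j < d ==> \<Phi> j (append_vec d (u w) w) = 0"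
  "\<And>l. l < d ==> Cp_open m \<infinity> W (\<lambda>w. u w l)"
proof -
 let ?z = "append_vec d u0 w0"
 define A where "A j l = pderiv_coord l (\<Phi> j) ?z" for j l
 obtain B where B: "\<forall>j<d. \<forall>l<d. (\<Sum>k<d. B j k * A k l) = (if j = l then 1 else 0)"
  "\<forall>j<d. \<forall>l<d. (\<Sum>k<d. A j k * B k l) = (if j = l then 1 else 0)"
  using matrix_inverse_ex[of d A] inj[folded A_def] by blast
 have BA: "(\<Sum>k<d. B j k * A k l) = (if j = l then 1 else 0)" if "j < d" "l < d" for j l
  using B(1) that by simp
 have AB: "(\<Sum>k<d. A j k * B k l) = (if j = l then 1 else 0)" if "j < d" "l < d" for j l
  using B(2) that by simp
 define \<Psi> where "\<Psi> j z = (\<Sum>k<d. B j k * \<Phi> k z)" for j z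
 have D: "pderiv_coord l (\<Psi> j) ?z = (if j = l then 1 else 0)" if "j < d" "l < d" for j l
 proof -
  have "((\<lambda>t. \<Phi> k (?z(l := t))) has_real_derivative A k l) (at (?z l))" if "k < d" for k
   unfolding A_def by (rule Ck_open_1D(1)[OF Cp_open_Ck[OF \<Phi>[OF that]] Ob z0]) (use \<open>l < d\<close> in auto)
  then have "((\<lambda>t. \<Psi> j (?z(l := t))) has_real_derivative (\<Sum>k<d. B j k * A k l)) (at (?z l))"
   unfolding \<Psi>_def by (intro DERIV_sum DERIV_cmult) auto
  from pderiv_coord_eqI[OF this] show ?thesis using BA[OF that] by simp
 qed
 have zero: "\<Phi> j z = 0" if j: "j < d" and z: "\<And>k. k < d ==> \<Psi> k z = 0" for j z
 proof -
  have "0 = (\<Sum>k<d. A j k * \<Psi> k z)" using z by simp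
  also have "\<dots> = (\<Sum>i<d. (\<Sum>k<d. A j k * B k i) * \<Phi> i z)"
   unfolding \<Psi>_def sum_distrib_left sum_distrib_right by (subst sum.swap) (simp add: mult.assoc)
  also have "\<dots> = (\<Sum>i<d. (if j = i then 1 else 0) * \<Phi> i z)" using AB[OF j] by (intro sum.cong) auto
  also have "\<dots> = \<Phi> j z" by (rule sum_kron[OF j])
  finally show ?thesis by simp
 qed
 have smooth: "Cp_open (d + m) \<infinity> Ob (\<Psi> j)" if "j < d" for j
  unfolding \<Psi>_def[abs_def] by (intro Cp_open_sum[OF Ob] Cp_open_mult[OF Ob] Cp_open_const[OF Ob] \<Phi>) auto
 have \<Psi>0: "\<Psi> j ?z = 0" if "j < d" for j unfolding \<Psi>_def using \<Phi>0 by simp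
 show thesis
 proof (rule implicit_function_id[OF Ob smooth u0 w0 z0 \<Psi>0 D])
  fix W u
  assume Wu: "opn m W" "w0 \<in> W" "u w0 = u0"
   "\<And>w. w \<in> W ==> u w \<in> Rn d \<and> append_vec d (u w) w \<in> Ob"
   "\<And>w j. w \<in> W ==> j < d ==> \<Psi> j (append_vec d (u w) w) = 0"
   "\<And>l. l < d ==> Cp_open m \<infinity> W (\<lambda>w. u w l)"
  show thesis
  proof (rule that[OF Wu(1,2,3,4)])
   show "\<Phi> j (append_vec d (u w) w) = 0" if "w \<in> W" "j < d" for w j
    by (rule zero[OF that(2) Wu(5)[OF that(1)]])
  qed (use Wu(6) in auto)
 qed
qed

section \<open>Tubular neighborhoods\<close>

definition ds :: "nat => (nat => real) => (nat => real) => real" where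
 "ds m x y = sqrt (ip m (\<lambda>i. y i - x i) (\<lambda>i. y i - x i))"

definition normal :: "nat => (nat => real) set => (nat => real) => (nat => real) => bool" where
 "normal m M x v \<longleftrightarrow> v \<in> Rn m \<and> (\<forall>w\<in>tangent_space M x. ip m v w = 0)"

text \<open>A local form of Federer's reach: near \<open>x\<close> the manifold stays within curvature \<open>1/r\<close> of its
 tangent spaces.\<close>

definition reach_at :: "nat => (nat => real) set => (nat => real) => real => bool" where
 "reach_at m M x r \<longleftrightarrow> 0 < r \<and> r \<le> 1 \<and> (\<forall>y\<in>M. \<forall>z\<in>M. \<forall>v\<in>Rn m. ds m x y < r --> ds m x z < r -->
   normal m M y v --> ip m v v \<le> 1 -->
   r * ip m v (\<lambda>i. z i - y i) \<le> ip m (\<lambda>i. z i - y i) (\<lambda>i. z i - y i))"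

text \<open>The inserted 0 gives the supremum a value even if no radius is admissible; it is finite
  because \<open>reach_at\<close> bounds radii by 1.\<close>

definition reach :: "nat => (nat => real) set => (nat => real) => real" where
 "reach m M x = Sup (insert 0 {r. reach_at m M x r})"

lemma ds_nonneg: "0 \<le> ds m x y"
 by (simp add: ds_def ip_self_nonneg)

lemma ds_self: "ds m x x = 0"
 by (simp add: ds_def ip_zero)

lemma ip_minus_swap: "ip m (\<lambda>i. x i - y i) (\<lambda>i. x i - y i) = ip m (\<lambda>i. y i - x i) (\<lambda>i. y i - x i)"
 unfolding ip_def by (rule sum.cong) (auto simp: algebra_simps)

lemma ds_commute: "ds m x y = ds m y x"
 unfolding ds_def by (simp only: ip_minus_swap[of m x y])

lemma ds_triangle: "ds m x z \<le> ds m x y + ds m y z"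
proof -
 have "(\<lambda>i. z i - x i) = (\<lambda>i. (y i - x i) + (z i - y i))" by (simp add: fun_eq_iff)
 then show ?thesis
  using sqrt_ip_triangle[of m "\<lambda>i. y i - x i" "\<lambda>i. z i - y i"] by (simp only: ds_def)
qed

lemma ds_less_iff: "r > 0 ==> ds m x y < r \<longleftrightarrow> ip m (\<lambda>i. y i - x i) (\<lambda>i. y i - x i) < r\<^sup>2"
 unfolding ds_def by (metis ip_self_nonneg less_imp_le real_less_lsqrt real_sqrt_less_iff real_sqrt_unique)

lemma coord_le_ds: "i < m ==> \<bar>y i - x i\<bar> \<le> ds m x y"
 unfolding ds_def by (rule abs_coord_le_ip)

text \<open>For negative \<open>x\<close> the smaller factor gives the larger product, and 0 is the
  bound; this is what allows radii to be shrunk in \<open>reach_at\<close>.\<close>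

lemma scale_le_max:
 fixes s r x :: real
 assumes "0 < s" "s \<le> r"
 shows "s * x \<le> max 0 (r * x)"
proof (cases "x \<ge> 0")
 case True
 then have "s * x \<le> r * x" using assms(2) by (rule mult_right_mono[rotated])
 then show ?thesis by simp
next
 case False
 then have "s * x \<le> 0" using assms(1) by (intro mult_nonneg_nonpos) auto
 then show ?thesis by simp
qed

lemma reach_at_mono:
 assumes "reach_at m M x r" "0 < s" "s \<le> r"
 shows "reach_at m M x s"
 unfolding reach_at_def
proof (intro conjI ballI impI)
 fix y z v assume a: "y \<in> M" "z \<in> M" "v \<in> Rn m" "ds m x y < s" "ds m x z < s" "normal m M y v" "ip m v v \<le> 1"
 have "r * ip m v (\<lambda>i. z i - y i) \<le> ip m (\<lambda>i. z i - y i) (\<lambda>i. z i - y i)"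
  using assms a unfolding reach_at_def by (meson order_less_le_trans)
 moreover have "s * ip m v (\<lambda>i. z i - y i) \<le> max 0 (r * ip m v (\<lambda>i. z i - y i))"
  by (rule scale_le_max[OF assms(2,3)])
 ultimately show "s * ip m v (\<lambda>i. z i - y i) \<le> ip m (\<lambda>i. z i - y i) (\<lambda>i. z i - y i)"
  using ip_self_nonneg[of m "\<lambda>i. z i - y i"] by linarith
qed (use assms in \<open>auto simp: reach_at_def\<close>)

lemma reach_at_shift:
 assumes "reach_at m M x r" "ds m x y < r"
 shows "reach_at m M y (r - ds m x y)"
proof -
 let ?s = "r - ds m x y"
 have s: "0 < ?s" "?s \<le> r" using assms(2) ds_nonneg[of m x y] by auto
 have r: "reach_at m M x r" by (rule assms(1))
 show ?thesis
  unfolding reach_at_def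
 proof (intro conjI ballI impI)
  fix y' z v assume a: "y' \<in> M" "z \<in> M" "v \<in> Rn m" "ds m y y' < ?s" "ds m y z < ?s" "normal m M y' v" "ip m v v \<le> 1"
  have "ds m x y' < r" "ds m x z < r"
   using ds_triangle[of m x y' y] ds_triangle[of m x z y] a(4,5) by auto
  then have "r * ip m v (\<lambda>i. z i - y' i) \<le> ip m (\<lambda>i. z i - y' i) (\<lambda>i. z i - y' i)"
   using r a unfolding reach_at_def by blast
  moreover have "?s * ip m v (\<lambda>i. z i - y' i) \<le> max 0 (r * ip m v (\<lambda>i. z i - y' i))"
   by (rule scale_le_max[OF s])
  ultimately show "?s * ip m v (\<lambda>i. z i - y' i) \<le> ip m (\<lambda>i. z i - y' i) (\<lambda>i. z i - y' i)"
   using ip_self_nonneg[of m "\<lambda>i. z i - y' i"] by linarith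
 qed (use s r in \<open>auto simp: reach_at_def\<close>)
qed

lemma reach_bdd: "bdd_above (insert 0 {r. reach_at m M x r})"
 unfolding bdd_above_def by (intro exI[of _ 1]) (auto simp: reach_at_def)

lemma reach_upper: "reach_at m M x r ==> r \<le> reach m M x"
 unfolding reach_def by (rule cSup_upper[OF _ reach_bdd]) simp

lemma reach_nonneg: "0 \<le> reach m M x"
 unfolding reach_def by (rule cSup_upper[OF _ reach_bdd]) simp

lemma reach_at_less:
 assumes "0 < r" "r < reach m M x"
 shows "reach_at m M x r"
proof -
 obtain s where "s \<in> insert 0 {r. reach_at m M x r}" "r < s"
  using assms(2) unfolding reach_def by (auto elim: less_cSupE)
 then show ?thesis using assms(1) reach_at_mono[of m M x s r] by auto
qed

text \<open>A ball of radius \<open>r\<close> about \<open>x\<close> contains the ball of radius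
  \<open>r - ds m x y\<close> about \<open>y\<close>, so an admissible radius at \<open>x\<close>
  yields one at \<open>y\<close>.\<close>

lemma reach_lipschitz: "reach m M x - ds m x y \<le> reach m M y"
proof (rule field_le_epsilon)
 fix e :: real assume e: "e > 0"
 show "reach m M x - ds m x y \<le> reach m M y + e"
 proof (cases "ds m x y + e < reach m M x")
  case True
  define r where "r = reach m M x - e"
  have "reach_at m M x r"
   by (rule reach_at_less) (use True e ds_nonneg[of m x y] in \<open>auto simp: r_def\<close>)
  from reach_upper[OF reach_at_shift[OF this, of y]] True show ?thesis by (simp add: r_def)
 next
  case False
  then show ?thesis using reach_nonneg[of m M y] by linarith
 qed
qed

lemma continuous_on_reach: "continuous_on S (reach m M)"
 unfolding continuous_on_def
proof
 fix x
 have "((\<lambda>y. ds m x y) \<longlongrightarrow> ds m x x) (at x within S)"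
  unfolding ds_def ip_def using continuous_on_coord[of UNIV] unfolding continuous_on_def
  by (intro tendsto_intros) (auto intro: tendsto_within_subset)
 then have z: "((\<lambda>y. ds m x y) \<longlongrightarrow> 0) (at x within S)" by (simp add: ds_self)
 have "((\<lambda>y. reach m M y - reach m M x) \<longlongrightarrow> 0) (at x within S)"
 proof (rule Lim_null_comparison[OF _ z], rule always_eventually, rule allI)
  fix y show "norm (reach m M y - reach m M x) \<le> ds m x y"
   using reach_lipschitz[of m M x y] reach_lipschitz[of m M y x] ds_commute[of m x y] by simp
 qed
 then show "(reach m M \<longlongrightarrow> reach m M x) (at x within S)" by (simp add: LIM_zero_iff)
qed

lemma reach_at_use:
 assumes "reach_at m M x r" "y \<in> M" "z \<in> M" "ds m x y < r" "ds m x z < r" "normal m M y v" "c > 0" "sqrt (ip m v v) < c"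
 shows "r * ip m v (\<lambda>i. z i - y i) \<le> c * ip m (\<lambda>i. z i - y i) (\<lambda>i. z i - y i)"
proof -
 let ?v = "\<lambda>i. v i / c"
 have "normal m M y ?v" using assms(6) by (auto simp: normal_def mem_Rn ip_divide)
 moreover have "ip m v v < c\<^sup>2" using assms(7,8) ip_self_nonneg[of m v]
  by (metis real_sqrt_less_iff real_sqrt_unique less_imp_le)
 then have "ip m ?v ?v \<le> 1" using assms(7) by (simp add: ip_divide power2_eq_square divide_le_eq)
 ultimately have "r * ip m ?v (\<lambda>i. z i - y i) \<le> ip m (\<lambda>i. z i - y i) (\<lambda>i. z i - y i)"
  using assms(1-5) unfolding reach_at_def normal_def by blast
 then show ?thesis using assms(7) by (simp add: ip_divide pos_divide_le_eq mult.commute)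
qed

lemma ex_uniform:
 assumes "finite I" "\<And>i. i \<in> I ==> \<exists>e>0. \<exists>C\<ge>0. P i e (C::real)"
  and mono: "\<And>i e C e' C'. P i e C ==> 0 < e' ==> e' \<le> (e::real) ==> C \<le> C' ==> P i e' C'"
 shows "\<exists>e>0. \<exists>C\<ge>0. \<forall>i\<in>I. P i e C"
 using assms(1,2)
proof (induction I rule: finite_induct)
 case empty
 show ?case by (intro exI[of _ 1] exI[of _ 0] conjI) auto
next
 case (insert j I)
 obtain e C where e: "e > 0" "C \<ge> 0" "\<forall>i\<in>I. P i e C" using insert.IH insert.prems by blast
 obtain e' C' where e': "e' > 0" "C' \<ge> 0" "P j e' C'" using insert.prems by blast
 have "\<forall>i\<in>insert j I. P i (min e e') (C + C')"
 proof
  fix i assume "i \<in> insert j I"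
  then show "P i (min e e') (C + C')"
  proof
   assume "i = j"
   then show ?thesis using mono[OF e'(3), of "min e e'" "C + C'"] e e' by simp
  next
   assume "i \<in> I"
   then show ?thesis using mono[of i e C "min e e'" "C + C'"] e e' by simp
  qed
 qed
 moreover have "min e e' > 0" "C + C' \<ge> 0" using e e' by auto
 ultimately show ?case by blast
qed

text \<open>The tangent space is spanned by the first \<open>d\<close> partial derivatives of
  \<open>\<psi>\<close>. Normality becomes \<open>d\<close> equations with smooth coefficients in
  the chart coordinates, to which the implicit function theorem applies.\<close>

lemma chart_normal_iff:
 assumes c: "chart n p d M U V \<phi> \<psi>" and u: "u \<in> V" "u \<in> Rn d" and v: "v \<in> Rn n"
 shows "normal n M (\<psi> u) v \<longleftrightarrow> (\<forall>j<d. (\<Sum>i<n. v i * pderiv_coord j (\<lambda>y. \<psi> y i) u) = 0)"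
proof -
 interpret chart n p d M U V \<phi> \<psi> by (rule c)
 have \<psi>u: "\<psi> u \<in> U" using u \<psi>U by auto
 have \<psi>M: "\<psi> u \<in> M" using M_iff[OF \<psi>u] u by (simp add: \<phi>\<psi> mem_Rn)
 have ipJ: "ip n v (J u c) = (\<Sum>j<n. c j * (\<Sum>i<n. v i * pderiv_coord j (\<lambda>y. \<psi> y i) u))" for c
 proof -
  have "ip n v (J u c) = (\<Sum>i<n. \<Sum>j<n. c j * (v i * pderiv_coord j (\<lambda>y. \<psi> y i) u))"
   unfolding ip_def J_def by (rule sum.cong) (auto simp: lapp_def grad_def sum_distrib_left mult_ac)
  also have "\<dots> = (\<Sum>j<n. c j * (\<Sum>i<n. v i * pderiv_coord j (\<lambda>y. \<psi> y i) u))"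
   by (subst sum.swap) (simp add: sum_distrib_left)
  finally show ?thesis .
 qed
 show ?thesis
 proof
  assume N: "normal n M (\<psi> u) v"
  show "\<forall>j<d. (\<Sum>i<n. v i * pderiv_coord j (\<lambda>y. \<psi> y i) u) = 0"
  proof (intro allI impI)
   fix j assume j: "j < d"
   have sR: "stdb j \<in> Rn n" "stdb j \<in> Rn d" using j dn by (auto intro: stdb_Rn)
   have "J u (stdb j) \<in> tangent_space M (\<psi> u)"
    using tangent_space_iff[OF \<psi>u \<psi>M] KJ[OF u(1) sR(1)] sR by (simp add: J_def lapp_Rn)
   then have "ip n v (J u (stdb j)) = 0" using N by (simp add: normal_def)
   moreover have "ip n v (J u (stdb j)) = (\<Sum>k<n. (if k = j then 1 else 0) * (\<Sum>i<n. v i * pderiv_coord k (\<lambda>y. \<psi> y i) u))"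
    unfolding ipJ stdb_def by simp
   moreover have "\<dots> = (\<Sum>i<n. v i * pderiv_coord j (\<lambda>y. \<psi> y i) u)" using j dn by (intro sum_kron) simp
   ultimately show "(\<Sum>i<n. v i * pderiv_coord j (\<lambda>y. \<psi> y i) u) = 0" by simp
  qed
 next
  assume R: "\<forall>j<d. (\<Sum>i<n. v i * pderiv_coord j (\<lambda>y. \<psi> y i) u) = 0"
  have "ip n v w = 0" if w: "w \<in> tangent_space M (\<psi> u)" for w
  proof -
   have w': "w \<in> Rn n" "K (\<psi> u) w \<in> Rn d" using tangent_space_iff[OF \<psi>u \<psi>M] w by auto
   have "w = J u (K (\<psi> u) w)" using JK[OF \<psi>u w'(1)] u by (simp add: \<phi>\<psi>)
   then have "ip n v w = (\<Sum>j<n. K (\<psi> u) w j * (\<Sum>i<n. v i * pderiv_coord j (\<lambda>y. \<psi> y i) u))" using ipJ by metis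
   also have "\<dots> = 0"
   proof (rule sum.neutral, rule ballI)
    fix j show "K (\<psi> u) w j * (\<Sum>i<n. v i * pderiv_coord j (\<lambda>y. \<psi> y i) u) = 0"
     using R w'(2) by (cases "j < d") (auto simp: mem_Rn)
   qed
   finally show ?thesis .
  qed
  then show "normal n M (\<psi> u) v" using v by (simp add: normal_def)
 qed
qed

text \<open>In a chart, \<open>z - y\<close> is a tangent vector at \<open>y\<close> plus a Taylor
  remainder of second order. A unit normal sees the remainder only, which is at most
  \<open>K'\<close> times the squared distance; any sufficiently small \<open>r\<close> with
  \<open>r * K' \<le> 1\<close> is then admissible.\<close>

lemma reach_at_exists:
 assumes M: "submanifold m \<infinity> d M" and x: "x \<in> M"
 shows "\<exists>r. reach_at m M x r"
proof -
 obtain U V \<phi> \<psi> where c: "chart m \<infinity> d M U V \<phi> \<psi>" and xU: "x \<in> U"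
  by (rule submanifold_chart[OF M x]) auto
 interpret chart m \<infinity> d M U V \<phi> \<psi> by (rule c)
 define u0 where "u0 = \<phi> x"
 have u0V: "u0 \<in> V" using \<phi>V xU by (auto simp: u0_def)
 define P where "P i e C \<longleftrightarrow> (\<forall>a\<in>bx m u0 e. \<forall>b\<in>bx m u0 e.
   \<bar>\<psi> b i - \<psi> a i - (\<Sum>j<m. pderiv_coord j (\<lambda>y. \<psi> y i) a * (b j - a j))\<bar> \<le> C * (l1 m (\<lambda>j. b j - a j))\<^sup>2)"
  for i e C
 have "\<exists>e>0. \<exists>C\<ge>0. P i e C" if "i \<in> {..<m}" for i
 proof -
  have \<psi>2: "Ck_open m (Suc (Suc 0)) V (\<lambda>y. \<psi> y i)" using Cp_open_Ck[OF \<psi>p] that by simp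
  show ?thesis unfolding P_def by (rule taylor2[OF V \<psi>2 u0V]) blast
 qed
 then have "\<exists>e>0. \<exists>C\<ge>0. \<forall>i\<in>{..<m}. P i e C"
 proof (rule ex_uniform[OF finite_lessThan])
  fix i e C e' C' assume P: "P i e C" and e: "0 < e'" "e' \<le> e" "C \<le> C'"
  show "P i e' C'"
   unfolding P_def
  proof (intro ballI)
   fix a b assume ab: "a \<in> bx m u0 e'" "b \<in> bx m u0 e'"
   then have "a \<in> bx m u0 e" "b \<in> bx m u0 e" using bx_mono[OF e(2)] by blast+
   then have "\<bar>\<psi> b i - \<psi> a i - (\<Sum>j<m. pderiv_coord j (\<lambda>y. \<psi> y i) a * (b j - a j))\<bar> \<le> C * (l1 m (\<lambda>j. b j - a j))\<^sup>2"
    using P unfolding P_def by blast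
   also have "\<dots> \<le> C' * (l1 m (\<lambda>j. b j - a j))\<^sup>2" using e(3) by (intro mult_right_mono) auto
   finally show "\<bar>\<psi> b i - \<psi> a i - (\<Sum>j<m. pderiv_coord j (\<lambda>y. \<psi> y i) a * (b j - a j))\<bar> \<le> C' * (l1 m (\<lambda>j. b j - a j))\<^sup>2" .
  qed
 qed
 then obtain e1 C1 where e1: "e1 > 0" "C1 \<ge> 0" "\<And>i. i < m ==> P i e1 C1" by auto
 obtain e2 C2 where e2: "e2 > 0" "C2 \<ge> 0"
  "\<And>k a b. k < m ==> a \<in> bx m x e2 ==> b \<in> bx m x e2 ==> \<bar>\<phi> b k - \<phi> a k\<bar> \<le> C2 * l1 m (\<lambda>i. b i - a i)"
  by (rule loc_lip_family[of m U "{..<m}" "\<lambda>k y. \<phi> y k" x]) (use U \<phi>1 xU in auto)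
 have xR: "x \<in> Rn m" using xU U_Rn by auto
 let ?F = "inf (nhds x) (principal (Rn m))"
 have \<phi>R: "\<forall>\<^sub>F y in ?F. \<phi> y \<in> Rn m"
  using eventually_nb_in[OF U xU] by eventually_elim (use \<phi>V V_Rn in auto)
 have "(\<phi> \<longlongrightarrow> u0) ?F"
 proof (rule tendsto_Rn[OF \<phi>R])
  show "u0 \<in> Rn m" using u0V V_Rn by auto
  show "((\<lambda>y. \<phi> y i) \<longlongrightarrow> u0 i) ?F" if "i < m" for i
   unfolding u0_def by (rule continuous_on_nb[OF U Ck_open_continuous[OF U_Rn \<phi>1[OF that]] xU])
 qed
 then have "\<forall>\<^sub>F y in ?F. \<phi> y \<in> bx m u0 e1"
  by (rule opn_eventually[OF bx_opn _ _ \<phi>R, rotated]) (use u0V V_Rn e1(1) in \<open>auto simp: bx_def\<close>)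
 then have "\<forall>\<^sub>F y in ?F. y \<in> U \<and> \<phi> y \<in> bx m u0 e1" using eventually_nb_in[OF U xU] by eventually_elim auto
 then obtain e3 where e3: "e3 > 0" "\<And>y. y \<in> bx m x e3 ==> y \<in> U \<and> \<phi> y \<in> bx m u0 e1"
  unfolding eventually_nb[OF xR] by blast
 \<comment> \<open>\<open>D\<close> bounds chart distance by ambient distance: \<open>C2\<close> is
   a Lipschitz constant of the components of the chart, one factor \<open>m\<close> sums these
   components, the other compares sum norm and Euclidean norm.\<close>
 define D where "D = real m * C2 * real m"
 define K' where "K' = real m * (C1 * D\<^sup>2)"
 have K'0: "K' \<ge> 0" unfolding K'_def using e1(2) by (intro mult_nonneg_nonneg) auto
 define r where "r = min (min e2 e3) (min 1 (1 / (K' + 1)))"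
 have r: "r > 0" "r \<le> e2" "r \<le> e3" "r \<le> 1" "r * K' \<le> 1"
 proof -
  show "r > 0" unfolding r_def using e2(1) e3(1) K'0 by simp
  show "r \<le> e2" "r \<le> e3" "r \<le> 1" unfolding r_def by linarith+
  have "r * K' \<le> 1 / (K' + 1) * K'" unfolding r_def using K'0 by (intro mult_right_mono) auto
  also have "\<dots> \<le> 1" using K'0 by (simp add: field_simps)
  finally show "r * K' \<le> 1" .
 qed
 have inbx: "y \<in> bx m x e2" "y \<in> bx m x e3" if "y \<in> M" "ds m x y < r" for y
 proof -
  have "\<bar>y i - x i\<bar> < r" if "i < m" for i using coord_le_ds[OF that, of y x] \<open>ds m x y < r\<close> by linarith
  then have "y \<in> bx m x r" using \<open>y \<in> M\<close> MR by (auto simp: bx_def)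
  then show "y \<in> bx m x e2" "y \<in> bx m x e3" using bx_mono[OF r(2)] bx_mono[OF r(3)] by blast+
 qed
 have "r * ip m v (\<lambda>i. z i - y i) \<le> ip m (\<lambda>i. z i - y i) (\<lambda>i. z i - y i)"
  if y: "y \<in> M" "ds m x y < r" and z: "z \<in> M" "ds m x z < r" and v: "normal m M y v" "ip m v v \<le> 1" for y z v
 proof -
  let ?\<Delta> = "\<lambda>i. z i - y i"
  define a b where "a = \<phi> y" and "b = \<phi> z"
  have yU: "y \<in> U" and zU: "z \<in> U" and ab: "a \<in> bx m u0 e1" "b \<in> bx m u0 e1"
   using e3(2) inbx y z by (auto simp: a_def b_def)
  have aV: "a \<in> V" using \<phi>V yU by (auto simp: a_def)
  have \<psi>a: "\<psi> a = y" and \<psi>b: "\<psi> b = z" using yU zU by (simp_all add: a_def b_def \<psi>\<phi>)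
  have aR: "a \<in> Rn d" "b \<in> Rn d" using M_iff[OF yU] M_iff[OF zU] y z by (auto simp: a_def b_def mem_Rn)
  have vR: "v \<in> Rn m" using v by (simp add: normal_def)
  define L where "L = l1 m (\<lambda>j. b j - a j)"
  have cj: "(\<Sum>i<m. v i * (\<Sum>j<m. pderiv_coord j (\<lambda>y. \<psi> y i) a * (b j - a j))) = 0"
  proof -
   have nj: "\<forall>j<d. (\<Sum>i<m. v i * pderiv_coord j (\<lambda>y. \<psi> y i) a) = 0"
    using chart_normal_iff[OF c aV aR(1) vR] v \<psi>a by simp
   have "(\<Sum>i<m. v i * (\<Sum>j<m. pderiv_coord j (\<lambda>y. \<psi> y i) a * (b j - a j))) =
     (\<Sum>i<m. \<Sum>j<m. (b j - a j) * (v i * pderiv_coord j (\<lambda>y. \<psi> y i) a))"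
    by (simp add: sum_distrib_left mult_ac)
   also have "\<dots> = (\<Sum>j<m. (b j - a j) * (\<Sum>i<m. v i * pderiv_coord j (\<lambda>y. \<psi> y i) a))"
    by (subst sum.swap) (simp add: sum_distrib_left)
   also have "\<dots> = 0"
   proof (rule sum.neutral, rule ballI)
    fix j show "(b j - a j) * (\<Sum>i<m. v i * pderiv_coord j (\<lambda>y. \<psi> y i) a) = 0"
     using nj aR by (cases "j < d") (auto simp: mem_Rn)
   qed
   finally show ?thesis .
  qed
  have "ip m v ?\<Delta> = (\<Sum>i<m. v i * (\<psi> b i - \<psi> a i - (\<Sum>j<m. pderiv_coord j (\<lambda>y. \<psi> y i) a * (b j - a j))))"
   using cj unfolding ip_def \<psi>a \<psi>b by (simp add: right_diff_distrib sum_subtractf)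
  also have "\<dots> \<le> (\<Sum>i<m. C1 * L\<^sup>2)"
  proof (rule sum_mono)
   fix i assume "i \<in> {..<m}"
   then have i: "i < m" by simp
   let ?R = "\<psi> b i - \<psi> a i - (\<Sum>j<m. pderiv_coord j (\<lambda>y. \<psi> y i) a * (b j - a j))"
   have "\<bar>?R\<bar> \<le> C1 * L\<^sup>2" using e1(3)[OF i] ab unfolding P_def L_def by blast
   moreover have "\<bar>v i\<bar> \<le> 1"
    using abs_coord_le_ip[OF i, of v] v(2) by (meson order_trans real_sqrt_le_1_iff)
   ultimately have "\<bar>v i\<bar> * \<bar>?R\<bar> \<le> 1 * (C1 * L\<^sup>2)" by (intro mult_mono) auto
   moreover have "v i * ?R \<le> \<bar>v i\<bar> * \<bar>?R\<bar>" unfolding abs_mult[symmetric] by (rule abs_ge_self)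
   ultimately show "v i * ?R \<le> C1 * L\<^sup>2" by linarith
  qed
  also have "\<dots> = real m * (C1 * L\<^sup>2)" by simp
  also have "\<dots> \<le> real m * (C1 * (D * sqrt (ip m ?\<Delta> ?\<Delta>))\<^sup>2)"
  proof (intro mult_left_mono power_mono)
   have "L \<le> (\<Sum>j<m. C2 * l1 m ?\<Delta>)"
    unfolding L_def l1_def[of m "\<lambda>j. b j - a j"]
   proof (rule sum_mono)
    fix j assume "j \<in> {..<m}"
    then show "\<bar>b j - a j\<bar> \<le> C2 * l1 m ?\<Delta>" unfolding a_def b_def
     using e2(3)[of j y z] inbx(1)[OF y] inbx(1)[OF z] by simp
   qed
   also have "\<dots> = (real m * C2) * l1 m ?\<Delta>" by simp
   also have "\<dots> \<le> (real m * C2) * (real m * sqrt (ip m ?\<Delta> ?\<Delta>))"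
    using e2(2) by (intro mult_left_mono l1_le_ip) auto
   finally show "L \<le> D * sqrt (ip m ?\<Delta> ?\<Delta>)" by (simp add: D_def mult_ac)
  qed (use e1(2) l1_nonneg in \<open>auto simp: L_def\<close>)
  also have "\<dots> = K' * ip m ?\<Delta> ?\<Delta>"
   by (simp add: K'_def power_mult_distrib ip_self_nonneg)
  finally have le: "ip m v ?\<Delta> \<le> K' * ip m ?\<Delta> ?\<Delta>" .
  have "r * ip m v ?\<Delta> \<le> r * (K' * ip m ?\<Delta> ?\<Delta>)" using le r(1) by (intro mult_left_mono) auto
  also have "\<dots> = (r * K') * ip m ?\<Delta> ?\<Delta>" by simp
  also have "\<dots> \<le> 1 * ip m ?\<Delta> ?\<Delta>" using r(5) ip_self_nonneg by (intro mult_right_mono)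
  finally show ?thesis by simp
 qed
 then have "reach_at m M x r" unfolding reach_at_def using r by blast
 then show ?thesis ..
qed

lemma reach_pos: "submanifold m \<infinity> d M ==> x \<in> M ==> 0 < reach m M x"
 using reach_at_exists[of m d M x] reach_upper[of m M x] by (force simp: reach_at_def)

text \<open>Put \<Delta> = y - x = v - w. The condition of \<open>reach_at\<close> for radius 3c and
  normals shorter than c gives \<open>3 <v, \<Delta>> \<le> |\<Delta>|^2\<close> and the same for
  -w; their sum is \<open>3 |\<Delta>|^2 \<le> 2 |\<Delta>|^2\<close>. This dictates the tube
  radius, a quarter of the reach: the normals are shorter than c, so the distance of the feet is
  less than 3c, which is less than the reach 4c of \<open>x\<close>.\<close>

lemma tube_inj_aux:
 assumes xy: "x \<in> M" "y \<in> M" and M: "M \<subseteq> Rn m" and nv: "normal m M x v" "normal m M y w"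
  and v: "sqrt (ip m v v) < reach m M x / 4" and w: "sqrt (ip m w w) < reach m M y / 4"
  and eq: "\<And>i. x i + v i = y i + w i" and le: "reach m M y \<le> reach m M x"
 shows "x = y"
proof -
 define c where "c = reach m M x / 4"
 have vc: "sqrt (ip m v v) < c" "sqrt (ip m w w) < c" using v w le by (auto simp: c_def)
 have "0 \<le> sqrt (ip m v v)" by (simp add: ip_self_nonneg)
 then have c: "c > 0" using vc by linarith
 have yx: "(\<lambda>i. y i - x i) = (\<lambda>i. v i - w i)" using eq by (auto simp: fun_eq_iff algebra_simps)
 have xy': "(\<lambda>i. x i - y i) = (\<lambda>i. w i - v i)" using eq by (auto simp: fun_eq_iff algebra_simps)
 have "ds m x y \<le> sqrt (ip m v v) + sqrt (ip m w w)"
 proof -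
  have "(\<lambda>i. y i - x i) = (\<lambda>i. v i + (- 1) * w i)" unfolding yx by simp
  moreover have "ip m (\<lambda>i. (- 1) * w i) (\<lambda>i. (- 1) * w i) = ip m w w" unfolding ip_scale by simp
  ultimately show ?thesis
   unfolding ds_def using sqrt_ip_triangle[of m v "\<lambda>i. (- 1) * w i"] by (simp only:)
 qed
 then have d: "ds m x y < 3 * c" using vc c by linarith
 have R: "reach_at m M x (3 * c)" by (rule reach_at_less) (use c in \<open>auto simp: c_def\<close>)
 have d0: "ds m x x < 3 * c" using c by (simp add: ds_self)
 have 1: "3 * c * ip m v (\<lambda>i. y i - x i) \<le> c * ip m (\<lambda>i. y i - x i) (\<lambda>i. y i - x i)"
  by (rule reach_at_use[OF R xy d0 d nv(1) c vc(1)])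
 have 2: "3 * c * ip m w (\<lambda>i. x i - y i) \<le> c * ip m (\<lambda>i. x i - y i) (\<lambda>i. x i - y i)"
  by (rule reach_at_use[OF R xy(2,1) d d0 nv(2) c vc(2)])
 define I where "I = ip m (\<lambda>i. v i - w i) (\<lambda>i. v i - w i)"
 have I2: "ip m (\<lambda>i. w i - v i) (\<lambda>i. w i - v i) = I" unfolding I_def by (rule ip_minus_swap)
 have cancel: "3 * a \<le> b" if "3 * c * a \<le> c * b" for a b
 proof -
  have "0 \<le> c * (b - 3 * a)" using that by (simp add: algebra_simps)
  then show ?thesis using c by (simp add: zero_le_mult_iff)
 qed
 have "3 * ip m v (\<lambda>i. v i - w i) \<le> I"
  by (rule cancel[OF 1[unfolded yx I_def[symmetric]]])
 moreover have "3 * ip m w (\<lambda>i. w i - v i) \<le> I"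
  by (rule cancel[OF 2[unfolded xy' I2]])
 moreover have "ip m v (\<lambda>i. v i - w i) + ip m w (\<lambda>i. w i - v i) = I"
  unfolding I_def ip_diff by (simp add: ip_commute)
 ultimately have "I \<le> 0" using ip_self_nonneg[of m "\<lambda>i. v i - w i"] unfolding I_def[symmetric] by linarith
 then have I0: "I = 0" using ip_self_nonneg[of m "\<lambda>i. v i - w i"] unfolding I_def[symmetric] by linarith
 have "(\<lambda>i. v i - w i) \<in> Rn m" using nv by (simp add: normal_def mem_Rn)
 then have "(\<lambda>i. v i - w i) = (\<lambda>_. 0)" using ip_self_eq_0 I0 unfolding I_def by blast
 then show ?thesis using yx by (auto simp: fun_eq_iff)
qed

lemma tube_inj:
 assumes xy: "x \<in> M" "y \<in> M" and M: "M \<subseteq> Rn m" and nv: "normal m M x v" "normal m M y w"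
  and v: "sqrt (ip m v v) < reach m M x / 4" and w: "sqrt (ip m w w) < reach m M y / 4"
  and eq: "\<And>i. x i + v i = y i + w i"
 shows "x = y"
proof (cases "reach m M y \<le> reach m M x")
 case True
 then show ?thesis using tube_inj_aux[OF xy M nv v w eq] by blast
next
 case False
 then show ?thesis using tube_inj_aux[OF xy(2,1) M nv(2,1) w v eq[symmetric]] by auto
qed

text \<open>If \<open>D\<close> were positive, \<open>h'\<close> would be positive immediately to
  the right of 0 and the mean value theorem would give \<open>h t > h 0\<close>. Comparison on the
  right side and differentiability of \<open>h'\<close> at 0 suffice.\<close>

lemma second_derivative_test:
 fixes h h' :: "real => real"
 assumes e: "e > 0" and h: "\<And>t. \<bar>t\<bar> < e ==> (h has_real_derivative h' t) (at t)"
  and h': "(h' has_real_derivative D) (at 0)" "h' 0 = 0" and le: "\<And>t. 0 < t ==> t < e ==> h t \<le> h 0"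
 shows "D \<le> 0"
proof (rule ccontr)
 assume "\<not> D \<le> 0"
 then obtain \<delta> where \<delta>: "\<delta> > 0" "\<And>s. s > 0 ==> s < \<delta> ==> h' 0 < h' (0 + s)"
  using DERIV_pos_inc_right[OF h'(1)] by auto
 define t where "t = min e \<delta> / 2"
 have t: "0 < t" "t < e" "t < \<delta>" using e \<delta>(1) by (auto simp: t_def)
 obtain z where z: "0 < z" "z < t" "h t - h 0 = (t - 0) * h' z"
  using MVT2[of 0 t h h'] h t by auto
 have "h' z > 0" using \<delta>(2)[of z] z t h'(2) by auto
 then have "h t - h 0 > 0" using z t by simp
 then show False using le[OF t(1,2)] by linarith
qed

lemma opn_preimage_open:
 assumes U: "opn n U" and h: "continuous_on U h" and T: "open T"
 shows "opn n {x \<in> U. h x \<in> T}"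
proof -
 obtain S where S: "open S" "U = Rn n \<inter> S" using U openin_Euclidean_space_iff by metis
 obtain A where A: "open A" "A \<inter> U = h -` T \<inter> U"
  using h T unfolding continuous_on_open_invariant by metis
 have "{x \<in> U. h x \<in> T} = Rn n \<inter> (S \<inter> A)" using A S by blast
 moreover have "open (S \<inter> A)" using S(1) A(1) by (rule open_Int)
 ultimately show ?thesis unfolding openin_Euclidean_space_iff by blast
qed

lemma opn_less:
 assumes "opn n U" "continuous_on U f" "continuous_on U (g :: _ => real)"
 shows "opn n {x \<in> U. f x < g x}"
proof -
 have "opn n {x \<in> U. g x - f x \<in> {0<..}}"
  by (rule opn_preimage_open) (use assms in \<open>auto intro: continuous_intros\<close>)
 then show ?thesis by simp
qed

lemma continuous_on_Rn_coords:
 assumes "\<And>i. i < n ==> continuous_on U (\<lambda>x. G x i)" "G \<in> U \<rightarrow> Rn n"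
 shows "continuous_on U G"
proof (rule continuous_on_coordinatewise_then_product)
 fix i show "continuous_on U (\<lambda>x. G x i)"
 proof (cases "i < n")
  case False
  then have "G x i = 0" if "x \<in> U" for x using assms(2) that by (auto simp: Pi_iff mem_Rn)
  then show ?thesis by (simp cong: continuous_on_cong)
 qed (use assms(1) in auto)
qed

lemma opn_preimage:
 assumes U: "opn m U" and V: "opn n V"
  and G: "\<And>i. i < n ==> continuous_on U (\<lambda>x. G x i)" "G \<in> U \<rightarrow> Rn n"
 shows "opn m {x \<in> U. G x \<in> V}"
proof -
 obtain T where T: "open T" "V = Rn n \<inter> T" using V openin_Euclidean_space_iff by metis
 have "opn m {x \<in> U. G x \<in> T}"
  by (rule opn_preimage_open[OF U continuous_on_Rn_coords[OF G] T(1)])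
 moreover have "{x \<in> U. G x \<in> T} = {x \<in> U. G x \<in> V}" using T(2) G(2) by blast
 ultimately show ?thesis by simp
qed

lemma opn_Rn: "opn n (Rn n)"
 by simp

text \<open>The foot of \<open>w\<close> is found in a chart by solving the \<open>d\<close>
  normality equations for \<open>u\<close>. Their Jacobian in \<open>u\<close> is minus the Hessian
  of half the squared distance from \<open>w0\<close> to the manifold, and the reach inequality
  makes that Hessian nondegenerate.\<close>

lemma tube_local:
 assumes M: "submanifold m \<infinity> d M" and x0: "x0 \<in> M" and nv: "normal m M x0 v0"
  and v0: "sqrt (ip m v0 v0) < reach m M x0 / 4" and w0: "w0 = (\<lambda>i. x0 i + v0 i)"
 shows "\<exists>W P. opn m W \<and> w0 \<in> W \<and>
  (\<forall>w\<in>W. P w \<in> M \<and> normal m M (P w) (\<lambda>i. w i - P w i) \<and>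
    sqrt (ip m (\<lambda>i. w i - P w i) (\<lambda>i. w i - P w i)) < reach m M (P w) / 4) \<and>
  (\<forall>i<m. Cp_open m \<infinity> W (\<lambda>w. P w i))"
proof -
 obtain U V \<phi> \<psi> where c: "chart m \<infinity> d M U V \<phi> \<psi>" and xU: "x0 \<in> U"
  by (rule submanifold_chart[OF M x0]) auto
 interpret chart m \<infinity> d M U V \<phi> \<psi> by (rule c)
 define u0 where "u0 = \<phi> x0"
 have u0V: "u0 \<in> V" using \<phi>V xU by (auto simp: u0_def)
 have u0d: "u0 \<in> Rn d" using M_iff[OF xU] x0 by (simp add: u0_def mem_Rn)
 have \<psi>u0: "\<psi> u0 = x0" using xU by (simp add: u0_def \<psi>\<phi>)
 have v0R: "v0 \<in> Rn m" using nv by (simp add: normal_def)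
 have w0R: "w0 \<in> Rn m" using v0R x0 MR w0 by (auto intro!: Rn_add)
 define q where "q j i = pderiv_coord j (\<lambda>y. \<psi> y i)" for j i
 have qp: "Cp_open m \<infinity> V (q j i)" if "i < m" "j < d" for i j
  unfolding q_def using Cp_open_pderiv[OF \<psi>p[OF that(1)]] that(2) dn by simp
 define Ob where "Ob = {z \<in> Rn (d + m). trunc d z \<in> V}"
 have Ob: "opn (d + m) Ob"
  unfolding Ob_def
 proof (rule opn_preimage[OF opn_Rn V])
  show "trunc d \<in> Rn (d + m) \<rightarrow> Rn m" using dn by (auto simp: trunc_def mem_Rn)
  show "continuous_on (Rn (d + m)) (\<lambda>z. trunc d z i)" for i
   by (cases "i < d") (auto simp: trunc_def continuous_on_coord)
 qed
 have compV: "Cp_open (d + m) \<infinity> Ob (\<lambda>z. g (trunc d z))" if "Cp_open m \<infinity> V g" for g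
 proof (rule Cp_open_compose[OF Ob V that])
  show "Cp_open (d + m) \<infinity> Ob (\<lambda>z. trunc d z i)" for i
   by (cases "i < d") (simp_all add: trunc_def Cp_open_coord[OF Ob] Cp_open_const[OF Ob])
 qed (auto simp: Ob_def)
 define \<Phi> where "\<Phi> j z = (\<Sum>i<m. (z (d + i) - \<psi> (trunc d z) i) * q j i (trunc d z))" for j z
 have \<Phi>p: "Cp_open (d + m) \<infinity> Ob (\<Phi> j)" if "j < d" for j
  unfolding \<Phi>_def[abs_def] using that
  by (intro Cp_open_sum[OF Ob] Cp_open_mult[OF Ob] Cp_open_diff[OF Ob] Cp_open_coord[OF Ob] compV
     compV[of "\<lambda>y. \<psi> y _"] qp \<psi>p) auto
 define z0 where "z0 = append_vec d u0 w0"
 have tz: "trunc d z0 = u0" unfolding z0_def by (rule trunc_append[OF u0d])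
 have sz: "z0 (d + i) = w0 i" for i unfolding z0_def append_vec_def by simp
 have z0O: "z0 \<in> Ob" using append_vec_Rn[OF w0R] tz u0V by (simp add: Ob_def z0_def)
 have wi: "w0 i - \<psi> u0 i = v0 i" for i by (simp add: w0 \<psi>u0)
 have n0: "(\<Sum>i<m. v0 i * q j i u0) = 0" if "j < d" for j
  using chart_normal_iff[OF c u0V u0d v0R] nv \<psi>u0 that by (simp add: q_def)
 have \<Phi>0: "\<Phi> j z0 = 0" if "j < d" for j
  unfolding \<Phi>_def tz sz wi by (rule n0[OF that])
 have \<psi>D: "((\<lambda>t. \<psi> (u0(l := t)) i) has_real_derivative q l i u0) (at (u0 l))" if "i < m" "l < d" for i l
  unfolding q_def using that dn by (intro Ck_open_1D(1)[OF \<psi>1 V u0V]) auto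
 have qD: "((\<lambda>t. q j i (u0(l := t))) has_real_derivative pderiv_coord l (q j i) u0) (at (u0 l))"
  if "i < m" "j < d" "l < d" for i j l
  using Ck_open_1D(1)[OF Cp_open_Ck[OF qp[OF that(1,2)], of "Suc 0"] V u0V, of l] that dn by simp
 have \<Phi>D: "pderiv_coord l (\<Phi> j) z0 = (\<Sum>i<m. v0 i * pderiv_coord l (q j i) u0) - (\<Sum>i<m. q l i u0 * q j i u0)"
  if jl: "j < d" "l < d" for j l
 proof (rule pderiv_coord_eqI)
  have f: "\<Phi> j (z0(l := t)) = (\<Sum>i<m. (w0 i - \<psi> (u0(l := t)) i) * q j i (u0(l := t)))" for t
  proof -
   have "trunc d (z0(l := t)) = u0(l := t)"
    using jl(2) tz by (auto simp: trunc_def fun_eq_iff split: if_splits)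
   moreover have "(z0(l := t)) (d + i) = w0 i" for i using jl(2) sz by simp
   ultimately show ?thesis unfolding \<Phi>_def by presburger
  qed
  have "((\<lambda>t. \<Sum>i<m. (w0 i - \<psi> (u0(l := t)) i) * q j i (u0(l := t))) has_real_derivative
    (\<Sum>i<m. (0 - q l i u0) * q j i (u0(l := u0 l)) + pderiv_coord l (q j i) u0 * (w0 i - \<psi> (u0(l := u0 l)) i))) (at (u0 l))"
   using jl by (intro DERIV_sum DERIV_mult DERIV_diff DERIV_const \<psi>D qD) auto
  moreover have "(\<Sum>i<m. (0 - q l i u0) * q j i (u0(l := u0 l)) + pderiv_coord l (q j i) u0 * (w0 i - \<psi> (u0(l := u0 l)) i))
    = (\<Sum>i<m. v0 i * pderiv_coord l (q j i) u0) - (\<Sum>i<m. q l i u0 * q j i u0)"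
   unfolding fun_upd_triv wi by (simp add: sum.distrib sum_negf sum_subtractf mult.commute)
  moreover have "z0 l = u0 l" using tz jl(2) by (metis trunc_def)
  ultimately show "((\<lambda>t. \<Phi> j (z0(l := t))) has_real_derivative
    (\<Sum>i<m. v0 i * pderiv_coord l (q j i) u0) - (\<Sum>i<m. q l i u0 * q j i u0)) (at (z0 l))"
   unfolding f by simp
 qed
 have inj: "\<forall>l<d. y l = 0" if y: "\<forall>j<d. (\<Sum>l<d. pderiv_coord l (\<Phi> j) z0 * y l) = 0" for y
 proof -
  \<comment> \<open>For \<open>y\<close> in the kernel of the Jacobian, \<open>a\<close> and
    \<open>s\<close> are the first and second derivatives of \<open>\<psi>\<close> along the line
    from \<open>u0\<close> in direction \<open>y\<close>. The kernel equation paired with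
    \<open>y\<close> says \<open>|a|^2 = <v0, s>\<close>.\<close>
  define a where "a i = (\<Sum>l<d. y l * q l i u0)" for i
  define s where "s i = (\<Sum>j<d. \<Sum>l<d. y j * (y l * pderiv_coord l (q j i) u0))" for i
  have e1: "(\<Sum>j<d. y j * (\<Sum>l<d. (\<Sum>i<m. v0 i * pderiv_coord l (q j i) u0) * y l)) = (\<Sum>i<m. v0 i * s i)"
  proof -
   have "(\<Sum>i<m. v0 i * s i) = (\<Sum>i<m. \<Sum>j<d. \<Sum>l<d. v0 i * (y j * (y l * pderiv_coord l (q j i) u0)))"
    by (simp add: s_def sum_distrib_left)
   also have "\<dots> = (\<Sum>j<d. \<Sum>i<m. \<Sum>l<d. v0 i * (y j * (y l * pderiv_coord l (q j i) u0)))" by (rule sum.swap)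
   also have "\<dots> = (\<Sum>j<d. \<Sum>l<d. \<Sum>i<m. v0 i * (y j * (y l * pderiv_coord l (q j i) u0)))"
    by (intro sum.cong refl sum.swap)
   also have "\<dots> = (\<Sum>j<d. y j * (\<Sum>l<d. (\<Sum>i<m. v0 i * pderiv_coord l (q j i) u0) * y l))"
    by (simp add: sum_distrib_left sum_distrib_right mult_ac)
   finally show ?thesis by simp
  qed
  have e2: "(\<Sum>j<d. y j * (\<Sum>l<d. (\<Sum>i<m. q l i u0 * q j i u0) * y l)) = (\<Sum>i<m. a i * a i)"
  proof -
   have "(\<Sum>i<m. a i * a i) = (\<Sum>i<m. \<Sum>j<d. \<Sum>l<d. (y j * q j i u0) * (y l * q l i u0))"
    by (simp add: a_def sum_product)
   also have "\<dots> = (\<Sum>j<d. \<Sum>i<m. \<Sum>l<d. (y j * q j i u0) * (y l * q l i u0))" by (rule sum.swap)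
   also have "\<dots> = (\<Sum>j<d. \<Sum>l<d. \<Sum>i<m. (y j * q j i u0) * (y l * q l i u0))"
    by (intro sum.cong refl sum.swap)
   also have "\<dots> = (\<Sum>j<d. y j * (\<Sum>l<d. (\<Sum>i<m. q l i u0 * q j i u0) * y l))"
    by (simp add: sum_distrib_left sum_distrib_right mult_ac)
   finally show ?thesis by simp
  qed
  have "0 = (\<Sum>j<d. y j * (\<Sum>l<d. pderiv_coord l (\<Phi> j) z0 * y l))" using y by simp
  also have "\<dots> = (\<Sum>j<d. y j * (\<Sum>l<d. ((\<Sum>i<m. v0 i * pderiv_coord l (q j i) u0) - (\<Sum>i<m. q l i u0 * q j i u0)) * y l))"
   by (intro sum.cong refl arg_cong2[of _ _ _ _ "(*)"]) (auto simp: \<Phi>D)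
  also have "\<dots> = (\<Sum>i<m. v0 i * s i) - (\<Sum>i<m. a i * a i)"
   unfolding e1[symmetric] e2[symmetric] by (simp add: left_diff_distrib right_diff_distrib sum_subtractf)
  finally have E: "(\<Sum>i<m. a i * a i) = (\<Sum>i<m. v0 i * s i)" by simp
  define y' where "y' = trunc d y"
  have y'R: "y' \<in> Rn d" "y' \<in> Rn m" using dn by (auto simp: y'_def trunc_def mem_Rn)
  have sumd: "(\<Sum>j<m. f j * y' j) = (\<Sum>j<d. f j * y j)" for f
  proof -
   have "(\<Sum>j<m. f j * y' j) = (\<Sum>j<d. f j * y' j)"
    by (rule sum.mono_neutral_right) (use dn in \<open>auto simp: y'_def trunc_def\<close>)
   also have "\<dots> = (\<Sum>j<d. f j * y j)" by (rule sum.cong) (auto simp: y'_def trunc_def)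
   finally show ?thesis .
  qed
  let ?l = "\<lambda>t i. u0 i + t * y' i"
  have lR: "?l t \<in> Rn d" "?l t \<in> Rn m" for t using u0d y'R dn by (auto simp: mem_Rn)
  have l0: "?l 0 = u0" by simp
  have cont_l: "((\<lambda>t. ?l t) \<longlongrightarrow> u0) (nhds 0)"
   unfolding tendsto_fun_iff by (auto intro!: tendsto_eq_intros filterlim_ident)
  have evV: "\<forall>\<^sub>F t in nhds (0::real). ?l t \<in> V"
   by (rule opn_eventually[OF V u0V cont_l]) (use lR in simp)
  define r where "r = 3 * (reach m M x0 / 4)"
  have rho: "reach m M x0 > 0" by (rule reach_pos[OF M x0])
  have R: "reach_at m M x0 r" by (rule reach_at_less) (use rho in \<open>auto simp: r_def\<close>)
  have Wopn: "opn m {u \<in> V. ds m x0 (\<psi> u) < r}"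
  proof (rule opn_less[OF V])
   show "continuous_on V (\<lambda>u. ds m x0 (\<psi> u))"
    unfolding ds_def ip_def
    by (intro continuous_intros) (use Ck_open_continuous[OF V_Rn \<psi>1] in auto)
  qed auto
  have "\<forall>\<^sub>F t in nhds (0::real). ?l t \<in> {u \<in> V. ds m x0 (\<psi> u) < r}"
   by (rule opn_eventually[OF Wopn _ cont_l]) (use lR u0V \<psi>u0 rho in \<open>auto simp: ds_self r_def\<close>)
  then obtain e where e: "e > 0" "\<And>t. \<bar>t\<bar> < e ==> ?l t \<in> V \<and> ds m x0 (\<psi> (?l t)) < r"
   by (auto simp: eventually_nhds_metric dist_real_def)
  have inM: "\<psi> (?l t) \<in> M" if "\<bar>t\<bar> < e" for t
  proof -
   have "?l t \<in> V" using e(2)[OF that] by simp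
   moreover from this have "\<psi> (?l t) \<in> U" using \<psi>U by auto
   ultimately show ?thesis using M_iff lR(1)[of t] by (simp add: \<phi>\<psi> mem_Rn)
  qed
  define c1 where "c1 t i = (\<Sum>j<d. q j i (?l t) * y j)" for t i
  have cD: "((\<lambda>t. \<psi> (?l t) i) has_real_derivative c1 t i) (at t)" if "\<bar>t\<bar> < e" "i < m" for t i
  proof -
   have "((\<lambda>t. \<psi> (?l t) i) has_real_derivative (\<Sum>j<m. pderiv_coord j (\<lambda>y. \<psi> y i) (?l t) * y' j)) (at t)"
    by (rule chain_curve[where \<gamma> = ?l and v = y', OF V \<psi>1[OF that(2)]])
      (use e(2)[OF that(1)] lR in \<open>auto intro!: derivative_eq_intros\<close>)
   then show ?thesis unfolding sumd c1_def q_def .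
  qed
  have c1D: "((\<lambda>t. c1 t i) has_real_derivative s i) (at 0)" if i: "i < m" for i
  proof -
   have "((\<lambda>t. q j i (?l t)) has_real_derivative (\<Sum>l<m. pderiv_coord l (q j i) (?l 0) * y' l)) (at 0)" if "j < d" for j
    by (rule chain_curve[where \<gamma> = ?l and v = y', OF V Cp_open_Ck[OF qp[OF i that]]])
      (use lR u0V in \<open>auto intro!: derivative_eq_intros\<close>)
   then have "((\<lambda>t. c1 t i) has_real_derivative (\<Sum>j<d. (\<Sum>l<m. pderiv_coord l (q j i) (?l 0) * y' l) * y j)) (at 0)"
    unfolding c1_def by (intro DERIV_sum DERIV_cmult_right) auto
   moreover have "(\<Sum>j<d. (\<Sum>l<m. pderiv_coord l (q j i) (?l 0) * y' l) * y j) = s i"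
    unfolding sumd l0 s_def by (simp add: sum_distrib_left sum_distrib_right mult_ac)
   ultimately show ?thesis by simp
  qed
  have c10: "c1 0 i = a i" for i by (simp add: c1_def a_def mult.commute)
  \<comment> \<open>The factor 1/3 is the tube radius divided by the radius \<open>r\<close>, so the
    reach inequality gives \<open>h t \<le> h 0\<close>. The second derivative at 0 is
    \<open><v0, s> - 2/3 |a|^2\<close>; with the kernel equation this yields
    \<open>|a|^2 \<le> 2/3 |a|^2\<close>, hence \<open>a = 0\<close>.\<close>
  define h where "h t = (\<Sum>i<m. v0 i * (\<psi> (?l t) i - x0 i)) - 1 / 3 * (\<Sum>i<m. (\<psi> (?l t) i - x0 i) * (\<psi> (?l t) i - x0 i))" for t
  define h' where "h' t = (\<Sum>i<m. v0 i * c1 t i) - 2 / 3 * (\<Sum>i<m. (\<psi> (?l t) i - x0 i) * c1 t i)" for t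
  have "(\<Sum>i<m. v0 i * s i) - 2 / 3 * (\<Sum>i<m. a i * a i) \<le> 0"
  proof (rule second_derivative_test[OF e(1), of h h'])
   fix t assume t: "\<bar>t\<bar> < e"
   have "(h has_real_derivative ((\<Sum>i<m. v0 i * (c1 t i - 0)) - 1 / 3 * (\<Sum>i<m. (c1 t i - 0) * (\<psi> (?l t) i - x0 i) + (c1 t i - 0) * (\<psi> (?l t) i - x0 i)))) (at t)"
    unfolding h_def by (intro DERIV_diff DERIV_cmult DERIV_sum DERIV_mult DERIV_const cD t) auto
   then show "(h has_real_derivative h' t) (at t)"
    by (simp add: h'_def sum.distrib sum_distrib_left mult.commute[of "c1 t _"])
  next
   have "(h' has_real_derivative ((\<Sum>i<m. v0 i * s i) - 2 / 3 * (\<Sum>i<m. (c1 0 i - 0) * c1 0 i + s i * (\<psi> (?l 0) i - x0 i)))) (at 0)"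
    unfolding h'_def by (intro DERIV_diff DERIV_cmult DERIV_sum DERIV_mult DERIV_const cD c1D) (use e(1) in auto)
   then show "(h' has_real_derivative (\<Sum>i<m. v0 i * s i) - 2 / 3 * (\<Sum>i<m. a i * a i)) (at 0)"
    unfolding l0 \<psi>u0 c10 by simp
  next
   have "(\<Sum>i<m. v0 i * a i) = (\<Sum>i<m. \<Sum>l<d. y l * (v0 i * q l i u0))"
    by (simp add: a_def sum_distrib_left mult_ac)
   also have "\<dots> = (\<Sum>l<d. y l * (\<Sum>i<m. v0 i * q l i u0))" by (subst sum.swap) (simp add: sum_distrib_left)
   also have "\<dots> = 0" using n0 by simp
   finally show "h' 0 = 0" unfolding h'_def l0 \<psi>u0 c10 by simp
  next
   fix t :: real assume t: "0 < t" "t < e"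
   then have te: "\<bar>t\<bar> < e" by simp
   have "r * ip m v0 (\<lambda>i. \<psi> (?l t) i - x0 i) \<le> (reach m M x0 / 4) * ip m (\<lambda>i. \<psi> (?l t) i - x0 i) (\<lambda>i. \<psi> (?l t) i - x0 i)"
    by (rule reach_at_use[OF R x0 inM[OF te] _ _ nv _ v0]) (use e(2)[OF te] rho in \<open>auto simp: ds_self r_def\<close>)
   then have "(reach m M x0 / 4) * (3 * ip m v0 (\<lambda>i. \<psi> (?l t) i - x0 i)) \<le> (reach m M x0 / 4) * ip m (\<lambda>i. \<psi> (?l t) i - x0 i) (\<lambda>i. \<psi> (?l t) i - x0 i)"
    by (simp add: r_def)
   then have "3 * ip m v0 (\<lambda>i. \<psi> (?l t) i - x0 i) \<le> ip m (\<lambda>i. \<psi> (?l t) i - x0 i) (\<lambda>i. \<psi> (?l t) i - x0 i)"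
    by (rule mult_left_le_imp_le) (use rho in simp)
   then show "h t \<le> h 0" unfolding h_def l0 \<psi>u0 by (simp add: ip_def)
  qed
  then have "(\<Sum>i<m. a i * a i) \<le> 0" using E by linarith
  then have "(\<Sum>i<m. a i * a i) = 0" by (intro antisym sum_nonneg) auto
  then have a0: "a i = 0" if "i < m" for i using that by (simp add: sum_nonneg_eq_0_iff)
  have "J u0 y' = (\<lambda>_. 0)"
  proof
   fix i show "J u0 y' i = 0"
    using a0[of i] sumd[of "\<lambda>j. pderiv_coord j (\<lambda>y. \<psi> y i) u0"]
    by (cases "i < m") (simp_all add: J_def lapp_def grad_def a_def q_def mult.commute)
  qed
  then have "y' = (\<lambda>_. 0)" using KJ[OF u0V y'R(2)] by (simp add: K_def lapp_zero)
  then show ?thesis by (auto simp: y'_def trunc_def fun_eq_iff split: if_splits)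
 qed
 show ?thesis
 proof (rule implicit_function[OF Ob \<Phi>p u0d w0R z0O[unfolded z0_def] \<Phi>0[unfolded z0_def]], simp, simp)
  show "\<forall>l<d. y l = 0" if "\<forall>j<d. (\<Sum>l<d. pderiv_coord l (\<Phi> j) (append_vec d u0 w0) * y l) = 0" for y
   using inj[of y] that unfolding z0_def by blast
 next
  fix W u
  assume W: "opn m W" "w0 \<in> W" and uw0: "u w0 = u0"
   and u: "\<And>w. w \<in> W ==> u w \<in> Rn d \<and> append_vec d (u w) w \<in> Ob"
   and z: "\<And>w j. w \<in> W ==> j < d ==> \<Phi> j (append_vec d (u w) w) = 0"
   and us: "\<And>l. l < d ==> Cp_open m \<infinity> W (\<lambda>w. u w l)"
  define P where "P w = \<psi> (u w)" for w
  have uV: "u w \<in> V" if "w \<in> W" for w using u[OF that] trunc_append[of "u w" d w] by (auto simp: Ob_def)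
  have PM: "P w \<in> M" if w: "w \<in> W" for w
  proof -
   have "P w \<in> U" using uV[OF w] \<psi>U by (auto simp: P_def)
   moreover have "\<phi> (P w) = u w" using uV[OF w] by (simp add: P_def \<phi>\<psi>)
   ultimately show ?thesis using M_iff u[OF w] by (simp add: mem_Rn)
  qed
  have WR: "W \<subseteq> Rn m" by (rule opn_subset[OF W(1)])
  have Pn: "normal m M (P w) (\<lambda>i. w i - P w i)" if w: "w \<in> W" for w
  proof -
   have "(\<lambda>i. w i - P w i) \<in> Rn m" using w WR PM[OF w] MR by (intro Rn_diff) auto
   then show ?thesis
    unfolding P_def using chart_normal_iff[OF c uV[OF w], of "\<lambda>i. w i - \<psi> (u w) i"] u[OF w] z[OF w]
     trunc_append[of "u w" d w]
    by (auto simp: \<Phi>_def q_def) (simp add: append_vec_def)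
  qed
  have Ps: "Cp_open m \<infinity> W (\<lambda>w. P w i)" if "i < m" for i
   unfolding P_def
  proof (rule Cp_open_compose[OF W(1) V \<psi>p[OF that]])
   fix j show "Cp_open m \<infinity> W (\<lambda>w. u w j)"
   proof (cases "j < d")
    case False
    have "Cp_open m \<infinity> W (\<lambda>w. u w j) \<longleftrightarrow> Cp_open m \<infinity> W (\<lambda>w. 0)"
     by (rule Cp_open_cong[OF W(1)]) (use u False in \<open>auto simp: mem_Rn\<close>)
    then show ?thesis by (simp add: Cp_open_const[OF W(1)])
   qed (rule us)
  qed (use uV in auto)
  have Pc: "continuous_on W (\<lambda>w. P w i)" if "i < m" for i
   by (rule Ck_open_continuous[OF WR Cp_open_Ck[OF Ps[OF that], of 0]]) simp
  define W' where "W' = {w \<in> W. sqrt (ip m (\<lambda>i. w i - P w i) (\<lambda>i. w i - P w i)) < reach m M (P w) / 4}"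
  have "continuous_on W P" by (rule continuous_on_Rn_coords[OF Pc]) (use PM MR in auto)
  then have "continuous_on W (\<lambda>w. reach m M (P w))"
   by (rule continuous_on_compose2[OF continuous_on_reach[of UNIV]]) auto
  then have "opn m W'"
   unfolding W'_def ip_def by (intro opn_less[OF W(1)] continuous_intros Pc continuous_on_coord) auto
  moreover have "w0 \<in> W'"
  proof -
   have "P w0 = x0" by (simp add: P_def uw0 \<psi>u0)
   moreover have "(\<lambda>i. w0 i - x0 i) = v0" by (simp add: w0)
   ultimately show ?thesis using W(2) v0 by (simp add: W'_def)
  qed
  moreover have "\<forall>i<m. Cp_open m \<infinity> W' (\<lambda>w. P w i)"
   using Ps Cp_open_subset[of m \<infinity> W _ W'] by (auto simp: W'_def)
  ultimately show ?thesis using PM Pn by (intro exI[of _ W'] exI[of _ P]) (auto simp: W'_def)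
 qed
qed

lemma in_normal_tube:
 "z \<in> normal_tube m M \<epsilon> \<longleftrightarrow> z \<in> Rn (m + m) \<and> trunc m z \<in> M \<and> normal m M (trunc m z) (\<lambda>i. z (m + i)) \<and>
   sqrt (ip m (\<lambda>i. z (m + i)) (\<lambda>i. z (m + i))) < \<epsilon> (trunc m z)" if "M \<subseteq> Rn m"
proof
 assume "z \<in> normal_tube m M \<epsilon>"
 then obtain x v where z: "z = append_vec m x v" "x \<in> M" "v \<in> Rn m"
   "\<forall>w\<in>tangent_space M x. (\<Sum>i<m. v i * w i) = 0" "L2_set v {..<m} < \<epsilon> x"
  by (auto simp: normal_tube_def)
 have "trunc m z = x" "(\<lambda>i. z (m + i)) = v" using z that by (auto simp: trunc_append shift_append)
 then show "z \<in> Rn (m + m) \<and> trunc m z \<in> M \<and> normal m M (trunc m z) (\<lambda>i. z (m + i)) \<and>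
   sqrt (ip m (\<lambda>i. z (m + i)) (\<lambda>i. z (m + i))) < \<epsilon> (trunc m z)"
  using z append_vec_Rn[of v m m x] by (simp add: normal_def L2_set_eq_ip ip_def)
next
 assume "z \<in> Rn (m + m) \<and> trunc m z \<in> M \<and> normal m M (trunc m z) (\<lambda>i. z (m + i)) \<and>
   sqrt (ip m (\<lambda>i. z (m + i)) (\<lambda>i. z (m + i))) < \<epsilon> (trunc m z)"
 then show "z \<in> normal_tube m M \<epsilon>"
  unfolding normal_tube_def
  by (intro CollectI exI[of _ "trunc m z"] exI[of _ "\<lambda>i. z (m + i)"])
    (simp add: append_trunc_shift normal_def L2_set_eq_ip ip_def)
qed

lemma append_in_normal_tube:
 assumes "M \<subseteq> Rn m" "x \<in> M"
 shows "append_vec m x v \<in> normal_tube m M \<epsilon> \<longleftrightarrow> normal m M x v \<and> sqrt (ip m v v) < \<epsilon> x"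
proof -
 have "x \<in> Rn m" using assms by auto
 then show ?thesis
  using assms append_vec_Rn[of v m m x] by (auto simp: in_normal_tube[OF assms(1)] trunc_append shift_append normal_def)
qed

lemma normal_exp_append: "x \<in> Rn m ==> v \<in> Rn m ==> normal_exp m (append_vec m x v) = (\<lambda>i. x i + v i)"
 by (auto simp: normal_exp_def append_vec_def mem_Rn fun_eq_iff)

lemma normal_exp_eq: "z \<in> Rn (m + m) ==> normal_exp m z = (\<lambda>i. trunc m z i + z (m + i))"
 by (auto simp: normal_exp_def trunc_def mem_Rn fun_eq_iff)

lemma normal_zero: "normal m M x (\<lambda>_. 0)"
 by (simp add: normal_def mem_Rn ip_zero)

lemma normal_scale: "normal m M x v ==> normal m M x (\<lambda>i. c * v i)"
 by (auto simp: normal_def mem_Rn ip_scale)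

section \<open>Definability of the reach and existence of tubes\<close>

context o_minimal_field
begin

lemma dt_upd: "(\<And>i. dt n (\<lambda>z. F z i)) ==> dt n t ==> dt n (\<lambda>z. ((F z)(k := t z)) i)"
 by (cases "i = k") simp_all

lemma definable_fun_graph:
 assumes g: "definable_fun Df m A g"
  and F: "\<And>i. dt N (\<lambda>x. F x i)" "\<And>x. x \<in> Rn N ==> F x \<in> Rn m" and t: "dt N t"
 shows "dp N (\<lambda>x. F x \<in> A \<and> t x = g (F x))"
proof -
 have D: "{x(m := g x) |x. x \<in> A} \<in> Df (Suc m)" and A: "A \<subseteq> Rn m"
  using g subset[of A m] by (auto simp: definable_fun_def)
 have "dp N (\<lambda>x. (F x)(m := t x) \<in> {x(m := g x) |x. x \<in> A})"
 proof (rule dp_mem[OF D])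
  show "(F x)(m := t x) \<in> Rn (Suc m)" if "x \<in> Rn N" for x using F(2)[OF that] by (auto simp: mem_Rn)
 qed (intro dt_upd F t)
 then show ?thesis
 proof (rule dp_iffI)
  fix x assume x: "x \<in> Rn N"
  show "(F x)(m := t x) \<in> {x(m := g x) |x. x \<in> A} \<longleftrightarrow> F x \<in> A \<and> t x = g (F x)"
  proof
   assume "(F x)(m := t x) \<in> {x(m := g x) |x. x \<in> A}"
   then obtain y where y: "y \<in> A" "(F x)(m := t x) = y(m := g y)" by blast
   have "F x i = y i" for i
   proof (cases "i = m")
    case True then show ?thesis using F(2)[OF x] y(1) A by (auto simp: mem_Rn subset_iff)
   next
    case False then show ?thesis using fun_cong[OF y(2), of i] by simp
   qed
   then have "F x = y" by blast
   moreover have "t x = g y" using fun_cong[OF y(2), of m] by simp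
   ultimately show "F x \<in> A \<and> t x = g (F x)" using y(1) by simp
  qed auto
 qed
qed

lemma dp_normal:
 assumes D: "M \<in> Df m" and M: "submanifold m p d M" "1 \<le> p"
  and F: "\<And>i. dt N (\<lambda>x. F x i)" "\<And>x. x \<in> Rn N ==> F x \<in> Rn m"
  and G: "\<And>i. dt N (\<lambda>x. G x i)" "\<And>x. x \<in> Rn N ==> G x \<in> Rn m"
 shows "dp N (\<lambda>x. F x \<in> M \<and> normal m M (F x) (G x))"
proof -
 have w: "dt (N + m) (\<lambda>z. F (trunc N z) i)" "dt (N + m) (\<lambda>z. G (trunc N z) i)" for i
  using dt_weaken[OF F(1)] dt_weaken[OF G(1)] by auto
 have "dp N (\<lambda>x. F x \<in> M \<and> (\<forall>w\<in>Rn m. (F x \<in> M \<and> w \<in> tangent_space M (F x)) --> ip m (G x) w = 0))"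
 proof (rule dp_and[OF dp_mem[OF D F]], assumption, rule dp_all_vec, rule dp_imp)
  show "dp (N + m) (\<lambda>z. F (trunc N z) \<in> M \<and> (\<lambda>i. z (N + i)) \<in> tangent_space M (F (trunc N z)))"
   by (rule dp_tangent[OF D M w(1)]) (auto intro!: F(2) dt_coord trunc_Rn shift_Rn)
  show "dp (N + m) (\<lambda>z. ip m (G (trunc N z)) (\<lambda>i. z (N + i)) = 0)"
   by (intro dp_eq dt_ip dt_const dt_coord w(2))
 qed
 then show ?thesis
 proof (rule dp_iffI)
  fix x assume x: "x \<in> Rn N"
  show "(F x \<in> M \<and> (\<forall>w\<in>Rn m. (F x \<in> M \<and> w \<in> tangent_space M (F x)) --> ip m (G x) w = 0)) \<longleftrightarrow>
    F x \<in> M \<and> normal m M (F x) (G x)"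
   using G(2)[OF x] tangent_space_Rn[OF submanifold_Rn[OF M(1)]] unfolding normal_def by blast
 qed
qed

lemma dp_reach_at:
 assumes D: "M \<in> Df m" and M: "submanifold m p d M" "1 \<le> p"
  and F: "\<And>i. dt N (\<lambda>x. F x i)" and r: "dt N r"
 shows "dp N (\<lambda>x. reach_at m M (F x) (r x))"
proof -
 \<comment> \<open>The numbers of variables under one, two and three quantifiers.\<close>
 define N1 N2 N3 where "N1 = N + m" and "N2 = N1 + m" and "N3 = N2 + m"
 have le: "N \<le> N3" by (simp add: N1_def N2_def N3_def)
 have t: "trunc N (trunc N1 (trunc N2 z)) = trunc N z" "trunc N1 (trunc N2 z) = trunc N1 z" for z :: "nat => real"
  by (auto simp: N1_def N2_def trunc_trunc)
 have F3: "dt N3 (\<lambda>z. F (trunc N (trunc N1 (trunc N2 z))) i)" for i using dt_weaken[OF F le] t by simp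
 have r3: "dt N3 (\<lambda>z. r (trunc N (trunc N1 (trunc N2 z))))" using dt_weaken[OF r le] t by simp
 have r0: "dp N (\<lambda>x. 0 < r x)" "dp N (\<lambda>x. r x \<le> 1)" by (intro dp_less dp_le dt_const r)+
 \<comment> \<open>Distances are compared through squares, which keeps square roots out of the
   terms; the two comparisons agree because \<open>r x > 0\<close> is part of the formula.\<close>
 let ?near = "\<lambda>x y r. ip m (\<lambda>i. y i - x i) (\<lambda>i. y i - x i) < r\<^sup>2"
 have "dp N (\<lambda>x. 0 < r x \<and> r x \<le> 1 \<and> (\<forall>y\<in>M. \<forall>z\<in>M. \<forall>v\<in>Rn m. ?near (F x) y (r x) --> ?near (F x) z (r x) -->
   (y \<in> M \<and> normal m M y v) --> ip m v v \<le> 1 --> r x * ip m v (\<lambda>i. z i - y i) \<le> ip m (\<lambda>i. z i - y i) (\<lambda>i. z i - y i)))"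
 proof (intro dp_and r0)
  show "dp N (\<lambda>x. \<forall>y\<in>M. \<forall>z\<in>M. \<forall>v\<in>Rn m. ?near (F x) y (r x) --> ?near (F x) z (r x) -->
   (y \<in> M \<and> normal m M y v) --> ip m v v \<le> 1 --> r x * ip m v (\<lambda>i. z i - y i) \<le> ip m (\<lambda>i. z i - y i) (\<lambda>i. z i - y i))"
  proof (rule dp_ball[OF D], fold N1_def, rule dp_ball[OF D], fold N2_def, rule dp_all_vec, fold N3_def, intro dp_imp)
   show "dp N3 (\<lambda>z. (\<lambda>i. trunc N1 (trunc N2 z) (N + i)) \<in> M \<and>
     normal m M (\<lambda>i. trunc N1 (trunc N2 z) (N + i)) (\<lambda>i. z (N2 + i)))"
   proof (rule dp_normal[OF D M])
    show "dt N3 (\<lambda>z. trunc N1 (trunc N2 z) (N + i))" "dt N3 (\<lambda>z. z (N2 + i))" for i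
     by (intro dt_trunc dt_coord)+
   qed (auto simp: mem_Rn N1_def N2_def N3_def trunc_def)
  qed (intro dp_less dp_le dt_ip dt_diff dt_mult dt_power dt_const dt_trunc dt_coord F3 r3)+
 qed
 then show ?thesis
 proof (rule dp_iffI)
  fix x
  have nr: "?near (F x) y (r x) \<longleftrightarrow> ds m (F x) y < r x" if "r x > 0" for y using ds_less_iff[OF that] by simp
  show "(0 < r x \<and> r x \<le> 1 \<and> (\<forall>y\<in>M. \<forall>z\<in>M. \<forall>v\<in>Rn m. ?near (F x) y (r x) --> ?near (F x) z (r x) -->
   (y \<in> M \<and> normal m M y v) --> ip m v v \<le> 1 --> r x * ip m v (\<lambda>i. z i - y i) \<le> ip m (\<lambda>i. z i - y i) (\<lambda>i. z i - y i)))
   \<longleftrightarrow> reach_at m M (F x) (r x)"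
  proof (cases "r x > 0")
   case True
   show ?thesis unfolding reach_at_def nr[OF True] by blast
  qed (simp add: reach_at_def)
 qed
qed

text \<open>A supremum is definable through its order properties: all admissible radii are below it
  and all smaller positive radii are admissible. Positivity of the reach on \<open>M\<close> makes
  this a characterization in spite of the inserted 0.\<close>

lemma definable_fun_reach:
 assumes D: "M \<in> Df m" and M: "submanifold m \<infinity> d M"
 shows "definable_fun Df m M (\<lambda>x. reach m M x / 4)"
 unfolding definable_fun_def
proof (intro conjI D)
 have p1: "(1::enat) \<le> \<infinity>" by simp
 have MR: "M \<subseteq> Rn m" by (rule submanifold_Rn[OF M])
 have "dp (Suc m) (\<lambda>z. trunc m z \<in> M \<and> 0 < 4 * z m \<and> (\<forall>r. reach_at m M (trunc m z) r --> r \<le> 4 * z m) \<and>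
   (\<forall>r. 0 < r \<and> r < 4 * z m --> reach_at m M (trunc m z) r))"
  by (intro dp_and dp_mem[OF D] dp_all dp_imp dp_less dp_le dp_reach_at[OF D M p1] dt_intros trunc_Rn)
 then show "{x(m := reach m M x / 4) |x. x \<in> M} \<in> Df (Suc m)"
 proof (rule dp_DfI)
  fix z
  have iff: "(0 < s \<and> (\<forall>r. reach_at m M x r --> r \<le> s) \<and> (\<forall>r. 0 < r \<and> r < s --> reach_at m M x r)) \<longleftrightarrow> s = reach m M x"
   if x: "x \<in> M" for x s
  proof
   assume s: "0 < s \<and> (\<forall>r. reach_at m M x r --> r \<le> s) \<and> (\<forall>r. 0 < r \<and> r < s --> reach_at m M x r)"
   have "reach m M x \<le> s" unfolding reach_def by (rule cSup_least) (use s in auto)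
   moreover have "\<not> reach m M x < s"
   proof
    assume "reach m M x < s"
    then obtain r where r: "reach m M x < r" "r < s" using dense by blast
    then have "reach_at m M x r" using s reach_nonneg[of m M x] by auto
    then show False using reach_upper[of m M x r] r by simp
   qed
   ultimately show "s = reach m M x" by linarith
  next
   assume "s = reach m M x"
   then show "0 < s \<and> (\<forall>r. reach_at m M x r --> r \<le> s) \<and> (\<forall>r. 0 < r \<and> r < s --> reach_at m M x r)"
    using reach_pos[OF M x] reach_upper reach_at_less by auto
  qed
  show "z \<in> {x(m := reach m M x / 4) |x. x \<in> M} \<longleftrightarrow> z \<in> Rn (Suc m) \<and> (trunc m z \<in> M \<and> 0 < 4 * z m \<and>
    (\<forall>r. reach_at m M (trunc m z) r --> r \<le> 4 * z m) \<and> (\<forall>r. 0 < r \<and> r < 4 * z m --> reach_at m M (trunc m z) r))"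
   (is "?L \<longleftrightarrow> ?R")
  proof
   assume ?L
   then obtain x where x: "x \<in> M" "z = x(m := reach m M x / 4)" by blast
   then have "trunc m z = x" "z \<in> Rn (Suc m)" "4 * z m = reach m M x" using MR by (auto simp: trunc_def mem_Rn fun_eq_iff subset_iff)
   then show ?R using iff[of x "4 * z m"] x(1) by simp
  next
   assume R: ?R
   then have "4 * z m = reach m M (trunc m z)" using iff[of "trunc m z" "4 * z m"] by blast
   then have "z = (trunc m z)(m := reach m M (trunc m z) / 4)"
    using R by (auto simp: trunc_def mem_Rn fun_eq_iff)
   then show ?L using R by blast
  qed
 qed
qed

text \<open>With a quarter of the reach as radius, \<open>tube_inj\<close> gives injectivity, and
  \<open>tube_local\<close> gives openness of the image and smoothness of the inverse.\<close>

lemma tubular_neighborhood_exists: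
 assumes D: "M \<in> Df m" and M: "submanifold m \<infinity> d M"
 shows "\<exists>T \<pi>. tubular_neighborhood Df m M T \<pi>"
proof -
 have p1: "(1::enat) \<le> \<infinity>" by simp
 have MR: "M \<subseteq> Rn m" by (rule submanifold_Rn[OF M])
 define \<epsilon> where "\<epsilon> x = reach m M x / 4" for x
 define N where "N = normal_tube m M \<epsilon>"
 define T where "T = normal_exp m ` N"
 note Nt = in_normal_tube[OF MR, of _ \<epsilon>, folded N_def]
 have \<epsilon>D: "definable_fun Df m M \<epsilon>" using definable_fun_reach[OF D M] by (simp add: \<epsilon>_def[abs_def])
 have \<epsilon>pos: "\<epsilon> x > 0" if "x \<in> M" for x using reach_pos[OF M that] by (simp add: \<epsilon>_def)
 have inj: "inj_on (normal_exp m) N"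
 proof (rule inj_onI)
  fix y z assume y: "y \<in> N" and z: "z \<in> N" and eq: "normal_exp m y = normal_exp m z"
  have y': "y \<in> Rn (m + m)" and z': "z \<in> Rn (m + m)" using y z Nt by blast+
  have e: "trunc m y i + y (m + i) = trunc m z i + z (m + i)" for i
   using fun_cong[OF eq, of i] by (simp add: normal_exp_eq y' z')
  have tr: "trunc m y = trunc m z"
   by (rule tube_inj[of _ M _ m "\<lambda>i. y (m + i)" "\<lambda>i. z (m + i)"])
     (use y z Nt MR e in \<open>auto simp: \<epsilon>_def\<close>)
  then have sh: "(\<lambda>i. y (m + i)) = (\<lambda>i. z (m + i))" using e by (auto simp: fun_eq_iff)
  have "append_vec m (trunc m y) (\<lambda>i. y (m + i)) = append_vec m (trunc m z) (\<lambda>i. z (m + i))"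
   by (simp only: tr sh)
  then show "y = z" unfolding append_trunc_shift .
 qed
 have loc: "\<exists>W P. opn m W \<and> w0 \<in> W \<and>
   (\<forall>w\<in>W. append_vec m (P w) (\<lambda>i. w i - P w i) \<in> N \<and> normal_exp m (append_vec m (P w) (\<lambda>i. w i - P w i)) = w) \<and>
   (\<forall>i<m. Cp_open m \<infinity> W (\<lambda>w. P w i))" if w0: "w0 \<in> T" for w0
 proof -
  obtain z where z: "z \<in> N" "w0 = normal_exp m z" using w0 by (auto simp: T_def)
  have zz: "z \<in> Rn (m + m)" "trunc m z \<in> M" "normal m M (trunc m z) (\<lambda>i. z (m + i))"
   "sqrt (ip m (\<lambda>i. z (m + i)) (\<lambda>i. z (m + i))) < reach m M (trunc m z) / 4"
   using z(1) Nt by (auto simp: \<epsilon>_def)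
  obtain W P where W: "opn m W" "w0 \<in> W" and P: "\<forall>i<m. Cp_open m \<infinity> W (\<lambda>w. P w i)"
   and a: "\<forall>w\<in>W. P w \<in> M \<and> normal m M (P w) (\<lambda>i. w i - P w i) \<and>
    sqrt (ip m (\<lambda>i. w i - P w i) (\<lambda>i. w i - P w i)) < reach m M (P w) / 4"
   using tube_local[OF M zz(2,3,4), of w0] z(2) normal_exp_eq[OF zz(1)] by auto
  have "append_vec m (P w) (\<lambda>i. w i - P w i) \<in> N \<and> normal_exp m (append_vec m (P w) (\<lambda>i. w i - P w i)) = w" if w: "w \<in> W" for w
  proof -
   have "P w \<in> Rn m" "(\<lambda>i. w i - P w i) \<in> Rn m" using a w MR by (auto simp: normal_def)
   then show ?thesis
    using a w unfolding N_def by (simp add: append_in_normal_tube[OF MR] normal_exp_append \<epsilon>_def)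
  qed
  then show ?thesis using W P by blast
 qed
 \<comment> \<open>Injectivity identifies the local inverses from \<open>loc\<close> with the global
   one.\<close>
 have inv: "inv_into N (normal_exp m) w = z" if "z \<in> N" "normal_exp m z = w" for z w
  using inv_into_f_f[OF inj that(1)] that(2) by simp
 have Topn: "opn m T"
 proof (subst openin_subopen, rule ballI)
  fix w0 assume "w0 \<in> T"
  from loc[OF this] obtain W P where W: "opn m W" "w0 \<in> W"
   "\<forall>w\<in>W. append_vec m (P w) (\<lambda>i. w i - P w i) \<in> N \<and> normal_exp m (append_vec m (P w) (\<lambda>i. w i - P w i)) = w"
   by (elim exE conjE)
  have "W \<subseteq> T"
  proof
   fix w assume "w \<in> W"
   then have w: "append_vec m (P w) (\<lambda>i. w i - P w i) \<in> N" "normal_exp m (append_vec m (P w) (\<lambda>i. w i - P w i)) = w"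
    using W(3) by blast+
   have "normal_exp m (append_vec m (P w) (\<lambda>i. w i - P w i)) \<in> T" unfolding T_def by (rule imageI[OF w(1)])
   then show "w \<in> T" unfolding w(2) .
  qed
  then show "\<exists>W. opn m W \<and> w0 \<in> W \<and> W \<subseteq> T" using W by blast
 qed
 have MT: "M \<subseteq> T"
 proof
  fix x assume x: "x \<in> M"
  have "append_vec m x (\<lambda>_. 0) \<in> N"
   unfolding N_def using append_in_normal_tube[OF MR x] \<epsilon>pos[OF x] by (simp add: normal_zero ip_zero)
  moreover have "normal_exp m (append_vec m x (\<lambda>_. 0)) = x"
   using x MR by (subst normal_exp_append) (auto simp: Rn_zero)
  ultimately show "x \<in> T" unfolding T_def by (intro image_eqI[of x "normal_exp m" "append_vec m x (\<lambda>_. 0)"]) simp_all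
 qed
 have NR: "N \<subseteq> Rn (m + m)" using Nt by blast
 have ND: "N \<in> Df (m + m)"
 proof -
  have "dp (m + m) (\<lambda>z. (trunc m z \<in> M \<and> normal m M (trunc m z) (\<lambda>i. z (m + i))) \<and>
    (\<exists>t. (trunc m z \<in> M \<and> t = \<epsilon> (trunc m z)) \<and> (0 < t \<and> ip m (\<lambda>i. z (m + i)) (\<lambda>i. z (m + i)) < t\<^sup>2)))"
  proof (rule dp_and)
   show "dp (m + m) (\<lambda>z. trunc m z \<in> M \<and> normal m M (trunc m z) (\<lambda>i. z (m + i)))"
    by (rule dp_normal[OF D M p1]) (auto intro!: dt_coord dt_trunc trunc_Rn shift_Rn)
   show "dp (m + m) (\<lambda>z. \<exists>t. (trunc m z \<in> M \<and> t = \<epsilon> (trunc m z)) \<and> (0 < t \<and> ip m (\<lambda>i. z (m + i)) (\<lambda>i. z (m + i)) < t\<^sup>2))"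
   proof (rule dp_ex, rule dp_and)
    show "dp (Suc (m + m)) (\<lambda>z. trunc m (trunc (m + m) z) \<in> M \<and> z (m + m) = \<epsilon> (trunc m (trunc (m + m) z)))"
     by (rule definable_fun_graph[OF \<epsilon>D]) (intro dt_coord dt_trunc trunc_Rn)+
    show "dp (Suc (m + m)) (\<lambda>z. 0 < z (m + m) \<and> ip m (\<lambda>i. trunc (m + m) z (m + i)) (\<lambda>i. trunc (m + m) z (m + i)) < (z (m + m))\<^sup>2)"
     by (intro dp_intros dt_intros)
   qed
  qed
  then show ?thesis
  proof (rule dp_DfI)
   fix z
   have "sqrt (ip m v v) < t \<longleftrightarrow> 0 < t \<and> ip m v v < t\<^sup>2" for v t
   proof
    assume l: "sqrt (ip m v v) < t"
    have s0: "0 \<le> sqrt (ip m v v)" by (simp add: ip_self_nonneg)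
    have "(sqrt (ip m v v))\<^sup>2 < t\<^sup>2" by (rule power_strict_mono[OF l s0]) simp
    moreover have "0 < t" using l s0 by linarith
    ultimately show "0 < t \<and> ip m v v < t\<^sup>2" by (simp add: ip_self_nonneg)
   qed (auto intro!: real_less_lsqrt simp: ip_self_nonneg)
   then show "z \<in> N \<longleftrightarrow> z \<in> Rn (m + m) \<and> ((trunc m z \<in> M \<and> normal m M (trunc m z) (\<lambda>i. z (m + i))) \<and>
    (\<exists>t. (trunc m z \<in> M \<and> t = \<epsilon> (trunc m z)) \<and> (0 < t \<and> ip m (\<lambda>i. z (m + i)) (\<lambda>i. z (m + i)) < t\<^sup>2)))"
    unfolding Nt by auto
  qed
 qed
 have defm: "definable_map Df (m + m) m N (normal_exp m)"
 proof (rule definable_map_terms[OF ND, where t = "\<lambda>i z. z i + z (m + i)"])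
  show "normal_exp m \<in> N \<rightarrow> Rn m" by (auto simp: normal_exp_def mem_Rn)
 qed (auto simp: normal_exp_def intro!: dt_add dt_coord)
 have "bij_betw (normal_exp m) N T" using inj by (simp add: bij_betw_def T_def)
 moreover have "Cp_map (m + m) m \<infinity> N (normal_exp m)"
  unfolding Cp_map_def
 proof (intro conjI allI impI)
  show "normal_exp m \<in> N \<rightarrow> Rn m" by (auto simp: normal_exp_def mem_Rn)
  fix j assume j: "j < m"
  have "Cp_open (m + m) \<infinity> (Rn (m + m)) (\<lambda>z. z j + z (m + j))"
   by (intro Cp_open_add Cp_open_coord opn_Rn)
  then show "Cp_on (m + m) \<infinity> N (\<lambda>z. normal_exp m z j)"
   unfolding Cp_on_def Cp_open_def
   by (intro ballI exI[of _ "Rn (m + m)"] exI[of _ "\<lambda>z. z j + z (m + j)"])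
     (use NR j in \<open>auto simp: normal_exp_def\<close>)
 qed
 moreover have "Cp_map m (m + m) \<infinity> T (inv_into N (normal_exp m))"
  unfolding Cp_map_def
 proof (intro conjI allI impI)
  show "inv_into N (normal_exp m) \<in> T \<rightarrow> Rn (m + m)"
   using NR inv_into_into[of _ "normal_exp m" N] unfolding T_def by blast
  fix j assume j: "j < m + m"
  show "Cp_on m \<infinity> T (\<lambda>w. inv_into N (normal_exp m) w j)"
   unfolding Cp_on_def
  proof
   fix w0 assume "w0 \<in> T"
   from loc[OF this] obtain W P where W: "opn m W" "w0 \<in> W"
    and a: "\<forall>w\<in>W. append_vec m (P w) (\<lambda>i. w i - P w i) \<in> N \<and> normal_exp m (append_vec m (P w) (\<lambda>i. w i - P w i)) = w"
    and P: "\<forall>i<m. Cp_open m \<infinity> W (\<lambda>w. P w i)"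
    by (elim exE conjE)
   have "Cp_open m \<infinity> W (\<lambda>w. append_vec m (P w) (\<lambda>i. w i - P w i) j)"
   proof (cases "j < m")
    case True
    then show ?thesis using P by (simp add: append_vec_def)
   next
    case False
    then have "Cp_open m \<infinity> W (\<lambda>w. w (j - m) - P w (j - m))"
     using P j by (intro Cp_open_diff[OF W(1)] Cp_open_coord[OF W(1)]) auto
    then show ?thesis using False by (simp add: append_vec_def)
   qed
   moreover have "\<forall>w\<in>W \<inter> T. append_vec m (P w) (\<lambda>i. w i - P w i) j = inv_into N (normal_exp m) w j"
    using a inv by auto
   ultimately show "\<exists>U h. opn m U \<and> w0 \<in> U \<and> (\<forall>k. enat k \<le> \<infinity> --> Ck_open m k U h) \<and>
     (\<forall>y\<in>U \<inter> T. h y = inv_into N (normal_exp m) y j)"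
    using W unfolding Cp_open_def by blast
  qed
 qed
 ultimately have diffeo: "Cp_diffeo (m + m) m \<infinity> N T (normal_exp m)" by (simp add: Cp_diffeo_def)
 \<comment> \<open>The radius has to be of class \<open>C^r\<close> for some \<open>r\<close>;
   continuity of the reach gives \<open>r = 0\<close>.\<close>
 have c0: "Cp_on m (enat 0) M \<epsilon>"
  unfolding Cp_on_def
 proof
  fix x assume x: "x \<in> M"
  have "continuous_on (Rn m) \<epsilon>" unfolding \<epsilon>_def[abs_def] by (intro continuous_intros continuous_on_reach) auto
  then show "\<exists>U h. opn m U \<and> x \<in> U \<and> (\<forall>k. enat k \<le> enat 0 --> Ck_open m k U h) \<and> (\<forall>y\<in>U \<inter> M. h y = \<epsilon> y)"
   by (intro exI[of _ "Rn m"] exI[of _ \<epsilon>]) (use x MR in \<open>auto simp: continuous_map_Euclidean_space_iff\<close>)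
 qed
 have "tubular_neighborhood Df m M T (\<lambda>w. trunc m (inv_into N (normal_exp m) w))"
  unfolding tubular_neighborhood_def
  by (rule exI[of _ \<epsilon>], fold N_def) (use \<epsilon>D c0 \<epsilon>pos Topn MT defm diffeo inv in auto)
 then show ?thesis by blast
qed

text \<open>Stated for an arbitrary tubular neighborhood, because the retraction inside
  \<open>jet\<close> is an unspecified choice and need not be the one constructed from the
  reach.\<close>

lemma tubular_neighborhood_facts:
 assumes D: "M \<in> Df m" and M: "submanifold m \<infinity> d M" and T: "tubular_neighborhood Df m M T \<pi>"
 shows "opn m T" "M \<subseteq> T" "\<pi> \<in> T \<rightarrow> M"
  "\<And>i. i < m ==> Cp_open m \<infinity> T (\<lambda>w. \<pi> w i)"
  "\<And>x. x \<in> M ==> \<pi> x = x"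
  "\<And>x v. x \<in> M ==> normal m M x v ==> \<exists>\<delta>>0. \<forall>t. \<bar>t\<bar> < \<delta> --> (\<lambda>i. x i + t * v i) \<in> T \<and> \<pi> (\<lambda>i. x i + t * v i) = x"
  "definable_map Df m m T \<pi>"
proof -
 have MR: "M \<subseteq> Rn m" by (rule submanifold_Rn[OF M])
 obtain \<epsilon> where \<epsilon>: "\<forall>x\<in>M. \<epsilon> x > 0" and Topn: "opn m T" and MT: "M \<subseteq> T"
  and defm: "definable_map Df (m + m) m (normal_tube m M \<epsilon>) (normal_exp m)"
  and diffeo: "Cp_diffeo (m + m) m \<infinity> (normal_tube m M \<epsilon>) T (normal_exp m)"
  and \<pi>: "\<forall>z\<in>normal_tube m M \<epsilon>. \<pi> (normal_exp m z) = trunc m z"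
  using T unfolding tubular_neighborhood_def by blast
 define N where "N = normal_tube m M \<epsilon>"
 have bij: "bij_betw (normal_exp m) N T" and ci: "Cp_map m (m + m) \<infinity> T (inv_into N (normal_exp m))"
  using diffeo by (auto simp: Cp_diffeo_def N_def)
 have \<pi>z: "\<pi> (normal_exp m z) = trunc m z" if "z \<in> N" for z using \<pi> that by (simp add: N_def)
 have NM: "trunc m z \<in> M" if "z \<in> N" for z using that in_normal_tube[OF MR] by (simp add: N_def)
 have Tz: "\<exists>z\<in>N. w = normal_exp m z" if "w \<in> T" for w using bij that by (auto simp: bij_betw_def)
 show Topn: "opn m T" and MT: "M \<subseteq> T" by fact+
 show \<pi>M: "\<pi> \<in> T \<rightarrow> M" using Tz \<pi>z NM by fastforce
 show "Cp_open m \<infinity> T (\<lambda>w. \<pi> w i)" if i: "i < m" for i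
 proof -
  have "Cp_open m \<infinity> T (\<lambda>w. inv_into N (normal_exp m) w i)"
   using ci i unfolding Cp_map_def Cp_on_open_iff[OF Topn] by simp
  moreover have "inv_into N (normal_exp m) w i = \<pi> w i" if w: "w \<in> T" for w
  proof -
   have "inv_into N (normal_exp m) w \<in> N" "normal_exp m (inv_into N (normal_exp m) w) = w"
    using bij w by (auto simp: bij_betw_def inv_into_into f_inv_into_f)
   then have "\<pi> w = trunc m (inv_into N (normal_exp m) w)" using \<pi>z[of "inv_into N (normal_exp m) w"] by simp
   then show ?thesis using i by (simp add: trunc_def)
  qed
  ultimately show ?thesis using Cp_open_cong[OF Topn, of "\<lambda>w. inv_into N (normal_exp m) w i" "\<lambda>w. \<pi> w i"] by simp
 qed
 have normal_line: "\<exists>\<delta>>0. \<forall>t. \<bar>t\<bar> < \<delta> --> (\<lambda>i. x i + t * v i) \<in> T \<and> \<pi> (\<lambda>i. x i + t * v i) = x"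
  if x: "x \<in> M" and v: "normal m M x v" for x v
 proof -
  define \<delta> where "\<delta> = \<epsilon> x / (sqrt (ip m v v) + 1)"
  have s0: "sqrt (ip m v v) \<ge> 0" by (simp add: ip_self_nonneg)
  have \<delta>: "\<delta> > 0" using \<epsilon> x s0 by (simp add: \<delta>_def divide_pos_pos add_nonneg_pos)
  have "(\<lambda>i. x i + t * v i) \<in> T \<and> \<pi> (\<lambda>i. x i + t * v i) = x" if t: "\<bar>t\<bar> < \<delta>" for t
  proof -
   have "sqrt (ip m (\<lambda>i. t * v i) (\<lambda>i. t * v i)) = \<bar>t\<bar> * sqrt (ip m v v)"
    unfolding ip_scale by (simp add: real_sqrt_mult mult.assoc[symmetric])
   also have "\<dots> \<le> \<bar>t\<bar> * (sqrt (ip m v v) + 1)" by (intro mult_left_mono) auto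
   also have "\<dots> < \<delta> * (sqrt (ip m v v) + 1)" by (rule mult_strict_right_mono) (use t s0 in linarith)+
   also have "\<dots> = \<epsilon> x"
   proof -
    have "sqrt (ip m v v) + 1 \<noteq> 0" using s0 by linarith
    then show ?thesis by (simp add: \<delta>_def)
   qed
   finally have n: "append_vec m x (\<lambda>i. t * v i) \<in> N"
    unfolding N_def using append_in_normal_tube[OF MR x] normal_scale[OF v] by simp
   have ex: "normal_exp m (append_vec m x (\<lambda>i. t * v i)) = (\<lambda>i. x i + t * v i)"
    using x MR v by (intro normal_exp_append) (auto simp: normal_def mem_Rn)
   have tr: "trunc m (append_vec m x (\<lambda>i. t * v i)) = x" using x MR by (intro trunc_append) auto
   have "normal_exp m (append_vec m x (\<lambda>i. t * v i)) \<in> T" using bij_betwE[OF bij] n by blast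
   then show ?thesis using \<pi>z[OF n] unfolding ex tr by blast
  qed
  then show ?thesis using \<delta> by blast
 qed
 show "\<pi> x = x" if x: "x \<in> M" for x
 proof -
  obtain \<delta> where d: "\<delta> > 0" "\<forall>t. \<bar>t\<bar> < \<delta> --> (\<lambda>i. x i + t * 0) \<in> T \<and> \<pi> (\<lambda>i. x i + t * 0) = x"
   using normal_line[OF x normal_zero] by blast
  have "\<bar>0::real\<bar> < \<delta>" using d(1) by simp
  from d(2)[rule_format, OF this] show ?thesis by simp
 qed
 show "\<exists>\<delta>>0. \<forall>t. \<bar>t\<bar> < \<delta> --> (\<lambda>i. x i + t * v i) \<in> T \<and> \<pi> (\<lambda>i. x i + t * v i) = x"
  if "x \<in> M" "normal m M x v" for x v by (rule normal_line[OF that])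
 have ND: "N \<in> Df (m + m)" using defm by (simp add: definable_map_def N_def)
 have TD: "T \<in> Df m"
 proof -
  have "dp m (\<lambda>w. \<exists>z\<in>N. \<forall>i<m. w i = z i + z (m + i))"
   by (intro dp_bex[OF ND] dp_intros dt_intros)
  then show ?thesis
  proof (rule dp_DfI)
   fix w
   have "(\<forall>i<m. w i = z i + z (m + i)) \<longleftrightarrow> w = normal_exp m z" if "w \<in> Rn m" for z
    using that by (auto simp: normal_exp_def mem_Rn fun_eq_iff)
   moreover have "w \<in> T ==> w \<in> Rn m" using opn_subset[OF Topn] by blast
   moreover have "w \<in> T \<longleftrightarrow> (\<exists>z\<in>N. w = normal_exp m z)" using bij by (auto simp: bij_betw_def)
   ultimately show "w \<in> T \<longleftrightarrow> w \<in> Rn m \<and> (\<exists>z\<in>N. \<forall>i<m. w i = z i + z (m + i))" by auto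
  qed
 qed
 show "definable_map Df m m T \<pi>"
 proof (rule definable_mapI[OF TD])
  show "\<pi> \<in> T \<rightarrow> Rn m" using \<pi>M MR by auto
  show "dp (m + m) (\<lambda>z. trunc m z \<in> T \<and> (\<lambda>w x. \<exists>y\<in>N. (\<forall>i<m. w i = y i + y (m + i)) \<and> (\<forall>i<m. x i = y i)) (trunc m z) (\<lambda>i. z (m + i)))"
   by (intro dp_and dp_mem[OF TD] dp_bex[OF ND] dp_intros dt_intros trunc_Rn)
  fix w x assume w: "w \<in> T" and x: "x \<in> Rn m"
  have wR: "w \<in> Rn m" using w opn_subset[OF Topn] by blast
  have 1: "(\<forall>i<m. w i = y i + y (m + i)) \<longleftrightarrow> w = normal_exp m y" for y
   using wR by (auto simp: normal_exp_def mem_Rn fun_eq_iff)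
  have 2: "(\<forall>i<m. x i = y i) \<longleftrightarrow> x = trunc m y" for y
   using x by (auto simp: trunc_def mem_Rn fun_eq_iff)
  show "(\<exists>y\<in>N. (\<forall>i<m. w i = y i + y (m + i)) \<and> (\<forall>i<m. x i = y i)) \<longleftrightarrow> x = \<pi> w"
   unfolding 1 2
  proof
   assume "\<exists>y\<in>N. w = normal_exp m y \<and> x = trunc m y"
   then obtain y where y: "y \<in> N" "w = normal_exp m y" "x = trunc m y" by blast
   show "x = \<pi> w" unfolding y(2,3) by (rule \<pi>z[OF y(1), symmetric])
  next
   assume x: "x = \<pi> w"
   obtain y where y: "y \<in> N" "w = normal_exp m y" using Tz[OF w] by blast
   have "x = trunc m y" unfolding x y(2) by (rule \<pi>z[OF y(1)])
   then show "\<exists>y\<in>N. w = normal_exp m y \<and> x = trunc m y" using y by blast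
  qed
 qed
qed

end

section \<open>One-jets and transversality\<close>

lemma lapp_stdb: "i < m ==> j < n ==> lapp m n D (stdb i) j = D i j"
 using sum_kron(1)[of i m "\<lambda>k. D k j"] by (simp add: lapp_def stdb_def)

lemma lapp_eqD:
 assumes "\<And>v. v \<in> Rn m ==> lapp m n D v = lapp m n E v" "i < m" "j < n"
 shows "D i j = E i j"
 using fun_cong[OF assms(1)[OF stdb_Rn[OF assms(2)]], of j] by (simp add: lapp_stdb[OF assms(2,3)])

lemma lapp_chain:
 assumes U: "opn m U" and W: "opn n W"
  and G: "\<And>i. i < n ==> Ck_open m (Suc 0) U (\<lambda>x. G x i)" "G \<in> U \<rightarrow> W"
  and H: "\<And>j. j < k ==> Ck_open n (Suc 0) W (H j)" and x: "x \<in> U"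
 shows "lapp m k (grad (\<lambda>j x. H j (G x)) x) v = lapp n k (grad H (G x)) (lapp m n (grad (\<lambda>i x. G x i) x) v)"
proof
 fix j
 show "lapp m k (grad (\<lambda>j x. H j (G x)) x) v j = lapp n k (grad H (G x)) (lapp m n (grad (\<lambda>i x. G x i) x) v) j"
 proof (cases "j < k")
  case True
  have "(\<Sum>l<m. pderiv_coord l (\<lambda>x. H j (G x)) x * v l) =
    (\<Sum>l<m. \<Sum>i<n. pderiv_coord i (H j) (G x) * (pderiv_coord l (\<lambda>x. G x i) x * v l))"
   by (rule sum.cong) (auto simp: pderiv_coord_compose[OF U W H[OF True] G x] sum_distrib_right mult.assoc)
  also have "\<dots> = (\<Sum>i<n. pderiv_coord i (H j) (G x) * (\<Sum>l<m. pderiv_coord l (\<lambda>x. G x i) x * v l))"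
   by (subst sum.swap) (simp add: sum_distrib_left)
  finally show ?thesis using True by (simp add: lapp_def grad_def)
 qed (simp add: lapp_def)
qed

lemma tangent_normal_decomposition:
 assumes M: "submanifold m p d M" "1 \<le> p" "x \<in> M" and v: "v \<in> Rn m"
 obtains a b where "a \<in> tangent_space M x" "normal m M x b" "v = (\<lambda>i. a i + b i)"
proof -
 obtain e where e: "orthonormal m d e" "lin_span d e = tangent_space M x"
  by (rule tangent_orthonormal_basis[OF M])
 show thesis
 proof (rule that[of "proj m d e v" "\<lambda>i. v i - proj m d e v i"])
  show "proj m d e v \<in> tangent_space M x" using proj_in_span e(2) by metis
  show "normal m M x (\<lambda>i. v i - proj m d e v i)"
   unfolding normal_def using residual_orthogonal[OF e(1)] e(2) Rn_diff[OF v proj_Rn[OF e(1)]] by blast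
 qed simp
qed

definition mvec :: "nat => nat => nat" where
 "mvec i = (\<lambda>k. if k = i then 1 else 0)"

lemma multi_indices_1: "multi_indices m 1 = mvec ` {..<m}"
proof
 show "mvec ` {..<m} \<subseteq> multi_indices m 1"
  by (auto simp: multi_indices_def mvec_def)
 show "multi_indices m 1 \<subseteq> mvec ` {..<m}"
 proof
  fix \<alpha> assume a: "\<alpha> \<in> multi_indices m 1"
  then have "(\<Sum>i<m. \<alpha> i) = 1" by (simp add: multi_indices_def)
  then obtain i where i: "i < m" "\<alpha> i = 1" "\<forall>k<m. i \<noteq> k --> \<alpha> k = 0"
   using sum_eq_1_iff[of "{..<m}" \<alpha>] by auto
  have "\<alpha> = mvec i"
  proof
   fix k show "\<alpha> k = mvec i k"
    using i a by (cases "k < m") (auto simp: mvec_def multi_indices_def)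
  qed
  then show "\<alpha> \<in> mvec ` {..<m}" using i(1) by blast
 qed
qed

lemma inj_mvec: "inj_on mvec A"
 by (auto simp: inj_on_def mvec_def fun_eq_iff split: if_splits)

lemma card_multi_indices_1: "card (multi_indices m 1) = m"
 unfolding multi_indices_1 by (simp add: card_image[OF inj_mvec])

text \<open>The place of the \<open>i\<close>-th first-order derivative in the enumeration used by
  \<open>jet\<close>. Only its bijectivity on \<open>{..<m}\<close> matters.\<close>

definition jidx :: "nat => nat => nat" where
 "jidx m i = to_nat_on (multi_indices m 1) (mvec i)"

lemma from_nat_into_jidx: "i < m ==> from_nat_into (multi_indices m 1) (jidx m i) = mvec i"
 unfolding jidx_def multi_indices_1 by (rule from_nat_into_to_nat_on) (auto intro: countable_finite)

lemma jidx_bij: "bij_betw (jidx m) {..<m} {..<m}"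
proof -
 have f: "finite (multi_indices m 1)" unfolding multi_indices_1 by simp
 have "bij_betw (to_nat_on (multi_indices m 1)) (mvec ` {..<m}) {..<m}"
  using to_nat_on_finite[OF f] unfolding card_multi_indices_1 unfolding multi_indices_1 .
 moreover have "bij_betw mvec {..<m} (mvec ` {..<m})" by (simp add: bij_betw_def inj_mvec)
 ultimately have "bij_betw (to_nat_on (multi_indices m 1) \<circ> mvec) {..<m} {..<m}"
  using bij_betw_trans by blast
 then show ?thesis by (simp add: jidx_def[abs_def] o_def)
qed

lemma jidx_less: "i < m ==> jidx m i < m"
 using bij_betwE[OF jidx_bij, of m] by auto

lemma mixed_pderiv_mvec:
 assumes "i < m"
 shows "mixed_pderiv m (mvec i) g = pderiv_coord i g"
proof -
 have "fold (\<lambda>k. pderiv_coord k ^^ mvec i k) xs g = (if i \<in> set xs then pderiv_coord i g else g)"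
  if "distinct xs" for xs g
  using that by (induction xs arbitrary: g) (auto simp: mvec_def)
 then show ?thesis using assms by (simp add: mixed_pderiv_def)
qed

text \<open>The derivative block of a 1-jet, in the matrix format of \<open>lapp\<close>; the
  component index runs fastest in \<open>jet\<close>, hence the stride \<open>n\<close>.\<close>

definition jetL :: "nat => nat => (nat => real) => nat => nat => real" where
 "jetL m n z = (\<lambda>i j. z (m + n + jidx m i * n + j))"

definition jetY :: "nat => nat => (nat => real) => nat => real" where
 "jetY m n z = trunc n (\<lambda>i. z (m + i))"

lemma jet_dim_1: "jet_dim m n 1 = m + n + n * m"
 unfolding jet_dim_def card_multi_indices_1 by (rule refl)

lemma jet_index_less: "i < m ==> j < n ==> jidx m i * n + j < n * m"
proof -
 assume "i < m" "j < n"
 then have "jidx m i * n + j < jidx m i * n + n" by simp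
 also have "\<dots> = Suc (jidx m i) * n" by simp
 also have "\<dots> \<le> m * n" using jidx_less[OF \<open>i < m\<close>] by (intro mult_right_mono) auto
 finally show ?thesis by (simp add: mult.commute)
qed

lemma jet_vec_eqI:
 assumes z: "z \<in> Rn (jet_dim m n 1)" "z' \<in> Rn (jet_dim m n 1)"
  and x: "trunc m z = trunc m z'" and y: "jetY m n z = jetY m n z'"
  and L: "\<And>i j. i < m ==> j < n ==> jetL m n z i j = jetL m n z' i j"
 shows "z = z'"
proof
 fix k
 consider "k < m" | "m \<le> k" "k < m + n" | "m + n \<le> k" "k < m + n + n * m" | "m + n + n * m \<le> k" by linarith
 then show "z k = z' k"
 proof cases
  case 1
  then show ?thesis using fun_cong[OF x, of k] by (simp add: trunc_def)
 next
  case 2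
  then have "k - m < n" "m + (k - m) = k" by linarith+
  then show ?thesis using fun_cong[OF y, of "k - m"] by (simp add: jetY_def trunc_def)
 next
  case 3
  define l where "l = k - (m + n)"
  have l: "l < n * m" using 3 by (simp add: l_def)
  then have n0: "n > 0" by (cases n) auto
  have "l div n < m" using l n0 by (simp add: div_less_iff_less_mult mult.commute)
  then obtain i where i: "i < m" "jidx m i = l div n"
   using bij_betw_imp_surj_on[OF jidx_bij, of m] by (metis imageE lessThan_iff)
  have "k = m + n + jidx m i * n + l mod n" using 3 i(2) by (simp add: l_def)
  then show ?thesis using L[OF i(1), of "l mod n"] n0 by (simp add: jetL_def)
 next
  case 4
  then show ?thesis using z unfolding jet_dim_1 by (simp add: mem_Rn)
 qed
qed

definition lin_trans :: "nat => nat => (nat => real) set => (nat => real) set => (nat => real) => (nat => nat => real) => bool" where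
 "lin_trans m n N S y L \<longleftrightarrow> (\<forall>u\<in>tangent_space N y. \<exists>v\<in>Rn m. \<exists>b\<in>tangent_space S y. u = (\<lambda>j. lapp m n L v j + b j))"

text \<open>A proper subspace of the tangent space of \<open>N\<close> has a unit normal inside it.
  Failure of transversality becomes the existence of a unit vector, a form that survives
  limits.\<close>

lemma not_lin_trans_iff:
 assumes N: "subsp n (tangent_space N y)" and S: "subsp n (tangent_space S y)"
  and SN: "tangent_space S y \<subseteq> tangent_space N y" and L: "\<And>v. v \<in> Rn m ==> lapp m n L v \<in> tangent_space N y"
 shows "\<not> lin_trans m n N S y L \<longleftrightarrow> (\<exists>\<eta>\<in>tangent_space N y. ip n \<eta> \<eta> = 1 \<and>
  (\<forall>v\<in>Rn m. ip n \<eta> (lapp m n L v) = 0) \<and> (\<forall>b\<in>tangent_space S y. ip n \<eta> b = 0))"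
proof
 define E where "E = {\<lambda>j. lapp m n L v j + b j | v b. v \<in> Rn m \<and> b \<in> tangent_space S y}"
 have EI: "(\<lambda>j. lapp m n L v j + b j) \<in> E" if "v \<in> Rn m" "b \<in> tangent_space S y" for v b
  using that by (auto simp: E_def)
 have EN: "E \<subseteq> tangent_space N y" using L SN subspD(3)[OF N] by (auto simp: E_def)
 have E: "subsp n E"
  unfolding subsp_def
 proof (intro conjI ballI allI)
  show "E \<subseteq> Rn n" using EN N by (auto simp: subsp_def)
  show "(\<lambda>_. 0) \<in> E" using EI[OF Rn_zero subspD(2)[OF S]] by (simp add: lapp_zero)
 next
  fix x1 x2 assume "x1 \<in> E" "x2 \<in> E"
  then obtain v b v' b' where e: "x1 = (\<lambda>j. lapp m n L v j + b j)" "x2 = (\<lambda>j. lapp m n L v' j + b' j)"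
   "v \<in> Rn m" "v' \<in> Rn m" "b \<in> tangent_space S y" "b' \<in> tangent_space S y" by (auto simp: E_def)
  show "(\<lambda>i. x1 i + x2 i) \<in> E"
   using EI[OF Rn_add[OF e(3,4)] subspD(3)[OF S e(5,6)]] by (simp add: e(1,2) lapp_add algebra_simps)
 next
  fix x c assume "x \<in> E"
  then obtain v b where e: "x = (\<lambda>j. lapp m n L v j + b j)" "v \<in> Rn m" "b \<in> tangent_space S y" by (auto simp: E_def)
  show "(\<lambda>i. c * x i) \<in> E"
   using EI[OF Rn_scale[OF e(2)] subspD(4)[OF S e(3)]] by (simp add: e(1) lapp_scale algebra_simps)
 qed
 assume "\<not> lin_trans m n N S y L"
 then obtain u where u: "u \<in> tangent_space N y" "u \<notin> E" unfolding lin_trans_def E_def by blast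
 obtain k e where e: "orthonormal n k e" "lin_span k e = E" by (rule orthonormal_basis_exists[OF E])
 define w where "w = (\<lambda>i. u i - proj n k e u i)"
 have uR: "u \<in> Rn n" by (rule subspD(1)[OF N u(1)])
 have wpos: "ip n w w > 0" unfolding w_def by (rule orthonormal_extend(1)[OF e(1) uR]) (use u(2) e(2) in simp)
 have wN: "w \<in> tangent_space N y"
  unfolding w_def by (rule subsp_diff[OF N u(1)]) (use EN e(2) proj_in_span in blast)
 have wE: "ip n w x = 0" if "x \<in> E" for x unfolding w_def by (rule residual_orthogonal[OF e(1)]) (use that e(2) in simp)
 define \<eta> where "\<eta> = (\<lambda>i. (1 / sqrt (ip n w w)) * w i)"
 have "\<eta> \<in> tangent_space N y" unfolding \<eta>_def by (rule subspD(4)[OF N wN])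
 moreover have "ip n \<eta> \<eta> = 1" unfolding \<eta>_def ip_scale using wpos by simp
 moreover have "ip n \<eta> (lapp m n L v) = 0" if "v \<in> Rn m" for v
  using wE[OF EI[OF that subspD(2)[OF S]]] unfolding \<eta>_def ip_scale by simp
 moreover have "ip n \<eta> b = 0" if "b \<in> tangent_space S y" for b
  using wE[OF EI[OF Rn_zero that]] unfolding \<eta>_def ip_scale by (simp add: lapp_zero)
 ultimately show "\<exists>\<eta>\<in>tangent_space N y. ip n \<eta> \<eta> = 1 \<and>
  (\<forall>v\<in>Rn m. ip n \<eta> (lapp m n L v) = 0) \<and> (\<forall>b\<in>tangent_space S y. ip n \<eta> b = 0)" by blast
next
 assume "\<exists>\<eta>\<in>tangent_space N y. ip n \<eta> \<eta> = 1 \<and>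
  (\<forall>v\<in>Rn m. ip n \<eta> (lapp m n L v) = 0) \<and> (\<forall>b\<in>tangent_space S y. ip n \<eta> b = 0)"
 then obtain \<eta> where h: "\<eta> \<in> tangent_space N y" "ip n \<eta> \<eta> = 1" "\<And>v. v \<in> Rn m ==> ip n \<eta> (lapp m n L v) = 0"
  "\<And>b. b \<in> tangent_space S y ==> ip n \<eta> b = 0" by blast
 show "\<not> lin_trans m n N S y L"
 proof
  assume "lin_trans m n N S y L"
  then obtain v b where v: "v \<in> Rn m" "b \<in> tangent_space S y" "\<eta> = (\<lambda>j. lapp m n L v j + b j)"
   using h(1) unfolding lin_trans_def by blast
  have "ip n \<eta> \<eta> = ip n \<eta> (\<lambda>j. lapp m n L v j + b j)" using v(3) by simp
  also have "\<dots> = 0" unfolding ip_add using h(3)[OF v(1)] h(4)[OF v(2)] by simp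
  finally show False using h(2) by simp
 qed
qed

section \<open>Formal one-jets and their realization\<close>

context o_minimal_field
begin

lemma tubular_retraction_works:
 assumes "M \<in> Df m" "submanifold m \<infinity> d M"
 obtains T where "tubular_neighborhood Df m M T (tubular_retraction Df m M)"
proof -
 have "\<exists>\<pi> T. tubular_neighborhood Df m M T \<pi>" using tubular_neighborhood_exists[OF assms] by blast
 from someI_ex[OF this] show thesis using that unfolding tubular_retraction_def[symmetric] by blast
qed

text \<open>\<open>Cp_on\<close> provides local extensions only; composition with the retraction
  gives a single smooth function on the tube.\<close>

lemma smooth_extension:
 assumes D: "M \<in> Df m" and M: "submanifold m \<infinity> d M" and T: "tubular_neighborhood Df m M T \<pi>"
  and g: "Cp_on m \<infinity> M g"
 shows "Cp_open m \<infinity> T (\<lambda>w. g (\<pi> w))"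
proof (rule Cp_open_local)
 note F = tubular_neighborhood_facts[OF D M T]
 show "T \<subseteq> Rn m" by (rule opn_subset[OF F(1)])
 fix w assume w: "w \<in> T"
 have MR: "M \<subseteq> Rn m" by (rule submanifold_Rn[OF M])
 have "\<pi> w \<in> M" using F(3) w by auto
 then obtain U h where U: "opn m U" "\<pi> w \<in> U" "Cp_open m \<infinity> U h" "\<forall>y\<in>U \<inter> M. h y = g y"
  using g unfolding Cp_on_def Cp_open_def by metis
 define W where "W = {w \<in> T. \<pi> w \<in> U}"
 have W: "opn m W" unfolding W_def
 proof (rule opn_preimage[OF F(1) U(1)])
  show "continuous_on T (\<lambda>w. \<pi> w i)" if "i < m" for i
   by (rule Ck_open_continuous[OF opn_subset[OF F(1)] Cp_open_Ck[OF F(4)[OF that], of 0]]) simp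
 qed (use F(3) MR in auto)
 have "Cp_open m \<infinity> W (\<lambda>w. h (\<pi> w))"
 proof (rule Cp_open_compose[OF W U(1,3)])
  show "Cp_open m \<infinity> W (\<lambda>w. \<pi> w i)" if "i < m" for i
   by (rule Cp_open_subset[OF F(4)[OF that]]) (auto simp: W_def)
 qed (auto simp: W_def)
 moreover have "h (\<pi> w') = g (\<pi> w')" if "w' \<in> W" for w' using that U(4) F(3) by (auto simp: W_def)
 ultimately have "Cp_open m \<infinity> W (\<lambda>w. g (\<pi> w))"
  using Cp_open_cong[OF W, of "\<lambda>w. h (\<pi> w)" "\<lambda>w. g (\<pi> w)"] by simp
 then show "\<exists>W. opn m W \<and> w \<in> W \<and> Cp_open m \<infinity> W (\<lambda>w. g (\<pi> w))"
  using W w U(2) by (auto simp: W_def)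
qed

text \<open>The retraction is constant along short normal segments.\<close>

lemma derivative_normal_eq_0:
 assumes D: "M \<in> Df m" and M: "submanifold m \<infinity> d M" and T: "tubular_neighborhood Df m M T \<pi>"
  and h: "\<And>j. j < n ==> Ck_open m (Suc 0) T (\<lambda>w. g j (\<pi> w))" and x: "x \<in> M" and v: "normal m M x v"
 shows "lapp m n (grad (\<lambda>j w. g j (\<pi> w)) x) v = (\<lambda>_. 0)"
proof
 note F = tubular_neighborhood_facts[OF D M T]
 have xR: "x \<in> Rn m" and vR: "v \<in> Rn m" using x submanifold_Rn[OF M] v by (auto simp: normal_def)
 fix j
 show "lapp m n (grad (\<lambda>j w. g j (\<pi> w)) x) v j = 0"
 proof (cases "j < n")
  case True
  obtain \<delta> where \<delta>: "\<delta> > 0" "\<And>t. \<bar>t\<bar> < \<delta> ==> \<pi> (\<lambda>i. x i + t * v i) = x" using F(6)[OF x v] by blast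
  have "((\<lambda>t. g j (\<pi> (\<lambda>i. x i + t * v i))) has_real_derivative
    (\<Sum>i<m. pderiv_coord i (\<lambda>w. g j (\<pi> w)) (\<lambda>i. x i + 0 * v i) * v i)) (at 0)"
   by (rule chain_curve[where \<gamma> = "\<lambda>t i. x i + t * v i" and v = v, OF F(1) h[OF True]])
     (use F(2) x xR vR in \<open>auto intro!: derivative_eq_intros always_eventually simp: mem_Rn\<close>)
  moreover have "\<forall>\<^sub>F t in nhds (0::real). g j (\<pi> (\<lambda>i. x i + t * v i)) = g j x"
   unfolding eventually_nhds_metric dist_real_def using \<delta> by (intro exI[of _ \<delta>]) auto
  then have "((\<lambda>t. g j (\<pi> (\<lambda>i. x i + t * v i))) has_real_derivative 0) (at 0)"
   by (subst DERIV_cong_ev[OF refl _ refl]) auto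
  ultimately have "(\<Sum>i<m. pderiv_coord i (\<lambda>w. g j (\<pi> w)) (\<lambda>i. x i + 0 * v i) * v i) = 0"
   by (rule DERIV_unique)
  then show ?thesis using True by (simp add: lapp_def grad_def)
 qed (simp add: lapp_def)
qed

text \<open>The retraction is the identity along curves in \<open>M\<close>. Together with
  \<open>derivative_normal_eq_0\<close> its derivative at a point of \<open>M\<close> is the
  orthogonal projection onto the tangent space.\<close>

lemma retraction_derivative_tangent:
 assumes D: "M \<in> Df m" and M: "submanifold m \<infinity> d M" and T: "tubular_neighborhood Df m M T \<pi>"
  and x: "x \<in> M" and v: "v \<in> tangent_space M x"
 shows "lapp m m (grad (\<lambda>j w. \<pi> w j) x) v = v"
proof
 note F = tubular_neighborhood_facts[OF D M T]
 have MR: "M \<subseteq> Rn m" by (rule submanifold_Rn[OF M])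
 obtain \<gamma> where g: "curve_through M x v \<gamma>" using v by (auto simp: tangent_space_def)
 have g0: "\<gamma> 0 = x" and gv: "\<And>i. ((\<lambda>t. \<gamma> t i) has_real_derivative v i) (at 0)"
  using g by (auto simp: curve_through_def has_velocity_def)
 have ev: "\<forall>\<^sub>F t in nhds 0. \<gamma> t \<in> Rn m"
  using curve_eventually[OF g] by (rule eventually_mono) (use MR in auto)
 fix j
 show "lapp m m (grad (\<lambda>j w. \<pi> w j) x) v j = v j"
 proof (cases "j < m")
  case True
  have p1: "Ck_open m (Suc 0) T (\<lambda>w. \<pi> w j)" by (rule Cp_open_Ck[OF F(4)[OF True]]) simp
  have "((\<lambda>t. \<pi> (\<gamma> t) j) has_real_derivative (\<Sum>i<m. pderiv_coord i (\<lambda>w. \<pi> w j) (\<gamma> 0) * v i)) (at 0)"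
   by (rule chain_curve[OF F(1) p1 _ ev gv]) (use F(2) x g0 in auto)
  moreover have "\<forall>\<^sub>F t in nhds 0. \<pi> (\<gamma> t) j = \<gamma> t j"
   using curve_eventually[OF g] by (rule eventually_mono) (simp add: F(5))
  then have "((\<lambda>t. \<pi> (\<gamma> t) j) has_real_derivative v j) (at 0)"
   using gv[of j] by (subst DERIV_cong_ev[OF refl _ refl]) auto
  ultimately have "(\<Sum>i<m. pderiv_coord i (\<lambda>w. \<pi> w j) (\<gamma> 0) * v i) = v j" by (rule DERIV_unique)
  then show ?thesis using True g0 by (simp add: lapp_def grad_def)
 next
  case False
  then show ?thesis using tangent_space_Rn[OF MR v] by (simp add: lapp_def mem_Rn)
 qed
qed

text \<open>Formal 1-jets: the derivative maps into the tangent space of \<open>N\<close> and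
  annihilates the normal vectors of \<open>M\<close>. By \<open>jet_space_1\<close> these conditions
  describe the jet space exactly, and no quantifier over maps remains.\<close>

definition gjet :: "nat => (nat => real) set => nat => (nat => real) set => (nat => real) => bool" where
 "gjet m M n N z \<longleftrightarrow> z \<in> Rn (jet_dim m n 1) \<and> trunc m z \<in> M \<and> jetY m n z \<in> N \<and>
   (\<forall>v\<in>Rn m. lapp m n (jetL m n z) v \<in> tangent_space N (jetY m n z)) \<and>
   (\<forall>v. normal m M (trunc m z) v --> lapp m n (jetL m n z) v = (\<lambda>_. 0))"

abbreviation fext where
 "fext m M f \<equiv> \<lambda>j w. f (tubular_retraction Df m M w) j"

lemma jet_1:
 assumes x: "x \<in> Rn m" and f: "f x \<in> Rn n"
 shows "jet Df m M n 1 f x \<in> Rn (jet_dim m n 1)" "trunc m (jet Df m M n 1 f x) = x"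
  "jetY m n (jet Df m M n 1 f x) = f x"
  "\<And>i j. i < m ==> j < n ==> jetL m n (jet Df m M n 1 f x) i j = grad (fext m M f) x i j"
proof -
 show "jet Df m M n 1 f x \<in> Rn (jet_dim m n 1)" by (auto simp: jet_def mem_Rn jet_dim_def)
 show "trunc m (jet Df m M n 1 f x) = x" using x by (auto simp: jet_def trunc_def mem_Rn fun_eq_iff)
 show "jetY m n (jet Df m M n 1 f x) = f x"
  using f by (auto simp: jet_def jetY_def trunc_def mem_Rn fun_eq_iff)
 fix i j assume ij: "i < m" "j < n"
 have "m + n + jidx m i * n + j < jet_dim m n 1" using jet_index_less[OF ij] unfolding jet_dim_1 by linarith
 moreover have "(m + n + jidx m i * n + j - (m + n)) div n = jidx m i"
  "(m + n + jidx m i * n + j - (m + n)) mod n = j" using ij(2) by (simp_all add: add.assoc)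
 ultimately show "jetL m n (jet Df m M n 1 f x) i j = grad (fext m M f) x i j"
  unfolding jetL_def jet_def grad_def
  by (simp only: from_nat_into_jidx[OF ij(1)] mixed_pderiv_mvec[OF ij(1)]) simp
qed

lemma lapp_cong: "(\<And>i j. i < m ==> j < n ==> D i j = E i j) ==> lapp m n D v = lapp m n E v"
 unfolding lapp_def by (intro ext) (auto intro!: sum.cong)

lemma D_infD:
 assumes "f \<in> D_inf Df m M n N"
 shows "x \<in> M ==> f x \<in> N" "f \<in> M \<rightarrow> Rn n" "j < n ==> Cp_on m \<infinity> M (\<lambda>x. f x j)"
 using assms by (auto simp: D_inf_def Cp_map_def)

lemma gjet_jet:
 assumes D: "M \<in> Df m" and M: "submanifold m \<infinity> d M" and N: "N \<subseteq> Rn n"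
  and f: "f \<in> D_inf Df m M n N" and x: "x \<in> M"
 shows "gjet m M n N (jet Df m M n 1 f x)"
proof -
 obtain T where T: "tubular_neighborhood Df m M T (tubular_retraction Df m M)"
  by (rule tubular_retraction_works[OF D M])
 note F = tubular_neighborhood_facts[OF D M T]
 have xR: "x \<in> Rn m" using x submanifold_Rn[OF M] by auto
 have fR: "f x \<in> Rn n" using D_infD(2)[OF f] x by auto
 note J = jet_1[where m = m and n = n and x = x and f = f and M = M, OF xR fR]
 have L: "lapp m n (jetL m n (jet Df m M n 1 f x)) v = lapp m n (grad (fext m M f) x) v" for v
  by (rule lapp_cong) (rule J(4))
 have h: "Ck_open m (Suc 0) T (fext m M f j)" if "j < n" for j
  using Cp_open_Ck[OF smooth_extension[OF D M T D_infD(3)[OF f that]], of "Suc 0"] by simp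
 have xT: "x \<in> T" using F(2) x by auto
 have "lapp m n (grad (fext m M f) x) v \<in> tangent_space N (f x)" if v: "v \<in> Rn m" for v
 proof -
  have "lapp m n (grad (fext m M f) x) v \<in> tangent_space N (f (tubular_retraction Df m M x))"
   by (rule tangent_space_line[OF F(1) h xT v N, where F = "\<lambda>w. f (tubular_retraction Df m M w)"])
     (use F(3) D_infD(1)[OF f] in auto)
  then show ?thesis by (simp add: F(5)[OF x])
 qed
 moreover have "lapp m n (grad (fext m M f) x) v = (\<lambda>_. 0)" if "normal m M x v" for v
  by (rule derivative_normal_eq_0[OF D M T h x that])
 ultimately show ?thesis
  unfolding gjet_def J(2,3) L using J(1) x D_infD(1)[OF f x] by blast
qed

lemma definable_map_cong:
 assumes F: "definable_map Df m n A F" and e: "\<And>x. x \<in> A ==> F x = G x"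
 shows "definable_map Df m n A G"
proof -
 have "{append_vec m x (F x) | x. x \<in> A} = {append_vec m x (G x) | x. x \<in> A}" using e by (intro Collect_cong ex_cong1) auto
 moreover have "F \<in> A \<rightarrow> Rn n \<longleftrightarrow> G \<in> A \<rightarrow> Rn n" by (rule Pi_cong) (use e in auto)
 ultimately show ?thesis using F unfolding definable_map_def by simp
qed

text \<open>Maps into \<open>N\<close> are written as definable terms in the ambient space, with
  values in the tube, and then retracted.\<close>

lemma D_inf_retract:
 assumes M: "M \<in> Df m" "M \<subseteq> Rn m"
  and N: "N \<in> Df n" "submanifold n \<infinity> d N" and T: "tubular_neighborhood Df n N T \<pi>"
  and O': "opn m Q" "M \<subseteq> Q"
  and h: "\<And>j. j < n ==> Cp_open m \<infinity> Q (\<lambda>w. h w j)" "h \<in> Q \<rightarrow> T" and t: "\<And>j. j < n ==> dt m (\<lambda>w. h w j)"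
 shows "restrict (\<lambda>w. \<pi> (h w)) M \<in> D_inf Df m M n N" "\<And>j. j < n ==> Cp_open m \<infinity> Q (\<lambda>w. \<pi> (h w) j)"
proof -
 note F = tubular_neighborhood_facts[OF N T]
 have TR: "T \<subseteq> Rn n" by (rule opn_subset[OF F(1)])
 show s: "Cp_open m \<infinity> Q (\<lambda>w. \<pi> (h w) j)" if "j < n" for j
  by (rule Cp_open_compose[OF O'(1) F(1) F(4)[OF that] h])
 have hT: "h w \<in> T" if "w \<in> M" for w using h(2) O'(2) that by auto
 have NR: "N \<subseteq> Rn n" by (rule submanifold_Rn[OF N(2)])
 have "definable_map Df m n M (\<lambda>w. \<pi> (h w))"
 proof (rule definable_map_compose[OF _ F(7)])
  show "definable_map Df m n M h"
   by (rule definable_map_terms[OF M(1) _ t]) (use hT TR in auto)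
 qed (use hT in auto)
 then have "definable_map Df m n M (restrict (\<lambda>w. \<pi> (h w)) M)" by (rule definable_map_cong) simp
 moreover have "Cp_map m n \<infinity> M (restrict (\<lambda>w. \<pi> (h w)) M)"
  unfolding Cp_map_def
 proof (intro conjI allI impI)
  show "restrict (\<lambda>w. \<pi> (h w)) M \<in> M \<rightarrow> Rn n" using hT F(3) NR by auto
  fix j assume j: "j < n"
  show "Cp_on m \<infinity> M (\<lambda>x. restrict (\<lambda>w. \<pi> (h w)) M x j)"
   unfolding Cp_on_def
   by (intro ballI exI[of _ Q] exI[of _ "\<lambda>w. \<pi> (h w) j"])
     (use s[OF j] O' in \<open>auto simp: Cp_open_def\<close>)
 qed
 moreover have "restrict (\<lambda>w. \<pi> (h w)) M \<in> M \<rightarrow>\<^sub>E N" using hT F(3) by auto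
 ultimately show "restrict (\<lambda>w. \<pi> (h w)) M \<in> D_inf Df m M n N" by (simp add: D_inf_def)
qed

text \<open>The affine map with the prescribed derivative leaves the tube far from \<open>x\<close>.
  Dividing its linear part by a polynomial equal to 1 to first order at \<open>x\<close> makes the
  displacement small everywhere and keeps value and derivative at \<open>x\<close>; the retraction
  onto \<open>N\<close> preserves both since \<open>L\<close> has tangent values.\<close>

lemma gjet_realized:
 assumes D: "M \<in> Df m" and M: "submanifold m \<infinity> d M" and DN: "N \<in> Df n" and N: "submanifold n \<infinity> d' N"
  and z: "gjet m M n N z"
 shows "z \<in> jet_space Df m M n N 1"
proof -
 define x y L where "x = trunc m z" and "y = jetY m n z" and "L = jetL m n z"
 have zR: "z \<in> Rn (jet_dim m n 1)" and x: "x \<in> M" and y: "y \<in> N"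
  and LN: "\<And>v. v \<in> Rn m ==> lapp m n L v \<in> tangent_space N y"
  and L0: "\<And>v. normal m M x v ==> lapp m n L v = (\<lambda>_. 0)"
  using z by (auto simp: gjet_def x_def y_def L_def)
 obtain T where T: "tubular_neighborhood Df m M T (tubular_retraction Df m M)"
  by (rule tubular_retraction_works[OF D M])
 obtain TN \<rho> where TN: "tubular_neighborhood Df n N TN \<rho>" using tubular_neighborhood_exists[OF DN N] by blast
 let ?\<pi> = "tubular_retraction Df m M"
 note F = tubular_neighborhood_facts[OF D M T]
 note G = tubular_neighborhood_facts[OF DN N TN]
 have xR: "x \<in> Rn m" and yR: "y \<in> Rn n" using x y submanifold_Rn[OF M] submanifold_Rn[OF N] by auto
 have yT: "y \<in> TN" using y G(2) by auto
 obtain e where e: "e > 0" "\<And>u. u \<in> Rn n ==> \<forall>i<n. \<bar>u i - y i\<bar> < e ==> u \<in> TN"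
  using G(1) yT unfolding opn_iff by blast
 define \<Lambda> where "\<Lambda> = (\<Sum>i<m. \<Sum>j<n. \<bar>L i j\<bar>) * real m + 1"
 have \<Lambda>: "\<Lambda> > 0" unfolding \<Lambda>_def by (intro add_nonneg_pos mult_nonneg_nonneg sum_nonneg) auto
 \<comment> \<open>With \<open>t = \<Lambda> |w - x| / e\<close> the denominator is
   \<open>1 + t^2 \<ge> 2 t\<close>, so each coordinate of the displacement is at most
   \<open>e / 2\<close>.\<close>
 define C where "C = (\<Lambda> / e)\<^sup>2"
 have C0: "C \<ge> 0" by (simp add: C_def)
 define den where "den w = 1 + C * ip m (\<lambda>i. w i - x i) (\<lambda>i. w i - x i)" for w
 have den: "den w \<ge> 1" for w unfolding den_def using C0 ip_self_nonneg by simp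
 define h where "h w = (\<lambda>j. y j + lapp m n L (\<lambda>i. w i - x i) j * inverse (den w))" for w
 have hR: "h w \<in> Rn n" for w using yR by (auto simp: h_def mem_Rn lapp_def)
 have hT: "h w \<in> TN" for w
 proof (rule e(2)[OF hR], intro allI impI)
  fix j assume j: "j < n"
  define s where "s = sqrt (ip m (\<lambda>i. w i - x i) (\<lambda>i. w i - x i))"
  have s0: "s \<ge> 0" by (simp add: s_def ip_self_nonneg)
  have "\<bar>lapp m n L (\<lambda>i. w i - x i) j\<bar> \<le> (\<Sum>i<m. \<bar>L i j\<bar> * \<bar>w i - x i\<bar>)"
   using j by (simp add: lapp_def abs_mult[symmetric] sum_abs)
  also have "\<dots> \<le> (\<Sum>i<m. (\<Sum>i<m. \<Sum>j<n. \<bar>L i j\<bar>) * s)"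
  proof (rule sum_mono)
   fix i assume "i \<in> {..<m}"
   then have i: "i < m" by simp
   have "\<bar>L i j\<bar> \<le> (\<Sum>j<n. \<bar>L i j\<bar>)" by (rule member_le_sum) (use j in auto)
   also have "\<dots> \<le> (\<Sum>i<m. \<Sum>j<n. \<bar>L i j\<bar>)"
    by (rule member_le_sum[of i]) (use i in \<open>auto intro: sum_nonneg\<close>)
   finally show "\<bar>L i j\<bar> * \<bar>w i - x i\<bar> \<le> (\<Sum>i<m. \<Sum>j<n. \<bar>L i j\<bar>) * s"
    using abs_coord_le_ip[OF i, of "\<lambda>i. w i - x i"] unfolding s_def by (intro mult_mono sum_nonneg) auto
  qed
  also have "\<dots> \<le> \<Lambda> * s" unfolding \<Lambda>_def using s0 by (simp add: algebra_simps)
  finally have b: "\<bar>lapp m n L (\<lambda>i. w i - x i) j\<bar> \<le> \<Lambda> * s" .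
  have dw: "den w = 1 + (\<Lambda> * s / e)\<^sup>2"
   by (simp add: den_def C_def s_def power_mult_distrib power_divide ip_self_nonneg)
  have "2 * (\<Lambda> * s / e) \<le> den w"
   using zero_le_power2[of "\<Lambda> * s / e - 1"] by (simp add: dw power2_diff)
  then have "\<Lambda> * s \<le> e * den w / 2" using e(1) by (simp add: field_simps)
  then have "\<bar>lapp m n L (\<lambda>i. w i - x i) j\<bar> \<le> e * den w / 2" using b by linarith
  moreover have "e * den w / 2 < e * den w" using e(1) den[of w] by simp
  ultimately have "\<bar>lapp m n L (\<lambda>i. w i - x i) j\<bar> < e * den w" by linarith
  moreover have "den w > 0" using den[of w] by linarith
  ultimately have "\<bar>lapp m n L (\<lambda>i. w i - x i) j\<bar> / den w < e" by (simp add: pos_divide_less_eq)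
  then show "\<bar>h w j - y j\<bar> < e"
   using \<open>den w > 0\<close> by (simp add: h_def abs_mult divide_inverse)
 qed
 have lapps: "Cp_open m \<infinity> (Rn m) (\<lambda>w. lapp m n L (\<lambda>i. w i - x i) j)" for j
  unfolding lapp_def by (cases "j < n")
   (simp_all add: Cp_open_sum Cp_open_mult Cp_open_diff Cp_open_const Cp_open_coord)
 have dens: "Cp_open m \<infinity> (Rn m) (\<lambda>w. inverse (den w))"
 proof (rule Cp_open_inverse[OF opn_Rn])
  show "Cp_open m \<infinity> (Rn m) den" unfolding den_def[abs_def] ip_def
   by (intro Cp_open_add Cp_open_mult Cp_open_sum Cp_open_diff Cp_open_const Cp_open_coord opn_Rn) auto
  show "den w \<noteq> 0" for w using den[of w] by linarith
 qed
 have hs: "Cp_open m \<infinity> (Rn m) (\<lambda>w. h w j)" for j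
  unfolding h_def by (intro Cp_open_add Cp_open_mult lapps dens Cp_open_const opn_Rn)
 have ht: "dt m (\<lambda>w. h w j)" for j
 proof -
  have "dt m (\<lambda>w. lapp m n L (\<lambda>i. w i - x i) j)"
   unfolding lapp_def by (cases "j < n") (auto intro!: dt_intros)
  then show ?thesis unfolding h_def den_def by (intro dt_intros)
 qed
 define f where "f = restrict (\<lambda>w. \<rho> (h w)) M"
 have fD: "f \<in> D_inf Df m M n N" and fs: "\<And>j. j < n ==> Cp_open m \<infinity> (Rn m) (\<lambda>w. \<rho> (h w) j)"
  unfolding f_def using D_inf_retract[OF D submanifold_Rn[OF M] DN N TN opn_Rn submanifold_Rn[OF M] hs _ ht] hT by auto
 have hx: "h x = y" by (simp add: h_def lapp_zero)
 have fx: "f x = y" using x by (simp add: f_def hx G(5)[OF y])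
 have gh: "lapp m n (grad (\<lambda>j w. h w j) x) v = lapp m n L v" for v
 proof (rule lapp_cong)
  fix i j assume ij: "i < m" "j < n"
  have "pderiv_coord i (\<lambda>w. h w j) x = L i j"
  proof (rule pderiv_coord_eqI)
   have c: "h (x(i := t)) j = y j + (L i j * (t - x i)) * inverse (1 + C * ((t - x i) * (t - x i)))" for t
   proof -
    have "(\<Sum>k<m. L k j * ((x(i := t)) k - x k)) = (\<Sum>k<m. (L k j * (t - x k)) * (if k = i then 1 else 0))"
     by (rule sum.cong) auto
    also have "\<dots> = L i j * (t - x i)" by (rule sum_kron(1)[OF ij(1)])
    finally have 1: "(\<Sum>k<m. L k j * ((x(i := t)) k - x k)) = L i j * (t - x i)" .
    have "(\<Sum>k<m. ((x(i := t)) k - x k) * ((x(i := t)) k - x k)) = (\<Sum>k<m. ((t - x k) * (t - x k)) * (if k = i then 1 else 0))"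
     by (rule sum.cong) auto
    also have "\<dots> = (t - x i) * (t - x i)" by (rule sum_kron(1)[OF ij(1)])
    finally have 2: "(\<Sum>k<m. ((x(i := t)) k - x k) * ((x(i := t)) k - x k)) = (t - x i) * (t - x i)" .
    show ?thesis using ij(2) unfolding h_def den_def lapp_def ip_def 2 using 1 by simp
   qed
   have "((\<lambda>t. y j + (L i j * (t - x i)) * inverse (1 + C * ((t - x i) * (t - x i)))) has_real_derivative L i j) (at (x i))"
    by (auto intro!: derivative_eq_intros)
   then show "((\<lambda>t. h (x(i := t)) j) has_real_derivative L i j) (at (x i))" unfolding c .
  qed
  then show "grad (\<lambda>j w. h w j) x i j = L i j" by (simp add: grad_def)
 qed
 have k1: "Ck_open a (Suc 0) U g" if "Cp_open a \<infinity> U g" for a U g by (rule Cp_open_Ck[OF that]) simp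
 have derF: "lapp m n (grad (\<lambda>j w. \<rho> (h w) j) x) v = lapp m n L v" if "v \<in> Rn m" for v
 proof -
  have "lapp m n (grad (\<lambda>j w. \<rho> (h w) j) x) v = lapp n n (grad (\<lambda>j w. \<rho> w j) (h x)) (lapp m n (grad (\<lambda>i w. h w i) x) v)"
   by (rule lapp_chain[OF opn_Rn G(1), where H = "\<lambda>j w. \<rho> w j" and G = h])
     (use k1 hs G(4) hT xR in auto)
  also have "\<dots> = lapp m n L v"
   unfolding hx gh by (rule retraction_derivative_tangent[OF DN N TN y LN[OF that]])
  finally show ?thesis .
 qed
 have MR: "M \<subseteq> Rn m" by (rule submanifold_Rn[OF M])
 have der: "lapp m n (grad (fext m M f) x) v = lapp m n L v" if v: "v \<in> Rn m" for v
 proof -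
  have xT: "x \<in> T" using F(2) x by auto
  have "lapp m n (grad (fext m M f) x) v = lapp m n (grad (\<lambda>j w. \<rho> (h (?\<pi> w)) j) x) v"
  proof (rule lapp_cong)
   fix i j assume "i < m" "j < n"
   then show "grad (fext m M f) x i j = grad (\<lambda>j w. \<rho> (h (?\<pi> w)) j) x i j"
    unfolding grad_def using F(3) by (intro pderiv_coord_cong[OF F(1) _ xT]) (auto simp: f_def)
  qed
  also have "\<dots> = lapp m n (grad (\<lambda>j w. \<rho> (h w) j) (?\<pi> x)) (lapp m m (grad (\<lambda>i w. ?\<pi> w i) x) v)"
   by (rule lapp_chain[OF F(1) opn_Rn, where H = "\<lambda>j w. \<rho> (h w) j" and G = ?\<pi>])
     (use k1 fs F(3,4) MR xT in auto)
  also have "\<dots> = lapp m n L (lapp m m (grad (\<lambda>i w. ?\<pi> w i) x) v)"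
   unfolding F(5)[OF x] by (rule derF[OF lapp_Rn])
  \<comment> \<open>The retraction of \<open>M\<close> discards the normal part \<open>b\<close>
    before \<open>L\<close> is applied; this is harmless because \<open>L\<close> annihilates
    it.\<close>
  also have "\<dots> = lapp m n L v"
  proof -
   obtain a b where ab: "a \<in> tangent_space M x" "normal m M x b" "v = (\<lambda>i. a i + b i)"
    by (rule tangent_normal_decomposition[OF M _ x v]) auto
   have pa: "lapp m m (grad (\<lambda>i w. ?\<pi> w i) x) a = a" by (rule retraction_derivative_tangent[OF D M T x ab(1)])
   have pb: "lapp m m (grad (\<lambda>i w. ?\<pi> w i) x) b = (\<lambda>_. 0)"
    by (rule derivative_normal_eq_0[OF D M T _ x ab(2), where g = "\<lambda>i w. w i"]) (use k1 F(4) in auto)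
   show ?thesis unfolding ab(3) lapp_add pa pb L0[OF ab(2)] by (simp add: lapp_zero)
  qed
  finally show ?thesis .
 qed
 have fxR: "f x \<in> Rn n" using yR fx by simp
 note J = jet_1[where m = m and n = n and x = x and f = f and M = M, OF xR fxR]
 have "z = jet Df m M n 1 f x"
 proof (rule jet_vec_eqI[OF zR J(1)])
  show "trunc m z = trunc m (jet Df m M n 1 f x)" unfolding J(2) by (simp add: x_def)
  show "jetY m n z = jetY m n (jet Df m M n 1 f x)" unfolding J(3) by (simp add: fx y_def)
  fix i j assume ij: "i < m" "j < n"
  show "jetL m n z i j = jetL m n (jet Df m M n 1 f x) i j"
   unfolding J(4)[OF ij] L_def[symmetric] using lapp_eqD[OF der ij] by simp
 qed
 then show ?thesis unfolding jet_space_def using x fD by blast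
qed

lemma jet_space_1:
 assumes "M \<in> Df m" "submanifold m \<infinity> d M" "N \<in> Df n" "submanifold n \<infinity> d' N"
 shows "z \<in> jet_space Df m M n N 1 \<longleftrightarrow> gjet m M n N z"
 using gjet_realized[OF assms] gjet_jet[OF assms(1,2) submanifold_Rn[OF assms(4)]]
 unfolding jet_space_def by blast

text \<open>The normal part of an ambient vector does not contribute, so the derivative of the
  extension on \<open>Rn m\<close> and the differential on the tangent space have the same image.
  This image lies in the tangent space of \<open>N\<close>, as does that of \<open>S\<close>, so
  equality of the sum reduces to one inclusion.\<close>

lemma transverse_iff_lin_trans:
 assumes D: "M \<in> Df m" and M: "submanifold m \<infinity> d M" and N: "submanifold n \<infinity> d' N"
  and S: "S \<subseteq> N" "submanifold n 1 k S" and f: "f \<in> D_inf Df m M n N"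
 shows "transverse M N f S \<longleftrightarrow> (\<forall>x\<in>M. f x \<in> S --> lin_trans m n N S (f x) (grad (fext m M f) x))"
proof -
 obtain T where T: "tubular_neighborhood Df m M T (tubular_retraction Df m M)"
  by (rule tubular_retraction_works[OF D M])
 note F = tubular_neighborhood_facts[OF D M T]
 have MR: "M \<subseteq> Rn m" and NR: "N \<subseteq> Rn n" using submanifold_Rn M N by auto
 have h: "Ck_open m (Suc 0) T (fext m M f j)" if "j < n" for j
  using Cp_open_Ck[OF smooth_extension[OF D M T D_infD(3)[OF f that]], of "Suc 0"] by simp
 have "(f x \<notin> S \<or> {\<lambda>i. a i + b i | a b. a \<in> differential M f x ` tangent_space M x \<and> b \<in> tangent_space S (f x)} = tangent_space N (f x))
   \<longleftrightarrow> (f x \<in> S --> lin_trans m n N S (f x) (grad (fext m M f) x))" if x: "x \<in> M" for x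
 proof (cases "f x \<in> S")
  case fS: True
  let ?L = "grad (fext m M f) x"
  have xT: "x \<in> T" using F(2) x by auto
  have dif: "differential M f x v = lapp m n ?L v" if "v \<in> tangent_space M x" for v
   by (rule differential_eq[OF MR F(1) xT h _ _ that]) (use F(5) D_infD(2)[OF f] in auto)
  have im: "\<exists>a\<in>tangent_space M x. lapp m n ?L a = lapp m n ?L v" if v: "v \<in> Rn m" for v
  proof -
   obtain a b where ab: "a \<in> tangent_space M x" "normal m M x b" "v = (\<lambda>i. a i + b i)"
    by (rule tangent_normal_decomposition[OF M _ x v]) auto
   have "lapp m n ?L b = (\<lambda>_. 0)" by (rule derivative_normal_eq_0[OF D M T h x ab(2)])
   then have "lapp m n ?L v = lapp m n ?L a" unfolding ab(3) lapp_add by simp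
   then show ?thesis using ab(1) by auto
  qed
  have J: "gjet m M n N (jet Df m M n 1 f x)" by (rule gjet_jet[OF D M NR f x])
  have xR: "x \<in> Rn m" and fR: "f x \<in> Rn n" using x MR D_infD(2)[OF f] by auto
  note J1 = jet_1[where m = m and n = n and x = x and f = f and M = M, OF xR fR]
  have LN: "lapp m n ?L v \<in> tangent_space N (f x)" if "v \<in> Rn m" for v
  proof -
   have "lapp m n (jetL m n (jet Df m M n 1 f x)) v = lapp m n ?L v" by (rule lapp_cong) (rule J1(4))
   then show ?thesis using J that unfolding gjet_def J1(3) by auto
  qed
  have Ns: "subsp n (tangent_space N (f x))" by (rule tangent_subsp[OF N]) (use D_infD(1)[OF f x] in auto)
  have SN: "tangent_space S (f x) \<subseteq> tangent_space N (f x)" by (rule tangent_space_mono[OF S(1)])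
  have "{\<lambda>i. a i + b i | a b. a \<in> differential M f x ` tangent_space M x \<and> b \<in> tangent_space S (f x)} =
    {\<lambda>i. lapp m n ?L v i + b i | v b. v \<in> Rn m \<and> b \<in> tangent_space S (f x)}" (is "?A = ?B")
  proof
   show "?A \<subseteq> ?B" using dif tangent_space_Rn[OF MR] by force
   show "?B \<subseteq> ?A"
   proof
    fix u assume "u \<in> ?B"
    then obtain v b where vb: "u = (\<lambda>i. lapp m n ?L v i + b i)" "v \<in> Rn m" "b \<in> tangent_space S (f x)" by blast
    obtain a where a: "a \<in> tangent_space M x" "lapp m n ?L a = lapp m n ?L v" using im[OF vb(2)] by blast
    have "lapp m n ?L v = differential M f x a" using dif[OF a(1)] a(2) by simp
    then show "u \<in> ?A" using vb a(1) by blast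
   qed
  qed
  moreover have "?B \<subseteq> tangent_space N (f x)" using LN SN subspD(3)[OF Ns] by blast
  ultimately show ?thesis using fS unfolding lin_trans_def by blast
 qed simp
 from ball_cong[OF refl this] show ?thesis unfolding transverse_def .
qed

section \<open>The set of transversal jets\<close>

lemma dt_lapp: "(\<And>i j. dt N (\<lambda>z. L z i j)) ==> (\<And>i. dt N (\<lambda>z. V z i)) ==> dt N (\<lambda>z. lapp m n (L z) (V z) j)"
 unfolding lapp_def by (cases "j < n") (auto intro!: dt_intros)

lemma dt_jetY: "(\<And>i. dt N (\<lambda>z. F z i)) ==> dt N (\<lambda>z. jetY m n (F z) i)"
 unfolding jetY_def by (intro dt_trunc)

lemma dt_jetL: "(\<And>i. dt N (\<lambda>z. F z i)) ==> dt N (\<lambda>z. jetL m n (F z) i j)"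
 unfolding jetL_def by simp

lemma jetY_Rn: "jetY m n z \<in> Rn n"
 unfolding jetY_def by (rule trunc_Rn)

text \<open>All quantifiers range over vectors and the tangent bundles are definable. In the formula
  each tangency condition carries the membership of its base point, as \<open>dp_tangent\<close>
  demands; the second half of the proof removes these guards.\<close>

lemma transversal_jets_definable:
 assumes D: "M \<in> Df m" and M: "submanifold m \<infinity> d M" and DN: "N \<in> Df n" and N: "submanifold n \<infinity> d' N"
  and fin: "finite \<Sigma>" and S: "\<And>S. S \<in> \<Sigma> ==> S \<in> Df n \<and> (\<exists>k. submanifold n 1 k S)"
 shows "{z. gjet m M n N z \<and> (\<forall>S\<in>\<Sigma>. jetY m n z \<in> S --> lin_trans m n N S (jetY m n z) (jetL m n z))} \<in> Df (jet_dim m n 1)"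
proof -
 define J where "J = jet_dim m n 1"
 have pi: "(1::enat) \<le> \<infinity>" and p1: "(1::enat) \<le> 1" by simp_all
 note dts = dt_jetY dt_lapp dt_jetL dt_trunc dt_coord
 have A: "dp J (\<lambda>z. \<forall>v\<in>Rn m. jetY m n z \<in> N \<and> lapp m n (jetL m n z) v \<in> tangent_space N (jetY m n z))"
  by (rule dp_all_vec, rule dp_tangent[OF DN N pi]) (intro dts jetY_Rn lapp_Rn)+
 have B: "dp J (\<lambda>z. \<forall>v\<in>Rn m. (trunc m z \<in> M \<and> normal m M (trunc m z) v) --> (\<forall>j<n. lapp m n (jetL m n z) v j = 0))"
 proof (rule dp_all_vec, rule dp_imp)
  show "dp (J + m) (\<lambda>z. trunc m (trunc J z) \<in> M \<and> normal m M (trunc m (trunc J z)) (\<lambda>i. z (J + i)))"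
   by (rule dp_normal[OF D M pi]) (intro dts trunc_Rn shift_Rn | assumption)+
  show "dp (J + m) (\<lambda>z. \<forall>j<n. lapp m n (jetL m n (trunc J z)) (\<lambda>i. z (J + i)) j = 0)"
   by (intro dp_all_less dp_eq dts dt_const)
 qed
 have Cs: "dp J (\<lambda>z. jetY m n z \<in> S --> (\<forall>u\<in>Rn n. (jetY m n z \<in> N \<and> u \<in> tangent_space N (jetY m n z)) -->
   (\<exists>v\<in>Rn m. \<exists>b\<in>Rn n. (jetY m n z \<in> S \<and> b \<in> tangent_space S (jetY m n z)) \<and> (\<forall>j<n. u j = lapp m n (jetL m n z) v j + b j))))"
  if S\<Sigma>: "S \<in> \<Sigma>" for S
 proof -
  obtain k where k: "S \<in> Df n" "submanifold n 1 k S" using S[OF S\<Sigma>] by blast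
  show ?thesis
  proof (rule dp_imp[OF dp_mem[OF k(1)]], intro dts, rule jetY_Rn, rule dp_all_vec, rule dp_imp)
   show "dp (J + n) (\<lambda>z. jetY m n (trunc J z) \<in> N \<and> (\<lambda>i. z (J + i)) \<in> tangent_space N (jetY m n (trunc J z)))"
    by (rule dp_tangent[OF DN N pi]) (intro dts jetY_Rn shift_Rn | assumption)+
   show "dp (J + n) (\<lambda>z. \<exists>v\<in>Rn m. \<exists>b\<in>Rn n. (jetY m n (trunc J z) \<in> S \<and> b \<in> tangent_space S (jetY m n (trunc J z))) \<and>
     (\<forall>j<n. z (J + j) = lapp m n (jetL m n (trunc J z)) v j + b j))"
   proof (rule dp_ex_vec, rule dp_ex_vec, rule dp_and)
    show "dp (J + n + m + n) (\<lambda>z. jetY m n (trunc J (trunc (J + n) (trunc (J + n + m) z))) \<in> S \<and>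
      (\<lambda>i. z (J + n + m + i)) \<in> tangent_space S (jetY m n (trunc J (trunc (J + n) (trunc (J + n + m) z)))))"
     by (rule dp_tangent[OF k p1]) (intro dts jetY_Rn shift_Rn | assumption)+
    show "dp (J + n + m + n) (\<lambda>z. \<forall>j<n. trunc (J + n) (trunc (J + n + m) z) (J + j) =
      lapp m n (jetL m n (trunc J (trunc (J + n) (trunc (J + n + m) z)))) (\<lambda>i. trunc (J + n + m) z (J + n + i)) j + z (J + n + m + j))"
     by (intro dp_all_less dp_eq dts dt_add)
   qed
  qed
 qed
 have all: "dp J (\<lambda>z. (trunc m z \<in> M \<and> jetY m n z \<in> N) \<and>
  (\<forall>v\<in>Rn m. jetY m n z \<in> N \<and> lapp m n (jetL m n z) v \<in> tangent_space N (jetY m n z)) \<and>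
  (\<forall>v\<in>Rn m. (trunc m z \<in> M \<and> normal m M (trunc m z) v) --> (\<forall>j<n. lapp m n (jetL m n z) v j = 0)) \<and>
  (\<forall>S\<in>\<Sigma>. jetY m n z \<in> S --> (\<forall>u\<in>Rn n. (jetY m n z \<in> N \<and> u \<in> tangent_space N (jetY m n z)) -->
   (\<exists>v\<in>Rn m. \<exists>b\<in>Rn n. (jetY m n z \<in> S \<and> b \<in> tangent_space S (jetY m n z)) \<and> (\<forall>j<n. u j = lapp m n (jetL m n z) v j + b j)))))"
  by (rule dp_and[OF dp_and[OF dp_mem[OF D] dp_mem[OF DN]] dp_and[OF A dp_and[OF B dp_ball_finite[OF fin Cs]]]])
    (intro dts trunc_Rn jetY_Rn | assumption)+
 show ?thesis
  unfolding J_def[symmetric]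
 proof (rule dp_DfI[OF all])
  fix z
  have NR: "N \<subseteq> Rn n" by (rule submanifold_Rn[OF N])
  have e0: "(\<forall>j<n. lapp m n (jetL m n z) v j = 0) \<longleftrightarrow> lapp m n (jetL m n z) v = (\<lambda>_. 0)" for v
   by (auto simp: lapp_def fun_eq_iff)
  have e1: "(\<forall>j<n. u j = lapp m n (jetL m n z) v j + b j) \<longleftrightarrow> u = (\<lambda>j. lapp m n (jetL m n z) v j + b j)"
   if "u \<in> Rn n" "b \<in> Rn n" for u v b
   using that by (auto simp: lapp_def fun_eq_iff mem_Rn)
  have c: "(\<forall>u\<in>Rn n. (jetY m n z \<in> N \<and> u \<in> tangent_space N (jetY m n z)) -->
   (\<exists>v\<in>Rn m. \<exists>b\<in>Rn n. (jetY m n z \<in> S \<and> b \<in> tangent_space S (jetY m n z)) \<and> (\<forall>j<n. u j = lapp m n (jetL m n z) v j + b j)))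
   \<longleftrightarrow> lin_trans m n N S (jetY m n z) (jetL m n z)" if S\<Sigma>: "S \<in> \<Sigma>" and y: "jetY m n z \<in> N" "jetY m n z \<in> S" for S
  proof -
   have SR: "S \<subseteq> Rn n" using S[OF S\<Sigma>] subset by blast
   have "u \<in> tangent_space N (jetY m n z) ==> u \<in> Rn n" "u \<in> tangent_space S (jetY m n z) ==> u \<in> Rn n" for u
    using tangent_space_Rn[OF NR] tangent_space_Rn[OF SR] by auto
   then show ?thesis unfolding lin_trans_def using e1 y by meson
  qed
  have nR: "normal m M (trunc m z) v ==> v \<in> Rn m" for v by (simp add: normal_def)
  show "z \<in> {z. gjet m M n N z \<and> (\<forall>S\<in>\<Sigma>. jetY m n z \<in> S --> lin_trans m n N S (jetY m n z) (jetL m n z))} \<longleftrightarrow>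
   z \<in> Rn J \<and> ((trunc m z \<in> M \<and> jetY m n z \<in> N) \<and>
  (\<forall>v\<in>Rn m. jetY m n z \<in> N \<and> lapp m n (jetL m n z) v \<in> tangent_space N (jetY m n z)) \<and>
  (\<forall>v\<in>Rn m. (trunc m z \<in> M \<and> normal m M (trunc m z) v) --> (\<forall>j<n. lapp m n (jetL m n z) v j = 0)) \<and>
  (\<forall>S\<in>\<Sigma>. jetY m n z \<in> S --> (\<forall>u\<in>Rn n. (jetY m n z \<in> N \<and> u \<in> tangent_space N (jetY m n z)) -->
   (\<exists>v\<in>Rn m. \<exists>b\<in>Rn n. (jetY m n z \<in> S \<and> b \<in> tangent_space S (jetY m n z)) \<and> (\<forall>j<n. u j = lapp m n (jetL m n z) v j + b j)))))"
  proof (cases "trunc m z \<in> M \<and> jetY m n z \<in> N")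
   case True
   have h1: "(\<forall>v\<in>Rn m. jetY m n z \<in> N \<and> lapp m n (jetL m n z) v \<in> tangent_space N (jetY m n z)) \<longleftrightarrow> (\<forall>v\<in>Rn m. lapp m n (jetL m n z) v \<in> tangent_space N (jetY m n z))"
    using True by simp
   have h2: "(\<forall>v\<in>Rn m. (trunc m z \<in> M \<and> normal m M (trunc m z) v) --> (\<forall>j<n. lapp m n (jetL m n z) v j = 0)) \<longleftrightarrow> (\<forall>v. normal m M (trunc m z) v --> lapp m n (jetL m n z) v = (\<lambda>_. 0))"
    unfolding e0 using True nR by blast
   have h3: "(\<forall>S\<in>\<Sigma>. jetY m n z \<in> S --> (\<forall>u\<in>Rn n. (jetY m n z \<in> N \<and> u \<in> tangent_space N (jetY m n z)) -->
   (\<exists>v\<in>Rn m. \<exists>b\<in>Rn n. (jetY m n z \<in> S \<and> b \<in> tangent_space S (jetY m n z)) \<and> (\<forall>j<n. u j = lapp m n (jetL m n z) v j + b j))))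
    \<longleftrightarrow> (\<forall>S\<in>\<Sigma>. jetY m n z \<in> S --> lin_trans m n N S (jetY m n z) (jetL m n z))"
    by (intro ball_cong refl imp_cong c) (use True in auto)
   show ?thesis unfolding mem_Collect_eq h1 h2 h3 unfolding gjet_def J_def[symmetric] by (simp only: conj_assoc)
  next
   case False
   then have F: "trunc m z \<in> M ==> jetY m n z \<in> N ==> X" for X by blast
   show ?thesis unfolding mem_Collect_eq gjet_def by (rule iffI; elim conjE; rule F; assumption)
  qed
 qed
qed

lemma openin_sequentiallyI:
 fixes A S :: "'a::metric_space set"
 assumes "A \<subseteq> S" "\<And>z zs. z \<in> A ==> (\<And>s. zs s \<in> S - A) ==> zs \<longlonglongrightarrow> z ==> False"
 shows "openin (top_of_set S) A"
 unfolding openin_euclidean_subtopology_iff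
proof (intro conjI ballI assms(1))
 fix z assume z: "z \<in> A"
 show "\<exists>e>0. \<forall>x'\<in>S. dist x' z < e --> x' \<in> A"
 proof (rule ccontr)
  assume c: "\<not> ?thesis"
  have "\<exists>x'. x' \<in> S - A \<and> dist x' z < 1 / (real s + 1)" for s
  proof -
   have "1 / (real s + 1) > 0" by simp
   then show ?thesis using c by blast
  qed
  then obtain zs where zs: "\<And>s. zs s \<in> S - A" "\<And>s. dist (zs s) z < 1 / (real s + 1)" by metis
  have "(\<lambda>s. 1 / (real s + 1)) \<longlonglongrightarrow> 0"
   using LIMSEQ_inverse_real_of_nat by (simp add: inverse_eq_divide add.commute)
  then have "(\<lambda>s. dist (zs s) z) \<longlonglongrightarrow> 0"
   by (rule tendsto_sandwich[OF _ _ tendsto_const, rotated 2]) (use zs(2) in \<open>auto intro!: always_eventually less_imp_le\<close>)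
  then have "zs \<longlonglongrightarrow> z" by (rule tendsto_dist_iff[THEN iffD2])
  then show False using assms(2)[OF z, of zs] zs(1) by blast
 qed
qed

lemma transversal_jets_open:
 assumes M: "submanifold m \<infinity> d M" and N: "submanifold n \<infinity> d' N"
  and V: "V \<subseteq> N" "closedin (subtopology (Euclidean_space n) N) V"
  and strat: "definable_stratification Df n V \<Sigma>" and reg: "whitney_a_regular n \<Sigma>"
 shows "openin (top_of_set {z. gjet m M n N z})
  {z. gjet m M n N z \<and> (\<forall>S\<in>\<Sigma>. jetY m n z \<in> S --> lin_trans m n N S (jetY m n z) (jetL m n z))}"
proof (rule openin_sequentiallyI)
 fix z zs
 assume z: "z \<in> {z. gjet m M n N z \<and> (\<forall>S\<in>\<Sigma>. jetY m n z \<in> S --> lin_trans m n N S (jetY m n z) (jetL m n z))}"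
  and zs: "\<And>s. zs s \<in> {z. gjet m M n N z} - {z. gjet m M n N z \<and> (\<forall>S\<in>\<Sigma>. jetY m n z \<in> S --> lin_trans m n N S (jetY m n z) (jetL m n z))}"
  and lim: "zs \<longlonglongrightarrow> z"
 have pi: "(1::enat) \<le> \<infinity>" and p1: "(1::enat) \<le> 1" by simp_all
 have fin: "finite \<Sigma>" and part: "\<Union>\<Sigma> = V" and sub: "\<And>S. S \<in> \<Sigma> ==> definable_submanifold Df n 1 S"
  using strat by (auto simp: definable_stratification_def partition_on_def)
 have S1: "submanifold n 1 (mdim n S) S" if "S \<in> \<Sigma>" for S
  using sub[OF that] submanifold_mdim unfolding definable_submanifold_def by blast
 have SN: "S \<subseteq> N" if "S \<in> \<Sigma>" for S using part V(1) that by blast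
 have "\<forall>s. \<exists>S. S \<in> \<Sigma> \<and> jetY m n (zs s) \<in> S \<and> \<not> lin_trans m n N S (jetY m n (zs s)) (jetL m n (zs s))"
  using zs by blast
 then obtain St where St: "\<And>s. St s \<in> \<Sigma>" "\<And>s. jetY m n (zs s) \<in> St s"
   "\<And>s. \<not> lin_trans m n N (St s) (jetY m n (zs s)) (jetL m n (zs s))" by metis
 \<comment> \<open>There are finitely many strata, so a single \<open>X\<close> accounts for
   infinitely many of the non-transverse jets.\<close>
 have "\<exists>X. X \<in> St ` UNIV \<and> infinite {s. St s = X}"
 proof -
  have "finite (St ` UNIV)" using fin St(1) by (meson finite_subset image_subsetI)
  then obtain s0 where "infinite {s \<in> UNIV. St s = St s0}" using pigeonhole_infinite[of UNIV St] by auto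
  then show ?thesis by auto
 qed
 then obtain X where X: "X \<in> \<Sigma>" "infinite {s. St s = X}" using St(1) by blast
 obtain r0 :: "nat => nat" where r0: "strict_mono r0" "\<And>s. St (r0 s) = X"
  using infinite_enumerate[OF X(2)] by auto
 define ys Ls where "ys s = jetY m n (zs (r0 s))" and "Ls s = jetL m n (zs (r0 s))" for s
 define y L where "y = jetY m n z" and "L = jetL m n z"
 have lim0: "(\<lambda>s. zs (r0 s)) \<longlonglongrightarrow> z" using LIMSEQ_subseq_LIMSEQ[OF lim r0(1)] by (simp add: o_def)
 have ylim: "ys \<longlonglongrightarrow> y"
  unfolding tendsto_fun_iff
 proof
  fix i show "(\<lambda>s. ys s i) \<longlonglongrightarrow> y i"
   using lim0 unfolding tendsto_fun_iff by (cases "i < n") (auto simp: ys_def y_def jetY_def trunc_def)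
 qed
 have Llim: "(\<lambda>s. Ls s i j) \<longlonglongrightarrow> L i j" for i j
  using lim0 unfolding tendsto_fun_iff by (simp add: Ls_def L_def jetL_def)
 have gz: "gjet m M n N z" and gzs: "gjet m M n N (zs s)" for s using z zs by auto
 have yN: "y \<in> N" using gz by (simp add: gjet_def y_def)
 have LN: "lapp m n L v \<in> tangent_space N y" if "v \<in> Rn m" for v using gz that by (simp add: gjet_def y_def L_def)
 have LsN: "lapp m n (Ls s) v \<in> tangent_space N (ys s)" if "v \<in> Rn m" for v s
  using gzs[of "r0 s"] that by (simp add: gjet_def ys_def Ls_def)
 have ysX: "ys s \<in> X" for s using St(2)[of "r0 s"] r0(2) by (simp add: ys_def)
 have ysN: "ys s \<in> N" for s using ysX SN[OF X(1)] by blast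
 have NR: "N \<subseteq> Rn n" by (rule submanifold_Rn[OF N])
 \<comment> \<open>Closedness of \<open>V\<close> in \<open>N\<close> enters here: without it the
   limit could lie on no stratum.\<close>
 have yV: "y \<in> V"
 proof -
  obtain C where C: "closedin (Euclidean_space n) C" "V = C \<inter> N" using V(2) by (auto simp: closedin_subtopology)
  have "closed C" by (rule closedin_Euclidean_imp_closed[OF C(1)])
  moreover have "ys s \<in> C" for s using ysX part X(1) C(2) by blast
  ultimately have "y \<in> C" using ylim closed_sequentially by blast
  then show ?thesis using C(2) yN by blast
 qed
 then obtain Y where Y: "Y \<in> \<Sigma>" "y \<in> Y" using part by blast
 have ycl: "y \<in> Euclidean_space n closure_of X"
  unfolding in_closure_of
 proof (intro conjI allI impI)
  show "y \<in> Rn n" using yN NR by auto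
  fix W assume "y \<in> W \<and> opn n W"
  then have "\<forall>\<^sub>F s in sequentially. ys s \<in> W"
   using opn_eventually[of n W y ys sequentially] ylim ysN NR by (auto intro: always_eventually)
  then show "\<exists>x. x \<in> X \<and> x \<in> W" using ysX eventually_happens[of _ sequentially] by fastforce
 qed
 \<comment> \<open>The limit point lies in the closure of \<open>X\<close>, so \<open>X\<close> and
   \<open>Y\<close> are subject to the regularity condition; \<open>X = Y\<close> is covered as
   well.\<close>
 have reg': "whitney_a_over n X Y" using reg X(1) Y ycl unfolding whitney_a_regular_def by blast
 define k where "k = mdim n X"
 have "\<exists>\<eta>. \<eta> \<in> tangent_space N (ys s) \<and> ip n \<eta> \<eta> = 1 \<and>
  (\<forall>v\<in>Rn m. ip n \<eta> (lapp m n (Ls s) v) = 0) \<and> (\<forall>b\<in>tangent_space X (ys s). ip n \<eta> b = 0)" for s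
 proof -
  have "\<not> lin_trans m n N X (ys s) (Ls s)" using St(3)[of "r0 s"] r0(2) by (simp add: ys_def Ls_def)
  then show ?thesis
   using not_lin_trans_iff[OF tangent_subsp[OF N pi ysN] tangent_subsp[OF S1[OF X(1)] p1 ysX]
     tangent_space_mono[OF SN[OF X(1)]] LsN] by blast
 qed
 then obtain \<eta>s where \<eta>s: "\<And>s. \<eta>s s \<in> tangent_space N (ys s)" "\<And>s. ip n (\<eta>s s) (\<eta>s s) = 1"
  "\<And>s v. v \<in> Rn m ==> ip n (\<eta>s s) (lapp m n (Ls s) v) = 0"
  "\<And>s b. b \<in> tangent_space X (ys s) ==> ip n (\<eta>s s) b = 0" by metis
 have "\<exists>b. orthonormal n k b \<and> lin_span k b = tangent_space X (ys s)" for s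
  unfolding k_def by (rule tangent_orthonormal_basis[OF S1[OF X(1)] p1 ysX]) blast
 then obtain bs where bs: "\<And>s. orthonormal n k (bs s)" "\<And>s. lin_span k (bs s) = tangent_space X (ys s)" by metis
 obtain r1 l where r1: "strict_mono r1" "orthonormal n k l" "\<And>j. j < k ==> (\<lambda>s. bs (r1 s) j) \<longlonglongrightarrow> l j"
  by (rule orthonormal_subseq[of n k bs, OF bs(1)]) blast
 have \<eta>R: "\<eta>s (r1 s) \<in> Rn n" for s using tangent_space_Rn[OF NR \<eta>s(1)] .
 have \<eta>b: "\<bar>\<eta>s (r1 s) i\<bar> \<le> 1" if "i < n" for s i
  using abs_coord_le_ip[OF that, of "\<eta>s (r1 s)"] \<eta>s(2) by simp
 obtain r2 \<eta> where r2: "strict_mono r2" "\<eta> \<in> Rn n" "(\<lambda>s. \<eta>s (r1 (r2 s))) \<longlonglongrightarrow> \<eta>"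
  by (rule bounded_subseq[OF \<eta>R \<eta>b])
 define r where "r = r1 \<circ> r2"
 have r: "strict_mono r" unfolding r_def by (rule strict_mono_o[OF r1(1) r2(1)])
 have \<eta>lim: "(\<lambda>s. \<eta>s (r s)) \<longlonglongrightarrow> \<eta>" using r2(3) by (simp add: r_def)
 have blim: "(\<lambda>s. bs (r s) j) \<longlonglongrightarrow> l j" if "j < k" for j
  using LIMSEQ_subseq_LIMSEQ[OF r1(3)[OF that] r2(1)] by (simp add: r_def o_def)
 have yrlim: "(\<lambda>s. ys (r s)) \<longlonglongrightarrow> y" using LIMSEQ_subseq_LIMSEQ[OF ylim r] by (simp add: o_def)
 have Lrlim: "(\<lambda>s. Ls (r s) i j) \<longlonglongrightarrow> L i j" for i j using LIMSEQ_subseq_LIMSEQ[OF Llim r] by (simp add: o_def)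
 have "limitin (grassmannian n k) (\<lambda>s. lin_span k (bs (r s))) (lin_span k l) sequentially"
  by (rule limitin_grassmannian_orthonormal[OF bs(1) r1(2) blim])
 then have G: "limitin (grassmannian n (mdim n X)) (\<lambda>s. tangent_space X (ys (r s))) (lin_span k l) sequentially"
  unfolding bs(2) unfolding k_def .
 have ylE: "limitin (Euclidean_space n) (\<lambda>s. ys (r s)) y sequentially"
  unfolding limitin_Euclidean_space using yrlim yN NR ysN by (auto intro!: always_eventually)
 have TY: "tangent_space Y y \<subseteq> lin_span k l"
  by (rule bspec[OF reg'[unfolded whitney_a_over_def] IntI[OF Y(2) ycl], THEN spec[of _ "\<lambda>s. ys (r s)"], THEN spec, THEN mp])
    (intro conjI allI ysX ylE G)
 have "\<eta> \<in> tangent_space N y"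
  by (rule tangent_closed[OF N pi yN yrlim ysN \<eta>lim \<eta>s(1)])
 moreover have "ip n \<eta> \<eta> = 1"
  by (rule LIMSEQ_unique[OF tendsto_ip[OF \<eta>lim \<eta>lim]]) (simp add: \<eta>s(2))
 moreover have "ip n \<eta> (lapp m n L v) = 0" if v: "v \<in> Rn m" for v
 proof -
  have "(\<lambda>s. lapp m n (Ls (r s)) v) \<longlonglongrightarrow> lapp m n L v"
   unfolding tendsto_fun_iff
  proof
   fix j show "(\<lambda>s. lapp m n (Ls (r s)) v j) \<longlonglongrightarrow> lapp m n L v j"
    by (cases "j < n") (auto simp: lapp_def intro!: tendsto_intros Lrlim)
  qed
  from tendsto_ip[OF \<eta>lim this, of n] show ?thesis
   by (rule LIMSEQ_unique) (simp add: \<eta>s(3)[OF v])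
 qed
 moreover have "ip n \<eta> b = 0" if b: "b \<in> tangent_space Y y" for b
 proof -
  have l0: "ip n \<eta> (l j) = 0" if j: "j < k" for j
  proof (rule LIMSEQ_unique[OF tendsto_ip[OF \<eta>lim blim[OF j]]])
   have "bs (r s) j \<in> tangent_space X (ys (r s))" for s using lin_span_base[OF j, of "bs (r s)"] bs(2) by simp
   then show "(\<lambda>s. ip n (\<eta>s (r s)) (bs (r s) j)) \<longlonglongrightarrow> 0" using \<eta>s(4) by simp
  qed
  obtain c where "b = (\<lambda>i. \<Sum>j<k. c j * l j i)" using TY b unfolding lin_span_def by blast
  then show ?thesis by (simp add: ip_sum l0)
 qed
 ultimately have "\<not> lin_trans m n N Y y L"
  using not_lin_trans_iff[OF tangent_subsp[OF N pi yN] tangent_subsp[OF S1[OF Y(1)] p1 Y(2)]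
     tangent_space_mono[OF SN[OF Y(1)]] LN] by blast
 then show False using z Y unfolding y_def L_def by blast
qed blast

text \<open>The transversal jets form a definable open subset of the jet space, so the transverse
  maps form a basic open set already for \<open>k = 1\<close>.\<close>

lemma transverse_maps_open:
 assumes D: "M \<in> Df m" and M: "submanifold m \<infinity> d M" and DN: "N \<in> Df n" and N: "submanifold n \<infinity> d' N"
  and V: "V \<subseteq> N" "closedin (subtopology (Euclidean_space n) N) V"
  and strat: "definable_stratification Df n V \<Sigma>" and reg: "whitney_a_regular n \<Sigma>"
 shows "openin (D_inf_topology Df m M n N) {f \<in> D_inf Df m M n N. \<forall>S\<in>\<Sigma>. transverse M N f S}"
proof -
 define A where "A = {z. gjet m M n N z \<and> (\<forall>S\<in>\<Sigma>. jetY m n z \<in> S --> lin_trans m n N S (jetY m n z) (jetL m n z))}"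
 have fin: "finite \<Sigma>" and part: "\<Union>\<Sigma> = V" and sub: "\<And>S. S \<in> \<Sigma> ==> S \<in> Df n \<and> (\<exists>k. submanifold n 1 k S)"
  using strat by (auto simp: definable_stratification_def partition_on_def definable_submanifold_def)
 have MR: "M \<subseteq> Rn m" and NR: "N \<subseteq> Rn n" using submanifold_Rn M N by auto
 have js: "jet_space Df m M n N 1 = {z. gjet m M n N z}" using jet_space_1[OF D M DN N] by blast
 have "A \<in> Df (jet_dim m n 1)" unfolding A_def by (rule transversal_jets_definable[OF D M DN N fin sub])
 moreover have "openin (subtopology (Euclidean_space (jet_dim m n 1)) (jet_space Df m M n N 1)) A"
 proof -
  have "{z. gjet m M n N z} \<subseteq> Rn (jet_dim m n 1)" by (auto simp: gjet_def)
  then show ?thesis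
   unfolding js A_def using transversal_jets_open[OF M N V strat reg] by (simp only: subtopology_Rn)
 qed
 ultimately have B: "{f \<in> D_inf Df m M n N. jet Df m M n 1 f ` M \<subseteq> A} \<in> Dk_basis Df m M n N 1"
  unfolding Dk_basis_def by blast
 have "(\<forall>S\<in>\<Sigma>. transverse M N f S) \<longleftrightarrow> jet Df m M n 1 f ` M \<subseteq> A" if f: "f \<in> D_inf Df m M n N" for f
 proof -
  have e: "jet Df m M n 1 f x \<in> A \<longleftrightarrow> (\<forall>S\<in>\<Sigma>. f x \<in> S --> lin_trans m n N S (f x) (grad (fext m M f) x))" if x: "x \<in> M" for x
  proof -
   have xR: "x \<in> Rn m" and fR: "f x \<in> Rn n" using x MR D_infD(2)[OF f] by auto
   note J1 = jet_1[where m = m and n = n and x = x and f = f and M = M, OF xR fR]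
   have "lapp m n (jetL m n (jet Df m M n 1 f x)) v = lapp m n (grad (fext m M f) x) v" for v
    by (rule lapp_cong) (rule J1(4))
   then show ?thesis unfolding A_def mem_Collect_eq lin_trans_def J1(3) using gjet_jet[OF D M NR f x] by presburger
  qed
  have t: "transverse M N f S \<longleftrightarrow> (\<forall>x\<in>M. f x \<in> S --> lin_trans m n N S (f x) (grad (fext m M f) x))" if "S \<in> \<Sigma>" for S
  proof -
   obtain k where "submanifold n 1 k S" using sub[OF \<open>S \<in> \<Sigma>\<close>] by blast
   moreover have "S \<subseteq> N" using part V(1) that by blast
   ultimately show ?thesis using transverse_iff_lin_trans[OF D M N _ _ f] by blast
  qed
  have 1: "(\<forall>S\<in>\<Sigma>. transverse M N f S) \<longleftrightarrow>
    (\<forall>S\<in>\<Sigma>. \<forall>x\<in>M. f x \<in> S --> lin_trans m n N S (f x) (grad (fext m M f) x))"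
   by (rule ball_cong[OF refl t])
  have 2: "jet Df m M n 1 f ` M \<subseteq> A \<longleftrightarrow>
    (\<forall>x\<in>M. \<forall>S\<in>\<Sigma>. f x \<in> S --> lin_trans m n N S (f x) (grad (fext m M f) x))"
   unfolding image_subset_iff by (rule ball_cong[OF refl e])
  show ?thesis unfolding 1 2 by blast
 qed
 then have "{f \<in> D_inf Df m M n N. \<forall>S\<in>\<Sigma>. transverse M N f S} = {f \<in> D_inf Df m M n N. jet Df m M n 1 f ` M \<subseteq> A}"
  by (intro Collect_cong conj_cong refl)
 then show ?thesis unfolding D_inf_topology_def using B by (auto intro!: topology_generated_by_Basis)
qed

end

section \<open>Smooth perturbations with compact support\<close>

text \<open>The derivative of \<open>P(1/t) exp(-1/t)\<close> is
  \<open>t^(-2) (P - P')(1/t) exp(-1/t)\<close>; the recursion is this rule in the variable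
  \<open>1/t\<close>.\<close>

primrec sstep_poly :: "nat => real poly" where
 "sstep_poly 0 = 1"
| "sstep_poly (Suc j) = monom 1 2 * (sstep_poly j - pderiv (sstep_poly j))"

text \<open>The \<open>j\<close>-th derivative of \<open>exp(-1/t)\<close>, extended by \<open>0\<close> to \<open>t \<le> 0\<close>.\<close>

definition sstep :: "nat => real => real" where
 "sstep j t = (if t > 0 then poly (sstep_poly j) (1 / t) * exp (- (1 / t)) else 0)"

lemma poly_exp_tendsto_0: "((\<lambda>u. poly p u * exp (- u)) \<longlongrightarrow> (0::real)) at_top"
proof -
 have "((\<lambda>u. \<Sum>i\<le>degree p. coeff p i * (u ^ i / exp u)) \<longlongrightarrow> (\<Sum>i\<le>degree p. coeff p i * 0)) at_top"
  by (intro tendsto_sum tendsto_mult tendsto_const tendsto_power_div_exp_0)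
 moreover have "(\<Sum>i\<le>degree p. coeff p i * (u ^ i / exp u)) = poly p u * exp (- u)" for u
  by (simp add: poly_altdef sum_distrib_right exp_minus divide_inverse mult.assoc)
 ultimately show ?thesis by simp
qed

lemma sstep_deriv: "(sstep j has_real_derivative sstep (Suc j) t) (at t)"
proof -
 let ?P = "sstep_poly j"
 consider "t > 0" | "t < 0" | "t = 0" by linarith
 then show ?thesis
 proof cases
  case 1
  have i: "((\<lambda>t. 1 / t) has_real_derivative - (1 / t^2)) (at t)"
   using 1 by (auto intro!: derivative_eq_intros simp: power2_eq_square)
  have p: "((\<lambda>t. poly ?P (1 / t)) has_real_derivative poly (pderiv ?P) (1 / t) * - (1 / t^2)) (at t)"
   by (rule DERIV_chain2[OF poly_DERIV i])
  have e: "((\<lambda>t. exp (- (1 / t))) has_real_derivative exp (- (1 / t)) * - (- (1 / t^2))) (at t)"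
   by (rule DERIV_chain2[OF DERIV_exp DERIV_minus[OF i]])
  have "((\<lambda>t. poly ?P (1 / t) * exp (- (1 / t))) has_real_derivative sstep (Suc j) t) (at t)"
   by (rule DERIV_cong[OF DERIV_mult[OF p e]])
     (use 1 in \<open>simp add: sstep_def poly_monom power_divide algebra_simps diff_divide_distrib\<close>)
  then show ?thesis
   by (rule has_field_derivative_transform_within_open[of _ _ _ "{0<..}"]) (use 1 in \<open>auto simp: sstep_def\<close>)
 next
  case 2
  have "((\<lambda>_. 0) has_real_derivative sstep (Suc j) t) (at t)" using 2 by (simp add: sstep_def)
  then show ?thesis
   by (rule has_field_derivative_transform_within_open[of _ _ _ "{..<0}"]) (use 2 in \<open>auto simp: sstep_def\<close>)
 next
  case 3
  have "((\<lambda>y. (sstep j y - sstep j 0) / (y - 0)) \<longlongrightarrow> 0) (at_left 0)"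
   by (rule Lim_transform_eventually[OF tendsto_const])
     (auto simp: sstep_def eventually_at_filter intro!: always_eventually)
  moreover have "((\<lambda>y. (sstep j y - sstep j 0) / (y - 0)) \<longlongrightarrow> 0) (at_right 0)"
  proof (rule Lim_transform_eventually)
   \<comment> \<open>Division by \<open>y\<close> multiplies the polynomial in \<open>1/y\<close> by
     its variable, which is \<open>pCons 0\<close>.\<close>
   show "((\<lambda>y. poly (pCons 0 ?P) (inverse y) * exp (- inverse y)) \<longlongrightarrow> 0) (at_right 0)"
    by (rule filterlim_compose[OF poly_exp_tendsto_0 filterlim_inverse_at_top_right])
   show "\<forall>\<^sub>F y in at_right 0. poly (pCons 0 ?P) (inverse y) * exp (- inverse y) = (sstep j y - sstep j 0) / (y - 0)"
    using eventually_at_right_less[of "0::real"]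
    by (rule eventually_mono) (simp add: sstep_def field_simps)
  qed
  ultimately have "((\<lambda>y. (sstep j y - sstep j 0) / (y - 0)) \<longlongrightarrow> 0) (at 0)" by (rule filterlim_split_at)
  then show ?thesis using 3 by (simp add: has_field_derivative_iff sstep_def)
 qed
qed

lemma sstep_0: "sstep 0 t = (if t > 0 then exp (- (1 / t)) else 0)"
 by (simp add: sstep_def)

text \<open>A cut-off that vanishes outside the ball of radius \<open>\<rho>\<close>; the factor
  \<open>exp 1\<close> normalizes its value at the origin to 1.\<close>

definition bump :: "nat => real => (nat => real) => real" where
 "bump q \<rho> w = exp 1 * sstep 0 (1 - ip q w w / \<rho>\<^sup>2)"

lemma bump_bounds: "0 \<le> bump q \<rho> w" "bump q \<rho> w \<le> 1"
proof -
 show "0 \<le> bump q \<rho> w" by (simp add: bump_def sstep_0)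
 define t where "t = 1 - ip q w w / \<rho>\<^sup>2"
 have t: "t \<le> 1" unfolding t_def using ip_self_nonneg by simp
 have "exp 1 * sstep 0 t \<le> 1"
 proof (cases "t > 0")
  case True
  then have "1 - 1 / t \<le> 0" using t by (simp add: field_simps)
  then have "exp (1 - 1 / t) \<le> 1" by simp
  then show ?thesis using True by (simp add: sstep_0 exp_diff exp_minus divide_inverse)
 qed (simp add: sstep_0)
 then show "bump q \<rho> w \<le> 1" by (simp add: bump_def t_def)
qed

lemma bump_outside: "\<rho> > 0 ==> \<rho>\<^sup>2 \<le> ip q w w ==> bump q \<rho> w = 0"
 by (simp add: bump_def sstep_0 field_simps)

lemma Cp_open_ip:
 "opn n U ==> (\<And>i. i < k ==> Cp_open n p U (\<lambda>z. F z i)) ==>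
  (\<And>i. i < k ==> Cp_open n p U (\<lambda>z. G z i)) ==> Cp_open n p U (\<lambda>z. ip k (F z) (G z))"
 unfolding ip_def by (intro Cp_open_sum Cp_open_mult) auto

lemma Cp_open_bump:
 assumes U: "opn n U" and F: "\<And>i. i < q ==> Cp_open n p U (\<lambda>z. F z i)"
 shows "Cp_open n p U (\<lambda>z. bump q \<rho> (F z))"
proof -
 have "Cp_open n p U (\<lambda>z. 1 - ip q (F z) (F z) * inverse (\<rho>\<^sup>2))"
  by (intro Cp_open_diff Cp_open_mult Cp_open_ip Cp_open_const U F)
 then have "Cp_open n p U (\<lambda>z. sstep 0 (1 - ip q (F z) (F z) * inverse (\<rho>\<^sup>2)))"
  by (rule Cp_open_real_compose[where D = sstep and S = UNIV, OF U open_UNIV sstep_deriv]) simp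
 then show ?thesis unfolding bump_def divide_inverse by (intro Cp_open_mult Cp_open_const U)
qed

text \<open>For \<open>a = 0\<close>, \<open>b = \<eta>\<close> the map has derivative \<open>u - \<langle>u,\<eta>\<rangle>\<eta>\<close> at the origin and an invertible
 derivative elsewhere; for general \<open>a\<close>, \<open>b\<close> it sends the origin to \<open>y + a\<close> with derivative
 \<open>u - \<langle>u,b\<rangle>b\<close> and is unchanged away from the origin.\<close>

definition pert :: "nat => (nat => real) => (nat => real) => real => (nat => real) => (nat => real) =>
  (nat => real) => nat => real" where
 "pert q y \<eta> \<rho> a b w = trunc q (\<lambda>j. y j + w j - (1 - ip q w w) * ip q w \<eta> * \<eta> j +
   bump q \<rho> w * (a j + ip q w \<eta> * \<eta> j - ip q w b * b j))"

lemma pert_Rn: "pert q y \<eta> \<rho> a b w \<in> Rn q"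
 unfolding pert_def by (rule trunc_Rn)

lemma ip_cong: "(\<And>i. i < n ==> x i = x' i) ==> (\<And>i. i < n ==> z i = z' i) ==> ip n x z = ip n x' z'"
 unfolding ip_def by (rule sum.cong) auto

text \<open>Only the first \<open>q\<close> coordinates of the arguments count. This allows
  \<open>a\<close>, \<open>b\<close> and \<open>w\<close> to be read off from one long vector when
  the maps are put into a family.\<close>

lemma pert_cong:
 assumes "\<And>i. i < q ==> a i = a' i" "\<And>i. i < q ==> b i = b' i" "\<And>i. i < q ==> w i = w' i"
 shows "pert q y \<eta> \<rho> a b w = pert q y \<eta> \<rho> a' b' w'"
proof -
 have e: "ip q w w = ip q w' w'" "ip q w \<eta> = ip q w' \<eta>" "ip q w b = ip q w' b'"
  by (rule ip_cong; use assms in simp)+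
 then have "bump q \<rho> w = bump q \<rho> w'" by (simp add: bump_def)
 then show ?thesis using assms unfolding pert_def e by (auto simp: trunc_def fun_eq_iff)
qed

lemma Cp_open_pert:
 assumes U: "opn n U"
  and "\<And>i. i < q ==> Cp_open n p U (\<lambda>z. A z i)" "\<And>i. i < q ==> Cp_open n p U (\<lambda>z. B z i)"
   "\<And>i. i < q ==> Cp_open n p U (\<lambda>z. F z i)"
 shows "Cp_open n p U (\<lambda>z. pert q y \<eta> \<rho> (A z) (B z) (F z) j)"
proof (cases "j < q")
 case True
 then show ?thesis unfolding pert_def trunc_def
  by (simp only: if_True) (intro Cp_open_add Cp_open_mult Cp_open_diff Cp_open_const Cp_open_ip Cp_open_bump assms; assumption)
next
 case False
 then show ?thesis unfolding pert_def trunc_def by (simp add: Cp_open_const U)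
qed

lemma lapp_grad_line:
 assumes U: "opn m U" and h: "Ck_open m (Suc 0) U (h j)" and x: "x \<in> U" and u: "u \<in> Rn m"
  and D: "((\<lambda>t. h j (\<lambda>i. x i + t * u i)) has_real_derivative D) (at 0)" and j: "j < n"
 shows "lapp m n (grad h x) u j = D"
proof -
 have xR: "x \<in> Rn m" using x opn_subset[OF U] by auto
 have "((\<lambda>t. h j (\<lambda>i. x i + t * u i)) has_real_derivative
   (\<Sum>i<m. pderiv_coord i (h j) (\<lambda>i. x i + 0 * u i) * u i)) (at 0)"
  by (rule chain_curve[where \<gamma> = "\<lambda>t i. x i + t * u i" and v = u, OF U h])
    (use x xR u in \<open>auto intro!: derivative_eq_intros always_eventually simp: mem_Rn\<close>)
 then have "D = (\<Sum>i<m. pderiv_coord i (h j) (\<lambda>i. x i + 0 * u i) * u i)" by (rule DERIV_unique[OF D])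
 then show ?thesis using j by (simp add: lapp_def grad_def)
qed

lemma Ck_open_pert: "Ck_open q (Suc 0) (Rn q) (\<lambda>w. pert q y \<eta> \<rho> a b w j)"
proof (rule Cp_open_Ck[of _ \<infinity>])
 show "Cp_open q \<infinity> (Rn q) (\<lambda>w. pert q y \<eta> \<rho> a b w j)"
  by (rule Cp_open_pert[OF opn_Rn]) (intro Cp_open_const Cp_open_coord opn_Rn)+
qed simp

text \<open>For \<open>a = 0\<close> and \<open>b = \<eta>\<close> the factor of the bump vanishes
  identically, and what remains is polynomial along every line.\<close>

lemma pert_derivative:
 assumes w: "w \<in> Rn q" and u: "u \<in> Rn q" and j: "j < q"
 shows "lapp q q (grad (\<lambda>j w. pert q y \<eta> \<rho> (\<lambda>_. 0) \<eta> w j) w) u j =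
  u j - (1 - ip q w w) * ip q u \<eta> * \<eta> j + 2 * ip q w u * ip q w \<eta> * \<eta> j"
proof (rule lapp_grad_line[OF opn_Rn Ck_open_pert w u _ j])
 have e: "pert q y \<eta> \<rho> (\<lambda>_. 0) \<eta> (\<lambda>i. w i + t * u i) j = y j + (w j + t * u j) -
   (1 - (ip q w w + 2 * t * ip q w u + t * t * ip q u u)) * (ip q w \<eta> + t * ip q u \<eta>) * \<eta> j" for t
  using j ip_commute[of q u w] by (simp add: pert_def trunc_def ip_add ip_scale algebra_simps)
 show "((\<lambda>t. pert q y \<eta> \<rho> (\<lambda>_. 0) \<eta> (\<lambda>i. w i + t * u i) j) has_real_derivative
   u j - (1 - ip q w w) * ip q u \<eta> * \<eta> j + 2 * ip q w u * ip q w \<eta> * \<eta> j) (at 0)"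
  unfolding e by (auto intro!: derivative_eq_intros simp: algebra_simps)
qed

lemma pert_at_0: "y \<in> Rn q ==> a \<in> Rn q ==> pert q y \<eta> \<rho> a b (\<lambda>_. 0) = (\<lambda>j. y j + a j)"
 by (auto simp: pert_def trunc_def ip_zero bump_def sstep_0 mem_Rn fun_eq_iff exp_add[symmetric])

text \<open>The bump has value 1 and derivative 0 at the origin. To first order it therefore
  replaces \<open>y\<close> by \<open>y + a\<close> and the term of \<open>\<eta>\<close> by that of
  \<open>b\<close>.\<close>

lemma pert_derivative_0:
 assumes u: "u \<in> Rn q" and j: "j < q"
 shows "lapp q q (grad (\<lambda>j w. pert q y \<eta> \<rho> a b w j) (\<lambda>_. 0)) u j = u j - ip q u b * b j"
proof (rule lapp_grad_line[OF opn_Rn Ck_open_pert Rn_zero u _ j])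
 define c where "c = ip q u u / \<rho>\<^sup>2"
 define S where "S t = exp 1 * sstep 0 (1 - t * t * c)" for t :: real
 have e: "pert q y \<eta> \<rho> a b (\<lambda>i. 0 + t * u i) j = y j + t * u j -
   (1 - t * t * ip q u u) * (t * ip q u \<eta>) * \<eta> j + S t * (a j + t * ip q u \<eta> * \<eta> j - t * ip q u b * b j)" for t
  using j by (simp add: pert_def trunc_def ip_scale S_def c_def bump_def algebra_simps)
 have "((\<lambda>t. 1 - t * t * c) has_real_derivative 0) (at 0)"
  by (auto intro!: derivative_eq_intros)
 from DERIV_cmult[OF DERIV_chain2[OF sstep_deriv this], of "exp 1" 0]
 have S: "(S has_real_derivative 0) (at 0)" by (simp add: S_def[abs_def])
 have S0: "S 0 = 1" by (simp add: S_def sstep_0 exp_add[symmetric])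
 show "((\<lambda>t. pert q y \<eta> \<rho> a b (\<lambda>i. 0 + t * u i) j) has_real_derivative u j - ip q u b * b j) (at 0)"
  unfolding e by (rule derivative_eq_intros S refl | simp add: S0)+
qed

section \<open>Jets of smooth families\<close>

lemma pderiv_append:
 assumes "i < m"
 shows "pderiv_coord i (\<lambda>w. g (append_vec m w c)) = (\<lambda>w. pderiv_coord i g (append_vec m w c))"
proof
 fix w
 have "append_vec m (w(i := t)) c = (append_vec m w c)(i := t)" for t
  using assms by (auto simp: append_vec_def fun_eq_iff)
 moreover have "append_vec m w c i = w i" using assms by (simp add: append_vec_def)
 ultimately show "pderiv_coord i (\<lambda>w. g (append_vec m w c)) w = pderiv_coord i g (append_vec m w c)"
  by (simp add: pderiv_coord_def)
qed

lemma mixed_pderiv_append: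
 "mixed_pderiv m \<alpha> (\<lambda>w. g (append_vec m w c)) = (\<lambda>w. mixed_pderiv m \<alpha> g (append_vec m w c))"
proof -
 have p: "(pderiv_coord i ^^ k) (\<lambda>w. g (append_vec m w c)) = (\<lambda>w. (pderiv_coord i ^^ k) g (append_vec m w c))"
  if "i < m" for i k g
  by (induction k) (simp_all add: pderiv_append[OF that])
 have "fold (\<lambda>i. pderiv_coord i ^^ \<alpha> i) xs (\<lambda>w. g (append_vec m w c)) =
   (\<lambda>w. fold (\<lambda>i. pderiv_coord i ^^ \<alpha> i) xs g (append_vec m w c))" if "set xs \<subseteq> {..<m}" for xs g
  using that by (induction xs arbitrary: g) (simp_all add: p)
 from this[of "[0..<m]" g] show ?thesis by (simp add: mixed_pderiv_def atLeast0LessThan)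
qed

lemma mixed_pderiv_cong:
 assumes U: "opn m U" and e: "\<And>x. x \<in> U ==> f x = g x" and x: "x \<in> U"
 shows "mixed_pderiv m \<alpha> f x = mixed_pderiv m \<alpha> g x"
proof -
 have p: "\<forall>x\<in>U. (pderiv_coord i ^^ k) f x = (pderiv_coord i ^^ k) g x" if "i < m" "\<forall>x\<in>U. f x = g x" for i k f g
 proof (induction k)
  case (Suc k)
  show ?case
  proof
   fix x assume x: "x \<in> U"
   show "(pderiv_coord i ^^ Suc k) f x = (pderiv_coord i ^^ Suc k) g x"
    unfolding funpow.simps o_apply by (rule pderiv_coord_cong[OF U _ x that(1)]) (use Suc in blast)
  qed
 qed (use that in simp)
 have "\<forall>x\<in>U. fold (\<lambda>i. pderiv_coord i ^^ \<alpha> i) xs f x = fold (\<lambda>i. pderiv_coord i ^^ \<alpha> i) xs g x"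
  if "set xs \<subseteq> {..<m}" "\<forall>x\<in>U. f x = g x" for xs f g
  using that
 proof (induction xs arbitrary: f g)
  case (Cons i xs)
  have "\<forall>x\<in>U. (pderiv_coord i ^^ \<alpha> i) f x = (pderiv_coord i ^^ \<alpha> i) g x" by (rule p) (use Cons.prems in auto)
  then show ?case using Cons.IH[of "(pderiv_coord i ^^ \<alpha> i) f" "(pderiv_coord i ^^ \<alpha> i) g"] Cons.prems(1) by simp
 qed simp
 from this[of "[0..<m]" f g] have "\<forall>x\<in>U. mixed_pderiv m \<alpha> f x = mixed_pderiv m \<alpha> g x"
  unfolding mixed_pderiv_def using e by (simp add: atLeast0LessThan)
 then show ?thesis using x by blast
qed

lemma Cp_open_mixed_pderiv:
 assumes "Cp_open n \<infinity> U g" "m \<le> n"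
 shows "Cp_open n \<infinity> U (mixed_pderiv m \<alpha> g)"
proof -
 have p: "Cp_open n \<infinity> U ((pderiv_coord i ^^ k) g)" if "i < n" "Cp_open n \<infinity> U g" for i k g
  using that by (induction k) (simp_all add: Cp_open_pderiv)
 have "Cp_open n \<infinity> U (fold (\<lambda>i. pderiv_coord i ^^ \<alpha> i) xs g)" if "set xs \<subseteq> {..<n}" "Cp_open n \<infinity> U g" for xs g
  using that by (induction xs arbitrary: g) (simp_all add: p)
 moreover have "set [0..<m] \<subseteq> {..<n}" using assms(2) by auto
 ultimately show ?thesis using assms(1) unfolding mixed_pderiv_def by blast
qed

text \<open>The jet of a family in its first \<open>m\<close> variables, the other coordinates of
  \<open>z\<close> being parameters. No retraction appears because the family is used over open
  \<open>M\<close>, where the retraction is the identity.\<close>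

definition jetG :: "nat => nat => nat => ((nat => real) => nat => real) => (nat => real) => nat => real" where
 "jetG m n k G z = (\<lambda>i.
   if i < m then z i
   else if i < m + n then G z (i - m)
   else if i < jet_dim m n k then
    mixed_pderiv m (from_nat_into (multi_indices m k) ((i - (m + n)) div n)) (\<lambda>z. G z ((i - (m + n)) mod n)) z
   else 0)"

lemma continuous_on_jetG:
 assumes Q: "opn N Q" and mN: "m \<le> N" and G: "\<And>j. j < n ==> Cp_open N \<infinity> Q (\<lambda>z. G z j)"
 shows "continuous_on Q (\<lambda>z. jetG m n k G z i)"
proof -
 have QR: "Q \<subseteq> Rn N" by (rule opn_subset[OF Q])
 have c: "continuous_on Q g" if "Cp_open N \<infinity> Q g" for g
  by (rule Ck_open_continuous[OF QR Cp_open_Ck[OF that, of 0]]) simp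
 consider "i < m" | "m \<le> i" "i < m + n" | "m + n \<le> i" "i < jet_dim m n k" | "m + n \<le> i" "\<not> i < jet_dim m n k" by linarith
 then show ?thesis
 proof cases
  case 1
  then show ?thesis by (simp add: jetG_def continuous_on_coord)
 next
  case 2
  then show ?thesis using c[OF G[of "i - m"]] by (simp add: jetG_def)
 next
  case 3
  then have "n \<noteq> 0" by (cases n) (simp_all add: jet_dim_def)
  then have "(i - (m + n)) mod n < n" by simp
  from c[OF Cp_open_mixed_pderiv[OF G[OF this] mN]] show ?thesis using 3 by (simp add: jetG_def)
 next
  case 4
  then show ?thesis by (simp add: jetG_def)
 qed
qed

lemma jet_cong_open:
 assumes U: "opn m U" "U \<subseteq> M" and tr: "\<And>w. w \<in> M ==> tubular_retraction Df m M w = w"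
  and e: "\<And>w. w \<in> U ==> f w = g w" and x: "x \<in> U"
 shows "jet Df m M n k f x = jet Df m M n k g x"
proof -
 have "mixed_pderiv m \<alpha> (\<lambda>w. f (tubular_retraction Df m M w) j) x = mixed_pderiv m \<alpha> (\<lambda>w. g (tubular_retraction Df m M w) j) x" for \<alpha> j
  by (rule mixed_pderiv_cong[OF U(1) _ x]) (use U(2) tr e in auto)
 then show ?thesis using e[OF x] by (auto simp: jet_def fun_eq_iff)
qed

lemma jet_family:
 assumes M: "opn m M" and tr: "\<And>w. w \<in> M ==> tubular_retraction Df m M w = w"
  and e: "\<And>w. w \<in> M ==> f w = G (append_vec m w c)" and x: "x \<in> M"
 shows "jet Df m M n k f x = jetG m n k G (append_vec m x c)"
proof -
 have mp: "mixed_pderiv m \<alpha> (\<lambda>w. f (tubular_retraction Df m M w) j) x = mixed_pderiv m \<alpha> (\<lambda>z. G z j) (append_vec m x c)" for \<alpha> j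
 proof -
  have "mixed_pderiv m \<alpha> (\<lambda>w. f (tubular_retraction Df m M w) j) x = mixed_pderiv m \<alpha> (\<lambda>w. G (append_vec m w c) j) x"
   by (rule mixed_pderiv_cong[OF M _ x]) (use tr e in auto)
  then show ?thesis using mixed_pderiv_append[of m \<alpha> "\<lambda>z. G z j" c] by simp
 qed
 have "append_vec m x c i = x i" if "i < m" for i using that by (simp add: append_vec_def)
 then show ?thesis using e[OF x] mp by (auto simp: jet_def jetG_def fun_eq_iff)
qed

text \<open>If infinitely many \<open>g s\<close> left the basic set, their jets would violate its
  condition at points of the compact \<open>K\<close>, since elsewhere they agree with those of
  \<open>f\<close>. Such points accumulate at some \<open>l\<close> in \<open>K\<close>; all
  derivatives are continuous in point and parameter jointly, so the jets converge to the jet of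
  \<open>f\<close> at \<open>l\<close>, which lies in the open set.\<close>

lemma deformation_eventually_in_basis:
 assumes M: "opn m M" and tr: "\<And>w. w \<in> M ==> tubular_retraction Df m M w = w"
  and K: "compact K" "K \<subseteq> M"
  and Q: "opn (m + p) Q" and G: "\<And>j. j < n ==> Cp_open (m + p) \<infinity> Q (\<lambda>z. G z j)"
  and c: "c \<in> Rn p" "\<And>s. cs s \<in> Rn p" "cs \<longlonglongrightarrow> c"
  and MQ: "\<And>w. w \<in> M ==> append_vec m w c \<in> Q"
  and f: "\<And>w. w \<in> M ==> f w = G (append_vec m w c)"
  and g: "\<And>s. g s \<in> D_inf Df m M n N" "\<And>s w. w \<in> M ==> g s w = G (append_vec m w (cs s))"
  and out: "\<And>s w. w \<in> M - K ==> g s w = f w"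
  and b: "b \<in> Dk_basis Df m M n N k" "f \<in> b"
 shows "\<forall>\<^sub>F s in sequentially. g s \<in> b"
proof (rule ccontr)
 assume nt: "\<not> ?thesis"
 obtain r :: "nat => nat" where r: "strict_mono r" "\<And>s. g (r s) \<notin> b"
  using not_eventually_sequentiallyD[OF nt] by blast
 obtain U where U: "openin (subtopology (Euclidean_space (jet_dim m n k)) (jet_space Df m M n N k)) U"
  and bU: "b = {f \<in> D_inf Df m M n N. jet Df m M n k f ` M \<subseteq> U}" using b(1) unfolding Dk_basis_def by blast
 obtain T where T: "opn (jet_dim m n k) T" "U = T \<inter> jet_space Df m M n N k"
  using U unfolding openin_subtopology by blast
 have MR: "M \<subseteq> Rn m" by (rule opn_subset[OF M])
 have fU: "jet Df m M n k f w \<in> U" if "w \<in> M" for w using b(2) that unfolding bU by blast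
 have "\<exists>w. w \<in> M \<and> jet Df m M n k (g (r s)) w \<notin> U" for s using r(2)[of s] g(1) unfolding bU by blast
 then obtain w where w: "\<And>s. w s \<in> M" "\<And>s. jet Df m M n k (g (r s)) (w s) \<notin> U" by metis
 \<comment> \<open>Equality of maps passes to their jets on open sets, hence the need for openness
   of \<open>M - K\<close>.\<close>
 have MK: "opn m (M - K)"
 proof -
  obtain A where A: "open A" "M = Rn m \<inter> A" using M openin_Euclidean_space_iff by metis
  have "open (A - K)" by (rule open_Diff[OF A(1) compact_imp_closed[OF K(1)]])
  moreover have "M - K = Rn m \<inter> (A - K)" using A(2) by blast
  ultimately show ?thesis unfolding openin_Euclidean_space_iff by blast
 qed
 have wK: "w s \<in> K" for s
 proof (rule ccontr)
  assume "w s \<notin> K"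
  then have "jet Df m M n k (g (r s)) (w s) = jet Df m M n k f (w s)"
   by (intro jet_cong_open[OF MK _ tr]) (use out w(1) in auto)
  then show False using fU[OF w(1)] w(2) by metis
 qed
 have "seq_compact K" using K(1) by (simp add: compact_eq_seq_compact_metric)
 then obtain l r' where l: "l \<in> K" "strict_mono r'" "(w \<circ> r') \<longlonglongrightarrow> l" by (rule seq_compactE) (use wK in auto)
 have lM: "l \<in> M" using l(1) K(2) by blast
 have lim: "(\<lambda>s. append_vec m (w (r' s)) (cs (r (r' s)))) \<longlonglongrightarrow> append_vec m l c"
  unfolding tendsto_fun_iff
 proof
  fix i
  have "strict_mono (\<lambda>s. r (r' s))" using strict_mono_o[OF r(1) l(2)] by (simp add: o_def)
  from LIMSEQ_subseq_LIMSEQ[OF c(3) this] have "(\<lambda>s. cs (r (r' s)) j) \<longlonglongrightarrow> c j" for j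
   by (simp add: o_def tendsto_fun_iff)
  moreover have "(\<lambda>s. w (r' s) i) \<longlonglongrightarrow> l i" using l(3) by (simp add: o_def tendsto_fun_iff)
  ultimately show "(\<lambda>s. append_vec m (w (r' s)) (cs (r (r' s))) i) \<longlonglongrightarrow> append_vec m l c i"
   by (simp add: append_vec_def)
 qed
 have aR: "append_vec m (w (r' s)) (cs (r (r' s))) \<in> Rn (m + p)" for s
  by (rule append_vec_Rn) (use w(1) MR c(2) in auto)
 have "(\<lambda>s. jetG m n k G (append_vec m (w (r' s)) (cs (r (r' s))))) \<longlonglongrightarrow> jetG m n k G (append_vec m l c)"
  unfolding tendsto_fun_iff
 proof
  fix i
  show "(\<lambda>s. jetG m n k G (append_vec m (w (r' s)) (cs (r (r' s)))) i) \<longlonglongrightarrow> jetG m n k G (append_vec m l c) i"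
   by (rule continuous_on_opn_tendsto[OF Q continuous_on_jetG[where G = G and i = i and k = k and m = m and n = n, OF Q _ G] MQ[OF lM] lim])
     (use aR in \<open>auto intro: always_eventually\<close>)
 qed
 moreover have "jet Df m M n k f l = jetG m n k G (append_vec m l c)"
  by (rule jet_family[where G = G, OF M]) (use tr f lM in auto)
 moreover have "jet Df m M n k (g (r (r' s))) (w (r' s)) = jetG m n k G (append_vec m (w (r' s)) (cs (r (r' s))))" for s
  by (rule jet_family[where G = G, OF M]) (use tr g(2) w(1) in auto)
 ultimately have jl: "(\<lambda>s. jet Df m M n k (g (r (r' s))) (w (r' s))) \<longlonglongrightarrow> jet Df m M n k f l"
  by (simp only:)
 have "\<forall>\<^sub>F s in sequentially. jet Df m M n k (g (r (r' s))) (w (r' s)) \<in> T"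
  by (rule opn_eventually[OF T(1) _ jl])
    (use fU[OF lM] T(2) in \<open>auto intro!: always_eventually simp: mem_Rn jet_def jet_dim_def\<close>)
 then obtain s where s: "jet Df m M n k (g (r (r' s))) (w (r' s)) \<in> T"
  using eventually_happens[of _ sequentially] by auto
 have "jet Df m M n k (g (r (r' s))) (w (r' s)) \<in> jet_space Df m M n N k"
  unfolding jet_space_def using w(1) g(1) by blast
 then show False using s w(2)[of "r' s"] T(2) by blast
qed

text \<open>The sets that contain \<open>g s\<close> eventually as soon as they contain
  \<open>f\<close> are closed under finite intersections and arbitrary unions, so generators
  suffice.\<close>

lemma generated_topology_eventually:
 assumes "openin (topology_generated_by B) A" "f \<in> A"
  and b: "\<And>b. b \<in> B ==> f \<in> b ==> \<forall>\<^sub>F s in F. g s \<in> b"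
 shows "\<forall>\<^sub>F s in F. g s \<in> A"
proof -
 have "generate_topology_on B A" using assms(1) by (simp add: openin_topology_generated_by_iff)
 then have "f \<in> A --> (\<forall>\<^sub>F s in F. g s \<in> A)"
 proof (induction rule: generate_topology_on.induct)
  case (Int a b)
  then show ?case by (auto intro: eventually_conj)
 next
  case (UN K)
  show ?case
  proof
   assume "f \<in> \<Union>K"
   then obtain k where k: "k \<in> K" "f \<in> k" by blast
   then have "\<forall>\<^sub>F s in F. g s \<in> k" using UN.IH by blast
   then show "\<forall>\<^sub>F s in F. g s \<in> \<Union>K" by (rule eventually_mono) (use k(1) in blast)
  qed
 qed (use b in auto)
 then show ?thesis using assms(2) by blast
qed

context smooth_exp_o_minimal_field
begin

lemma dt_bump: "(\<And>i. dt n (\<lambda>z. F z i)) ==> dt n (\<lambda>z. bump q \<rho> (F z))"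
 unfolding bump_def sstep_0 by (intro dt_if dp_less dt_exp dt_intros)

lemma dt_pert:
 assumes "\<And>i. dt n (\<lambda>z. F z i)"
 shows "dt n (\<lambda>z. pert q y \<eta> \<rho> a b (F z) j)"
 unfolding pert_def by (intro dt_bump dt_intros assms)

end

section \<open>Failure of regularity destroys openness\<close>

lemma submanifold_open:
 assumes M: "opn q M"
 shows "submanifold q \<infinity> q M"
proof -
 have MR: "M \<subseteq> Rn q" by (rule opn_subset[OF M])
 have c: "Cp_on q \<infinity> M (\<lambda>x. x j)" for j unfolding Cp_on_open_iff[OF M] by (rule Cp_open_coord[OF M])
 have i: "inv_into M (\<lambda>x. x) y = y" if "y \<in> M" for y
  using inv_into_f_f[of "\<lambda>x. x" M y] that by (simp add: inj_on_def)
 have "Cp_open q \<infinity> M (\<lambda>y. inv_into M (\<lambda>x. x) y j)" for j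
  using Cp_open_cong[OF M, of "\<lambda>y. inv_into M (\<lambda>x. x) y j" "\<lambda>y. y j" \<infinity>] Cp_open_coord[OF M] i by simp
 then have "Cp_map q q \<infinity> M (inv_into M (\<lambda>x. x))"
  unfolding Cp_map_def Cp_on_open_iff[OF M] using i MR by auto
 moreover have "Cp_map q q \<infinity> M (\<lambda>x. x)" unfolding Cp_map_def using c MR by auto
 ultimately have "Cp_diffeo q q \<infinity> M M (\<lambda>x. x)" unfolding Cp_diffeo_def by (simp add: bij_betw_def inj_on_def)
 moreover have "(\<lambda>x. x) ` (M \<inter> M) = M \<inter> {y. \<forall>i\<ge>q. y i = 0}" using MR by (auto simp: mem_Rn)
 ultimately show ?thesis unfolding submanifold_def using M MR by blast
qed

text \<open>\<open>v\<close> is approximated by tangent vectors of \<open>N\<close> along the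
  sequence, whose residuals modulo the tangent spaces of \<open>X\<close> are tangent to
  \<open>N\<close> and orthogonal to \<open>X\<close>. In the limit the residual is nonzero because
  \<open>v\<close> is not in \<open>\<tau>\<close>, so it can be normalized.\<close>

lemma irregular_sequence:
 assumes N: "submanifold q \<infinity> d N" and X: "submanifold q 1 k X" "X \<subseteq> N" and Y: "Y \<subseteq> N" "y \<in> Y"
  and xs: "\<And>s. xs s \<in> X" "xs \<longlonglongrightarrow> y"
  and G: "limitin (grassmannian q k) (\<lambda>s. tangent_space X (xs s)) \<tau> sequentially"
  and v: "v \<in> tangent_space Y y" "v \<notin> \<tau>"
 obtains zs \<eta>s \<eta> where "\<And>s. zs s \<in> X" "zs \<longlonglongrightarrow> y" "\<And>s. \<eta>s s \<in> tangent_space N (zs s)"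
  "\<And>s. ip q (\<eta>s s) (\<eta>s s) = 1" "\<And>s b. b \<in> tangent_space X (zs s) ==> ip q (\<eta>s s) b = 0"
  "\<eta>s \<longlonglongrightarrow> \<eta>" "ip q v \<eta> \<noteq> 0"
proof -
 have pi: "(1::enat) \<le> \<infinity>" and p1: "(1::enat) \<le> 1" by simp_all
 have yN: "y \<in> N" and xN: "xs s \<in> N" for s using Y X(2) xs(1) by auto
 have NR: "N \<subseteq> Rn q" by (rule submanifold_Rn[OF N])
 have vN: "v \<in> tangent_space N y" using tangent_space_mono[OF Y(1)] v(1) by blast
 have vR: "v \<in> Rn q" by (rule tangent_space_Rn[OF NR vN])
 have "\<exists>b. orthonormal q k b \<and> lin_span k b = tangent_space X (xs s)" for s
  by (rule tangent_orthonormal_basis[OF X(1) p1 xs(1)]) blast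
 then obtain bs where bs: "\<And>s. orthonormal q k (bs s)" "\<And>s. lin_span k (bs s) = tangent_space X (xs s)" by metis
 obtain r l where r: "strict_mono r" "orthonormal q k l" "\<And>j. j < k ==> (\<lambda>s. bs (r s) j) \<longlonglongrightarrow> l j"
  by (rule orthonormal_subseq[of q k bs, OF bs(1)]) blast
 have "limitin (grassmannian q k) ((\<lambda>s. tangent_space X (xs s)) \<circ> r) \<tau> sequentially"
  by (rule limitin_subsequence[OF r(1) G])
 then have G': "limitin (grassmannian q k) (\<lambda>s. lin_span k (bs (r s))) \<tau> sequentially" by (simp add: o_def bs(2))
 have \<tau>: "\<tau> = lin_span k l"
  by (rule grassmannian_limit_unique[of q k "\<lambda>s. bs (r s)", OF bs(1) r(2) _ G']) (rule r(3))
 have xr: "(\<lambda>s. xs (r s)) \<longlonglongrightarrow> y" using LIMSEQ_subseq_LIMSEQ[OF xs(2) r(1)] by (simp add: o_def)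
 obtain vs where vs: "vs \<longlonglongrightarrow> v" "\<And>s. vs s \<in> tangent_space N (xs (r s))"
  by (rule tangent_lsc[OF N pi yN xr xN vN]) blast
 define ps where "ps s = proj q k (bs (r s)) (vs s)" for s
 define \<zeta>s where "\<zeta>s s = (\<lambda>i. vs s i - ps s i)" for s
 define \<zeta> where "\<zeta> = (\<lambda>i. v i - proj q k l v i)"
 have \<zeta>lim: "\<zeta>s \<longlonglongrightarrow> \<zeta>"
  unfolding tendsto_fun_iff
 proof
  fix i
  have "(\<lambda>s. \<Sum>j<k. ip q (vs s) (bs (r s) j) * bs (r s) j i) \<longlonglongrightarrow> (\<Sum>j<k. ip q v (l j) * l j i)"
   by (rule tendsto_sum, rule tendsto_mult, rule tendsto_ip[OF vs(1)])
     (use r(3) in \<open>auto simp: tendsto_fun_iff\<close>)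
  moreover have "(\<lambda>s. vs s i) \<longlonglongrightarrow> v i" using vs(1) by (simp add: tendsto_fun_iff)
  ultimately show "(\<lambda>s. \<zeta>s s i) \<longlonglongrightarrow> \<zeta> i" unfolding \<zeta>s_def \<zeta>_def ps_def proj_def by (rule tendsto_diff[rotated])
 qed
 have pos: "ip q \<zeta> \<zeta> > 0" unfolding \<zeta>_def by (rule orthonormal_extend(1)[OF r(2) vR]) (use v(2) \<tau> in simp)
 have "ip q \<zeta> (proj q k l v) = 0" unfolding \<zeta>_def by (rule residual_orthogonal[OF r(2) proj_in_span])
 then have v\<zeta>: "ip q v \<zeta> = ip q \<zeta> \<zeta>"
  using ip_diff(1)[of q v "proj q k l v" \<zeta>] ip_commute[of q "proj q k l v" \<zeta>] by (simp add: \<zeta>_def)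
 have nlim: "(\<lambda>s. ip q (\<zeta>s s) (\<zeta>s s)) \<longlonglongrightarrow> ip q \<zeta> \<zeta>" by (rule tendsto_ip[OF \<zeta>lim \<zeta>lim])
 then have "\<forall>\<^sub>F s in sequentially. ip q (\<zeta>s s) (\<zeta>s s) > 0" using pos by (rule order_tendstoD(1))
 then obtain s0 where s0: "\<And>s. s \<ge> s0 ==> ip q (\<zeta>s s) (\<zeta>s s) > 0" unfolding eventually_sequentially by blast
 \<comment> \<open>The shift by \<open>s0\<close> skips the terms whose residual may vanish.\<close>
 define c where "c s = 1 / sqrt (ip q (\<zeta>s (s + s0)) (\<zeta>s (s + s0)))" for s
 define c0 where "c0 = 1 / sqrt (ip q \<zeta> \<zeta>)"
 have sp: "subsp q (tangent_space N (xs (r s)))" for s by (rule tangent_subsp[OF N pi xN])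
 have \<zeta>N: "\<zeta>s s \<in> tangent_space N (xs (r s))" for s
  unfolding \<zeta>s_def
 proof (rule subsp_diff[OF sp vs(2)])
  have "ps s \<in> tangent_space X (xs (r s))" unfolding ps_def using proj_in_span bs(2) by blast
  then show "ps s \<in> tangent_space N (xs (r s))" using tangent_space_mono[OF X(2)] by blast
 qed
 show thesis
 proof (rule that[of "\<lambda>s. xs (r (s + s0))" "\<lambda>s i. c s * \<zeta>s (s + s0) i" "\<lambda>i. c0 * \<zeta> i"])
  show "xs (r (s + s0)) \<in> X" for s by (rule xs(1))
  show "(\<lambda>s. xs (r (s + s0))) \<longlonglongrightarrow> y" by (rule LIMSEQ_ignore_initial_segment[OF xr])
  show "(\<lambda>i. c s * \<zeta>s (s + s0) i) \<in> tangent_space N (xs (r (s + s0)))" for s by (rule subspD(4)[OF sp \<zeta>N])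
  show "ip q (\<lambda>i. c s * \<zeta>s (s + s0) i) (\<lambda>i. c s * \<zeta>s (s + s0) i) = 1" for s
   unfolding ip_scale c_def using s0[of "s + s0"] by simp
  show "ip q (\<lambda>i. c s * \<zeta>s (s + s0) i) b = 0" if "b \<in> tangent_space X (xs (r (s + s0)))" for s b
  proof -
   have "ip q (\<zeta>s (s + s0)) b = 0"
    unfolding \<zeta>s_def ps_def by (rule residual_orthogonal[OF bs(1)]) (use that bs(2) in simp)
   then show ?thesis by (simp add: ip_scale)
  qed
  have "c \<longlonglongrightarrow> c0" unfolding c_def c0_def
   by (intro tendsto_divide tendsto_const tendsto_real_sqrt LIMSEQ_ignore_initial_segment[OF nlim]) (use pos in simp)
  then have "(\<lambda>s. c s * \<zeta>s (s + s0) i) \<longlonglongrightarrow> c0 * \<zeta> i" for i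
   using LIMSEQ_ignore_initial_segment[OF \<zeta>lim, of s0] by (intro tendsto_mult) (auto simp: tendsto_fun_iff)
  then show "(\<lambda>s i. c s * \<zeta>s (s + s0) i) \<longlonglongrightarrow> (\<lambda>i. c0 * \<zeta> i)" by (simp add: tendsto_fun_iff)
  show "ip q v (\<lambda>i. c0 * \<zeta> i) \<noteq> 0" unfolding ip_scale v\<zeta> c0_def using pos by simp
 qed
qed

text \<open>The derivative is the identity plus a map of rank at most one with values along
  \<open>\<eta>\<close>, so a preimage of \<open>\<xi>\<close> is sought as
  \<open>\<xi> + \<kappa> \<eta>\<close>. The scalar equation for \<open>\<kappa>\<close> has
  coefficient \<open>n + 2 s^2\<close>, positive away from the origin; the factor
  \<open>1 - |w|^2\<close> in \<open>pert\<close> is there to produce it.\<close>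

lemma pert_surj:
 assumes x: "x \<in> Rn q" "x \<noteq> (\<lambda>_. 0)" and \<eta>: "\<eta> \<in> Rn q" "ip q \<eta> \<eta> = 1" and \<xi>: "\<xi> \<in> Rn q"
 obtains a where "a \<in> Rn q" "lapp q q (grad (\<lambda>j w. pert q y \<eta> \<rho> (\<lambda>_. 0) \<eta> w j) x) a = \<xi>"
proof -
 define n s \<beta> \<omega> where "n = ip q x x" and "s = ip q x \<eta>" and "\<beta> = ip q \<xi> \<eta>" and "\<omega> = ip q x \<xi>"
 have "n \<noteq> 0" unfolding n_def using ip_self_eq_0[OF x(1)] x(2) by simp
 then have n: "n > 0" using ip_self_nonneg[of q x] by (simp add: n_def)
 define \<kappa> where "\<kappa> = ((1 - n) * \<beta> - 2 * s * \<omega>) / (n + 2 * s\<^sup>2)"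
 have "n + 2 * s\<^sup>2 > 0" using n by (simp add: add_pos_nonneg)
 then have \<kappa>: "\<kappa> * (n + 2 * s\<^sup>2) = (1 - n) * \<beta> - 2 * s * \<omega>" by (simp add: \<kappa>_def)
 define a where "a = (\<lambda>i. \<xi> i + \<kappa> * \<eta> i)"
 have aR: "a \<in> Rn q" unfolding a_def by (rule Rn_add[OF \<xi> Rn_scale[OF \<eta>(1)]])
 have a1: "ip q a \<eta> = \<beta> + \<kappa>" by (simp add: a_def ip_add ip_scale \<eta>(2) \<beta>_def)
 have a2: "ip q x a = \<omega> + \<kappa> * s" by (simp add: a_def ip_add ip_scale \<omega>_def s_def)
 have z: "\<kappa> - (1 - n) * (\<beta> + \<kappa>) + 2 * (\<omega> + \<kappa> * s) * s = 0"
  using \<kappa> by (simp add: algebra_simps power2_eq_square)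
 have "lapp q q (grad (\<lambda>j w. pert q y \<eta> \<rho> (\<lambda>_. 0) \<eta> w j) x) a j = \<xi> j" for j
 proof (cases "j < q")
  case True
  have "lapp q q (grad (\<lambda>j w. pert q y \<eta> \<rho> (\<lambda>_. 0) \<eta> w j) x) a j =
    \<xi> j + (\<kappa> - (1 - n) * (\<beta> + \<kappa>) + 2 * (\<omega> + \<kappa> * s) * s) * \<eta> j"
   unfolding pert_derivative[OF x(1) aR True] a1 a2 n_def[symmetric] s_def[symmetric]
   by (simp add: a_def algebra_simps)
  then show ?thesis by (simp only: z)
 next
  case False
  then show ?thesis using \<xi> by (simp add: lapp_def mem_Rn)
 qed
 then show thesis using that[OF aR] by blast
qed

lemma pert_singular:
 assumes u: "u \<in> Rn q" and b: "b \<in> Rn q"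
 shows "lapp q q (grad (\<lambda>j w. pert q y \<eta> \<rho> a b w j) (\<lambda>_. 0)) u = (\<lambda>j. u j - ip q u b * b j)"
proof
 fix j show "lapp q q (grad (\<lambda>j w. pert q y \<eta> \<rho> a b w j) (\<lambda>_. 0)) u j = u j - ip q u b * b j"
 proof (cases "j < q")
  case True
  then show ?thesis by (rule pert_derivative_0[OF u])
 qed (use u b in \<open>simp add: lapp_def mem_Rn\<close>)
qed

context smooth_exp_o_minimal_field
begin

text \<open>The values of \<open>pert\<close> need not lie on \<open>N\<close>. At
  \<open>\<pi> p\<close> the derivative of the retraction fixes \<open>\<xi>\<close>, and near
  \<open>y\<close> its entries at \<open>p\<close> and at \<open>\<pi> p\<close> are close, so the
  product with \<open>\<xi>\<close> stays within distance less than 1 of 1.\<close>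

lemma retraction_onto_tangent:
 assumes DN: "N \<in> Df q" and N: "submanifold q \<infinity> d N" and T: "tubular_neighborhood Df q N T \<pi>" and y: "y \<in> N"
 obtains e where "e > 0" "bx q y e \<subseteq> T"
  "\<And>p \<xi>. p \<in> bx q y e ==> \<xi> \<in> tangent_space N (\<pi> p) ==> ip q \<xi> \<xi> = 1 ==>
    ip q \<xi> (lapp q q (grad (\<lambda>j w. \<pi> w j) p) \<xi>) \<noteq> 0"
proof -
 note F = tubular_neighborhood_facts[OF DN N T]
 define P where "P i j p = pderiv_coord i (\<lambda>w. \<pi> w j) p" for i j p
 have TR: "T \<subseteq> Rn q" by (rule opn_subset[OF F(1)])
 have NR: "N \<subseteq> Rn q" by (rule submanifold_Rn[OF N])
 have yT: "y \<in> T" and yR: "y \<in> Rn q" using F(2) y NR by auto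
 have c: "continuous_on T g" if "Cp_open q \<infinity> T g" for g
  by (rule Ck_open_continuous[OF TR Cp_open_Ck[OF that, of 0]]) simp
 have cP: "continuous_on T (P i j)" if "i < q" "j < q" for i j
  unfolding P_def by (rule c[OF Cp_open_pderiv[OF F(4)[OF that(2)] that(1)]])
 have c\<pi>: "continuous_on T \<pi>" by (rule continuous_on_Rn_coords[OF c[OF F(4)]]) (use F(3) NR in auto)
 have cP\<pi>: "continuous_on T (\<lambda>p. P i j (\<pi> p))" if "i < q" "j < q" for i j
  by (rule continuous_on_compose2[OF cP[OF that] c\<pi>]) (use F(2,3) in auto)
 \<comment> \<open>Entries that differ by at most \<open>2 \<kappa>\<close> change the product by at
   most \<open>q^2\<close> times that, which this choice keeps below 1.\<close>
 define \<kappa> where "\<kappa> = 1 / ((real q)\<^sup>2 + 1) / 2"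
 have q1: "(real q)\<^sup>2 + 1 > 0" by (simp add: add_nonneg_pos)
 have half: "2 * (x / 2) = x" for x :: real by simp
 have \<kappa>: "\<kappa> > 0" using q1 by (simp add: \<kappa>_def)
 have "2 * \<kappa> = 1 / ((real q)\<^sup>2 + 1)" unfolding \<kappa>_def by (rule half)
 then have "real q * (real q * (2 * \<kappa>)) = (real q)\<^sup>2 / ((real q)\<^sup>2 + 1)" by (simp add: power2_eq_square)
 also have "\<dots> < 1" using q1 by (simp add: pos_divide_less_eq)
 finally have \<kappa>q: "real q * (real q * (2 * \<kappa>)) < 1" .
 have "\<forall>\<^sub>F p in inf (nhds y) (principal (Rn q)). p \<in> T \<and>
   (\<forall>i\<in>{..<q}. \<forall>j\<in>{..<q}. \<bar>P i j p - P i j y\<bar> < \<kappa> \<and> \<bar>P i j (\<pi> p) - P i j y\<bar> < \<kappa>)"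
 proof (intro eventually_conj eventually_ball_finite ballI finite_lessThan eventually_nb_in[OF F(1) yT])
  fix i j assume "i \<in> {..<q}" "j \<in> {..<q}"
  then have ij: "i < q" "j < q" by auto
  show "\<forall>\<^sub>F p in inf (nhds y) (principal (Rn q)). \<bar>P i j p - P i j y\<bar> < \<kappa>"
   using tendstoD[OF continuous_on_nb[OF F(1) cP[OF ij] yT] \<kappa>] by (simp add: dist_real_def)
  show "\<forall>\<^sub>F p in inf (nhds y) (principal (Rn q)). \<bar>P i j (\<pi> p) - P i j y\<bar> < \<kappa>"
   using tendstoD[OF continuous_on_nb[OF F(1) cP\<pi>[OF ij] yT] \<kappa>] by (simp add: dist_real_def F(5)[OF y])
 qed
 then obtain e where e: "e > 0" "\<forall>p\<in>bx q y e. p \<in> T \<and>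
   (\<forall>i\<in>{..<q}. \<forall>j\<in>{..<q}. \<bar>P i j p - P i j y\<bar> < \<kappa> \<and> \<bar>P i j (\<pi> p) - P i j y\<bar> < \<kappa>)"
  unfolding eventually_nb[OF yR] by blast
 show thesis
 proof (rule that[OF e(1)])
  show "bx q y e \<subseteq> T" using e(2) by blast
  fix p \<xi> assume p: "p \<in> bx q y e" and \<xi>: "\<xi> \<in> tangent_space N (\<pi> p)" "ip q \<xi> \<xi> = 1"
  have \<pi>pN: "\<pi> p \<in> N" using e(2) p F(3) by auto
  define D D0 where "D = grad (\<lambda>j w. \<pi> w j) p" and "D0 = grad (\<lambda>j w. \<pi> w j) (\<pi> p)"
  have id: "lapp q q D0 \<xi> = \<xi>"
   unfolding D0_def by (rule retraction_derivative_tangent[OF DN N T \<pi>pN \<xi>(1)])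
  have \<xi>1: "\<bar>\<xi> i\<bar> \<le> 1" if "i < q" for i using abs_coord_le_ip[OF that, of \<xi>] \<xi>(2) by simp
  have Dd: "\<bar>D i j - D0 i j\<bar> \<le> 2 * \<kappa>" if "i < q" "j < q" for i j
  proof -
   have "\<bar>P i j p - P i j y\<bar> < \<kappa>" "\<bar>P i j (\<pi> p) - P i j y\<bar> < \<kappa>" using e(2) p that by auto
   then show ?thesis unfolding D_def D0_def grad_def P_def by linarith
  qed
  have dif: "\<bar>lapp q q D \<xi> j - \<xi> j\<bar> \<le> real q * (2 * \<kappa>)" if j: "j < q" for j
  proof -
   have "lapp q q D \<xi> j - \<xi> j = lapp q q D \<xi> j - lapp q q D0 \<xi> j" by (simp only: id)
   also have "\<dots> = (\<Sum>i<q. (D i j - D0 i j) * \<xi> i)"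
    using j by (simp add: lapp_def sum_subtractf[symmetric] algebra_simps)
   also have "\<bar>\<dots>\<bar> \<le> (\<Sum>i<q. 2 * \<kappa>)"
   proof (rule order_trans[OF sum_abs sum_mono])
    fix i assume "i \<in> {..<q}"
    then have "\<bar>D i j - D0 i j\<bar> * \<bar>\<xi> i\<bar> \<le> (2 * \<kappa>) * 1" using Dd[of i j] \<xi>1[of i] j \<kappa> by (intro mult_mono) auto
    then show "\<bar>(D i j - D0 i j) * \<xi> i\<bar> \<le> 2 * \<kappa>" by (simp add: abs_mult)
   qed
   finally show ?thesis by simp
  qed
  have "\<bar>ip q \<xi> (lapp q q D \<xi>) - 1\<bar> = \<bar>\<Sum>j<q. \<xi> j * (lapp q q D \<xi> j - \<xi> j)\<bar>"
   using \<xi>(2) unfolding ip_def right_diff_distrib sum_subtractf by simp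
  also have "\<dots> \<le> (\<Sum>j<q. real q * (2 * \<kappa>))"
  proof (rule order_trans[OF sum_abs sum_mono])
   fix j assume "j \<in> {..<q}"
   then have "\<bar>\<xi> j\<bar> * \<bar>lapp q q D \<xi> j - \<xi> j\<bar> \<le> 1 * (real q * (2 * \<kappa>))"
    using dif[of j] \<xi>1[of j] by (intro mult_mono) auto
   then show "\<bar>\<xi> j * (lapp q q D \<xi> j - \<xi> j)\<bar> \<le> real q * (2 * \<kappa>)" by (simp add: abs_mult)
  qed
  also have "\<dots> < 1" using \<kappa>q by simp
  finally show "ip q \<xi> (lapp q q (grad (\<lambda>j w. \<pi> w j) p) \<xi>) \<noteq> 0" unfolding D_def by auto
 qed
qed

lemma compact_ip_ball: "compact {w \<in> Rn q. ip q w w \<le> \<rho>\<^sup>2}"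
 unfolding compact_eq_seq_compact_metric
proof (rule seq_compactI)
 fix f :: "nat => nat => real" assume f: "\<forall>s. f s \<in> {w \<in> Rn q. ip q w w \<le> \<rho>\<^sup>2}"
 have fR: "f s \<in> Rn q" and fi: "ip q (f s) (f s) \<le> \<rho>\<^sup>2" for s using f by auto
 have fb: "\<bar>f s i\<bar> \<le> \<bar>\<rho>\<bar>" if "i < q" for s i
  using abs_coord_le_ip[OF that, of "f s"] real_sqrt_le_mono[OF fi[of s]] by simp
 obtain r l where r: "strict_mono r" "l \<in> Rn q" "(\<lambda>s. f (r s)) \<longlonglongrightarrow> l" by (rule bounded_subseq[OF fR fb])
 have "ip q l l \<le> \<rho>\<^sup>2" by (rule LIMSEQ_le_const2[OF tendsto_ip[OF r(3) r(3)]]) (use fi in blast)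
 then show "\<exists>l\<in>{w \<in> Rn q. ip q w w \<le> \<rho>\<^sup>2}. \<exists>r. strict_mono r \<and> (f \<circ> r) \<longlonglongrightarrow> l"
  using r by (auto simp: o_def)
qed

text \<open>The model map composed with the retraction is transverse to \<open>\<Sigma>\<close>, because its derivative at the
 origin omits only the direction \<open>\<eta>\<close>, which \<open>T\<^sub>yY\<close> supplies; the perturbations hit \<open>X\<close> at \<open>zs s\<close> with
 derivative orthogonal to \<open>\<eta>s s\<close>, a direction that \<open>T\<^sub>zX\<close> does not supply.\<close>

lemma transverse_maps_not_open:
 assumes DN: "N \<in> Df q" and N: "submanifold q \<infinity> d N"
  and sub: "\<And>S. S \<in> \<Sigma> ==> S \<subseteq> N \<and> (\<exists>k. submanifold q 1 k S)"
  and X: "X \<in> \<Sigma>" and Y: "Y \<in> \<Sigma>" "y \<in> Y" "\<And>S. S \<in> \<Sigma> ==> y \<in> S ==> S = Y" and v: "v \<in> tangent_space Y y"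
  and zs: "\<And>s. zs s \<in> X" "zs \<longlonglongrightarrow> y" and \<eta>s: "\<And>s. \<eta>s s \<in> tangent_space N (zs s)"
   "\<And>s. ip q (\<eta>s s) (\<eta>s s) = 1" "\<And>s b. b \<in> tangent_space X (zs s) ==> ip q (\<eta>s s) b = 0"
  and \<eta>: "\<eta>s \<longlonglongrightarrow> \<eta>" "ip q v \<eta> \<noteq> 0"
 shows "\<exists>M. M \<in> Df q \<and> submanifold q \<infinity> q M \<and> M \<noteq> {} \<and>
  \<not> openin (D_inf_topology Df q M q N) {f \<in> D_inf Df q M q N. \<forall>S\<in>\<Sigma>. transverse M N f S}"
proof -
 have pi: "(1::enat) \<le> \<infinity>" and p1: "(1::enat) \<le> 1" by simp_all
 have XN: "X \<subseteq> N" and YN: "Y \<subseteq> N" using sub X Y(1) by auto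
 have NR: "N \<subseteq> Rn q" by (rule submanifold_Rn[OF N])
 have yN: "y \<in> N" and zN: "zs s \<in> N" for s using YN Y(2) XN zs(1) by auto
 have yR: "y \<in> Rn q" and zR: "zs s \<in> Rn q" for s using yN zN NR by auto
 have \<eta>N: "\<eta> \<in> tangent_space N y" by (rule tangent_closed[OF N pi yN zs(2) zN \<eta>(1) \<eta>s(1)])
 have \<eta>R: "\<eta> \<in> Rn q" and \<eta>sR: "\<eta>s s \<in> Rn q" for s using tangent_space_Rn[OF NR] \<eta>N \<eta>s(1) by auto
 have \<eta>1: "ip q \<eta> \<eta> = 1" by (rule LIMSEQ_unique[OF tendsto_ip[OF \<eta>(1) \<eta>(1)]]) (simp add: \<eta>s(2))
 obtain T \<pi> where T: "tubular_neighborhood Df q N T \<pi>" using tubular_neighborhood_exists[OF DN N] by blast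
 note F = tubular_neighborhood_facts[OF DN N T]
 obtain e where e: "e > 0" "bx q y e \<subseteq> T"
  "\<And>p \<xi>. p \<in> bx q y e ==> \<xi> \<in> tangent_space N (\<pi> p) ==> ip q \<xi> \<xi> = 1 ==>
    ip q \<xi> (lapp q q (grad (\<lambda>j w. \<pi> w j) p) \<xi>) \<noteq> 0"
  by (rule retraction_onto_tangent[OF DN N T yN]) blast
 \<comment> \<open>On the ball each coordinate of the model map stays within
   \<open>2 r \<le> e / 2\<close> of that of \<open>y\<close>; the other half of \<open>e\<close> is
   reserved for the perturbation. The bound 1 keeps \<open>1 - |w|^2\<close> between 0 and
   1.\<close>
 define r where "r = min 1 (e / 4)"
 have r: "r > 0" "r \<le> 1" "2 * r \<le> e / 2" using e(1) by (auto simp: r_def min_def)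
 define M where "M = {w \<in> Rn q. ip q w w < r\<^sup>2}"
 have ipC: "Cp_open q p (Rn q) (\<lambda>w. ip q w w)" for p by (intro Cp_open_ip Cp_open_coord opn_Rn)
 have M: "opn q M"
  unfolding M_def
  by (rule opn_less[OF opn_Rn Ck_open_continuous[OF order_refl Cp_open_Ck[OF ipC[of \<infinity>], of 0]] continuous_on_const]) simp
 have MR: "M \<subseteq> Rn q" by (rule opn_subset[OF M])
 have D: "M \<in> Df q"
 proof (rule dp_DfI)
  show "dp q (\<lambda>w. ip q w w < r\<^sup>2)" by (intro dp_less dt_intros)
 qed (simp add: M_def)
 have Ms: "submanifold q \<infinity> q M" by (rule submanifold_open[OF M])
 have M0: "(\<lambda>_. 0) \<in> M" using r(1) by (simp add: M_def Rn_zero ip_zero)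
 have tr: "tubular_retraction Df q M w = w" if "w \<in> M" for w
 proof -
  obtain T' where "tubular_neighborhood Df q M T' (tubular_retraction Df q M)" by (rule tubular_retraction_works[OF D Ms])
  from tubular_neighborhood_facts(5)[OF D Ms this that] show ?thesis .
 qed
 \<comment> \<open>Half the radius, so that the closed ball supporting the perturbation is a compact
   subset of \<open>M\<close>.\<close>
 define \<rho> where "\<rho> = r / 2"
 have \<rho>: "\<rho> > 0" using r(1) by (simp add: \<rho>_def)
 define H where "H = pert q y \<eta> \<rho>"
 have nM: "sqrt (ip q w w) < r" if "w \<in> M" for w using that r(1) by (intro real_less_lsqrt) (auto simp: M_def ip_self_nonneg)
 have wM: "\<bar>w i\<bar> < r" if "w \<in> M" "i < q" for w i
  using abs_coord_le_ip[OF that(2), of w] nM[OF that(1)] by linarith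
 have \<eta>j: "\<bar>\<eta> j\<bar> \<le> 1" if "j < q" for j using abs_coord_le_ip[OF that, of \<eta>] \<eta>1 by simp
 have H0: "\<bar>H (\<lambda>_. 0) \<eta> w j - y j\<bar> < e / 2" if w: "w \<in> M" and j: "j < q" for w j
 proof -
  have "\<bar>ip q w \<eta>\<bar> \<le> sqrt (ip q w w)" using abs_ip_le[of q w \<eta>] \<eta>1 by simp
  then have s: "\<bar>ip q w \<eta>\<bar> \<le> r" using nM[OF w] by linarith
  have "ip q w w < 1"
  proof -
   have "r\<^sup>2 \<le> 1\<^sup>2" by (rule power_mono) (use r in auto)
   then show ?thesis using w by (simp add: M_def)
  qed
  then have n: "\<bar>1 - ip q w w\<bar> \<le> 1" using ip_self_nonneg[of q w] by linarith
  have "\<bar>1 - ip q w w\<bar> * \<bar>ip q w \<eta>\<bar> * \<bar>\<eta> j\<bar> \<le> 1 * r * 1"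
   using n s \<eta>j[OF j] r(1) by (intro mult_mono) auto
  then have "\<bar>(1 - ip q w w) * ip q w \<eta> * \<eta> j\<bar> \<le> r" by (simp add: abs_mult)
  moreover have "H (\<lambda>_. 0) \<eta> w j - y j = w j - (1 - ip q w w) * ip q w \<eta> * \<eta> j"
   using j by (simp add: H_def pert_def trunc_def)
  ultimately show ?thesis using wM[OF w j] r(3) by linarith
 qed
 \<comment> \<open>A bound for coordinate \<open>j\<close> of the perturbation, valid because the
   bump is at most 1 and \<open>|w i| \<le> 1\<close> on \<open>M\<close>.\<close>
 define \<delta> where "\<delta> s j = \<bar>zs s j - y j\<bar> + (\<Sum>i<q. \<bar>\<eta> i * \<eta> j - \<eta>s s i * \<eta>s s j\<bar>)" for s j
 have \<delta>: "\<forall>\<^sub>F s in sequentially. \<forall>j\<in>{..<q}. \<delta> s j < e / 2"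
 proof (intro eventually_ball_finite finite_lessThan ballI)
  fix j assume "j \<in> {..<q}"
  have zj: "(\<lambda>s. zs s i) \<longlonglongrightarrow> y i" and hj: "(\<lambda>s. \<eta>s s i) \<longlonglongrightarrow> \<eta> i" for i
   using zs(2) \<eta>(1) by (auto simp: tendsto_fun_iff)
  have "(\<lambda>s. \<delta> s j) \<longlonglongrightarrow> \<bar>y j - y j\<bar> + (\<Sum>i<q. \<bar>\<eta> i * \<eta> j - \<eta> i * \<eta> j\<bar>)"
   unfolding \<delta>_def by (intro tendsto_add tendsto_rabs tendsto_diff tendsto_sum tendsto_mult tendsto_const zj hj)
  then show "\<forall>\<^sub>F s in sequentially. \<delta> s j < e / 2" using e(1) by (intro order_tendstoD(2)) auto
 qed
 then obtain s1 where s1: "\<And>s j. s \<ge> s1 ==> j < q ==> \<delta> s j < e / 2" unfolding eventually_sequentially by auto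
 define a b where "a s = (\<lambda>i. zs (s + s1) i - y i)" and "b s = \<eta>s (s + s1)" for s
 have aR: "a s \<in> Rn q" and bR: "b s \<in> Rn q" for s unfolding a_def b_def by (auto intro: Rn_diff zR yR \<eta>sR)
 have HR: "H a b w \<in> Rn q" for a b w unfolding H_def by (rule pert_Rn)
 have box0: "H (\<lambda>_. 0) \<eta> w \<in> bx q y e" if "w \<in> M" for w
  unfolding bx_def using HR H0[OF that] e(1) by fastforce
 have boxs: "H (a s) (b s) w \<in> bx q y e" if w: "w \<in> M" for s w
 proof -
  have "\<bar>H (a s) (b s) w j - y j\<bar> < e" if j: "j < q" for j
  proof -
   have d: "H (a s) (b s) w j - H (\<lambda>_. 0) \<eta> w j =
     bump q \<rho> w * (a s j + (ip q w \<eta> * \<eta> j - ip q w (b s) * b s j))"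
    using j by (simp add: H_def pert_def trunc_def algebra_simps)
   have "ip q w \<eta> * \<eta> j - ip q w (b s) * b s j = (\<Sum>i<q. w i * (\<eta> i * \<eta> j - b s i * b s j))"
    unfolding ip_def sum_distrib_right sum_subtractf[symmetric] by (rule sum.cong[OF refl]) (simp add: algebra_simps)
   also have "\<bar>\<dots>\<bar> \<le> (\<Sum>i<q. \<bar>\<eta> i * \<eta> j - b s i * b s j\<bar>)"
   proof (rule order_trans[OF sum_abs sum_mono])
    fix i assume "i \<in> {..<q}"
    then have "\<bar>w i\<bar> \<le> 1" using wM[OF w, of i] r(2) by simp
    then show "\<bar>w i * (\<eta> i * \<eta> j - b s i * b s j)\<bar> \<le> \<bar>\<eta> i * \<eta> j - b s i * b s j\<bar>"
     unfolding abs_mult by (intro mult_left_le_one_le) auto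
   qed
   finally have "\<bar>a s j + (ip q w \<eta> * \<eta> j - ip q w (b s) * b s j)\<bar> \<le> \<delta> (s + s1) j"
    unfolding \<delta>_def a_def b_def by linarith
   then have k: "\<bar>a s j + (ip q w \<eta> * \<eta> j - ip q w (b s) * b s j)\<bar> < e / 2" using s1[of "s + s1" j] j by simp
   have "\<bar>H (a s) (b s) w j - H (\<lambda>_. 0) \<eta> w j\<bar> \<le> \<bar>a s j + (ip q w \<eta> * \<eta> j - ip q w (b s) * b s j)\<bar>"
    unfolding d abs_mult using bump_bounds[of q \<rho> w] by (intro mult_left_le_one_le) auto
   then show ?thesis using k H0[OF w j] by linarith
  qed
  then show ?thesis unfolding bx_def using HR by blast
 qed
 have box0B: "\<forall>w\<in>M. H (\<lambda>_. 0) \<eta> w \<in> bx q y e" and boxsB: "\<forall>w\<in>M. H (a s) (b s) w \<in> bx q y e" for s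
  using box0 boxs by auto
 define g where "g a b = restrict (\<lambda>w. \<pi> (H a b w)) M" for a b
 have HC: "Cp_open q \<infinity> M (\<lambda>w. H a b w j)" for a b j
  unfolding H_def by (rule Cp_open_pert[OF M]) (intro Cp_open_const Cp_open_coord M)+
 have gfacts: "g a b \<in> D_inf Df q M q N" "\<And>j. j < q ==> Cp_open q \<infinity> M (\<lambda>w. \<pi> (H a b w) j)"
  if "\<forall>w\<in>M. H a b w \<in> bx q y e" for a b
 proof -
  have t: "dt q (\<lambda>w. H a b w j)" for j unfolding H_def by (rule dt_pert) (rule dt_coord)
  have h: "H a b \<in> M \<rightarrow> T" using that e(2) by auto
  note I = D_inf_retract[OF D MR DN N T M order_refl HC h t]
  show "g a b \<in> D_inf Df q M q N" unfolding g_def by (rule I(1))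
  show "Cp_open q \<infinity> M (\<lambda>w. \<pi> (H a b w) j)" if "j < q" for j by (rule I(2)[OF that])
 qed
 have k1: "Ck_open m (Suc 0) U h" if "Cp_open m \<infinity> U h" for m U h by (rule Cp_open_Ck[OF that]) simp
 have gder: "lapp q q (grad (fext q M (g a b)) x) u =
    lapp q q (grad (\<lambda>j w. \<pi> w j) (H a b x)) (lapp q q (grad (\<lambda>j w. H a b w j) x) u)"
   "lapp q q (grad (fext q M (g a b)) x) u \<in> tangent_space N (\<pi> (H a b x))"
  if h: "\<forall>w\<in>M. H a b w \<in> bx q y e" and x: "x \<in> M" and u: "u \<in> Rn q" for a b x u
 proof -
  have c: "lapp q q (grad (fext q M (g a b)) x) u = lapp q q (grad (\<lambda>j w. \<pi> (H a b w) j) x) u"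
  proof (rule lapp_cong)
   fix i j assume "i < q" "j < q"
   then show "grad (fext q M (g a b)) x i j = grad (\<lambda>j w. \<pi> (H a b w) j) x i j"
    unfolding grad_def by (intro pderiv_coord_cong[OF M _ x]) (auto simp: g_def tr)
  qed
  show "lapp q q (grad (fext q M (g a b)) x) u =
    lapp q q (grad (\<lambda>j w. \<pi> w j) (H a b x)) (lapp q q (grad (\<lambda>j w. H a b w j) x) u)"
   unfolding c
   by (rule lapp_chain[OF M F(1), where H = "\<lambda>j w. \<pi> w j" and G = "H a b"])
     (use k1 HC F(4) x h e(2) in auto)
  show "lapp q q (grad (fext q M (g a b)) x) u \<in> tangent_space N (\<pi> (H a b x))"
   unfolding c
   by (rule tangent_space_line[OF M k1[OF gfacts(2)[OF h]] x u NR, where F = "\<lambda>w. \<pi> (H a b w)"])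
     (use F(3) h e(2) in auto)
 qed
 have g\<pi>: "g a b w = \<pi> (H a b w)" if "w \<in> M" for a b w using that by (simp add: g_def)
 have HN: "\<pi> (H a b w) \<in> N" if "H a b w \<in> bx q y e" for a b w using F(3) e(2) that by auto
 have zero_sum: "(\<lambda>j. y j + 0) = y" by simp
 define f where "f = g (\<lambda>_. 0) \<eta>"
 have fD: "f \<in> D_inf Df q M q N" unfolding f_def by (rule gfacts(1)[OF box0B])
 have nlt: "\<not> lin_trans q q N S (h x) (grad (fext q M h) x) \<longleftrightarrow> (\<exists>\<xi>\<in>tangent_space N (h x). ip q \<xi> \<xi> = 1 \<and>
    (\<forall>u\<in>Rn q. ip q \<xi> (lapp q q (grad (fext q M h) x) u) = 0) \<and> (\<forall>b\<in>tangent_space S (h x). ip q \<xi> b = 0))"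
  if S: "S \<in> \<Sigma>" and hS: "h x \<in> S" and L: "\<And>u. u \<in> Rn q ==> lapp q q (grad (fext q M h) x) u \<in> tangent_space N (h x)" for S h x
 proof -
  obtain k where k: "S \<subseteq> N" "submanifold q 1 k S" using sub[OF S] by blast
  have hN: "h x \<in> N" using k(1) hS by blast
  show ?thesis
   by (rule not_lin_trans_iff[OF tangent_subsp[OF N pi hN] tangent_subsp[OF k(2) p1 hS] tangent_space_mono[OF k(1)]]) (rule L)
 qed
 have ftrans: "transverse M N f S" if S: "S \<in> \<Sigma>" for S
 proof -
  obtain k where k: "S \<subseteq> N" "submanifold q 1 k S" using sub[OF S] by blast
  have "lin_trans q q N S (f x) (grad (fext q M f) x)" if x: "x \<in> M" and fS: "f x \<in> S" for x
  proof (rule ccontr)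
   assume c: "\<not> ?thesis"
   have xR: "x \<in> Rn q" using x MR by auto
   define p where "p = H (\<lambda>_. 0) \<eta> x"
   have fx: "f x = \<pi> p" unfolding f_def p_def by (rule g\<pi>[OF x])
   have dN: "lapp q q (grad (fext q M f) x) u \<in> tangent_space N (f x)" if "u \<in> Rn q" for u
    using gder(2)[OF box0B x that] unfolding fx unfolding p_def f_def .
   obtain \<xi> where \<xi>: "\<xi> \<in> tangent_space N (f x)" "ip q \<xi> \<xi> = 1"
    "\<And>u. u \<in> Rn q ==> ip q \<xi> (lapp q q (grad (fext q M f) x) u) = 0"
    "\<And>b. b \<in> tangent_space S (f x) ==> ip q \<xi> b = 0"
    using c nlt[OF S fS dN] by blast
   have \<xi>R: "\<xi> \<in> Rn q" by (rule tangent_space_Rn[OF NR \<xi>(1)])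
   have \<xi>d: "ip q \<xi> (lapp q q (grad (\<lambda>j w. \<pi> w j) p) (lapp q q (grad (\<lambda>j w. H (\<lambda>_. 0) \<eta> w j) x) u)) = 0"
    if "u \<in> Rn q" for u
    using \<xi>(3)[OF that] gder(1)[OF box0B x that] unfolding f_def p_def by simp
   show False
   proof (cases "x = (\<lambda>_. 0)")
    case True
    have py: "p = y" unfolding p_def H_def True pert_at_0[OF yR Rn_zero] zero_sum ..
    have fy: "f x = y" unfolding fx py by (rule F(5)[OF yN])
    have SY: "S = Y" using Y(3)[OF S] fS unfolding fy .
    \<comment> \<open>\<open>\<xi>\<close> annihilates the image of the derivative, which contains
      the tangent vector \<open>u\<close>. This gives \<open>c^2 = 1\<close>, then
      \<open>|u|^2 = 1 - c^2 = 0\<close> and \<open>\<xi> = c \<eta>\<close>; but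
      \<open>\<xi>\<close> is also orthogonal to \<open>v\<close>, against
      \<open>ip q v \<eta> \<noteq> 0\<close>.\<close>
    define c where "c = ip q \<xi> \<eta>"
    define u where "u = (\<lambda>j. \<xi> j - c * \<eta> j)"
    have L: "lapp q q (grad (\<lambda>j w. H (\<lambda>_. 0) \<eta> w j) x) \<xi> = u"
     unfolding u_def c_def H_def True by (rule pert_singular[OF \<xi>R \<eta>R])
    have sp: "subsp q (tangent_space N y)" by (rule tangent_subsp[OF N pi yN])
    have uN: "u \<in> tangent_space N y"
     unfolding u_def by (rule subsp_diff[OF sp _ subspD(4)[OF sp \<eta>N]]) (use \<xi>(1) fy in simp)
    have "ip q \<xi> u = 0"
     using \<xi>d[OF \<xi>R] unfolding L py retraction_derivative_tangent[OF DN N T yN uN] .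
    then have c2: "1 - c * c = 0" unfolding u_def ip_diff ip_scale \<xi>(2) by (simp add: c_def)
    have "ip q u u = 1 - c * c"
     unfolding u_def ip_diff ip_scale \<xi>(2) \<eta>1 ip_commute[of q \<eta> \<xi>] c_def[symmetric] by (simp add: algebra_simps)
    then have "u = (\<lambda>_. 0)" using ip_self_eq_0[OF subspD(1)[OF sp uN]] c2 by simp
    then have \<xi>\<eta>: "\<xi> = (\<lambda>j. c * \<eta> j)" unfolding u_def by (auto simp: fun_eq_iff)
    have "ip q \<xi> v = 0" using \<xi>(4) v unfolding fy SY by blast
    then have "c * ip q v \<eta> = 0" unfolding \<xi>\<eta> ip_scale using ip_commute[of q \<eta> v] by simp
    then show False using \<eta>(2) c2 by auto
   next
    case False
    \<comment> \<open>Away from the origin \<open>\<xi>\<close> itself is a value of the derivative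
      of the model map. Being orthogonal to the image, it would be orthogonal to its own image under
      the derivative of the retraction, which \<open>retraction_onto_tangent\<close>
      excludes.\<close>
    obtain u where u: "u \<in> Rn q" "lapp q q (grad (\<lambda>j w. H (\<lambda>_. 0) \<eta> w j) x) u = \<xi>"
     unfolding H_def by (rule pert_surj[OF xR False \<eta>R \<eta>1 \<xi>R]) blast
    have pb: "p \<in> bx q y e" unfolding p_def by (rule box0[OF x])
    show False using \<xi>d[OF u(1)] e(3)[OF pb _ \<xi>(2)] \<xi>(1) unfolding u(2) fx by blast
   qed
  qed
  then show ?thesis using transverse_iff_lin_trans[OF D Ms N k(1,2) fD] by blast
 qed
 define gs where "gs s = g (a s) (b s)" for s
 have gD: "gs s \<in> D_inf Df q M q N" for s unfolding gs_def by (rule gfacts(1)[OF boxsB])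
 have gnot: "\<not> transverse M N (gs s) X" for s
 proof -
  obtain k where k: "submanifold q 1 k X" using sub[OF X] by blast
  let ?z = "zs (s + s1)" and ?x = "\<lambda>_. 0 :: real" and ?h = "\<eta>s (s + s1)"
  have H0z: "H (a s) (b s) ?x = ?z" unfolding H_def pert_at_0[OF yR aR] by (simp add: a_def)
  have gz: "gs s ?x = ?z" unfolding gs_def g\<pi>[OF M0] H0z by (rule F(5)[OF zN])
  have gX: "gs s ?x \<in> X" unfolding gz by (rule zs(1))
  have dN: "lapp q q (grad (fext q M (gs s)) ?x) u \<in> tangent_space N (gs s ?x)" if "u \<in> Rn q" for u
   using gder(2)[OF boxsB M0 that] unfolding gs_def g\<pi>[OF M0] .
  have "ip q ?h (lapp q q (grad (fext q M (gs s)) ?x) u) = 0" if u: "u \<in> Rn q" for u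
  proof -
   define u' where "u' = (\<lambda>j. u j - ip q u ?h * ?h j)"
   have u'R: "u' \<in> Rn q" unfolding u'_def by (rule Rn_diff[OF u Rn_scale[OF \<eta>sR]])
   have hu': "ip q ?h u' = 0" unfolding u'_def ip_diff ip_scale \<eta>s(2) using ip_commute[of q ?h u] by simp
   have "lapp q q (grad (\<lambda>j w. H (a s) (b s) w j) ?x) u = u'"
    unfolding H_def u'_def b_def by (rule pert_singular[OF u \<eta>sR])
   then have L: "lapp q q (grad (fext q M (gs s)) ?x) u = lapp q q (grad (\<lambda>j w. \<pi> w j) ?z) u'"
    unfolding gs_def gder(1)[OF boxsB M0 u] H0z by simp
   \<comment> \<open>The retraction keeps the tangent part of \<open>u'\<close> and drops the normal
     part. Both \<open>u'\<close> and its normal part are orthogonal to \<open>?h\<close>, the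
     latter because \<open>?h\<close> is tangent to \<open>N\<close>; hence so is the tangent
     part.\<close>
   obtain t \<nu> where t: "t \<in> tangent_space N ?z" "normal q N ?z \<nu>" "u' = (\<lambda>i. t i + \<nu> i)"
    by (rule tangent_normal_decomposition[OF N pi zN u'R]) blast
   have "lapp q q (grad (\<lambda>j w. \<pi> w j) ?z) \<nu> = (\<lambda>_. 0)"
    by (rule derivative_normal_eq_0[OF DN N T _ zN t(2), where g = "\<lambda>j w. w j"]) (use k1 F(4) in auto)
   then have L': "lapp q q (grad (\<lambda>j w. \<pi> w j) ?z) u' = t"
    unfolding t(3) lapp_add retraction_derivative_tangent[OF DN N T zN t(1)] by simp
   have "ip q ?h \<nu> = 0" using t(2) \<eta>s(1)[of "s + s1"] ip_commute[of q ?h \<nu>] unfolding normal_def by auto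
   then show ?thesis using hu' unfolding L L' unfolding t(3) ip_add by simp
  qed
  then have "\<exists>\<xi>\<in>tangent_space N (gs s ?x). ip q \<xi> \<xi> = 1 \<and>
    (\<forall>u\<in>Rn q. ip q \<xi> (lapp q q (grad (fext q M (gs s)) ?x) u) = 0) \<and>
    (\<forall>b\<in>tangent_space X (gs s ?x). ip q \<xi> b = 0)"
   unfolding gz using \<eta>s by blast
  then have "\<not> lin_trans q q N X (gs s ?x) (grad (fext q M (gs s)) ?x)" using nlt[OF X gX dN] by blast
  then show ?thesis using transverse_iff_lin_trans[OF D Ms N XN k gD] M0 gX by blast
 qed
 define K where "K = {w \<in> Rn q. ip q w w \<le> \<rho>\<^sup>2}"
 have KM: "K \<subseteq> M"
 proof -
  have "\<rho>\<^sup>2 < r\<^sup>2" by (rule power_strict_mono) (use r(1) in \<open>auto simp: \<rho>_def\<close>)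
  then show ?thesis by (auto simp: K_def M_def)
 qed
 \<comment> \<open>One smooth family containing \<open>f\<close> and all \<open>gs s\<close>: the
   parameters \<open>a\<close> and \<open>b\<close> occupy the two blocks of \<open>q\<close>
   coordinates behind \<open>w\<close>.\<close>
 define G where "G z = \<pi> (H (\<lambda>i. z (q + i)) (\<lambda>i. z (q + (q + i))) z)" for z
 define Q where "Q = {z \<in> Rn (q + (q + q)). H (\<lambda>i. z (q + i)) (\<lambda>i. z (q + (q + i))) z \<in> T}"
 have HHC: "Cp_open (q + (q + q)) \<infinity> (Rn (q + (q + q))) (\<lambda>z. H (\<lambda>i. z (q + i)) (\<lambda>i. z (q + (q + i))) z j)" for j
  unfolding H_def by (rule Cp_open_pert[OF opn_Rn]) (intro Cp_open_coord opn_Rn)+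
 have Q: "openin (Euclidean_space (q + (q + q))) Q"
  unfolding Q_def
  by (rule opn_preimage[OF opn_Rn F(1) Ck_open_continuous[OF order_refl Cp_open_Ck[OF HHC, of 0]]]) (use HR in auto)
 have GC: "Cp_open (q + (q + q)) \<infinity> Q (\<lambda>z. G z j)" if "j < q" for j
  unfolding G_def
  by (rule Cp_open_compose[OF Q F(1) F(4)[OF that] Cp_open_subset[OF HHC]]) (auto simp: Q_def)
 have Happ: "H (\<lambda>i. append_vec q w (append_vec q a b) (q + i)) (\<lambda>i. append_vec q w (append_vec q a b) (q + (q + i)))
   (append_vec q w (append_vec q a b)) = H a b w" for a b w
  unfolding H_def by (rule pert_cong) (auto simp: append_vec_def)
 have Gapp: "G (append_vec q w (append_vec q a b)) = \<pi> (H a b w)" for a b w unfolding G_def Happ ..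
 have lim: "(\<lambda>s. append_vec q (a s) (b s)) \<longlonglongrightarrow> append_vec q (\<lambda>_. 0) \<eta>"
  unfolding tendsto_fun_iff
 proof
  fix i
  have "(\<lambda>s. zs (s + s1) i - y i) \<longlonglongrightarrow> y i - y i"
   by (intro tendsto_diff tendsto_const LIMSEQ_ignore_initial_segment) (use zs(2) in \<open>simp add: tendsto_fun_iff\<close>)
  moreover have "(\<lambda>s. \<eta>s (s + s1) j) \<longlonglongrightarrow> \<eta> j" for j
   by (intro LIMSEQ_ignore_initial_segment) (use \<eta>(1) in \<open>simp add: tendsto_fun_iff\<close>)
  ultimately show "(\<lambda>s. append_vec q (a s) (b s) i) \<longlonglongrightarrow> append_vec q (\<lambda>_. 0) \<eta> i"
   by (simp add: append_vec_def a_def b_def)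
 qed
 have ev: "\<forall>\<^sub>F s in sequentially. gs s \<in> B" if B: "B \<in> Dk_basis Df q M q N k" "f \<in> B" for k B
 proof (rule deformation_eventually_in_basis[where G = G and Q = Q and p = "q + q" and K = K and f = f and
    c = "append_vec q (\<lambda>_. 0) \<eta>" and cs = "\<lambda>s. append_vec q (a s) (b s)" and g = gs,
    OF M _ _ KM Q GC _ _ lim _ _ gD _ _ B])
  show "compact K" unfolding K_def by (rule compact_ip_ball)
  show "append_vec q (\<lambda>_. 0) \<eta> \<in> Rn (q + q)" by (rule append_vec_Rn[OF \<eta>R])
  show "append_vec q (a s) (b s) \<in> Rn (q + q)" for s by (rule append_vec_Rn[OF bR])
  show "append_vec q w (append_vec q (\<lambda>_. 0) \<eta>) \<in> Q" if "w \<in> M" for w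
   unfolding Q_def mem_Collect_eq Happ using box0[OF that] e(2) append_vec_Rn[OF append_vec_Rn[OF \<eta>R]] by blast
  show "f w = G (append_vec q w (append_vec q (\<lambda>_. 0) \<eta>))" if "w \<in> M" for w
   unfolding Gapp f_def by (rule g\<pi>[OF that])
  show "gs s w = G (append_vec q w (append_vec q (a s) (b s)))" if "w \<in> M" for s w
   unfolding Gapp gs_def by (rule g\<pi>[OF that])
  show "gs s w = f w" if w: "w \<in> M - K" for s w
  proof -
   have "bump q \<rho> w = 0" by (rule bump_outside[OF \<rho>]) (use w MR in \<open>auto simp: K_def\<close>)
   then have "H (a s) (b s) w = H (\<lambda>_. 0) \<eta> w" unfolding H_def pert_def by simp
   then show ?thesis using w by (simp add: gs_def f_def g\<pi>)
  qed
 qed (rule tr)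
 have "\<not> openin (D_inf_topology Df q M q N) {f \<in> D_inf Df q M q N. \<forall>S\<in>\<Sigma>. transverse M N f S}"
 proof
  assume o: "openin (D_inf_topology Df q M q N) {f \<in> D_inf Df q M q N. \<forall>S\<in>\<Sigma>. transverse M N f S}"
  have "\<forall>\<^sub>F s in sequentially. gs s \<in> {f \<in> D_inf Df q M q N. \<forall>S\<in>\<Sigma>. transverse M N f S}"
   by (rule generated_topology_eventually[OF o[unfolded D_inf_topology_def], of f]) (use fD ftrans ev in auto)
  then obtain s where "\<forall>S\<in>\<Sigma>. transverse M N (gs s) S"
   using eventually_happens[of _ sequentially] by fastforce
  then show False using gnot X by blast
 qed
 then show ?thesis using D Ms M0 by blast
qed

end

theorem theorem5p2:
  fixes Df :: "nat \<Rightarrow> (nat \<Rightarrow> real) set set"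
    and q :: nat and N V :: "(nat \<Rightarrow> real) set" and \<Sigma> :: "(nat \<Rightarrow> real) set set"
  assumes "smooth_exp_o_minimal_field Df"
    and "definable_submanifold Df q \<infinity> N"
    and "V \<subseteq> N" and "closedin (subtopology (Euclidean_space q) N) V"
    and "definable_stratification Df q V \<Sigma>"
  shows "(whitney_a_regular q \<Sigma> \<longleftrightarrow>
           (\<forall>m M. definable_submanifold Df m \<infinity> M \<longrightarrow>
              openin (D_inf_topology Df m M q N)
                {f \<in> D_inf Df m M q N. \<forall>S\<in>\<Sigma>. transverse M N f S})) \<and>
         (whitney_a_regular q \<Sigma> \<longleftrightarrow>
           (\<forall>m M. definable_submanifold Df m \<infinity> M \<and>
                  int (mdim m M) \<ge> int (mdim q N) - int (Min (mdim q ` \<Sigma>)) \<longrightarrow>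
              openin (D_inf_topology Df m M q N)
                {f \<in> D_inf Df m M q N. \<forall>S\<in>\<Sigma>. transverse M N f S}))"
proof -
  interpret smooth_exp_o_minimal_field Df by (rule assms(1))
  have pi: "(1::enat) \<le> \<infinity>" by simp
  obtain d where DN: "N \<in> Df q" and N: "submanifold q \<infinity> d N"
    using assms(2) by (auto simp: definable_submanifold_def)
  have part: "partition_on V \<Sigma>" and sub: "\<And>S. S \<in> \<Sigma> \<Longrightarrow> \<exists>k. submanifold q 1 k S"
    using assms(5) by (auto simp: definable_stratification_def definable_submanifold_def)
  have SN: "S \<subseteq> N" if "S \<in> \<Sigma>" for S using partition_onD1[OF part] assms(3) that by blast
  have forward: "openin (D_inf_topology Df m M q N) {f \<in> D_inf Df m M q N. \<forall>S\<in>\<Sigma>. transverse M N f S}"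
    if "whitney_a_regular q \<Sigma>" "definable_submanifold Df m \<infinity> M" for m M
    using that(2) transverse_maps_open[OF _ _ DN N assms(3,4,5) that(1)] unfolding definable_submanifold_def by blast
  \<comment> \<open>The hypothesis is the openness in (3), for manifolds of large dimension only.
    Since (2) contains it, the same argument closes both equivalences.\<close>
  have backward: "whitney_a_regular q \<Sigma>"
    if R: "\<And>m M. definable_submanifold Df m \<infinity> M \<Longrightarrow>
        int (mdim m M) \<ge> int (mdim q N) - int (Min (mdim q ` \<Sigma>)) \<Longrightarrow>
        openin (D_inf_topology Df m M q N) {f \<in> D_inf Df m M q N. \<forall>S\<in>\<Sigma>. transverse M N f S}"
  proof (rule ccontr)
    assume "\<not> whitney_a_regular q \<Sigma>"
    then obtain X Y where XY: "X \<in> \<Sigma>" "Y \<in> \<Sigma>" "\<not> whitney_a_over q X Y"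
      unfolding whitney_a_regular_def by blast
    then obtain y xs \<tau> where h: "y \<in> Y" "\<forall>s. xs s \<in> X" "limitin (Euclidean_space q) xs y sequentially"
        "limitin (grassmannian q (mdim q X)) (\<lambda>s. tangent_space X (xs s)) \<tau> sequentially"
        "\<not> tangent_space Y y \<subseteq> \<tau>"
      unfolding whitney_a_over_def by blast
    obtain v where v: "v \<in> tangent_space Y y" "v \<notin> \<tau>" using h(5) by blast
    have X1: "submanifold q 1 (mdim q X) X" using sub[OF XY(1)] submanifold_mdim by blast
    have lim: "xs \<longlonglongrightarrow> y" using h(3) by (simp add: limitin_Euclidean_space)
    have xX: "xs s \<in> X" for s using h(2) by blast
    have yN: "y \<in> N" using SN[OF XY(2)] h(1) by blast
    have disj: "S = Y" if "S \<in> \<Sigma>" "y \<in> S" for S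
      using partition_onD2[OF part] that XY(2) h(1) unfolding disjoint_def by blast
    obtain zs \<eta>s \<eta> where d: "\<And>s. zs s \<in> X" "zs \<longlonglongrightarrow> y" "\<And>s. \<eta>s s \<in> tangent_space N (zs s)"
      "\<And>s. ip q (\<eta>s s) (\<eta>s s) = 1" "\<And>s b. b \<in> tangent_space X (zs s) \<Longrightarrow> ip q (\<eta>s s) b = 0"
      "\<eta>s \<longlonglongrightarrow> \<eta>" "ip q v \<eta> \<noteq> 0"
      by (rule irregular_sequence[OF N X1 SN[OF XY(1)] SN[OF XY(2)] h(1) xX lim h(4) v]) blast
    have "\<exists>M. M \<in> Df q \<and> submanifold q \<infinity> q M \<and> M \<noteq> {} \<and>
        \<not> openin (D_inf_topology Df q M q N) {f \<in> D_inf Df q M q N. \<forall>S\<in>\<Sigma>. transverse M N f S}"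
      by (rule transverse_maps_not_open[OF DN N _ XY(1,2) h(1) disj v(1) d(1-7)]) (use SN sub in auto)
    then obtain M where M: "M \<in> Df q" "submanifold q \<infinity> q M" "M \<noteq> {}"
        "\<not> openin (D_inf_topology Df q M q N) {f \<in> D_inf Df q M q N. \<forall>S\<in>\<Sigma>. transverse M N f S}" by blast
    \<comment> \<open>An open set of the ambient space has dimension \<open>q \<ge> dim N\<close>,
      so it meets the dimension bound whatever the smallest stratum is.\<close>
    have "mdim q M = q" using M(3) mdim_eq[OF M(2) pi] by blast
    moreover have "mdim q N \<le> q" using mdim_eq[OF N pi yN] N by (simp add: submanifold_def)
    ultimately have "int (mdim q M) \<ge> int (mdim q N) - int (Min (mdim q ` \<Sigma>))" by linarith
    then show False using R[of q M] M(1,2,4) unfolding definable_submanifold_def by blast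
  qed
  show ?thesis
    by (intro conjI iffI allI impI; (elim conjE)?; rule forward backward; assumption?; blast?)
qed

end
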